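(* Let $R$ be a standard graded algebra over a field $k$ with homogeneous maximal ideal $\mathfrak m$, and let $M=\bigoplus_{i\ge 0}M_i$ be a nonzero finitely generated graded $R$-module equipped with an $\mathfrak m$-stable graded filtration $\mathbb M$. Then for all $i\ge 0$ $$t_i(M)\le t_i(gr_{\mathbb M}(M))+v_{\mathbb M}(M).$$ Furthermore, if $M$ is of homogeneous type with respect to $\mathbb M$, then for all $i\ge 0$ $$t_i(gr_{\mathbb M}(M))+u_{\mathbb M}(M)\le t_i(M)\le t_i(gr_{\mathbb M}(M))+v_{\mathbb M}(M).$$
   Context: A standard graded $k$-algebra is $R=\bigoplus_{i\ge0}R_i$ with $R_0=k$, generated as a $k$-algebra by finitely many elements of degree 1. An $\mathfrak m$-stable filtration $\mathbb M=\{\mathfrak F_pM\}_{p\ge0}$ of $M$ is a descending chain of submodules with $\mathfrak F_0M=M$, $\mathfrak m\,\mathfrak F_pM\subseteq\mathfrak F_{p+1}M$ for all $p\ge 0$, with equality for all $p\gg0$. It is a graded filtration if every $\mathfrak F_pM$ is a graded submodule of $M$. The associated graded module is $gr_{\mathbb M}(M)=\bigoplus_{p\ge0}\mathfrak F_pM/\mathfrak F_{p+1}M$; it is a graded module (the degree $p$ part being $\mathfrak F_pM/\mathfrak F_{p+1}M$) over $R^g=\bigoplus_{p\ge0}\mathfrak m^p/\mathfrak m^{p+1}$, which is identified with $R$. For a nonzero $x\in M$, its valuation $v_{\mathbb M}(x)$ is the largest $p$ with $x\in\mathfrak F_pM$, and $gr_{\mathbb M}(x)$ is the class of $x$ in $\mathfrak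 F_pM/\mathfrak F_{p+1}M$ for $p=v_{\mathbb M}(x)$. A finite set $\{f_1,\dots,f_s\}\subseteq M$ is a standard basis of $M$ with respect to $\mathbb M$ if $gr_{\mathbb M}(f_1),\dots,gr_{\mathbb M}(f_s)$ generate $gr_{\mathbb M}(M)$; it is minimal if no proper subset is a standard basis, and homogeneous if every $f_j$ is a homogeneous element of $M$. With a graded filtration, $M$ has a minimal homogeneous standard basis $\{f_1,\dots,f_s\}$, and one sets $\Delta_{\mathbb M}(M)=\{\deg(f_j)-v_{\mathbb M}(f_j):1\le j\le s\}$ (independent of the choice of minimal homogeneous standard basis), $v_{\mathbb M}(M)=\max\Delta_{\mathbb M}(M)$, $u_{\mathbb M}(M)=\min\Delta_{\mathbb M}(M)$. For a finitely generated graded $R$-module $N$, $\beta_{ij}^R(N)=\dim_k\operatorname{Tor}_i^R(N,k)_j$, $\beta_i^R(N)=\dim_k\operatorname{Tor}^R_i(N,k)$, and $t_i(N)=\sup\{j:\beta_{ij}^R(N)\ne0\}$, with $t_i(N)=-\infty$ if $\operatorname{Tor}_i^R(N,k)=0$. $M$ is of homogeneous type with respect to $\mathbb M$ if $\beta_i^R(M)=\beta_i^{R^g}(gr_{\mathbb M}(M))$ for every $i\ge0$. *)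

theory Defs
  imports
    "Jordan_Normal_Form.Missing_VectorSpace"
    "HOL-Algebra.Generated_Rings"
    "HOL-Algebra.Ideal_Product"
    "HOL-Library.Extended_Real"
begin

section \<open>Graded rings and modules\<close>

definition internal_direct_sum :: "('b, 'x) ring_scheme \<Rightarrow> (nat \<Rightarrow> 'b set) \<Rightarrow> bool" where
  "internal_direct_sum G A \<longleftrightarrow>
     (\<forall>i. additive_subgroup (A i) G) \<and>
     (\<forall>x\<in>carrier G. \<exists>!f. (\<forall>i. f i \<in> A i) \<and> finite {i. f i \<noteq> \<zero>\<^bsub>G\<^esub>} \<and>
        x = (\<Oplus>\<^bsub>G\<^esub>i\<in>{i. f i \<noteq> \<zero>\<^bsub>G\<^esub>}. f i))"

definition component :: "('b, 'x) ring_scheme \<Rightarrow> (nat \<Rightarrow> 'b set) \<Rightarrow> 'b \<Rightarrow> nat \<Rightarrow> 'b" where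
  "component G A x = (THE f. (\<forall>i. f i \<in> A i) \<and> finite {i. f i \<noteq> \<zero>\<^bsub>G\<^esub>} \<and>
     x = (\<Oplus>\<^bsub>G\<^esub>i\<in>{i. f i \<noteq> \<zero>\<^bsub>G\<^esub>}. f i))"

definition graded_ring :: "('a, 'x) ring_scheme \<Rightarrow> (nat \<Rightarrow> 'a set) \<Rightarrow> bool" where
  "graded_ring R A \<longleftrightarrow>
     cring R \<and> internal_direct_sum R A \<and> \<one>\<^bsub>R\<^esub> \<in> A 0 \<and>
     (\<forall>i j. \<forall>a\<in>A i. \<forall>b\<in>A j. a \<otimes>\<^bsub>R\<^esub> b \<in> A (i + j))"

text \<open>The ground field is the degree-zero part \<open>A 0\<close> itself.\<close>

definition standard_graded_algebra :: "('a, 'x) ring_scheme \<Rightarrow> (nat \<Rightarrow> 'a set) \<Rightarrow> bool" where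
  "standard_graded_algebra R A \<longleftrightarrow>
     graded_ring R A \<and> subfield (A 0) R \<and>
     (\<exists>S. finite S \<and> S \<subseteq> A 1 \<and> generate_ring R (A 0 \<union> S) = carrier R)"

definition graded_module ::
    "('a, 'x) ring_scheme \<Rightarrow> (nat \<Rightarrow> 'a set) \<Rightarrow> ('a, 'b, 'y) module_scheme \<Rightarrow> (nat \<Rightarrow> 'b set) \<Rightarrow> bool" where
  "graded_module R A M B \<longleftrightarrow>
     Module.module R M \<and> internal_direct_sum M B \<and>
     (\<forall>i j. \<forall>a\<in>A i. \<forall>x\<in>B j. a \<odot>\<^bsub>M\<^esub> x \<in> B (i + j))"

definition finitely_generated :: "('a, 'x) ring_scheme \<Rightarrow> ('a, 'b, 'y) module_scheme \<Rightarrow> bool" where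
  "finitely_generated R M \<longleftrightarrow>
     (\<exists>S. finite S \<and> S \<subseteq> carrier M \<and> LinearCombinations.module.span R M S = carrier M)"

text \<open>The ideal \<open>\<Oplus>\<^bsub>i>0\<^esub> A i\<close>.\<close>

definition irrelevant_ideal :: "('a, 'x) ring_scheme \<Rightarrow> (nat \<Rightarrow> 'a set) \<Rightarrow> 'a set" where
  "irrelevant_ideal R A = {a \<in> carrier R. component R A a 0 = \<zero>\<^bsub>R\<^esub>}"

primrec ideal_power :: "('a, 'x) ring_scheme \<Rightarrow> 'a set \<Rightarrow> nat \<Rightarrow> 'a set" where
  "ideal_power R I 0 = carrier R"
| "ideal_power R I (Suc p) = ideal_prod R I (ideal_power R I p)"

definition ideal_smult ::
    "('a, 'x) ring_scheme \<Rightarrow> ('a, 'b, 'y) module_scheme \<Rightarrow> 'a set \<Rightarrow> 'b set \<Rightarrow> 'b set" where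
  "ideal_smult R M I N = LinearCombinations.module.span R M {a \<odot>\<^bsub>M\<^esub> x | a x. a \<in> I \<and> x \<in> N}"

text \<open>As usual for additive structures, the ring fields \<^term>\<open>mult\<close> and \<^term>\<open>one\<close> of the
  module record carry no meaning.\<close>

definition quotient_module :: "('a, 'b, 'y) module_scheme \<Rightarrow> 'b set \<Rightarrow> ('a, 'b set) module" where
  "quotient_module M N =
     \<lparr>carrier = a_rcosets\<^bsub>M\<^esub> N, mult = undefined, one = undefined, zero = N, add = set_add M,
      smult = (\<lambda>a X. \<Union>x\<in>X. N +>\<^bsub>M\<^esub> (a \<odot>\<^bsub>M\<^esub> x))\<rparr>"


section \<open>Tor with coefficients in the residue field\<close>

text \<open>The graded free module \<open>\<Oplus>\<^bsub>c\<in>I\<^esub> R(-d c)\<close>: finitely supported families on \<open>I\<close>, the basis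
  vector at \<open>c\<close> having degree \<open>d c\<close>.\<close>

definition free_module :: "('a, 'x) ring_scheme \<Rightarrow> nat set \<Rightarrow> ('a, nat \<Rightarrow> 'a) module" where
  "free_module R I =
     \<lparr>carrier = {f. (\<forall>c. f c \<in> carrier R) \<and> (\<forall>c. c \<notin> I \<longrightarrow> f c = \<zero>\<^bsub>R\<^esub>) \<and> finite {c. f c \<noteq> \<zero>\<^bsub>R\<^esub>}},
      mult = undefined, one = undefined, zero = (\<lambda>c. \<zero>\<^bsub>R\<^esub>),
      add = (\<lambda>f g c. f c \<oplus>\<^bsub>R\<^esub> g c),
      smult = (\<lambda>a f c. a \<otimes>\<^bsub>R\<^esub> f c)\<rparr>"

definition free_grading ::
    "('a, 'x) ring_scheme \<Rightarrow> (nat \<Rightarrow> 'a set) \<Rightarrow> nat set \<Rightarrow> (nat \<Rightarrow> nat) \<Rightarrow> nat \<Rightarrow> (nat \<Rightarrow> 'a) set" where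
  "free_grading R A I d j =
     {f \<in> carrier (free_module R I). \<forall>c\<in>I. if d c \<le> j then f c \<in> A (j - d c) else f c = \<zero>\<^bsub>R\<^esub>}"

record ('a, 'b) free_res =
  fr_index :: "nat \<Rightarrow> nat set"
  fr_shift :: "nat \<Rightarrow> nat \<Rightarrow> nat"
  fr_diff :: "nat \<Rightarrow> (nat \<Rightarrow> 'a) \<Rightarrow> (nat \<Rightarrow> 'a)"  \<comment> \<open>\<open>fr_diff P i\<close> maps the \<open>i+1\<close>-st module to the \<open>i\<close>-th\<close>
  fr_aug :: "(nat \<Rightarrow> 'a) \<Rightarrow> 'b"

abbreviation fr_mod :: "('a, 'x) ring_scheme \<Rightarrow> ('a, 'b) free_res \<Rightarrow> nat \<Rightarrow> ('a, nat \<Rightarrow> 'a) module" where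
  "fr_mod R P i \<equiv> free_module R (fr_index P i)"

abbreviation fr_grading ::
    "('a, 'x) ring_scheme \<Rightarrow> (nat \<Rightarrow> 'a set) \<Rightarrow> ('a, 'b) free_res \<Rightarrow> nat \<Rightarrow> nat \<Rightarrow> (nat \<Rightarrow> 'a) set" where
  "fr_grading R A P i \<equiv> free_grading R A (fr_index P i) (fr_shift P i)"

definition graded_free_resolution ::
    "('a, 'x) ring_scheme \<Rightarrow> (nat \<Rightarrow> 'a set) \<Rightarrow> ('a, 'b, 'y) module_scheme \<Rightarrow> (nat \<Rightarrow> 'b set) \<Rightarrow>
     ('a, 'b) free_res \<Rightarrow> bool" where
  "graded_free_resolution R A N B P \<longleftrightarrow>
     (\<forall>i. mod_hom R (fr_mod R P (Suc i)) (fr_mod R P i) (fr_diff P i)) \<and>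
     mod_hom R (fr_mod R P 0) N (fr_aug P) \<and>
     (\<forall>i j. fr_diff P i ` fr_grading R A P (Suc i) j \<subseteq> fr_grading R A P i j) \<and>
     (\<forall>j. fr_aug P ` fr_grading R A P 0 j \<subseteq> B j) \<and>
     fr_aug P ` carrier (fr_mod R P 0) = carrier N \<and>
     {x \<in> carrier (fr_mod R P 0). fr_aug P x = \<zero>\<^bsub>N\<^esub>} = fr_diff P 0 ` carrier (fr_mod R P 1) \<and>
     (\<forall>i. {x \<in> carrier (fr_mod R P (Suc i)). fr_diff P i x = \<zero>\<^bsub>fr_mod R P i\<^esub>} =
          fr_diff P (Suc i) ` carrier (fr_mod R P (Suc (Suc i))))"

text \<open>Reduction of a resolution \<open>P\<close> modulo \<open>\<mm>\<close>: \<open>P\<^sub>i \<otimes> k\<close> is taken to be \<open>P\<^sub>i / \<mm> P\<^sub>i\<close>,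
  with the induced grading and differential.\<close>

definition mP :: "('a, 'x) ring_scheme \<Rightarrow> (nat \<Rightarrow> 'a set) \<Rightarrow> ('a, 'b) free_res \<Rightarrow> nat \<Rightarrow> (nat \<Rightarrow> 'a) set" where
  "mP R A P i = ideal_smult R (fr_mod R P i) (irrelevant_ideal R A) (carrier (fr_mod R P i))"

definition red_mod ::
    "('a, 'x) ring_scheme \<Rightarrow> (nat \<Rightarrow> 'a set) \<Rightarrow> ('a, 'b) free_res \<Rightarrow> nat \<Rightarrow> ('a, (nat \<Rightarrow> 'a) set) module" where
  "red_mod R A P i = quotient_module (fr_mod R P i) (mP R A P i)"

definition red_grading ::
    "('a, 'x) ring_scheme \<Rightarrow> (nat \<Rightarrow> 'a set) \<Rightarrow> ('a, 'b) free_res \<Rightarrow> nat \<Rightarrow> nat \<Rightarrow> (nat \<Rightarrow> 'a) set set" where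
  "red_grading R A P i j = {mP R A P i +>\<^bsub>fr_mod R P i\<^esub> x | x. x \<in> fr_grading R A P i j}"

definition red_diff ::
    "('a, 'x) ring_scheme \<Rightarrow> (nat \<Rightarrow> 'a set) \<Rightarrow> ('a, 'b) free_res \<Rightarrow> nat \<Rightarrow> (nat \<Rightarrow> 'a) set \<Rightarrow> (nat \<Rightarrow> 'a) set" where
  "red_diff R A P i X = (\<Union>x\<in>X. mP R A P i +>\<^bsub>fr_mod R P i\<^esub> fr_diff P i x)"

definition red_cycles ::
    "('a, 'x) ring_scheme \<Rightarrow> (nat \<Rightarrow> 'a set) \<Rightarrow> ('a, 'b) free_res \<Rightarrow> nat \<Rightarrow> (nat \<Rightarrow> 'a) set set" where
  "red_cycles R A P i =
     (case i of
        0 \<Rightarrow> carrier (red_mod R A P 0)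
      | Suc n \<Rightarrow> {X \<in> carrier (red_mod R A P (Suc n)). red_diff R A P n X = \<zero>\<^bsub>red_mod R A P n\<^esub>})"

definition red_boundaries ::
    "('a, 'x) ring_scheme \<Rightarrow> (nat \<Rightarrow> 'a set) \<Rightarrow> ('a, 'b) free_res \<Rightarrow> nat \<Rightarrow> (nat \<Rightarrow> 'a) set set" where
  "red_boundaries R A P i = red_diff R A P i ` carrier (red_mod R A P (Suc i))"

text \<open>Tor is computed from a chosen resolution.  Up to graded isomorphism the choice is irrelevant,
  and for finitely generated graded modules over a standard graded algebra a resolution with
  basis sets in \<^typ>\<open>nat\<close> and natural number shifts exists.\<close>

definition chosen_res ::
    "('a, 'x) ring_scheme \<Rightarrow> (nat \<Rightarrow> 'a set) \<Rightarrow> ('a, 'b, 'y) module_scheme \<Rightarrow> (nat \<Rightarrow> 'b set) \<Rightarrow> ('a, 'b) free_res" where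
  "chosen_res R A N B = (SOME P. graded_free_resolution R A N B P)"

definition Tor ::
    "('a, 'x) ring_scheme \<Rightarrow> (nat \<Rightarrow> 'a set) \<Rightarrow> ('a, 'b, 'y) module_scheme \<Rightarrow> (nat \<Rightarrow> 'b set) \<Rightarrow> nat \<Rightarrow>
     ('a, (nat \<Rightarrow> 'a) set set) module" where
  "Tor R A N B i = (let P = chosen_res R A N B in
     quotient_module ((red_mod R A P i)\<lparr>carrier := red_cycles R A P i\<rparr>) (red_boundaries R A P i))"

definition Tor_grading ::
    "('a, 'x) ring_scheme \<Rightarrow> (nat \<Rightarrow> 'a set) \<Rightarrow> ('a, 'b, 'y) module_scheme \<Rightarrow> (nat \<Rightarrow> 'b set) \<Rightarrow> nat \<Rightarrow> nat \<Rightarrow>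
     (nat \<Rightarrow> 'a) set set set" where
  "Tor_grading R A N B i j = (let P = chosen_res R A N B in
     {red_boundaries R A P i +>\<^bsub>red_mod R A P i\<^esub> X | X. X \<in> red_cycles R A P i \<inter> red_grading R A P i j})"

abbreviation ground_field :: "('a, 'x) ring_scheme \<Rightarrow> (nat \<Rightarrow> 'a set) \<Rightarrow> ('a, 'x) ring_scheme" where
  "ground_field R A \<equiv> R\<lparr>carrier := A 0\<rparr>"

definition betti ::
    "('a, 'x) ring_scheme \<Rightarrow> (nat \<Rightarrow> 'a set) \<Rightarrow> ('a, 'b, 'y) module_scheme \<Rightarrow> (nat \<Rightarrow> 'b set) \<Rightarrow> nat \<Rightarrow> nat" where
  "betti R A N B i = vectorspace.dim (ground_field R A) (Tor R A N B i)"

definition graded_betti ::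
    "('a, 'x) ring_scheme \<Rightarrow> (nat \<Rightarrow> 'a set) \<Rightarrow> ('a, 'b, 'y) module_scheme \<Rightarrow> (nat \<Rightarrow> 'b set) \<Rightarrow> nat \<Rightarrow> nat \<Rightarrow> nat" where
  "graded_betti R A N B i j =
     vectorspace.dim (ground_field R A) ((Tor R A N B i)\<lparr>carrier := Tor_grading R A N B i j\<rparr>)"

text \<open>The supremum of the empty set in \<^typ>\<open>ereal\<close> is \<open>-\<infinity>\<close>.\<close>

definition t_inv ::
    "('a, 'x) ring_scheme \<Rightarrow> (nat \<Rightarrow> 'a set) \<Rightarrow> ('a, 'b, 'y) module_scheme \<Rightarrow> (nat \<Rightarrow> 'b set) \<Rightarrow> nat \<Rightarrow> ereal" where
  "t_inv R A N B i = (SUP j\<in>{j. graded_betti R A N B i j \<noteq> 0}. ereal (real j))"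


section \<open>Stable filtrations and associated graded objects\<close>

definition stable_filtration ::
    "('a, 'x) ring_scheme \<Rightarrow> (nat \<Rightarrow> 'a set) \<Rightarrow> ('a, 'b, 'y) module_scheme \<Rightarrow> (nat \<Rightarrow> 'b set) \<Rightarrow> bool" where
  "stable_filtration R A M F \<longleftrightarrow>
     (\<forall>p. LinearCombinations.submodule R (F p) M) \<and>
     F 0 = carrier M \<and>
     (\<forall>p. F (Suc p) \<subseteq> F p) \<and>
     (\<forall>p. ideal_smult R M (irrelevant_ideal R A) (F p) \<subseteq> F (Suc p)) \<and>
     (\<exists>p0. \<forall>p\<ge>p0. ideal_smult R M (irrelevant_ideal R A) (F p) = F (Suc p))"

definition graded_submodule ::
    "('a, 'x) ring_scheme \<Rightarrow> ('a, 'b, 'y) module_scheme \<Rightarrow> (nat \<Rightarrow> 'b set) \<Rightarrow> 'b set \<Rightarrow> bool" where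
  "graded_submodule R M B N \<longleftrightarrow>
     LinearCombinations.submodule R N M \<and> (\<forall>x\<in>N. \<forall>i. component M B x i \<in> N)"

definition graded_stable_filtration ::
    "('a, 'x) ring_scheme \<Rightarrow> (nat \<Rightarrow> 'a set) \<Rightarrow> ('a, 'b, 'y) module_scheme \<Rightarrow> (nat \<Rightarrow> 'b set) \<Rightarrow>
     (nat \<Rightarrow> 'b set) \<Rightarrow> bool" where
  "graded_stable_filtration R A M B F \<longleftrightarrow>
     stable_filtration R A M F \<and> (\<forall>p. graded_submodule R M B (F p))"

text \<open>An element of \<open>\<Oplus>\<^bsub>p\<^esub> F p / F (p+1)\<close> is a sequence of cosets, almost all of them zero.
  In the product the component in degree \<open>p\<close> is the class of \<open>\<Sum>\<^bsub>i\<le>p\<^esub> a i \<cdot> x (p-i)\<close> for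
  representatives \<open>a i\<close> and \<open>x i\<close>; all choices give the same coset, so their union is that coset.\<close>

definition gr_carrier :: "('b, 'y) ring_scheme \<Rightarrow> (nat \<Rightarrow> 'b set) \<Rightarrow> (nat \<Rightarrow> 'b set) set" where
  "gr_carrier G F =
     {\<xi>. (\<forall>p. \<exists>x\<in>F p. \<xi> p = F (Suc p) +>\<^bsub>G\<^esub> x) \<and> finite {p. \<xi> p \<noteq> F (Suc p)}}"

definition gr_product ::
    "('b, 'y) ring_scheme \<Rightarrow> (nat \<Rightarrow> 'b set) \<Rightarrow> ('a \<Rightarrow> 'b \<Rightarrow> 'b) \<Rightarrow>
     (nat \<Rightarrow> 'a set) \<Rightarrow> (nat \<Rightarrow> 'b set) \<Rightarrow> nat \<Rightarrow> 'b set" where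
  "gr_product G F op \<rho> \<xi> p =
     \<Union>{F (Suc p) +>\<^bsub>G\<^esub> (\<Oplus>\<^bsub>G\<^esub>i\<in>{..p}. op (a i) (x (p - i))) | a x. (\<forall>i. a i \<in> \<rho> i) \<and> (\<forall>i. x i \<in> \<xi> i)}"

definition gr_class :: "('b, 'y) ring_scheme \<Rightarrow> (nat \<Rightarrow> 'b set) \<Rightarrow> nat \<Rightarrow> 'b \<Rightarrow> nat \<Rightarrow> 'b set" where
  "gr_class G F p x = (\<lambda>q. F (Suc q) +>\<^bsub>G\<^esub> (if q = p then x else \<zero>\<^bsub>G\<^esub>))"

definition gr_grading :: "('b, 'y) ring_scheme \<Rightarrow> (nat \<Rightarrow> 'b set) \<Rightarrow> nat \<Rightarrow> (nat \<Rightarrow> 'b set) set" where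
  "gr_grading G F p = {gr_class G F p x | x. x \<in> F p}"

abbreviation m_power :: "('a, 'x) ring_scheme \<Rightarrow> (nat \<Rightarrow> 'a set) \<Rightarrow> nat \<Rightarrow> 'a set" where
  "m_power R A \<equiv> ideal_power R (irrelevant_ideal R A)"

definition gr_ring :: "('a, 'x) ring_scheme \<Rightarrow> (nat \<Rightarrow> 'a set) \<Rightarrow> (nat \<Rightarrow> 'a set) ring" where
  "gr_ring R A =
     \<lparr>carrier = gr_carrier R (m_power R A),
      mult = gr_product R (m_power R A) (mult R),
      one = gr_class R (m_power R A) 0 \<one>\<^bsub>R\<^esub>,
      zero = (\<lambda>p. m_power R A (Suc p)),
      add = (\<lambda>\<xi> \<eta> p. \<xi> p <+>\<^bsub>R\<^esub> \<eta> p)\<rparr>"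

abbreviation gr_ring_grading :: "('a, 'x) ring_scheme \<Rightarrow> (nat \<Rightarrow> 'a set) \<Rightarrow> nat \<Rightarrow> (nat \<Rightarrow> 'a set) set" where
  "gr_ring_grading R A \<equiv> gr_grading R (m_power R A)"

definition gr_module ::
    "('a, 'b, 'y) module_scheme \<Rightarrow> (nat \<Rightarrow> 'b set) \<Rightarrow> (nat \<Rightarrow> 'a set, nat \<Rightarrow> 'b set) module" where
  "gr_module M F =
     \<lparr>carrier = gr_carrier M F, mult = undefined, one = undefined,
      zero = (\<lambda>p. F (Suc p)),
      add = (\<lambda>\<xi> \<eta> p. \<xi> p <+>\<^bsub>M\<^esub> \<eta> p),
      smult = gr_product M F (smult M)\<rparr>"

text \<open>Invariants of the associated graded module, taken over the associated graded ring.\<close>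

abbreviation gr_t ::
    "('a, 'x) ring_scheme \<Rightarrow> (nat \<Rightarrow> 'a set) \<Rightarrow> ('a, 'b, 'y) module_scheme \<Rightarrow> (nat \<Rightarrow> 'b set) \<Rightarrow> nat \<Rightarrow> ereal" where
  "gr_t R A M F \<equiv> t_inv (gr_ring R A) (gr_ring_grading R A) (gr_module M F) (gr_grading M F)"

definition homogeneous_type ::
    "('a, 'x) ring_scheme \<Rightarrow> (nat \<Rightarrow> 'a set) \<Rightarrow> ('a, 'b, 'y) module_scheme \<Rightarrow> (nat \<Rightarrow> 'b set) \<Rightarrow>
     (nat \<Rightarrow> 'b set) \<Rightarrow> bool" where
  "homogeneous_type R A M B F \<longleftrightarrow>
     (\<forall>i. betti R A M B i =
          betti (gr_ring R A) (gr_ring_grading R A) (gr_module M F) (gr_grading M F) i)"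


section \<open>Standard bases\<close>

text \<open>Meaningful for nonzero elements only, as is \<open>initial_form\<close>; hence zero is excluded from
  standard bases.\<close>

definition valuation :: "(nat \<Rightarrow> 'b set) \<Rightarrow> 'b \<Rightarrow> nat" where
  "valuation F x = (GREATEST p. x \<in> F p)"

definition initial_form :: "('a, 'b, 'y) module_scheme \<Rightarrow> (nat \<Rightarrow> 'b set) \<Rightarrow> 'b \<Rightarrow> nat \<Rightarrow> 'b set" where
  "initial_form M F x = gr_class M F (valuation F x) x"

definition standard_basis ::
    "('a, 'x) ring_scheme \<Rightarrow> (nat \<Rightarrow> 'a set) \<Rightarrow> ('a, 'b, 'y) module_scheme \<Rightarrow> (nat \<Rightarrow> 'b set) \<Rightarrow> 'b set \<Rightarrow> bool" where
  "standard_basis R A M F S \<longleftrightarrow>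
     finite S \<and> S \<subseteq> carrier M - {\<zero>\<^bsub>M\<^esub>} \<and>
     LinearCombinations.module.span (gr_ring R A) (gr_module M F) (initial_form M F ` S) =
       carrier (gr_module M F)"

definition minimal_homogeneous_standard_basis ::
    "('a, 'x) ring_scheme \<Rightarrow> (nat \<Rightarrow> 'a set) \<Rightarrow> ('a, 'b, 'y) module_scheme \<Rightarrow> (nat \<Rightarrow> 'b set) \<Rightarrow>
     (nat \<Rightarrow> 'b set) \<Rightarrow> 'b set \<Rightarrow> bool" where
  "minimal_homogeneous_standard_basis R A M B F S \<longleftrightarrow>
     standard_basis R A M F S \<and> (\<forall>T. T \<subset> S \<longrightarrow> \<not> standard_basis R A M F T) \<and>
     (\<forall>f\<in>S. \<exists>j. f \<in> B j)"

definition degree_of :: "(nat \<Rightarrow> 'b set) \<Rightarrow> 'b \<Rightarrow> nat" where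
  "degree_of B f = (THE j. f \<in> B j)"

text \<open>The set does not depend on the minimal homogeneous standard basis that is chosen.\<close>

definition Delta ::
    "('a, 'x) ring_scheme \<Rightarrow> (nat \<Rightarrow> 'a set) \<Rightarrow> ('a, 'b, 'y) module_scheme \<Rightarrow> (nat \<Rightarrow> 'b set) \<Rightarrow>
     (nat \<Rightarrow> 'b set) \<Rightarrow> int set" where
  "Delta R A M B F =
     (\<lambda>f. int (degree_of B f) - int (valuation F f)) `
       (SOME S. minimal_homogeneous_standard_basis R A M B F S)"

definition v_inv ::
    "('a, 'x) ring_scheme \<Rightarrow> (nat \<Rightarrow> 'a set) \<Rightarrow> ('a, 'b, 'y) module_scheme \<Rightarrow> (nat \<Rightarrow> 'b set) \<Rightarrow>
     (nat \<Rightarrow> 'b set) \<Rightarrow> int" where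
  "v_inv R A M B F = Max (Delta R A M B F)"

definition u_inv ::
    "('a, 'x) ring_scheme \<Rightarrow> (nat \<Rightarrow> 'a set) \<Rightarrow> ('a, 'b, 'y) module_scheme \<Rightarrow> (nat \<Rightarrow> 'b set) \<Rightarrow>
     (nat \<Rightarrow> 'b set) \<Rightarrow> int" where
  "u_inv R A M B F = Min (Delta R A M B F)"

end

theory Submission
  imports Defs
begin

text \<open>Let \<open>K\<close> be a free resolution of the residue field by finite matrices with homogeneous entries.
  Tor is balanced, so \<open>Tor\<^sub>i(M, k)\<^sub>j\<close> is the degree \<open>j\<close> homology of \<open>M \<otimes> K\<close>, which consists of finite
  families in \<open>M\<close>. The filtration of \<open>M\<close> induces one of \<open>M \<otimes> K\<close>, shifted by the weights of the
  basis elements, with associated graded complex \<open>gr M \<otimes> gr K\<close>. Call \<open>h p j\<close> the dimension of the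
  internal degree \<open>j\<close> part of \<open>Tor\<^sub>i(gr M, k)\<^sub>p\<close>. As for the first page of a spectral sequence,
  \<open>\<beta>\<^sub>i\<^sub>j(M) \<le> \<Sum>\<^sub>p h p j\<close>, while \<open>\<Sum>\<^sub>j h p j = \<beta>\<^sub>i\<^sub>p(gr M)\<close>; and \<open>h p j\<close> vanishes unless \<open>j - p\<close> is the
  difference of the degree and the valuation of some element of the standard basis, so that
  \<open>u \<le> j - p \<le> v\<close>. This gives the upper bound. If the total Betti numbers agree, then no cancellation
  takes place, which gives the lower bound.\<close>

section \<open>Quotients and dimensions of subquotients\<close>

text \<open>Resolving the residue field rather than \<open>M\<close> has a structural reason.
  \<open>Tor\<close> is defined by an arbitrary choice of resolution, possibly of infinite rank and
  unrelated to the filtration, whereas the matrices of \<open>K\<close> act on \<open>M\<close> and,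
  carried along the isomorphism of \<open>R\<close> with its associated graded ring, on gr M. An
  entry of degree \<open>d\<close> raises the filtration index by \<open>d\<close>, so
  \<open>M \<otimes> K\<close> is filtered without lifting any resolution from gr M to
  \<open>M\<close>. Balance also makes the dimensions independent of the choice. The bound on
  \<open>j - p\<close> comes from a bigrading of gr M: a homogeneous scalar of degree
  \<open>d\<close> moves internal degree and filtration index by \<open>d\<close>, so the difference
  stays what it is on generators. The formal gr M carries only the grading by \<open>p\<close>; the
  internal degree is therefore kept on representatives in \<open>M \<otimes> K\<close>. Dimensions
  are meaningful only for finite-dimensional spaces, so finiteness accompanies every comparison; its
  source is a resolution of finite rank.\<close>

lemma (in Module.module) submodule_minus_closed:
  assumes "submodule R N M" "x \<in> N" shows "\<ominus>\<^bsub>M\<^esub> x \<in> N"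
proof -
  have "x \<in> carrier M" using assms by (auto simp: submodule_def)
  then have "\<ominus>\<^bsub>M\<^esub> x = (\<ominus> \<one>) \<odot>\<^bsub>M\<^esub> x" by (simp add: smult_l_minus)
  then show ?thesis using assms by (simp add: submodule_def)
qed

lemma (in Module.module) submodule_diff_closed:
  assumes "submodule R N M" "x \<in> N" "y \<in> N" shows "x \<ominus>\<^bsub>M\<^esub> y \<in> N"
  using assms submodule_minus_closed[OF assms(1,3)] by (auto simp: a_minus_def submodule_def)

lemma (in Module.module) submodule_finsum_closed:
  assumes N: "submodule R N M" and f: "\<And>i. i \<in> S \<Longrightarrow> f i \<in> N"
  shows "finsum M f S \<in> N"
  using f
proof (induction S rule: infinite_finite_induct)
  case (insert i S)
  moreover have "f j \<in> carrier M" if "j \<in> insert i S" for j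
    using insert.prems[OF that] N by (auto simp: submodule_def)
  ultimately have "finsum M f (insert i S) = f i \<oplus>\<^bsub>M\<^esub> finsum M f S" "f i \<in> N" "finsum M f S \<in> N"
    by (auto simp: Pi_def)
  then show ?case using N by (simp add: submodule_def)
qed (use N in \<open>auto simp: submodule_def\<close>)

lemma (in Module.module) submodule_additive_subgroup:
  assumes "submodule R N M" shows "additive_subgroup N M"
proof (rule additive_subgroup.intro, unfold_locales)
  show "inv\<^bsub>add_monoid M\<^esub> x \<in> N" if "x \<in> N" for x
    using submodule_minus_closed[OF assms that] by (simp add: a_inv_def)
qed (use assms in \<open>auto simp: submodule_def\<close>)

lemma (in Module.module) submodule_abelian_subgroup:
  "submodule R N M \<Longrightarrow> abelian_subgroup N M"
  by (intro abelian_subgroupI3 submodule_additive_subgroup) (assumption, unfold_locales)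

lemma (in Module.module) submodule_finsum_eq:
  assumes N: "submodule R N M" and f: "\<And>i. i \<in> S \<Longrightarrow> f i \<in> N"
  shows "finsum (M\<lparr>carrier := N\<rparr>) f S = finsum M f S"
  using f
proof (induction S rule: infinite_finite_induct)
  case (infinite S)
  interpret N: Module.module R "M\<lparr>carrier := N\<rparr>" using N by (rule submodule_is_module)
  show ?case using infinite by simp
next
  case empty
  interpret N: Module.module R "M\<lparr>carrier := N\<rparr>" using N by (rule submodule_is_module)
  show ?case by simp
next
  case (insert i S)
  interpret N: Module.module R "M\<lparr>carrier := N\<rparr>" using N by (rule submodule_is_module)
  have "f j \<in> carrier M" if "j \<in> insert i S" for j
    using insert.prems[OF that] N by (auto simp: submodule_def)
  then show ?case using insert by (simp add: Pi_def)
qed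

lemma (in Module.module) submodule_submodule:
  assumes "submodule R N M" "submodule R N' M" "N' \<subseteq> N"
  shows "submodule R N' (M\<lparr>carrier := N\<rparr>)"
  using assms submodule_is_module[OF assms(1)] by (auto simp: submodule_def)

lemma (in Module.module) submodule_carrier: "submodule R (carrier M) M"
  by (auto simp: submodule_def) unfold_locales

lemma (in Module.module) submodule_Int:
  "submodule R N M \<Longrightarrow> submodule R N' M \<Longrightarrow> submodule R (N \<inter> N') M"
  by (auto simp: submodule_def)

lemma (in Module.module) submodule_set_add:
  assumes "submodule R N M" "submodule R N' M"
  shows "submodule R (N <+>\<^bsub>M\<^esub> N') M"
proof -
  have *: "N <+>\<^bsub>M\<^esub> N' = submodule_sum N N'"
    unfolding submodule_sum_def set_add_def' by force
  show ?thesis unfolding * using assms by (rule sum_is_submodule)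
qed

lemma set_add_iff: "z \<in> X <+>\<^bsub>G\<^esub> Y \<longleftrightarrow> (\<exists>x\<in>X. \<exists>y\<in>Y. z = x \<oplus>\<^bsub>G\<^esub> y)"
  by (auto simp: set_add_def')

lemma a_r_coset_carrier_update [simp]:
  "N +>\<^bsub>M\<lparr>carrier := Z\<rparr>\<^esub> x = N +>\<^bsub>M\<^esub> x"
  by (simp add: a_r_coset_def')

section \<open>Cosets and the quotient by a submodule\<close>

context Module.module begin

lemma M_minus_zero [simp]: "\<ominus>\<^bsub>M\<^esub> \<zero>\<^bsub>M\<^esub> = \<zero>\<^bsub>M\<^esub>"
  by (metis M.r_neg M.l_zero M.zero_closed M.a_inv_closed)

lemma coset_eq_iff:
  assumes N: "submodule R N M" and [simp]: "x \<in> carrier M" "y \<in> carrier M"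
  shows "N +>\<^bsub>M\<^esub> x = N +>\<^bsub>M\<^esub> y \<longleftrightarrow> x \<ominus>\<^bsub>M\<^esub> y \<in> N"
proof -
  interpret N: abelian_subgroup N M using N by (rule submodule_abelian_subgroup)
  have "N +>\<^bsub>M\<^esub> x = N +>\<^bsub>M\<^esub> y \<longleftrightarrow> x \<in> N +>\<^bsub>M\<^esub> y"
    using N.a_repr_independence' N.a_rcos_self by (metis assms(2,3))
  then show ?thesis using N.a_rcos_module[of y x] by (simp add: a_minus_def)
qed

lemma coset_zero_iff:
  assumes N: "submodule R N M" and [simp]: "x \<in> carrier M"
  shows "N +>\<^bsub>M\<^esub> x = N \<longleftrightarrow> x \<in> N"
proof -
  have "N +>\<^bsub>M\<^esub> \<zero>\<^bsub>M\<^esub> = N" using N by (intro M.a_coset_add_zero) (auto simp: submodule_def)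
  then show ?thesis using coset_eq_iff[OF N, of x "\<zero>\<^bsub>M\<^esub>"]
    by (simp add: a_minus_def M_minus_zero)
qed

lemma coset_add:
  assumes N: "submodule R N M" and [simp]: "x \<in> carrier M" "y \<in> carrier M"
  shows "(N +>\<^bsub>M\<^esub> x) <+>\<^bsub>M\<^esub> (N +>\<^bsub>M\<^esub> y) = N +>\<^bsub>M\<^esub> (x \<oplus>\<^bsub>M\<^esub> y)"
proof -
  interpret N: abelian_subgroup N M using N by (rule submodule_abelian_subgroup)
  show ?thesis by (simp add: N.a_rcos_sum)
qed

lemma coset_mem_iff:
  assumes N: "submodule R N M" and "x \<in> carrier M" "y \<in> carrier M"
  shows "y \<in> N +>\<^bsub>M\<^esub> x \<longleftrightarrow> y \<ominus>\<^bsub>M\<^esub> x \<in> N"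
proof -
  interpret N: abelian_subgroup N M using N by (rule submodule_abelian_subgroup)
  show ?thesis using N.a_rcos_module[of x y] assms by (simp add: a_minus_def)
qed

lemma coset_subset:
  assumes N: "submodule R N M" and "x \<in> carrier M"
  shows "N +>\<^bsub>M\<^esub> x \<subseteq> carrier M"
  using assms by (intro M.a_r_coset_subset_G) (auto simp: submodule_def)

text \<open>Maps out of a quotient are written as unions over all representatives. When the target
  coset depends only on the source coset, all members of the union coincide; this evaluates the
  scalar action on \<open>quotient_module\<close> as well as \<open>red_diff\<close>.\<close>

lemma coset_Union:
  assumes N: "submodule R N M" and x: "x \<in> carrier M" and N': "submodule R N' M'" "Module.module R' M'"
    and h: "h x \<in> carrier M'" "\<And>y. y \<in> carrier M \<Longrightarrow> y \<ominus>\<^bsub>M\<^esub> x \<in> N \<Longrightarrow> N' +>\<^bsub>M'\<^esub> h y = N' +>\<^bsub>M'\<^esub> h x"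
  shows "(\<Union>y\<in>N +>\<^bsub>M\<^esub> x. N' +>\<^bsub>M'\<^esub> h y) = N' +>\<^bsub>M'\<^esub> h x"
proof -
  have eq: "N' +>\<^bsub>M'\<^esub> h y = N' +>\<^bsub>M'\<^esub> h x" if "y \<in> N +>\<^bsub>M\<^esub> x" for y
    using that h(2) coset_subset[OF N x] coset_mem_iff[OF N x] by blast
  have "x \<in> N +>\<^bsub>M\<^esub> x" using x coset_mem_iff[OF N x x] N by (simp add: submodule_def M.r_neg a_minus_def)
  then show ?thesis by (intro SUP_eq_const eq) blast+
qed

lemma quotient_smult:
  assumes N: "submodule R N M" and a [simp]: "a \<in> carrier R" and x [simp]: "x \<in> carrier M"
  shows "a \<odot>\<^bsub>quotient_module M N\<^esub> (N +>\<^bsub>M\<^esub> x) = N +>\<^bsub>M\<^esub> (a \<odot>\<^bsub>M\<^esub> x)"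
  unfolding quotient_module_def
proof (simp, rule coset_Union[OF N x N])
  show "Module.module R M" by unfold_locales
  fix y assume y [simp]: "y \<in> carrier M" and yx: "y \<ominus>\<^bsub>M\<^esub> x \<in> N"
  have "a \<odot>\<^bsub>M\<^esub> y \<ominus>\<^bsub>M\<^esub> a \<odot>\<^bsub>M\<^esub> x = a \<odot>\<^bsub>M\<^esub> (y \<ominus>\<^bsub>M\<^esub> x)"
    by (simp add: a_minus_def smult_r_distr smult_r_minus)
  then have "a \<odot>\<^bsub>M\<^esub> y \<ominus>\<^bsub>M\<^esub> a \<odot>\<^bsub>M\<^esub> x \<in> N" using yx N by (simp add: submodule_def)
  then show "N +>\<^bsub>M\<^esub> a \<odot>\<^bsub>M\<^esub> y = N +>\<^bsub>M\<^esub> a \<odot>\<^bsub>M\<^esub> x" by (simp add: coset_eq_iff[OF N])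
qed simp

lemma quotient_carrier: "carrier (quotient_module M N) = {N +>\<^bsub>M\<^esub> x | x. x \<in> carrier M}"
  by (auto simp: quotient_module_def A_RCOSETS_def')

lemma quotient_add: "X \<oplus>\<^bsub>quotient_module M N\<^esub> Y = X <+>\<^bsub>M\<^esub> Y"
  by (simp add: quotient_module_def)

lemma quotient_zero: "\<zero>\<^bsub>quotient_module M N\<^esub> = N"
  by (simp add: quotient_module_def)

lemma quotient_module_is_module:
  assumes N: "submodule R N M" shows "Module.module R (quotient_module M N)"
proof -
  let ?Q = "quotient_module M N"
  have z: "N +>\<^bsub>M\<^esub> \<zero>\<^bsub>M\<^esub> = N" using N by (intro M.a_coset_add_zero) (auto simp: submodule_def)
  have add: "(N +>\<^bsub>M\<^esub> x) \<oplus>\<^bsub>?Q\<^esub> (N +>\<^bsub>M\<^esub> y) = N +>\<^bsub>M\<^esub> (x \<oplus>\<^bsub>M\<^esub> y)"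
    if "x \<in> carrier M" "y \<in> carrier M" for x y
    using that by (simp add: quotient_add coset_add[OF N])
  have zero: "\<zero>\<^bsub>?Q\<^esub> = N +>\<^bsub>M\<^esub> \<zero>\<^bsub>M\<^esub>" by (simp add: quotient_zero z)
  have cl: "N +>\<^bsub>M\<^esub> x \<in> carrier ?Q" if "x \<in> carrier M" for x using that by (auto simp: quotient_carrier)
  note smult = quotient_smult[OF N]
  have ex: "\<exists>x\<in>carrier M. X = N +>\<^bsub>M\<^esub> x" if "X \<in> carrier ?Q" for X
    using that by (auto simp: quotient_carrier)
  have "abelian_group ?Q"
  proof (rule abelian_groupI)
    fix X Y assume "X \<in> carrier ?Q" "Y \<in> carrier ?Q"
    then obtain x y where [simp]: "x \<in> carrier M" "X = N +>\<^bsub>M\<^esub> x" "y \<in> carrier M" "Y = N +>\<^bsub>M\<^esub> y"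
      using ex by blast
    show "X \<oplus>\<^bsub>?Q\<^esub> Y \<in> carrier ?Q" by (simp add: add cl)
    show "X \<oplus>\<^bsub>?Q\<^esub> Y = Y \<oplus>\<^bsub>?Q\<^esub> X" by (simp add: add M.a_comm)
    fix W assume "W \<in> carrier ?Q"
    then obtain w where [simp]: "w \<in> carrier M" "W = N +>\<^bsub>M\<^esub> w" using ex by blast
    show "X \<oplus>\<^bsub>?Q\<^esub> Y \<oplus>\<^bsub>?Q\<^esub> W = X \<oplus>\<^bsub>?Q\<^esub> (Y \<oplus>\<^bsub>?Q\<^esub> W)" by (simp add: add M.a_assoc)
  next
    fix X assume "X \<in> carrier ?Q"
    then obtain x where [simp]: "x \<in> carrier M" "X = N +>\<^bsub>M\<^esub> x" using ex by blast
    show "\<zero>\<^bsub>?Q\<^esub> \<oplus>\<^bsub>?Q\<^esub> X = X" by (simp add: zero add)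
    have "(N +>\<^bsub>M\<^esub> \<ominus>\<^bsub>M\<^esub> x) \<oplus>\<^bsub>?Q\<^esub> X = \<zero>\<^bsub>?Q\<^esub>" by (simp add: zero add M.l_neg)
    then show "\<exists>Y\<in>carrier ?Q. Y \<oplus>\<^bsub>?Q\<^esub> X = \<zero>\<^bsub>?Q\<^esub>" using cl[of "\<ominus>\<^bsub>M\<^esub> x"] by auto
  qed (simp add: zero cl)
  then show ?thesis
  proof (rule moduleI[rotated])
    fix a b X assume [simp]: "a \<in> carrier R" "b \<in> carrier R" and "X \<in> carrier ?Q"
    then obtain x where [simp]: "x \<in> carrier M" "X = N +>\<^bsub>M\<^esub> x" using ex by blast
    show "(a \<oplus> b) \<odot>\<^bsub>?Q\<^esub> X = a \<odot>\<^bsub>?Q\<^esub> X \<oplus>\<^bsub>?Q\<^esub> b \<odot>\<^bsub>?Q\<^esub> X" by (simp add: smult add smult_l_distr)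
    show "(a \<otimes> b) \<odot>\<^bsub>?Q\<^esub> X = a \<odot>\<^bsub>?Q\<^esub> (b \<odot>\<^bsub>?Q\<^esub> X)" by (simp add: smult smult_assoc1)
    show "a \<odot>\<^bsub>?Q\<^esub> X \<in> carrier ?Q" by (simp add: smult cl)
    fix Y assume "Y \<in> carrier ?Q"
    then obtain y where [simp]: "y \<in> carrier M" "Y = N +>\<^bsub>M\<^esub> y" using ex by blast
    show "a \<odot>\<^bsub>?Q\<^esub> (X \<oplus>\<^bsub>?Q\<^esub> Y) = a \<odot>\<^bsub>?Q\<^esub> X \<oplus>\<^bsub>?Q\<^esub> a \<odot>\<^bsub>?Q\<^esub> Y" by (simp add: smult add smult_r_distr)
  next
    fix X assume "X \<in> carrier ?Q"
    then obtain x where [simp]: "x \<in> carrier M" "X = N +>\<^bsub>M\<^esub> x" using ex by blast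
    show "\<one> \<odot>\<^bsub>?Q\<^esub> X = X" by (simp add: smult)
  qed (unfold_locales)
qed

end

section \<open>Finite-dimensional subquotients and their dimensions\<close>

lemma vectorspaceI: "field K \<Longrightarrow> Module.module K V \<Longrightarrow> vectorspace K V"
  by (simp add: vectorspace_def field_def)

lemma (in vectorspace) quotient_vectorspace:
  assumes "submodule K N V" shows "vectorspace K (quotient_module V N)"
  using field.field_axioms quotient_module_is_module[OF assms] by (rule vectorspaceI)

lemma (in vectorspace) submodule_vectorspace:
  assumes "submodule K N V" shows "vectorspace K (V\<lparr>carrier := N\<rparr>)"
  using field.field_axioms submodule_is_module[OF assms] by (rule vectorspaceI)

text \<open>A linearly independent subset of \<open>U\<close> stays independent in \<open>V\<close>,
  so its size is at most \<open>dim\<close>; a maximal one is a basis of \<open>U\<close>.\<close>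

lemma (in vectorspace) subspace_fin_dim:
  assumes U: "submodule K U V" and fd: fin_dim
  shows "vectorspace.fin_dim K (vs U)" "vectorspace.dim K (vs U) \<le> dim"
proof -
  interpret U: vectorspace K "vs U" using U by (rule submodule_vectorspace)
  have UV: "U \<subseteq> carrier V" using U by (auto simp: submodule_def)
  have P: "finite S \<and> card S \<le> dim" if "S \<subseteq> carrier (vs U) \<and> U.lin_indpt S" for S
    using that li_le_dim[OF fd, of S] span_li_not_depend(2)[OF _ U, of S] UV by auto
  have "U.lin_indpt {}" by (simp add: U.lin_dep_def)
  then obtain S where S: "finite S" "maximal S (\<lambda>S. S \<subseteq> carrier (vs U) \<and> U.lin_indpt S)"
    using maximal_exists[of "\<lambda>S. S \<subseteq> carrier (vs U) \<and> U.lin_indpt S" dim "{}"] P by auto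
  have b: "U.basis S" by (rule U.max_li_is_basis[OF S(2)])
  then show fdU: "U.fin_dim" using S(1) by (auto simp: U.fin_dim_def U.basis_def)
  show "U.dim \<le> dim" using U.dim_basis[OF S(1) b] P[of S] S(2) by (simp add: maximal_def)
qed

text \<open>The converse of \<open>L\<close> is a function: by linearity, two partners of the same
  \<open>w\<close> differ by a partner of zero. It is a linear map from a subspace \<open>U\<close>
  of \<open>W\<close> onto \<open>V\<close>, so dim V <= dim U <= dim W. Correspondences are used
  instead of maps because later comparisons, such as \<open>hd w = vd w'\<close>, come without a
  canonical choice of partner.\<close>

lemma dim_le_of_relation:
  fixes V (structure)
  assumes "vectorspace K V" "vectorspace K W" and fd: "vectorspace.fin_dim K W"
    and L: "\<And>v w. L v w \<Longrightarrow> v \<in> carrier V \<and> w \<in> carrier W"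
    and add: "\<And>v w v' w'. L v w \<Longrightarrow> L v' w' \<Longrightarrow> L (v \<oplus> v') (w \<oplus>\<^bsub>W\<^esub> w')"
    and smult: "\<And>a v w. a \<in> carrier K \<Longrightarrow> L v w \<Longrightarrow> L (a \<odot> v) (a \<odot>\<^bsub>W\<^esub> w)"
    and tot: "\<And>v. v \<in> carrier V \<Longrightarrow> \<exists>w. L v w"
    and inj: "\<And>v. L v \<zero>\<^bsub>W\<^esub> \<Longrightarrow> v = \<zero>"
  shows "vectorspace.fin_dim K V \<and> vectorspace.dim K V \<le> vectorspace.dim K W"
proof -
  interpret V: vectorspace K V by fact
  interpret W: vectorspace K W by fact
  define U where "U = {w. \<exists>v. L v w}"
  have neg: "L (\<ominus> v) (\<ominus>\<^bsub>W\<^esub> w)" if "L v w" for v w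
    using smult[OF _ that, of "\<ominus>\<^bsub>K\<^esub> \<one>\<^bsub>K\<^esub>"] L[OF that] by (simp add: V.smult_l_minus W.smult_l_minus)
  have uniq: "v = v'" if "L v w" "L v' w" for v v' w
  proof -
    have "L (v \<oplus> \<ominus> v') \<zero>\<^bsub>W\<^esub>"
      using add[OF that(1) neg[OF that(2)]] L[OF that(2)] by (simp add: W.r_neg)
    then have "v \<oplus> \<ominus> v' = \<zero>" by (rule inj)
    then show ?thesis using L[OF that(1)] L[OF that(2)]
      by (metis V.M.minus_equality V.M.minus_minus V.M.a_inv_closed)
  qed
  define f where "f w = (THE v. L v w)" for w
  have fL: "f w = v" if "L v w" for v w unfolding f_def using that uniq by blast
  have 0: "L \<zero> \<zero>\<^bsub>W\<^esub>"
    using tot[of "\<zero>"] smult[of "\<zero>\<^bsub>K\<^esub>"] L by fastforce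
  have U: "submodule K U W"
    unfolding submodule_def U_def
  proof (intro conjI allI impI subsetI; (elim CollectE exE)?)
    show "Module.module K W" ..
    show "\<zero>\<^bsub>W\<^esub> \<in> {w. \<exists>v. L v w}" using 0 by blast
  qed (use L add smult in blast)+
  interpret U: vectorspace K "W\<lparr>carrier := U\<rparr>" using U by (rule W.submodule_vectorspace)
  have hom: "f \<in> LinearCombinations.module_hom K (W\<lparr>carrier := U\<rparr>) V"
    unfolding LinearCombinations.module_hom_def U_def
  proof (intro CollectI conjI allI impI)
    show "f \<in> carrier (W\<lparr>carrier := {w. \<exists>v. L v w}\<rparr>) \<rightarrow> carrier V" using L fL by fastforce
  next
    fix w w' assume "w \<in> carrier (W\<lparr>carrier := {w. \<exists>v. L v w}\<rparr>) \<and> w' \<in> carrier (W\<lparr>carrier := {w. \<exists>v. L v w}\<rparr>)"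
    then obtain v v' where "L v w" "L v' w'" by auto
    then show "f (w \<oplus>\<^bsub>W\<lparr>carrier := {w. \<exists>v. L v w}\<rparr>\<^esub> w') = f w \<oplus> f w'"
      using add fL by simp
  next
    fix a w assume "a \<in> carrier K \<and> w \<in> carrier (W\<lparr>carrier := {w. \<exists>v. L v w}\<rparr>)"
    then obtain v where "L v w" "a \<in> carrier K" by auto
    then show "f (a \<odot>\<^bsub>W\<lparr>carrier := {w. \<exists>v. L v w}\<rparr>\<^esub> w) = a \<odot> f w"
      using smult fL by simp
  qed
  interpret f: linear_map K "W\<lparr>carrier := U\<rparr>" V f
    by (intro linear_map.intro mod_hom.intro mod_hom_axioms.intro hom) unfold_locales
  have surj: "f ` carrier (W\<lparr>carrier := U\<rparr>) = carrier V"
    using tot fL L by (force simp: U_def image_iff)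
  note Ufd = W.subspace_fin_dim[OF U fd]
  have "V.fin_dim" by (rule f.surj_fin_dim[OF Ufd(1) surj])
  moreover have "V.dim \<le> U.dim"
    using f.rank_nullity[OF Ufd(1)] f.surj_imp_imT_carrier[OF surj] by simp
  ultimately show ?thesis using Ufd(2) by simp
qed

text \<open>Since \<open>vectorspace.dim\<close> has no meaning in infinite dimension, \<open>dimq\<close> is only used together
  with \<open>finq\<close>.\<close>

definition dimq where "dimq K V Z B = vectorspace.dim K (quotient_module (V\<lparr>carrier := Z\<rparr>) B)"
definition finq where "finq K V Z B = vectorspace.fin_dim K (quotient_module (V\<lparr>carrier := Z\<rparr>) B)"

definition linrel where
  "linrel K V W L \<longleftrightarrow>
     (\<forall>v w. L v w \<longrightarrow> v \<in> carrier V \<and> w \<in> carrier W) \<and>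
     (\<forall>v w v' w'. L v w \<longrightarrow> L v' w' \<longrightarrow> L (v \<oplus>\<^bsub>V\<^esub> v') (w \<oplus>\<^bsub>W\<^esub> w')) \<and>
     (\<forall>a v w. a \<in> carrier K \<longrightarrow> L v w \<longrightarrow> L (a \<odot>\<^bsub>V\<^esub> v) (a \<odot>\<^bsub>W\<^esub> w))"

text \<open>The correspondence descends to the cosets of \<open>B\<close> and \<open>B'\<close>.
  Elements of \<open>B\<close> may have partners outside \<open>B'\<close>, which is why only an
  inequality results; this is the form in which the homology of a filtered complex is bounded by the
  first page of its spectral sequence.\<close>

lemma dimq_le:
  fixes V (structure)
  assumes "vectorspace K V" "submodule K Z V" "submodule K B V" "B \<subseteq> Z"
    and "vectorspace K V'" "submodule K Z' V'" "submodule K B' V'" "B' \<subseteq> Z'"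
    and L: "linrel K V V' L"
    and tot: "\<And>z. z \<in> Z \<Longrightarrow> \<exists>z'\<in>Z'. L z z'"
    and inj: "\<And>z z'. L z z' \<Longrightarrow> z \<in> Z \<Longrightarrow> z' \<in> B' \<Longrightarrow> z \<in> B"
    and fin: "finq K V' Z' B'"
  shows "finq K V Z B \<and> dimq K V Z B \<le> dimq K V' Z' B'"
  unfolding finq_def dimq_def
proof (rule dim_le_of_relation)
  interpret V: vectorspace K V by fact
  interpret V': vectorspace K V' by fact
  interpret Z: vectorspace K "V\<lparr>carrier := Z\<rparr>" using assms(2) by (rule V.submodule_vectorspace)
  interpret Z': vectorspace K "V'\<lparr>carrier := Z'\<rparr>" using assms(6) by (rule V'.submodule_vectorspace)
  note B = V.submodule_submodule[OF assms(2,3,4)] and B' = V'.submodule_submodule[OF assms(6,7,8)]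
  have ZV: "Z \<subseteq> carrier V" and ZV': "Z' \<subseteq> carrier V'" using assms(2,6) by (auto simp: submodule_def)
  show "vectorspace K (quotient_module (V\<lparr>carrier := Z\<rparr>) B)" using B by (rule Z.quotient_vectorspace)
  show "vectorspace K (quotient_module (V'\<lparr>carrier := Z'\<rparr>) B')" using B' by (rule Z'.quotient_vectorspace)
  show "vectorspace.fin_dim K (quotient_module (V'\<lparr>carrier := Z'\<rparr>) B')" using fin by (simp add: finq_def)
  let ?L = "\<lambda>X X'. \<exists>z\<in>Z. \<exists>z'\<in>Z'. L z z' \<and> X = B +> z \<and> X' = B' +>\<^bsub>V'\<^esub> z'"
  show "?L X X' \<Longrightarrow> X \<in> carrier (quotient_module (V\<lparr>carrier := Z\<rparr>) B) \<and>
      X' \<in> carrier (quotient_module (V'\<lparr>carrier := Z'\<rparr>) B')" for X X'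
    by (auto simp: Z.quotient_carrier Z'.quotient_carrier)
  show "\<exists>X'. ?L X X'" if "X \<in> carrier (quotient_module (V\<lparr>carrier := Z\<rparr>) B)" for X
    using that tot by (auto simp: Z.quotient_carrier) blast
  show "?L (X \<oplus>\<^bsub>quotient_module (V\<lparr>carrier := Z\<rparr>) B\<^esub> Y) (X' \<oplus>\<^bsub>quotient_module (V'\<lparr>carrier := Z'\<rparr>) B'\<^esub> Y')"
    if "?L X X'" "?L Y Y'" for X X' Y Y'
  proof -
    from that obtain x x' y y' where *: "x \<in> Z" "x' \<in> Z'" "L x x'" "X = B +> x" "X' = B' +>\<^bsub>V'\<^esub> x'"
      "y \<in> Z" "y' \<in> Z'" "L y y'" "Y = B +> y" "Y' = B' +>\<^bsub>V'\<^esub> y'" by blast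
    then have "X \<oplus>\<^bsub>quotient_module (V\<lparr>carrier := Z\<rparr>) B\<^esub> Y = B +> (x \<oplus> y)"
      "X' \<oplus>\<^bsub>quotient_module (V'\<lparr>carrier := Z'\<rparr>) B'\<^esub> Y' = B' +>\<^bsub>V'\<^esub> (x' \<oplus>\<^bsub>V'\<^esub> y')"
      using Z.coset_add[OF B] Z'.coset_add[OF B'] by (simp_all add: Z.quotient_add Z'.quotient_add set_add_def')
    moreover have "L (x \<oplus> y) (x' \<oplus>\<^bsub>V'\<^esub> y')" "x \<oplus> y \<in> Z" "x' \<oplus>\<^bsub>V'\<^esub> y' \<in> Z'"
      using * L assms(2,6) by (auto simp: linrel_def submodule_def)
    ultimately show ?thesis by blast
  qed
  show "?L (a \<odot>\<^bsub>quotient_module (V\<lparr>carrier := Z\<rparr>) B\<^esub> X) (a \<odot>\<^bsub>quotient_module (V'\<lparr>carrier := Z'\<rparr>) B'\<^esub> X')"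
    if "a \<in> carrier K" "?L X X'" for a X X'
  proof -
    from that obtain x x' where *: "x \<in> Z" "x' \<in> Z'" "L x x'" "X = B +> x" "X' = B' +>\<^bsub>V'\<^esub> x'" by blast
    then have "a \<odot>\<^bsub>quotient_module (V\<lparr>carrier := Z\<rparr>) B\<^esub> X = B +> (a \<odot> x)"
      "a \<odot>\<^bsub>quotient_module (V'\<lparr>carrier := Z'\<rparr>) B'\<^esub> X' = B' +>\<^bsub>V'\<^esub> (a \<odot>\<^bsub>V'\<^esub> x')"
      using Z.quotient_smult[OF B that(1)] Z'.quotient_smult[OF B' that(1)] by simp_all
    moreover have "L (a \<odot> x) (a \<odot>\<^bsub>V'\<^esub> x')" "a \<odot> x \<in> Z" "a \<odot>\<^bsub>V'\<^esub> x' \<in> Z'"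
      using * L assms(2,6) that by (auto simp: linrel_def submodule_def)
    ultimately show ?thesis by blast
  qed
  show "X = \<zero>\<^bsub>quotient_module (V\<lparr>carrier := Z\<rparr>) B\<^esub>" if X: "?L X \<zero>\<^bsub>quotient_module (V'\<lparr>carrier := Z'\<rparr>) B'\<^esub>" for X
  proof -
    from X obtain x x' where *: "x \<in> Z" "x' \<in> Z'" "L x x'" "X = B +> x" "B' = B' +>\<^bsub>V'\<^esub> x'"
      by (auto simp: Z'.quotient_zero)
    then have "x' \<in> B'" using Z'.coset_zero_iff[OF B', of x'] by simp
    then have "x \<in> B" using inj * by blast
    then show ?thesis using * Z.coset_zero_iff[OF B, of x] by (simp add: Z.quotient_zero)
  qed
qed

lemma dimq_eq:
  assumes V: "vectorspace K V" "submodule K Z V" "submodule K B V" "B \<subseteq> Z"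
    and V': "vectorspace K V'" "submodule K Z' V'" "submodule K B' V'" "B' \<subseteq> Z'"
    and L: "linrel K V V' L"
    and tot: "\<And>z. z \<in> Z \<Longrightarrow> \<exists>z'\<in>Z'. L z z'" "\<And>z'. z' \<in> Z' \<Longrightarrow> \<exists>z\<in>Z. L z z'"
    and inj: "\<And>z z'. L z z' \<Longrightarrow> z \<in> Z \<Longrightarrow> z' \<in> Z' \<Longrightarrow> z \<in> B \<longleftrightarrow> z' \<in> B'"
  shows "finq K V Z B \<longleftrightarrow> finq K V' Z' B'" "finq K V Z B \<Longrightarrow> dimq K V Z B = dimq K V' Z' B'"
proof -
  have L': "linrel K V' V (\<lambda>z' z. L z z')" using L unfolding linrel_def by blast
  have 1: "finq K V Z B \<and> dimq K V Z B \<le> dimq K V' Z' B'" if "finq K V' Z' B'"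
    by (rule dimq_le[OF V V' L tot(1) _ that]) (use inj V'(4) in blast)+
  have 2: "finq K V' Z' B' \<and> dimq K V' Z' B' \<le> dimq K V Z B" if "finq K V Z B"
    by (rule dimq_le[OF V' V L' tot(2) _ that]) (use inj V(4) in blast)+
  show "finq K V Z B \<longleftrightarrow> finq K V' Z' B'" using 1 2 by blast
  show "dimq K V Z B = dimq K V' Z' B'" if "finq K V Z B" using 1 2 that by force
qed

text \<open>Testing generation against subspaces instead of spans makes the condition easy to pull
  back along a quotient map.\<close>

lemma (in vectorspace) fin_dim_iff:
  "fin_dim \<longleftrightarrow> (\<exists>E. finite E \<and> E \<subseteq> carrier V \<and> (\<forall>U. submodule K U V \<and> E \<subseteq> U \<longrightarrow> carrier V \<subseteq> U))"
proof
  assume fin_dim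
  then obtain E where E: "finite E" "E \<subseteq> carrier V" "gen_set E" by (auto simp: fin_dim_def)
  then have "carrier V \<subseteq> U" if "submodule K U V" "E \<subseteq> U" for U
    using span_is_subset[OF that(2,1)] by simp
  then show "\<exists>E. finite E \<and> E \<subseteq> carrier V \<and> (\<forall>U. submodule K U V \<and> E \<subseteq> U \<longrightarrow> carrier V \<subseteq> U)" using E by blast
next
  assume "\<exists>E. finite E \<and> E \<subseteq> carrier V \<and> (\<forall>U. submodule K U V \<and> E \<subseteq> U \<longrightarrow> carrier V \<subseteq> U)"
  then obtain E where E: "finite E" "E \<subseteq> carrier V" "\<forall>U. submodule K U V \<and> E \<subseteq> U \<longrightarrow> carrier V \<subseteq> U" by (elim exE conjE) (rule that)
  have "carrier V \<subseteq> span E"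
    by (rule E(3)[rule_format, OF conjI[OF span_is_submodule[OF E(2)] in_own_span[OF E(2)]]])
  then have "gen_set E" using span_is_subset2[OF E(2)] by blast
  then show fin_dim using E by (auto simp: fin_dim_def)
qed

text \<open>Uses the correspondence between subspaces of \<open>Z / B\<close> and subspaces between
  \<open>B\<close> and \<open>Z\<close>: finitely many cosets generate the quotient exactly when
  their representatives together with \<open>B\<close> generate \<open>Z\<close>.\<close>

lemma finq_iff:
  fixes V (structure)
  assumes "vectorspace K V" and Z: "submodule K Z V" and B: "submodule K B V" and BZ: "B \<subseteq> Z"
  shows "finq K V Z B \<longleftrightarrow>
    (\<exists>E. finite E \<and> E \<subseteq> Z \<and> (\<forall>W. submodule K W V \<and> B \<subseteq> W \<and> E \<subseteq> W \<longrightarrow> Z \<subseteq> W))"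
proof -
  interpret V: vectorspace K V by fact
  interpret Z: vectorspace K "V\<lparr>carrier := Z\<rparr>" using Z by (rule V.submodule_vectorspace)
  note B' = V.submodule_submodule[OF Z B BZ]
  let ?Q = "quotient_module (V\<lparr>carrier := Z\<rparr>) B"
  interpret Q: vectorspace K ?Q using B' by (rule Z.quotient_vectorspace)
  have ZV: "Z \<subseteq> carrier V" using Z by (auto simp: submodule_def)
  have add: "(B +> x) \<oplus>\<^bsub>?Q\<^esub> (B +> y) = B +> (x \<oplus> y)" if "x \<in> Z" "y \<in> Z" for x y
    using Z.coset_add[OF B', of x y] that by (simp add: Z.quotient_add)
  have smult: "a \<odot>\<^bsub>?Q\<^esub> (B +> x) = B +> (a \<odot> x)" if "a \<in> carrier K" "x \<in> Z" for a x
    using Z.quotient_smult[OF B', of a x] that by simp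
  have zero: "\<zero>\<^bsub>?Q\<^esub> = B +> \<zero>" using Z.coset_zero_iff[OF B', of "\<zero>"] Z B
    by (simp add: Z.quotient_zero submodule_def)
  have C: "carrier ?Q = (\<lambda>x. B +> x) ` Z" by (auto simp: Z.quotient_carrier)
  note sm = Z[unfolded submodule_def] B[unfolded submodule_def]
  show ?thesis
  proof
    assume "finq K V Z B"
    then obtain E' where E': "finite E'" "E' \<subseteq> carrier ?Q"
      "\<forall>U. submodule K U ?Q \<and> E' \<subseteq> U \<longrightarrow> carrier ?Q \<subseteq> U"
      unfolding finq_def Q.fin_dim_iff by (elim exE conjE) (rule that)
    then obtain E where E: "E \<subseteq> Z" "finite E" "E' = (\<lambda>x. B +> x) ` E"
      unfolding C using finite_subset_image by meson
    show "\<exists>E. finite E \<and> E \<subseteq> Z \<and> (\<forall>W. submodule K W V \<and> B \<subseteq> W \<and> E \<subseteq> W \<longrightarrow> Z \<subseteq> W)"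
    proof (intro exI[of _ E] conjI allI impI E)
      fix W assume W: "submodule K W V \<and> B \<subseteq> W \<and> E \<subseteq> W"
      let ?U = "(\<lambda>x. B +> x) ` (W \<inter> Z)"
      have "submodule K ?U ?Q" unfolding submodule_def
      proof (intro conjI allI impI)
        show "\<zero>\<^bsub>?Q\<^esub> \<in> ?U" unfolding zero using W sm by (intro imageI) (auto simp: submodule_def)
        show "v \<oplus>\<^bsub>?Q\<^esub> w \<in> ?U" if vw: "v \<in> ?U" "w \<in> ?U" for v w
        proof -
          obtain x y where "x \<in> W \<inter> Z" "y \<in> W \<inter> Z" "v = B +> x" "w = B +> y" using vw by blast
          then show ?thesis using W sm by (simp add: add submodule_def)
        qed
        show "a \<odot>\<^bsub>?Q\<^esub> v \<in> ?U" if "a \<in> carrier K" "v \<in> ?U" for a v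
        proof -
          from that(2) obtain x where "x \<in> W \<inter> Z" "v = B +> x" by blast
          then show ?thesis using W sm that(1) by (simp add: smult submodule_def)
        qed
        show "Module.module K ?Q" ..
      qed (auto simp: C)
      moreover have "E' \<subseteq> ?U" using E W by auto
      ultimately have *: "carrier ?Q \<subseteq> ?U" by (intro E'(3)[rule_format] conjI)
      show "Z \<subseteq> W"
      proof
        fix z assume z: "z \<in> Z"
        then obtain w where w: "w \<in> W" "w \<in> Z" "B +> z = B +> w" using * unfolding C by blast
        then have "z \<ominus> w \<in> W" using V.coset_eq_iff[OF B, of z w] z ZV W by blast
        then have "(z \<ominus> w) \<oplus> w \<in> W" using w W by (auto simp: submodule_def)
        then show "z \<in> W" using z w ZV by (simp add: a_minus_def V.M.a_assoc V.M.l_neg subset_iff)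
      qed
    qed
  next
    assume "\<exists>E. finite E \<and> E \<subseteq> Z \<and> (\<forall>W. submodule K W V \<and> B \<subseteq> W \<and> E \<subseteq> W \<longrightarrow> Z \<subseteq> W)"
    then obtain E where E: "finite E" "E \<subseteq> Z" "\<forall>W. submodule K W V \<and> B \<subseteq> W \<and> E \<subseteq> W \<longrightarrow> Z \<subseteq> W"
      by (elim exE conjE) (rule that)
    show "finq K V Z B" unfolding finq_def Q.fin_dim_iff
    proof (intro exI[of _ "(\<lambda>x. B +> x) ` E"] conjI allI impI)
      fix U assume U: "submodule K U ?Q \<and> (\<lambda>x. B +> x) ` E \<subseteq> U"
      have Um: "u \<oplus>\<^bsub>?Q\<^esub> u' \<in> U" "a \<odot>\<^bsub>?Q\<^esub> u \<in> U" "\<zero>\<^bsub>?Q\<^esub> \<in> U"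
        if "u \<in> U" "u' \<in> U" "a \<in> carrier K" for a u u'
        using U that by (auto simp: submodule_def)
      have BU: "B \<in> U" using U by (auto simp: submodule_def Z.quotient_zero)
      let ?W = "{z \<in> Z. B +> z \<in> U}"
      have "submodule K ?W V" unfolding submodule_def
      proof (intro conjI allI impI)
        show "?W \<subseteq> carrier V" using ZV by auto
        show "\<zero> \<in> ?W" using sm BU V.coset_zero_iff[OF B, of "\<zero>"] by simp
        show "v \<oplus> w \<in> ?W" if "v \<in> ?W" "w \<in> ?W" for v w
          using that Um(1)[of "B +> v" "B +> w" "\<zero>\<^bsub>K\<^esub>"] sm add[of v w] by simp
        show "a \<odot> v \<in> ?W" if "a \<in> carrier K" "v \<in> ?W" for a v
          using that Um(2)[of "B +> v" "B +> v" a] sm smult[of a v] by simp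
      qed (rule V.module_axioms)
      moreover have "B \<subseteq> ?W"
      proof
        fix b assume b: "b \<in> B"
        then have "b \<in> carrier V" using BZ ZV by blast
        then have "B +> b = B" using V.coset_zero_iff[OF B] b by blast
        then show "b \<in> ?W" using b BZ BU by auto
      qed
      moreover have "E \<subseteq> ?W" using E U by auto
      ultimately have "Z \<subseteq> ?W" by (intro E(3)[rule_format] conjI)
      then show "carrier ?Q \<subseteq> U" by (auto simp: C)
    qed (use E in \<open>auto simp: C\<close>)
  qed
qed

text \<open>Rank-nullity for the projection of \<open>Z / B\<close> onto \<open>Z / Y\<close>, whose
  kernel is \<open>Y / B\<close>. Finiteness of \<open>Z / B\<close> from that of both pieces is
  obtained from \<open>finq_iff\<close> by uniting the two generating sets.\<close>

lemma dimq_add: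
  fixes V (structure)
  assumes V: "vectorspace K V" and Z: "submodule K Z V" and Y: "submodule K Y V" and B: "submodule K B V"
    and BY: "B \<subseteq> Y" and YZ: "Y \<subseteq> Z"
  shows "finq K V Z B \<longleftrightarrow> finq K V Z Y \<and> finq K V Y B"
    and "finq K V Z B \<Longrightarrow> dimq K V Z B = dimq K V Z Y + dimq K V Y B"
proof -
  interpret V: vectorspace K V by fact
  interpret Z: vectorspace K "V\<lparr>carrier := Z\<rparr>" using Z by (rule V.submodule_vectorspace)
  have BZ: "B \<subseteq> Z" using BY YZ by blast
  have ZV: "Z \<subseteq> carrier V" using Z by (auto simp: submodule_def)
  note B' = V.submodule_submodule[OF Z B BZ] and Y' = V.submodule_submodule[OF Z Y YZ]
  let ?Q = "quotient_module (V\<lparr>carrier := Z\<rparr>) B" and ?P = "quotient_module (V\<lparr>carrier := Z\<rparr>) Y"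
  interpret Q: vectorspace K ?Q using B' by (rule Z.quotient_vectorspace)
  interpret P: vectorspace K ?P using Y' by (rule Z.quotient_vectorspace)
  have C: "carrier ?Q = (\<lambda>x. B +> x) ` Z" by (auto simp: Z.quotient_carrier)
  \<comment> \<open>The coset of \<open>Y\<close> that contains a given coset of \<open>B\<close>,
    written as a union.\<close>
  define T where "T X = (\<Union>x\<in>X. Y +> x)" for X
  have T: "T (B +> z) = Y +> z" if "z \<in> Z" for z
    unfolding T_def
  proof (rule V.coset_Union[OF B _ Y])
    show "Y +> y = Y +> z" if "y \<in> carrier V" "y \<ominus> z \<in> B" for y
      using V.coset_eq_iff[OF Y that(1), of z] that BY ZV \<open>z \<in> Z\<close> by blast
  qed (use that ZV in \<open>auto intro: V.module_axioms\<close>)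
  have hom: "T \<in> LinearCombinations.module_hom K ?Q ?P"
    unfolding LinearCombinations.module_hom_def
  proof (intro CollectI conjI allI impI)
    show "T \<in> carrier ?Q \<rightarrow> carrier ?P" by (auto simp: C T Z.quotient_carrier)
  next
    fix X X' assume "X \<in> carrier ?Q \<and> X' \<in> carrier ?Q"
    then obtain x x' where *: "x \<in> Z" "X = B +> x" "x' \<in> Z" "X' = B +> x'" by (auto simp: C)
    moreover have "x \<oplus> x' \<in> Z" using * Z by (auto simp: submodule_def)
    ultimately show "T (X \<oplus>\<^bsub>?Q\<^esub> X') = T X \<oplus>\<^bsub>?P\<^esub> T X'"
      using Z.coset_add[OF B', of x x'] Z.coset_add[OF Y', of x x'] by (simp add: Z.quotient_add T)
  next
    fix a X assume "a \<in> carrier K \<and> X \<in> carrier ?Q"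
    then obtain x where *: "x \<in> Z" "X = B +> x" "a \<in> carrier K" by (auto simp: C)
    moreover have "a \<odot> x \<in> Z" using * Z by (auto simp: submodule_def)
    ultimately show "T (a \<odot>\<^bsub>?Q\<^esub> X) = a \<odot>\<^bsub>?P\<^esub> T X"
      using Z.quotient_smult[OF B', of a x] Z.quotient_smult[OF Y', of a x] by (simp add: T)
  qed
  interpret T: linear_map K ?Q ?P T
    by (intro linear_map.intro mod_hom.intro mod_hom_axioms.intro hom) unfold_locales
  have ker: "T.kerT = carrier (quotient_module (V\<lparr>carrier := Y\<rparr>) B)" (is "?l = ?r")
  proof -
    have z: "Y +> z = Y \<longleftrightarrow> z \<in> Y" if "z \<in> Z" for z using V.coset_zero_iff[OF Y] that ZV by blast
    have r: "?r = (\<lambda>x. B +> x) ` Y" by (auto simp: quotient_module_def A_RCOSETS_def')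
    have "T.kerT = {X \<in> carrier ?Q. T X = Y}" by (simp add: T.ker_def Z.quotient_zero)
    also have "\<dots> = (\<lambda>x. B +> x) ` Y"
    proof (intro equalityI subsetI)
      fix X assume "X \<in> {X \<in> carrier ?Q. T X = Y}"
      then obtain z where "z \<in> Z" "X = B +> z" "T X = Y" unfolding C by blast
      then show "X \<in> (\<lambda>x. B +> x) ` Y" using T[of z] z[of z] by simp
    next
      fix X assume "X \<in> (\<lambda>x. B +> x) ` Y"
      then obtain y where y: "y \<in> Y" "y \<in> Z" "X = B +> y" using YZ by blast
      then have "T X = Y" using T[of y] z[of y] by simp
      then show "X \<in> {X \<in> carrier ?Q. T X = Y}" using y unfolding C by blast
    qed
    finally show ?thesis unfolding r .
  qed
  \<comment> \<open>The kernel and \<open>Y / B\<close> agree as records, so the nullity is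
    literally \<open>dimq K V Y B\<close>.\<close>
  have eq: "?Q\<lparr>carrier := T.kerT\<rparr> = quotient_module (V\<lparr>carrier := Y\<rparr>) B"
    unfolding ker by (simp add: quotient_module_def set_add_def' fun_eq_iff)
  have surj: "T ` carrier ?Q = carrier ?P" by (force simp: C T Z.quotient_carrier image_iff)
  have fdP: "finq K V Z Y \<and> finq K V Y B" if "finq K V Z B"
    using T.surj_fin_dim[OF _ surj] Q.subspace_fin_dim(1)[OF T.ker_is_submodule] that eq
    by (simp add: finq_def)
  have "finq K V Z B" if "finq K V Z Y" "finq K V Y B"
  proof -
    obtain E where E: "finite E" "E \<subseteq> Z" "\<forall>W. submodule K W V \<and> Y \<subseteq> W \<and> E \<subseteq> W \<longrightarrow> Z \<subseteq> W"
      using \<open>finq K V Z Y\<close> unfolding finq_iff[OF V Z Y YZ] by (elim exE conjE) (rule that)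
    obtain E' where E': "finite E'" "E' \<subseteq> Y" "\<forall>W. submodule K W V \<and> B \<subseteq> W \<and> E' \<subseteq> W \<longrightarrow> Y \<subseteq> W"
      using \<open>finq K V Y B\<close> unfolding finq_iff[OF V Y B BY] by (elim exE conjE) (rule that)
    have "Z \<subseteq> W" if W: "submodule K W V \<and> B \<subseteq> W \<and> E \<union> E' \<subseteq> W" for W
    proof -
      have "Y \<subseteq> W" using W by (intro E'(3)[rule_format]) simp
      then show ?thesis using W by (intro E(3)[rule_format]) simp
    qed
    then show ?thesis unfolding finq_iff[OF V Z B BZ]
      using E(1,2) E'(1,2) YZ by (intro exI[of _ "E \<union> E'"]) auto
  qed
  then show "finq K V Z B \<longleftrightarrow> finq K V Z Y \<and> finq K V Y B" using fdP by blast
  show "dimq K V Z B = dimq K V Z Y + dimq K V Y B" if "finq K V Z B"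
    using T.rank_nullity that T.surj_imp_imT_carrier[OF surj] eq by (simp add: finq_def dimq_def)
qed

lemma dimq_self:
  assumes V: "vectorspace K V" and Z: "submodule K Z V"
  shows "finq K V Z Z" "dimq K V Z Z = 0"
proof -
  show "finq K V Z Z" unfolding finq_iff[OF V Z Z order.refl] by (intro exI[of _ "{}"]) auto
  then show "dimq K V Z Z = 0" using dimq_add(2)[OF V Z Z Z] by simp
qed

text \<open>The first isomorphism theorem for a \<open>\<pi>\<close> that is known to be linear only
  on \<open>Z\<close>; the relation pairing a coset with the value of \<open>\<pi>\<close> on a
  representative is used in both directions.\<close>

lemma dim_presentation:
  fixes V (structure)
  assumes "vectorspace K V" and Z: "submodule K Z V" and B: "submodule K B V" and BZ: "B \<subseteq> Z"
    and X: "vectorspace K X"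
    and add: "\<And>x y. x \<in> Z \<Longrightarrow> y \<in> Z \<Longrightarrow> \<pi> (x \<oplus> y) = \<pi> x \<oplus>\<^bsub>X\<^esub> \<pi> y"
    and smult: "\<And>a x. a \<in> carrier K \<Longrightarrow> x \<in> Z \<Longrightarrow> \<pi> (a \<odot> x) = a \<odot>\<^bsub>X\<^esub> \<pi> x"
    and im: "\<pi> ` Z = carrier X"
    and ker: "\<And>x. x \<in> Z \<Longrightarrow> \<pi> x = \<zero>\<^bsub>X\<^esub> \<longleftrightarrow> x \<in> B"
  shows "vectorspace.fin_dim K X \<longleftrightarrow> finq K V Z B"
    and "finq K V Z B \<Longrightarrow> vectorspace.dim K X = dimq K V Z B"
proof -
  interpret V: vectorspace K V by fact
  interpret X: vectorspace K X by fact
  interpret Z: vectorspace K "V\<lparr>carrier := Z\<rparr>" using Z by (rule V.submodule_vectorspace)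
  have ZV: "Z \<subseteq> carrier V" using Z by (auto simp: submodule_def)
  note B' = V.submodule_submodule[OF Z B BZ]
  let ?Q = "quotient_module (V\<lparr>carrier := Z\<rparr>) B"
  interpret Q: vectorspace K ?Q using B' by (rule Z.quotient_vectorspace)
  have C: "carrier ?Q = (\<lambda>x. B +> x) ` Z" by (auto simp: Z.quotient_carrier)
  let ?L = "\<lambda>A x. \<exists>z\<in>Z. A = B +> z \<and> x = \<pi> z"
  have L1: "A \<in> carrier ?Q \<and> x \<in> carrier X" if "?L A x" for A x using that im by (auto simp: C)
  have L2: "?L (A \<oplus>\<^bsub>?Q\<^esub> A') (x \<oplus>\<^bsub>X\<^esub> x')" if "?L A x" "?L A' x'" for A x A' x'
  proof -
    from that obtain z z' where *: "z \<in> Z" "A = B +> z" "x = \<pi> z" "z' \<in> Z" "A' = B +> z'" "x' = \<pi> z'" by blast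
    moreover have "z \<oplus> z' \<in> Z" using * Z by (auto simp: submodule_def)
    ultimately show ?thesis
      using Z.coset_add[OF B', of z z'] add[of z z'] by (intro bexI[of _ "z \<oplus> z'"]) (simp_all add: Z.quotient_add)
  qed
  have L3: "?L (a \<odot>\<^bsub>?Q\<^esub> A) (a \<odot>\<^bsub>X\<^esub> x)" if "a \<in> carrier K" "?L A x" for a A x
  proof -
    from that obtain z where *: "z \<in> Z" "A = B +> z" "x = \<pi> z" by blast
    moreover have "a \<odot> z \<in> Z" using * that Z by (auto simp: submodule_def)
    ultimately show ?thesis
      using Z.quotient_smult[OF B', of a z] smult[of a z] that(1) by (intro bexI[of _ "a \<odot> z"]) simp_all
  qed
  have z: "B +> z = B \<longleftrightarrow> z \<in> B" if "z \<in> Z" for z using V.coset_zero_iff[OF B] that ZV by blast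
  have 1: "vectorspace.fin_dim K ?Q \<and> vectorspace.dim K ?Q \<le> vectorspace.dim K X" if "X.fin_dim"
  proof (rule dim_le_of_relation[OF Q.vectorspace_axioms X that, where L = ?L])
    show "?L A x \<Longrightarrow> A \<in> carrier ?Q \<and> x \<in> carrier X" for A x by (rule L1)
    show "?L A x \<Longrightarrow> ?L A' x' \<Longrightarrow> ?L (A \<oplus>\<^bsub>?Q\<^esub> A') (x \<oplus>\<^bsub>X\<^esub> x')" for A x A' x' by (rule L2)
    show "a \<in> carrier K \<Longrightarrow> ?L A x \<Longrightarrow> ?L (a \<odot>\<^bsub>?Q\<^esub> A) (a \<odot>\<^bsub>X\<^esub> x)" for a A x by (rule L3)
    show "\<exists>w. ?L v w" if "v \<in> carrier ?Q" for v using that by (auto simp: C)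
    show "v = \<zero>\<^bsub>?Q\<^esub>" if "?L v \<zero>\<^bsub>X\<^esub>" for v
    proof -
      from that obtain y where y: "y \<in> Z" "v = B +> y" "\<zero>\<^bsub>X\<^esub> = \<pi> y" by blast
      then have "y \<in> B" using ker[of y] by simp
      then show ?thesis using y z[of y] by (simp add: Z.quotient_zero)
    qed
  qed
  have 2: "X.fin_dim \<and> X.dim \<le> vectorspace.dim K ?Q" if "vectorspace.fin_dim K ?Q"
  proof (rule dim_le_of_relation[OF X Q.vectorspace_axioms that, where L = "\<lambda>x A. ?L A x"])
    show "?L A x \<Longrightarrow> x \<in> carrier X \<and> A \<in> carrier ?Q" for A x using L1 by blast
    show "?L A x \<Longrightarrow> ?L A' x' \<Longrightarrow> ?L (A \<oplus>\<^bsub>?Q\<^esub> A') (x \<oplus>\<^bsub>X\<^esub> x')" for A x A' x' by (rule L2)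
    show "a \<in> carrier K \<Longrightarrow> ?L A x \<Longrightarrow> ?L (a \<odot>\<^bsub>?Q\<^esub> A) (a \<odot>\<^bsub>X\<^esub> x)" for a A x by (rule L3)
    show "\<exists>w. ?L w v" if "v \<in> carrier X" for v using that unfolding im[symmetric] by blast
    show "v = \<zero>\<^bsub>X\<^esub>" if "?L \<zero>\<^bsub>?Q\<^esub> v" for v
    proof -
      from that obtain y where y: "y \<in> Z" "B = B +> y" "v = \<pi> y" by (auto simp: Z.quotient_zero)
      then have "y \<in> B" using z[of y] by simp
      then show ?thesis using y ker by simp
    qed
  qed
  show "vectorspace.fin_dim K X \<longleftrightarrow> finq K V Z B" using 1 2 by (auto simp: finq_def)
  show "vectorspace.dim K X = dimq K V Z B" if "finq K V Z B"
    using 1 2 that by (simp add: finq_def dimq_def)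
qed

section \<open>Graded abelian groups\<close>

lemma additive_map_zero:
  fixes G (structure)
  assumes "abelian_group G" "abelian_group H" and h: "h \<in> carrier G \<rightarrow> carrier H"
    and add: "\<And>x y. x \<in> carrier G \<Longrightarrow> y \<in> carrier G \<Longrightarrow> h (x \<oplus> y) = h x \<oplus>\<^bsub>H\<^esub> h y"
  shows "h \<zero> = \<zero>\<^bsub>H\<^esub>"
proof -
  interpret G: abelian_group G by fact
  interpret H: abelian_group H by fact
  have "h \<zero> \<oplus>\<^bsub>H\<^esub> h \<zero> = h \<zero>" using add[of "\<zero>" "\<zero>"] by simp
  moreover have "h \<zero> \<in> carrier H" using h by auto
  ultimately show ?thesis by (metis H.add.r_cancel_one')
qed

lemma additive_map_minus:
  assumes "abelian_group G" "abelian_group H" and h: "h \<in> carrier G \<rightarrow> carrier H"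
    and add: "\<And>x y. x \<in> carrier G \<Longrightarrow> y \<in> carrier G \<Longrightarrow> h (x \<oplus>\<^bsub>G\<^esub> y) = h x \<oplus>\<^bsub>H\<^esub> h y"
    and x: "x \<in> carrier G"
  shows "h (\<ominus>\<^bsub>G\<^esub> x) = \<ominus>\<^bsub>H\<^esub> h x"
proof -
  interpret G: abelian_group G by fact
  interpret H: abelian_group H by fact
  have "h (\<ominus>\<^bsub>G\<^esub> x) \<oplus>\<^bsub>H\<^esub> h x = \<zero>\<^bsub>H\<^esub>"
    using add[of "\<ominus>\<^bsub>G\<^esub> x" x] x additive_map_zero[OF assms(1-3) add] by (simp add: G.l_neg)
  then show ?thesis using h x by (intro H.minus_equality[symmetric]) auto
qed

lemma additive_map_finsum:
  assumes G: "abelian_group G" and H: "abelian_group H" and h: "h \<in> carrier G \<rightarrow> carrier H"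
    and add: "\<And>x y. x \<in> carrier G \<Longrightarrow> y \<in> carrier G \<Longrightarrow> h (x \<oplus>\<^bsub>G\<^esub> y) = h x \<oplus>\<^bsub>H\<^esub> h y"
    and f: "\<And>i. i \<in> T \<Longrightarrow> f i \<in> carrier G"
  shows "h (finsum G f T) = finsum H (\<lambda>i. h (f i)) T"
proof -
  interpret G: abelian_group G by fact
  interpret H: abelian_group H by fact
  note z = additive_map_zero[OF G H h add]
  show ?thesis using f
  proof (induction T rule: infinite_finite_induct)
    case (insert i T)
    have "f i \<in> carrier G" "f \<in> T \<rightarrow> carrier G" using insert.prems by auto
    then show ?case using insert h by (simp add: add Pi_def)
  qed (simp_all add: z)
qed

text \<open>Only the additive group is involved, so that rings, modules, families and the associated
  graded module share one theory of components.\<close>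

locale igrading = abelian_group G for G :: "('g, 'y) ring_scheme" (structure) +
  fixes A :: "nat \<Rightarrow> 'g set" assumes ids: "internal_direct_sum G A"
begin

abbreviation "cmp \<equiv> component G A"

lemma A_subgroup: "additive_subgroup (A i) G"
  using ids by (simp add: internal_direct_sum_def)

lemma A_carrier: "x \<in> A i \<Longrightarrow> x \<in> carrier G"
  using additive_subgroup.a_Hcarr[OF A_subgroup] .

lemma A_zero [simp]: "\<zero> \<in> A i"
  using additive_subgroup.zero_closed[OF A_subgroup] .

lemma A_add: "x \<in> A i \<Longrightarrow> y \<in> A i \<Longrightarrow> x \<oplus> y \<in> A i"
  using additive_subgroup.a_closed[OF A_subgroup] .

lemma A_minus: "x \<in> A i \<Longrightarrow> \<ominus> x \<in> A i"
  using additive_subgroup.a_inv_closed[OF A_subgroup] by blast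

lemma A_finsum: "(\<And>t. t \<in> T \<Longrightarrow> f t \<in> A i) \<Longrightarrow> finsum G f T \<in> A i"
proof (induction T rule: infinite_finite_induct)
  case (insert t T)
  then have "f t \<in> carrier G" "f \<in> T \<rightarrow> carrier G" by (auto intro: A_carrier)
  then show ?case using insert by (simp add: A_add)
qed simp_all

lemma comp_ex1:
  assumes "x \<in> carrier G"
  shows "\<exists>!f. (\<forall>i. f i \<in> A i) \<and> finite {i. f i \<noteq> \<zero>} \<and> x = (\<Oplus>i\<in>{i. f i \<noteq> \<zero>}. f i)"
  using ids assms unfolding internal_direct_sum_def by blast

lemma comp_props:
  assumes "x \<in> carrier G"
  shows "cmp x i \<in> A i" "finite {i. cmp x i \<noteq> \<zero>}" "(\<Oplus>i\<in>{i. cmp x i \<noteq> \<zero>}. cmp x i) = x"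
  using theI'[OF comp_ex1[OF assms]] unfolding component_def by auto

lemma comp_carrier [simp]: "x \<in> carrier G \<Longrightarrow> cmp x i \<in> carrier G"
  using comp_props(1) A_carrier by blast

lemma finsum_support:
  assumes "finite T" "\<And>i. i \<notin> T \<Longrightarrow> f i = \<zero>" "\<And>i. f i \<in> carrier G"
  shows "(\<Oplus>i\<in>{i. f i \<noteq> \<zero>}. f i) = (\<Oplus>i\<in>T. f i)"
  by (rule add.finprod_mono_neutral_cong_left) (use assms in \<open>auto\<close>)

lemma comp_unique:
  assumes f: "\<And>i. f i \<in> A i" and T: "finite T" "\<And>i. i \<notin> T \<Longrightarrow> f i = \<zero>" and x: "x = (\<Oplus>i\<in>T. f i)"
  shows "cmp x = f"
proof -
  have fc: "f i \<in> carrier G" for i using f A_carrier by blast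
  then have xc: "x \<in> carrier G" unfolding x by (intro finsum_closed) auto
  have "finite {i. f i \<noteq> \<zero>}" using T by (rule_tac finite_subset[of _ T]) auto
  moreover have "x = (\<Oplus>i\<in>{i. f i \<noteq> \<zero>}. f i)" using finsum_support[OF T fc] x by simp
  ultimately have "(\<forall>i. f i \<in> A i) \<and> finite {i. f i \<noteq> \<zero>} \<and> x = (\<Oplus>i\<in>{i. f i \<noteq> \<zero>}. f i)" using f by blast
  then show ?thesis unfolding component_def using comp_ex1[OF xc] by (rule the1_equality[rotated])
qed

lemma comp_sum:
  assumes "finite T" "\<And>i. i \<notin> T \<Longrightarrow> cmp x i = \<zero>" "x \<in> carrier G"
  shows "(\<Oplus>i\<in>T. cmp x i) = x"
  using finsum_support[of T "cmp x"] comp_props(3)[OF assms(3)] assms by simp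

lemma comp_bound:
  assumes "x \<in> carrier G"
  obtains n where "\<And>i. i \<ge> n \<Longrightarrow> cmp x i = \<zero>" "(\<Oplus>i\<in>{..<n}. cmp x i) = x"
proof -
  obtain n where n: "{i. cmp x i \<noteq> \<zero>} \<subseteq> {..<n}"
    using comp_props(2)[OF assms] finite_nat_iff_bounded by blast
  then have "cmp x i = \<zero>" if "i \<ge> n" for i using that by (meson lessThan_iff mem_Collect_eq not_less subsetD)
  moreover from this have "(\<Oplus>i\<in>{..<n}. cmp x i) = x" using assms by (intro comp_sum) auto
  ultimately show ?thesis using that by blast
qed

lemma comp_homog: "x \<in> A j \<Longrightarrow> cmp x i = (if i = j then x else \<zero>)"
proof -
  assume x: "x \<in> A j"
  then have "x = (\<Oplus>i\<in>{j}. if i = j then x else \<zero>)" by (simp add: A_carrier)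
  then have "cmp x = (\<lambda>i. if i = j then x else \<zero>)" using x by (intro comp_unique) auto
  then show ?thesis by simp
qed

lemma comp_add:
  assumes "x \<in> carrier G" "y \<in> carrier G" shows "cmp (x \<oplus> y) i = cmp x i \<oplus> cmp y i"
proof -
  obtain m n where m: "\<And>i. i \<ge> m \<Longrightarrow> cmp x i = \<zero>" and n: "\<And>i. i \<ge> n \<Longrightarrow> cmp y i = \<zero>"
    using comp_bound assms by metis
  have x: "(\<Oplus>i\<in>{..<max m n}. cmp x i) = x" using assms m by (intro comp_sum) auto
  have y: "(\<Oplus>i\<in>{..<max m n}. cmp y i) = y" using assms n by (intro comp_sum) auto
  have "cmp (x \<oplus> y) = (\<lambda>i. cmp x i \<oplus> cmp y i)"
  proof (rule comp_unique[of _ "{..<max m n}"])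
    have "(\<Oplus>i\<in>{..<max m n}. cmp x i \<oplus> cmp y i)
      = (\<Oplus>i\<in>{..<max m n}. cmp x i) \<oplus> (\<Oplus>i\<in>{..<max m n}. cmp y i)"
      using assms by (intro finsum_addf) auto
    then show "x \<oplus> y = (\<Oplus>i\<in>{..<max m n}. cmp x i \<oplus> cmp y i)" by (simp add: x y)
  qed (use assms m n in \<open>auto intro: A_add comp_props(1)\<close>)
  then show ?thesis by simp
qed

lemma comp_zero [simp]: "cmp \<zero> i = \<zero>"
  using comp_homog[OF A_zero, of i i] by simp

lemma comp_minus: "x \<in> carrier G \<Longrightarrow> cmp (\<ominus> x) i = \<ominus> cmp x i"
  by (rule additive_map_minus[of G G "\<lambda>x. cmp x i"]) (auto simp: comp_add abelian_group_axioms)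

lemma comp_finsum:
  "(\<And>t. t \<in> T \<Longrightarrow> f t \<in> carrier G) \<Longrightarrow> cmp (finsum G f T) i = (\<Oplus>t\<in>T. cmp (f t) i)"
  by (rule additive_map_finsum[of G G "\<lambda>x. cmp x i"]) (auto simp: comp_add abelian_group_axioms)

lemma comp_eqI:
  assumes "x \<in> carrier G" "y \<in> carrier G" "\<And>i. cmp x i = cmp y i" shows "x = y"
proof -
  have eq: "cmp x = cmp y" using assms(3) by blast
  show ?thesis
    using comp_props(3)[OF assms(1), unfolded eq] comp_props(3)[OF assms(2)] by (rule trans[OF sym])
qed

lemma comp_eq_self: "x \<in> carrier G \<Longrightarrow> x \<in> A j \<longleftrightarrow> cmp x j = x"
  using comp_homog comp_props(1) by metis

end

text \<open>Candidate projections \<open>pr\<close> suffice: applying \<open>pr\<close> in degree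
  \<open>j\<close> to any decomposition into homogeneous summands returns the \<open>j\<close>-th
  summand, which gives uniqueness and identifies \<open>component\<close> with
  \<open>pr\<close>.\<close>

lemma igradingI:
  fixes G (structure)
  assumes G: "abelian_group G" and sub: "\<And>i. additive_subgroup (A i) G"
    and pr: "\<And>x i. x \<in> carrier G \<Longrightarrow> pr x i \<in> A i"
    and add: "\<And>x y i. x \<in> carrier G \<Longrightarrow> y \<in> carrier G \<Longrightarrow> pr (x \<oplus> y) i = pr x i \<oplus> pr y i"
    and homog: "\<And>x i j. x \<in> A j \<Longrightarrow> pr x i = (if i = j then x else \<zero>)"
    and ex: "\<And>x. x \<in> carrier G \<Longrightarrow> \<exists>n. (\<forall>i\<ge>n. pr x i = \<zero>) \<and> (\<Oplus>i\<in>{..<n}. pr x i) = x"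
  shows "igrading G A" and "x \<in> carrier G \<Longrightarrow> component G A x = pr x"
proof -
  interpret G: abelian_group G by fact
  have AG: "x \<in> carrier G" if "x \<in> A i" for x i using additive_subgroup.a_Hcarr[OF sub that] .
  have uniq: "f = pr x" if f: "\<And>i. f i \<in> A i" "finite T" "x = (\<Oplus>i\<in>T. f i)" "\<And>i. i \<notin> T \<Longrightarrow> f i = \<zero>" for x f T
  proof
    fix j
    have "pr x j = (\<Oplus>i\<in>T. pr (f i) j)" unfolding f(3)
      by (rule additive_map_finsum[of G G "\<lambda>x. pr x j"]) (use G add pr f(1) AG in blast)+
    also have "\<dots> = (\<Oplus>i\<in>T. if j = i then f i else \<zero>)"
      using homog[OF f(1)] AG[OF f(1)] by (intro G.finsum_cong') simp_all
    also have "\<dots> = f j"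
    proof (cases "j \<in> T")
      case True then show ?thesis using f(2) by (intro G.add.finprod_singleton) (auto intro: AG f(1))
    next
      case False
      then have "(\<Oplus>i\<in>T. if j = i then f i else \<zero>) = (\<Oplus>i\<in>T. \<zero>)" by (intro G.finsum_cong') auto
      then show ?thesis using f(4)[OF False] by simp
    qed
    finally show "f j = pr x j" by simp
  qed
  have "\<exists>!f. (\<forall>i. f i \<in> A i) \<and> finite {i. f i \<noteq> \<zero>} \<and> x = (\<Oplus>i\<in>{i. f i \<noteq> \<zero>}. f i)"
    if x: "x \<in> carrier G" for x
  proof (rule ex1I[of _ "pr x"])
    obtain n where n: "\<forall>i\<ge>n. pr x i = \<zero>" "(\<Oplus>i\<in>{..<n}. pr x i) = x" using ex[OF x] by blast
    have s: "{i. pr x i \<noteq> \<zero>} \<subseteq> {..<n}" using n(1) by (auto simp: not_less[symmetric])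
    then have "(\<Oplus>i\<in>{i. pr x i \<noteq> \<zero>}. pr x i) = (\<Oplus>i\<in>{..<n}. pr x i)"
      by (intro G.add.finprod_mono_neutral_cong_left) (auto intro: AG pr[OF x])
    then show "(\<forall>i. pr x i \<in> A i) \<and> finite {i. pr x i \<noteq> \<zero>} \<and> x = (\<Oplus>i\<in>{i. pr x i \<noteq> \<zero>}. pr x i)"
      using n pr[OF x] finite_subset[OF s] by simp
  next
    fix f assume "(\<forall>i. f i \<in> A i) \<and> finite {i. f i \<noteq> \<zero>} \<and> x = (\<Oplus>i\<in>{i. f i \<noteq> \<zero>}. f i)"
    then show "f = pr x" by (intro uniq[of f "{i. f i \<noteq> \<zero>}"]) auto
  qed
  then show *: "igrading G A" using G sub by (simp add: igrading_def igrading_axioms_def internal_direct_sum_def)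
  assume x: "x \<in> carrier G"
  interpret igrading G A by fact
  obtain n where "\<forall>i\<ge>n. pr x i = \<zero>" "(\<Oplus>i\<in>{..<n}. pr x i) = x" using ex[OF x] by blast
  then show "component G A x = pr x" by (intro comp_unique[of _ "{..<n}"] pr[OF x]) auto
qed

text \<open>The images of the components of \<open>x\<close> decompose \<open>h x\<close> into
  homogeneous summands, and such a decomposition is unique. Degrees below \<open>d\<close> receive
  nothing.\<close>

lemma comp_map_shift:
  fixes H (structure)
  assumes "igrading G A" "igrading H B" and h: "h \<in> carrier G \<rightarrow> carrier H"
    and add: "\<And>x y. x \<in> carrier G \<Longrightarrow> y \<in> carrier G \<Longrightarrow> h (x \<oplus>\<^bsub>G\<^esub> y) = h x \<oplus> h y"
    and hA: "\<And>i x. x \<in> A i \<Longrightarrow> h x \<in> B (i + d)" and x: "x \<in> carrier G"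
  shows "component H B (h x) n = (if d \<le> n then h (component G A x (n - d)) else \<zero>)"
proof -
  interpret G: igrading G A by fact
  interpret H: igrading H B by fact
  obtain m where m: "\<And>i. i \<ge> m \<Longrightarrow> G.cmp x i = \<zero>\<^bsub>G\<^esub>" "(\<Oplus>\<^bsub>G\<^esub>i\<in>{..<m}. G.cmp x i) = x"
    using G.comp_bound[OF x] by metis
  have ab: "abelian_group G" "abelian_group H" by unfold_locales
  have z: "h \<zero>\<^bsub>G\<^esub> = \<zero>" using ab h add by (rule additive_map_zero)
  define f where "f n = (if d \<le> n then h (G.cmp x (n - d)) else \<zero>)" for n
  have fB: "f n \<in> B n" for n unfolding f_def using hA[OF G.comp_props(1)[OF x], of "n - d"] by auto
  have "h x = h (\<Oplus>\<^bsub>G\<^esub>i\<in>{..<m}. G.cmp x i)" by (simp add: m(2))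
  also have "\<dots> = (\<Oplus>i\<in>{..<m}. h (G.cmp x i))"
    using x by (intro additive_map_finsum ab h add) auto
  also have "\<dots> = (\<Oplus>i\<in>{..<m}. f (i + d))"
    unfolding f_def by simp
  also have "\<dots> = (\<Oplus>i\<in>(\<lambda>i. i + d) ` {..<m}. f i)"
    by (rule H.add.finprod_reindex[symmetric]) (auto intro: H.A_carrier fB simp: inj_on_def)
  finally have "h x = (\<Oplus>i\<in>(\<lambda>i. i + d) ` {..<m}. f i)" .
  moreover have "f i = \<zero>" if "i \<notin> (\<lambda>i. i + d) ` {..<m}" for i
  proof (cases "d \<le> i")
    case True
    then have "i - d \<ge> m" using that by (metis image_eqI le_add_diff_inverse2 lessThan_iff not_less)
    then show ?thesis by (simp add: f_def m(1) z)
  qed (simp add: f_def)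
  ultimately have "H.cmp (h x) = f" by (intro H.comp_unique[OF fB, of "(\<lambda>i. i + d) ` {..<m}"]) auto
  then show ?thesis by (simp add: f_def)
qed

lemma comp_map:
  assumes "igrading G A" "igrading H B" "h \<in> carrier G \<rightarrow> carrier H"
    and "\<And>x y. x \<in> carrier G \<Longrightarrow> y \<in> carrier G \<Longrightarrow> h (x \<oplus>\<^bsub>G\<^esub> y) = h x \<oplus>\<^bsub>H\<^esub> h y"
    and "\<And>i x. x \<in> A i \<Longrightarrow> h x \<in> B i" and "x \<in> carrier G"
  shows "component H B (h x) n = h (component G A x n)"
  using comp_map_shift[OF assms(1-4), of 0 x n] assms(5,6) by simp

text \<open>\<open>Z / B\<close> is built up one degree at a time. Stopping at \<open>J\<close>
  without further knowledge gives an inequality; if \<open>Z\<close> is contained in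
  \<open>B\<close> in all degrees from \<open>J\<close> on, the process has reached \<open>Z\<close>
  and gives equality.\<close>

lemma graded_subquotient:
  assumes V: "vectorspace K V" and gr: "igrading V D" and D: "\<And>j. submodule K (D j) V"
    and Z: "submodule K Z V" and B: "submodule K B V" and BZ: "B \<subseteq> Z"
    and Zh: "\<And>z j. z \<in> Z \<Longrightarrow> component V D z j \<in> Z" and Bh: "\<And>z j. z \<in> B \<Longrightarrow> component V D z j \<in> B"
  shows "finq K V Z B \<Longrightarrow> finq K V (Z \<inter> D j) (B \<inter> D j)"
    and "finq K V Z B \<Longrightarrow> (\<Sum>j<J. dimq K V (Z \<inter> D j) (B \<inter> D j)) \<le> dimq K V Z B"
    and "(\<And>j. j < J \<Longrightarrow> finq K V (Z \<inter> D j) (B \<inter> D j)) \<Longrightarrow> (\<And>j. j \<ge> J \<Longrightarrow> Z \<inter> D j \<subseteq> B) \<Longrightarrow>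
      finq K V Z B \<and> dimq K V Z B = (\<Sum>j<J. dimq K V (Z \<inter> D j) (B \<inter> D j))"
proof -
  interpret V: vectorspace K V by fact
  interpret g: igrading V D by fact
  have ZV: "Z \<subseteq> carrier V" using Z by (auto simp: submodule_def)
  have smult: "g.cmp (a \<odot>\<^bsub>V\<^esub> x) j = a \<odot>\<^bsub>V\<^esub> g.cmp x j" if "a \<in> carrier K" "x \<in> carrier V" for a x j
    by (rule comp_map[OF gr gr]) (use that D in \<open>auto simp: V.smult_r_distr submodule_def\<close>)
  \<comment> \<open>Components in degrees below \<open>n\<close> are arbitrary, those from
    \<open>n\<close> on must lie in \<open>B\<close>. This interpolates between \<open>B\<close> at
    \<open>n = 0\<close> and \<open>Z\<close>, and taking the \<open>n\<close>-th component
    identifies \<open>Y (Suc n) / Y n\<close> with the degree \<open>n\<close> part of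
    \<open>Z / B\<close>.\<close>
  define Y where "Y n = {z \<in> Z. \<forall>j\<ge>n. g.cmp z j \<in> B}" for n
  have Y: "submodule K (Y n) V" for n
    unfolding submodule_def Y_def
    using Z B ZV V.module_axioms by (auto simp: submodule_def g.comp_add smult subset_iff)
  have YZ: "Y n \<subseteq> Z" for n by (auto simp: Y_def)
  have BY: "B \<subseteq> Y n" for n using BZ Bh by (auto simp: Y_def)
  have YY: "Y n \<subseteq> Y (Suc n)" for n by (auto simp: Y_def)
  have sum_in: "z \<in> N" if z: "z \<in> carrier V" and N: "submodule K N V" "\<And>j. g.cmp z j \<in> N" for z N
  proof -
    obtain n where "(\<Oplus>\<^bsub>V\<^esub>i\<in>{..<n}. g.cmp z i) = z" using g.comp_bound[OF z] by metis
    then show ?thesis using V.submodule_finsum_closed[OF N(1), of "{..<n}" "g.cmp z"] N(2) by simp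
  qed
  have Y0: "Y 0 = B"
  proof
    show "Y 0 \<subseteq> B" using sum_in[OF _ B] ZV by (auto simp: Y_def)
  qed (rule BY)
  have ZD: "submodule K (Z \<inter> D j) V" "submodule K (B \<inter> D j) V" "B \<inter> D j \<subseteq> Z \<inter> D j" for j
    using V.submodule_Int[OF Z D] V.submodule_Int[OF B D] BZ by auto
  have eq: "(finq K V (Y (Suc n)) (Y n) \<longleftrightarrow> finq K V (Z \<inter> D n) (B \<inter> D n)) \<and>
      (finq K V (Y (Suc n)) (Y n) \<longrightarrow> dimq K V (Y (Suc n)) (Y n) = dimq K V (Z \<inter> D n) (B \<inter> D n))" for n
  proof -
    let ?L = "\<lambda>z z'. z \<in> carrier V \<and> z' = g.cmp z n"
    have L: "linrel K V V ?L" by (auto simp: linrel_def g.comp_add smult)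
    have t1: "\<exists>z'\<in>Z \<inter> D n. ?L z z'" if "z \<in> Y (Suc n)" for z
      using that ZV Zh g.comp_props(1) by (auto simp: Y_def)
    have t2: "\<exists>z\<in>Y (Suc n). ?L z z'" if "z' \<in> Z \<inter> D n" for z'
      using that ZV B by (intro bexI[of _ z']) (auto simp: Y_def g.comp_homog submodule_def)
    have inj: "z \<in> Y n \<longleftrightarrow> z' \<in> B \<inter> D n" if "?L z z'" "z \<in> Y (Suc n)" "z' \<in> Z \<inter> D n" for z z'
      using that by (auto simp: Y_def) (metis le_antisym not_less_eq_eq)
    show ?thesis
      using dimq_eq[OF V Y Y YY V ZD L t1 t2 inj] by blast
  qed
  have main: "finq K V (Y n) B \<and> dimq K V (Y n) B = (\<Sum>j<n. dimq K V (Z \<inter> D j) (B \<inter> D j))"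
    if "\<And>j. j < n \<Longrightarrow> finq K V (Z \<inter> D j) (B \<inter> D j)" for n
    using that
  proof (induction n)
    case 0 then show ?case by (simp add: Y0 dimq_self[OF V B])
  next
    case (Suc n)
    then have IH: "finq K V (Y n) B" "dimq K V (Y n) B = (\<Sum>j<n. dimq K V (Z \<inter> D j) (B \<inter> D j))" by simp_all
    have f: "finq K V (Y (Suc n)) (Y n)" using eq[of n] Suc.prems[of n] by simp
    note a = dimq_add[OF V Y[of "Suc n"] Y[of n] B BY YY]
    have "finq K V (Y (Suc n)) B" using a(1) f IH(1) by simp
    then show ?case using a(2) eq[of n] f IH(2) by simp
  qed
  have fin: "finq K V (Z \<inter> D j) (B \<inter> D j)" if "finq K V Z B" for j
  proof -
    have "finq K V (Y (Suc j)) B" using dimq_add(1)[OF V Z Y[of "Suc j"] B BY YZ] that by simp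
    then have "finq K V (Y (Suc j)) (Y j)" using dimq_add(1)[OF V Y[of "Suc j"] Y[of j] B BY YY] by simp
    then show ?thesis using eq[of j] by simp
  qed
  then show "finq K V Z B \<Longrightarrow> finq K V (Z \<inter> D j) (B \<inter> D j)" .
  show "(\<Sum>j<J. dimq K V (Z \<inter> D j) (B \<inter> D j)) \<le> dimq K V Z B" if "finq K V Z B"
    using main[of J] fin[OF that] dimq_add(2)[OF V Z Y[of J] B BY YZ that] by simp
  assume *: "\<And>j. j < J \<Longrightarrow> finq K V (Z \<inter> D j) (B \<inter> D j)" "\<And>j. j \<ge> J \<Longrightarrow> Z \<inter> D j \<subseteq> B"
  have "g.cmp z j \<in> B" if "z \<in> Z" "j \<ge> J" for z j
    using *(2)[OF that(2)] Zh[OF that(1), of j] g.comp_props(1)[of z j] that(1) ZV by blast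
  then have "Y J = Z" by (auto simp: Y_def)
  then show "finq K V Z B \<and> dimq K V Z B = (\<Sum>j<J. dimq K V (Z \<inter> D j) (B \<inter> D j))"
    using main[of J] *(1) by simp
qed

section \<open>Families in a graded module\<close>

text \<open>Seen as a module over itself, \<open>R\<close> turns the free modules into the special
  case \<open>N = R\<close> of the families below, so that gradings and matrix maps are treated once
  for all.\<close>

definition ring_mod :: "('a, 'x) ring_scheme \<Rightarrow> ('a, 'a) module" where
  "ring_mod R = \<lparr>carrier = carrier R, mult = mult R, one = one R, zero = zero R, add = add R, smult = mult R\<rparr>"

lemma ring_mod_simps [simp]:
  "carrier (ring_mod R) = carrier R" "zero (ring_mod R) = zero R" "add (ring_mod R) = add R"
  "smult (ring_mod R) = mult R"
  by (simp_all add: ring_mod_def)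

lemma finsum_ring_mod: "finsum (ring_mod R) f T = finsum R f T"
  unfolding finsum_def finprod_def by simp

lemma ring_mod_module:
  assumes "cring R" shows "Module.module R (ring_mod R)"
proof -
  interpret R: cring R by fact
  have "abelian_group (ring_mod R)"
  proof (rule abelian_groupI)
    show "\<exists>y\<in>carrier (ring_mod R). y \<oplus>\<^bsub>ring_mod R\<^esub> x = \<zero>\<^bsub>ring_mod R\<^esub>" if "x \<in> carrier (ring_mod R)" for x
      using that R.l_neg[of x] by auto
  qed (auto simp: R.a_ac)
  then show ?thesis using assms
    by (intro moduleI) (auto simp: R.l_distr R.r_distr R.m_assoc)
qed

lemma internal_direct_sum_ring_mod: "internal_direct_sum (ring_mod R) A \<longleftrightarrow> internal_direct_sum R A"
  by (simp add: internal_direct_sum_def additive_subgroup_def finsum_ring_mod subgroup_def m_inv_def)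

lemma component_ring_mod: "component (ring_mod R) A = component R A"
  by (simp add: component_def finsum_ring_mod fun_eq_iff)

text \<open>Plays the role of the tensor product of \<open>N\<close> with the free module on
  \<open>I\<close>: a family stands for the sum of its entries tensored with the basis vectors.
  \<open>fam_grading\<close> accounts for the degrees \<open>d\<close> of the basis.\<close>

definition fam :: "('a, 'b, 'y) module_scheme \<Rightarrow> nat set \<Rightarrow> ('a, nat \<Rightarrow> 'b) module" where
  "fam N I =
     \<lparr>carrier = {f. (\<forall>c. f c \<in> carrier N) \<and> (\<forall>c. c \<notin> I \<longrightarrow> f c = \<zero>\<^bsub>N\<^esub>) \<and> finite {c. f c \<noteq> \<zero>\<^bsub>N\<^esub>}},
      mult = undefined, one = undefined, zero = (\<lambda>c. \<zero>\<^bsub>N\<^esub>),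
      add = (\<lambda>f g c. f c \<oplus>\<^bsub>N\<^esub> g c), smult = (\<lambda>a f c. a \<odot>\<^bsub>N\<^esub> f c)\<rparr>"

definition fam_grading ::
    "('a, 'b, 'y) module_scheme \<Rightarrow> (nat \<Rightarrow> 'b set) \<Rightarrow> nat set \<Rightarrow> (nat \<Rightarrow> nat) \<Rightarrow> nat \<Rightarrow> (nat \<Rightarrow> 'b) set" where
  "fam_grading N B I d j =
     {f \<in> carrier (fam N I). \<forall>c\<in>I. if d c \<le> j then f c \<in> B (j - d c) else f c = \<zero>\<^bsub>N\<^esub>}"

lemma fam_simps [simp]:
  "\<zero>\<^bsub>fam N I\<^esub> = (\<lambda>c. \<zero>\<^bsub>N\<^esub>)" "f \<oplus>\<^bsub>fam N I\<^esub> g = (\<lambda>c. f c \<oplus>\<^bsub>N\<^esub> g c)"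
  "a \<odot>\<^bsub>fam N I\<^esub> f = (\<lambda>c. a \<odot>\<^bsub>N\<^esub> f c)"
  by (simp_all add: fam_def)

lemma free_module_fam: "free_module R I = fam (ring_mod R) I"
  by (simp add: free_module_def fam_def)

lemma free_grading_fam: "free_grading R A I d j = fam_grading (ring_mod R) A I d j"
  by (simp add: free_grading_def fam_grading_def free_module_fam)

lemma fam_carrier_iff:
  "f \<in> carrier (fam N I) \<longleftrightarrow> (\<forall>c. f c \<in> carrier N) \<and> (\<forall>c. c \<notin> I \<longrightarrow> f c = \<zero>\<^bsub>N\<^esub>) \<and> finite {c. f c \<noteq> \<zero>\<^bsub>N\<^esub>}"
  by (simp add: fam_def)

lemma fam_carrier_finite:
  "finite I \<Longrightarrow> f \<in> carrier (fam N I) \<longleftrightarrow> (\<forall>c. f c \<in> carrier N) \<and> (\<forall>c. c \<notin> I \<longrightarrow> f c = \<zero>\<^bsub>N\<^esub>)"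
  unfolding fam_carrier_iff by (metis (mono_tags, lifting) finite_subset mem_Collect_eq subsetI)

lemma fam_module:
  fixes N (structure)
  assumes "Module.module R N" shows "Module.module R (fam N I)"
proof -
  interpret N: Module.module R N by fact
  have fin: "finite {c. h c \<noteq> \<zero>}"
    if "finite {c. f c \<noteq> \<zero>}" "finite {c. g c \<noteq> \<zero>}"
      "\<And>c. f c = \<zero> \<Longrightarrow> g c = \<zero> \<Longrightarrow> h c = \<zero>" for f g h :: "nat \<Rightarrow> 'c"
    by (rule finite_subset[OF _ finite_UnI[OF that(1,2)]]) (use that(3) in blast)
  have add: "f \<oplus>\<^bsub>fam N I\<^esub> g \<in> carrier (fam N I)" if "f \<in> carrier (fam N I)" "g \<in> carrier (fam N I)" for f g
    using that fin[of f g "\<lambda>c. f c \<oplus> g c"] by (simp add: fam_carrier_iff)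
  have smult: "a \<odot>\<^bsub>fam N I\<^esub> f \<in> carrier (fam N I)" if "a \<in> carrier R" "f \<in> carrier (fam N I)" for a f
    using that fin[of f f "\<lambda>c. a \<odot> f c"] by (simp add: fam_carrier_iff)
  have neg: "(\<lambda>c. \<ominus> f c) \<in> carrier (fam N I)" if "f \<in> carrier (fam N I)" for f
    using that fin[of f f "\<lambda>c. \<ominus> f c"] by (simp add: fam_carrier_iff)
  have "abelian_group (fam N I)"
  proof (rule abelian_groupI)
    show "\<exists>y\<in>carrier (fam N I). y \<oplus>\<^bsub>fam N I\<^esub> x = \<zero>\<^bsub>fam N I\<^esub>" if "x \<in> carrier (fam N I)" for x
      by (rule bexI[OF _ neg[OF that]]) (use that in \<open>simp add: fam_carrier_iff N.M.l_neg\<close>)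
  qed (use add in \<open>auto simp: fam_carrier_iff N.M.a_ac\<close>)
  then show ?thesis
  proof (rule moduleI[rotated])
    show "cring R" ..
  qed (use smult in \<open>auto simp: fam_carrier_iff N.smult_l_distr N.smult_r_distr N.smult_assoc1\<close>)
qed

lemma finsum_fam:
  assumes N: "Module.module R N" and f: "\<And>t. t \<in> T \<Longrightarrow> f t \<in> carrier (fam N I)"
  shows "finsum (fam N I) f T c = (\<Oplus>\<^bsub>N\<^esub>t\<in>T. f t c)"
proof -
  have ab: "abelian_group N" "abelian_group (fam N I)"
    using N fam_module[OF N] by (simp_all add: Module.module_def)
  show ?thesis
    by (rule additive_map_finsum[OF ab(2,1), of "\<lambda>f. f c"]) (use f in \<open>auto simp: fam_carrier_iff\<close>)
qed

lemma minus_fam: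
  assumes N: "Module.module R N" and f: "f \<in> carrier (fam N I)"
  shows "(\<ominus>\<^bsub>fam N I\<^esub> f) c = \<ominus>\<^bsub>N\<^esub> f c"
proof -
  have ab: "abelian_group N" "abelian_group (fam N I)"
    using N fam_module[OF N] by (simp_all add: Module.module_def)
  show ?thesis
    by (rule additive_map_minus[OF ab(2,1), of "\<lambda>f. f c"]) (use f in \<open>auto simp: fam_carrier_iff\<close>)
qed

lemma fam_igrading:
  fixes N (structure)
  assumes N: "Module.module R N" and gr: "igrading N B"
  shows "igrading (fam N I) (fam_grading N B I d)"
    and "f \<in> carrier (fam N I) \<Longrightarrow> component (fam N I) (fam_grading N B I d) f =
      (\<lambda>j c. if c \<in> I \<and> d c \<le> j then component N B (f c) (j - d c) else \<zero>)"
proof -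
  interpret N: Module.module R N by fact
  interpret g: igrading N B by fact
  interpret F: Module.module R "fam N I" by (rule fam_module[OF N])
  define pr where "pr f j c = (if c \<in> I \<and> d c \<le> j then g.cmp (f c) (j - d c) else \<zero>)" for f j c
  have prc: "pr f j \<in> carrier (fam N I)" if "f \<in> carrier (fam N I)" for f j
  proof -
    have "{c. pr f j c \<noteq> \<zero>} \<subseteq> {c. f c \<noteq> \<zero>}" by (auto simp: pr_def)
    moreover have "finite {c. f c \<noteq> \<zero>}" using that by (simp add: fam_carrier_iff)
    ultimately have "finite {c. pr f j c \<noteq> \<zero>}" by (rule finite_subset)
    moreover have "pr f j c \<in> carrier N" for c using that by (simp add: fam_carrier_iff pr_def)
    moreover have "pr f j c = \<zero>" if "c \<notin> I" for c using that by (simp add: pr_def)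
    ultimately show ?thesis by (simp add: fam_carrier_iff)
  qed
  have sub: "additive_subgroup (fam_grading N B I d j) (fam N I)" for j
  proof (rule additive_subgroup.intro, unfold_locales)
    show "inv\<^bsub>add_monoid (fam N I)\<^esub> f \<in> fam_grading N B I d j" if "f \<in> fam_grading N B I d j" for f
    proof -
      have f: "f \<in> carrier (fam N I)" using that by (simp add: fam_grading_def)
      have "\<ominus>\<^bsub>fam N I\<^esub> f \<in> fam_grading N B I d j"
        using that F.M.a_inv_closed[OF f] minus_fam[OF N f] by (auto simp: fam_grading_def g.A_minus)
      then show ?thesis by (simp add: a_inv_def)
    qed
    show "x \<otimes>\<^bsub>add_monoid (fam N I)\<^esub> y \<in> fam_grading N B I d j"
      if "x \<in> fam_grading N B I d j" "y \<in> fam_grading N B I d j" for x y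
      using that F.M.add.m_closed[of x y] by (auto simp: fam_grading_def g.A_add)
    show "\<one>\<^bsub>add_monoid (fam N I)\<^esub> \<in> fam_grading N B I d j"
      using F.M.zero_closed by (simp add: fam_grading_def)
    show "fam_grading N B I d j \<subseteq> carrier (add_monoid (fam N I))" by (auto simp: fam_grading_def)
  qed
  have ex: "\<exists>n. (\<forall>i\<ge>n. pr f i = \<zero>\<^bsub>fam N I\<^esub>) \<and> (\<Oplus>\<^bsub>fam N I\<^esub>i\<in>{..<n}. pr f i) = f"
    if f: "f \<in> carrier (fam N I)" for f
  proof -
    have fc: "f c \<in> carrier N" for c using f by (simp add: fam_carrier_iff)
    have "\<exists>m. \<forall>i\<ge>m. g.cmp (f c) i = \<zero>" for c using g.comp_bound[OF fc] by metis
    then obtain m where m: "\<And>c i. i \<ge> m c \<Longrightarrow> g.cmp (f c) i = \<zero>" by metis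
    \<comment> \<open>A common bound for the degrees exists because only finitely many coordinates
      are nonzero and each has finitely many components.\<close>
    have "finite ((\<lambda>c. d c + m c) ` {c. f c \<noteq> \<zero>})" using f by (simp add: fam_carrier_iff)
    then obtain n where n: "\<And>c. f c \<noteq> \<zero> \<Longrightarrow> d c + m c < n"
      unfolding finite_nat_set_iff_bounded by blast
    have z: "g.cmp (f c) i = \<zero>" if "d c + i \<ge> n" for c i
    proof (cases "f c = \<zero>")
      case False then show ?thesis using n[of c] that by (intro m) simp
    qed simp
    have "pr f i = \<zero>\<^bsub>fam N I\<^esub>" if "i \<ge> n" for i
      using that by (auto simp: pr_def intro!: ext z)
    moreover have "(\<Oplus>\<^bsub>fam N I\<^esub>i\<in>{..<n}. pr f i) = f"
    proof
      fix c
      have "(\<Oplus>\<^bsub>fam N I\<^esub>i\<in>{..<n}. pr f i) c = (\<Oplus>i\<in>{..<n}. pr f i c)"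
        by (rule finsum_fam[OF N prc[OF f]])
      also have "\<dots> = f c"
      proof (cases "c \<in> I")
        case False
        then show ?thesis using f by (simp add: pr_def fam_carrier_iff)
      next
        case True
        have z0: "pr f i c = \<zero>" if "i < n" "i \<notin> (\<lambda>i. i + d c) ` {..<n - d c}" for i
        proof (cases "d c \<le> i")
          case True
          then have "i = (i - d c) + d c" "i - d c < n - d c" using that by auto
          then have "i \<in> (\<lambda>i. i + d c) ` {..<n - d c}" by blast
          then show ?thesis using that by blast
        qed (simp add: pr_def)
        have "(\<Oplus>i\<in>{..<n}. pr f i c) = (\<Oplus>i\<in>(\<lambda>i. i + d c) ` {..<n - d c}. pr f i c)"
          by (rule N.M.add.finprod_mono_neutral_cong_right) (use z0 fc in \<open>auto simp: pr_def\<close>)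
        also have "\<dots> = (\<Oplus>i\<in>{..<n - d c}. pr f (i + d c) c)"
          by (rule N.M.add.finprod_reindex) (auto simp: pr_def fc inj_on_def)
        also have "\<dots> = (\<Oplus>i\<in>{..<n - d c}. g.cmp (f c) i)"
          using True by (simp add: pr_def)
        also have "\<dots> = f c" by (rule g.comp_sum) (auto intro: z fc)
        finally show ?thesis .
      qed
      finally show "(\<Oplus>\<^bsub>fam N I\<^esub>i\<in>{..<n}. pr f i) c = f c" .
    qed
    ultimately show ?thesis by blast
  qed
  have pr1: "pr f j \<in> fam_grading N B I d j" if "f \<in> carrier (fam N I)" for f j
    using that prc[OF that] by (auto simp: fam_grading_def pr_def fam_carrier_iff g.comp_props)
  have pr2: "pr (f \<oplus>\<^bsub>fam N I\<^esub> h) j = pr f j \<oplus>\<^bsub>fam N I\<^esub> pr h j"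
    if "f \<in> carrier (fam N I)" "h \<in> carrier (fam N I)" for f h j
    using that by (auto simp: pr_def fam_carrier_iff g.comp_add)
  have pr3: "pr f i = (if i = j then f else \<zero>\<^bsub>fam N I\<^esub>)" if f: "f \<in> fam_grading N B I d j" for f i j
  proof
    fix c
    show "pr f i c = (if i = j then f else \<zero>\<^bsub>fam N I\<^esub>) c"
    proof (cases "c \<in> I \<and> d c \<le> j")
      case True
      then have fc: "f c \<in> B (j - d c)" using f by (auto simp: fam_grading_def)
      have "i - d c = j - d c \<longleftrightarrow> i = j" if "d c \<le> i" using that True by auto
      then show ?thesis using True g.comp_homog[OF fc, of "i - d c"] by (auto simp: pr_def)
    next
      case False
      then have "f c = \<zero>" using f by (cases "c \<in> I") (auto simp: fam_grading_def fam_carrier_iff)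
      then show ?thesis by (simp add: pr_def)
    qed
  qed
  have ab: "abelian_group (fam N I)" ..
  show "igrading (fam N I) (fam_grading N B I d)"
    by (rule igradingI[of _ _ pr]) (fact ab sub pr1 pr2 pr3 ex)+
  assume f: "f \<in> carrier (fam N I)"
  have "component (fam N I) (fam_grading N B I d) f = pr f"
    by (rule igradingI(2)[of _ _ pr]) (fact ab sub pr1 pr2 pr3 ex f)+
  then show "component (fam N I) (fam_grading N B I d) f =
      (\<lambda>j c. if c \<in> I \<and> d c \<le> j then component N B (f c) (j - d c) else \<zero>)"
    by (simp add: pr_def fun_eq_iff)
qed

locale graded_alg =
  fixes R :: "('a, 'x) ring_scheme" (structure) and A :: "nat \<Rightarrow> 'a set"
  assumes gring: "graded_ring R A" and subf: "subfield (A 0) R"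
begin

lemma R_cring: "cring R" using gring by (simp add: graded_ring_def)

sublocale R: cring R by (rule R_cring)

sublocale A: igrading R A
  using gring by (intro igrading.intro igrading_axioms.intro) (unfold_locales, simp add: graded_ring_def)

abbreviation "K \<equiv> ground_field R A"

lemma A_mult: "a \<in> A i \<Longrightarrow> b \<in> A j \<Longrightarrow> a \<otimes> b \<in> A (i + j)"
  using gring by (simp add: graded_ring_def)

lemma one_A0: "\<one> \<in> A 0"
  using gring by (simp add: graded_ring_def)

lemma K_field: "field K"
  using R.subfield_iff(2)[OF subf] .

lemma graded_ring_mod: "graded_module R A (ring_mod R) A"
  using gring ring_mod_module[OF R_cring]
  by (auto simp: graded_module_def internal_direct_sum_ring_mod graded_ring_def)

end

locale graded_mod = graded_alg R A for R :: "('a, 'x) ring_scheme" and A +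
  fixes N :: "('a, 'b, 'y) module_scheme" (structure) and B :: "nat \<Rightarrow> 'b set"
  assumes gmod: "graded_module R A N B"
begin

lemma N_module: "Module.module R N" using gmod by (simp add: graded_module_def)

sublocale N: Module.module R N by (rule N_module)

sublocale B: igrading N B
  using gmod by (intro igrading.intro igrading_axioms.intro) (unfold_locales, simp add: graded_module_def)

lemma AB_smult: "a \<in> A i \<Longrightarrow> x \<in> B j \<Longrightarrow> a \<odot> x \<in> B (i + j)"
  using gmod by (simp add: graded_module_def)

lemma N_vectorspace: "vectorspace K N"
proof (rule vectorspaceI[OF K_field], rule moduleI)
  show "cring K" using K_field by (simp add: field_def domain_def)
qed (auto simp: N.smult_l_distr N.smult_r_distr N.smult_assoc1 A.A_carrier intro: N.M.abelian_group_axioms)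

sublocale NK: vectorspace K N by (rule N_vectorspace)

lemma B_submodule_K: "submodule K (B j) N"
  using NK.module_axioms AB_smult[of _ 0] by (auto simp: submodule_def B.A_carrier B.A_add)

lemma comp_smult:
  assumes a: "a \<in> A d" and x: "x \<in> carrier N"
  shows "B.cmp (a \<odot> x) n = (if d \<le> n then a \<odot> B.cmp x (n - d) else \<zero>)"
  by (rule comp_map_shift[OF B.igrading_axioms B.igrading_axioms])
    (use a x in \<open>auto simp: A.A_carrier N.smult_r_distr AB_smult add.commute[of _ d]\<close>)

lemma fam_graded: "graded_mod R A (fam N I) (fam_grading N B I d)"
proof (intro graded_mod.intro graded_mod_axioms.intro graded_alg_axioms)
  show "graded_module R A (fam N I) (fam_grading N B I d)"
    unfolding graded_module_def
  proof (intro conjI allI ballI)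
    interpret F: Module.module R "fam N I" by (rule fam_module[OF N_module])
    show "Module.module R (fam N I)" ..
    show "internal_direct_sum (fam N I) (fam_grading N B I d)"
      using fam_igrading(1)[OF N_module B.igrading_axioms] by (simp add: igrading_def igrading_axioms_def)
    fix i j a f assume a: "a \<in> A i" and f: "f \<in> fam_grading N B I d j"
    have "a \<odot>\<^bsub>fam N I\<^esub> f \<in> carrier (fam N I)"
      using a f by (intro F.smult_closed) (auto simp: fam_grading_def A.A_carrier)
    moreover have "a \<odot> f c \<in> B (i + j - d c)" if "c \<in> I" "d c \<le> j" for c
      using AB_smult[OF a, of "f c" "j - d c"] f that by (auto simp: fam_grading_def)
    moreover have "a \<odot> f c = \<zero>" if "c \<in> I" "\<not> d c \<le> j" for c
      using f that a by (simp add: fam_grading_def A.A_carrier)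
    ultimately show "a \<odot>\<^bsub>fam N I\<^esub> f \<in> fam_grading N B I d (i + j)"
      unfolding fam_grading_def by (auto, metis B.A_zero nat_le_linear)
  qed
qed

end

lemma (in graded_alg) free_graded: "graded_mod R A (free_module R I) (free_grading R A I d)"
proof -
  interpret RM: graded_mod R A "ring_mod R" A
    by (intro graded_mod.intro graded_mod_axioms.intro graded_alg_axioms graded_ring_mod)
  show ?thesis using RM.fam_graded[of I d] unfolding free_module_fam free_grading_fam[abs_def] .
qed

section \<open>Maps given by matrices\<close>

text \<open>A map of free modules from basis \<open>I'\<close> to basis \<open>I\<close> with matrix
  \<open>m\<close>, tensored with the identity of \<open>N\<close>. Outside \<open>I\<close> the
  value must be zero to land in \<open>fam N I\<close>.\<close>

definition tmap ::
    "('a, 'b, 'y) module_scheme \<Rightarrow> nat set \<Rightarrow> nat set \<Rightarrow> (nat \<Rightarrow> nat \<Rightarrow> 'a) \<Rightarrow> (nat \<Rightarrow> 'b) \<Rightarrow> nat \<Rightarrow> 'b" where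
  "tmap N I I' m y c = (if c \<in> I then (\<Oplus>\<^bsub>N\<^esub>e\<in>I'. m c e \<odot>\<^bsub>N\<^esub> y e) else \<zero>\<^bsub>N\<^esub>)"

locale matrix_map = N?: Module.module R N for R :: "('a, 'x) ring_scheme" and N :: "('a, 'b, 'y) module_scheme" (structure) +
  fixes I I' :: "nat set" and m :: "nat \<Rightarrow> nat \<Rightarrow> 'a"
  assumes finI: "finite I" and finI': "finite I'"
    and m: "\<And>c e. c \<in> I \<Longrightarrow> e \<in> I' \<Longrightarrow> m c e \<in> carrier R"
begin

lemma term_closed: "y \<in> carrier (fam N J) \<Longrightarrow> c \<in> I \<Longrightarrow> e \<in> I' \<Longrightarrow> m c e \<odot> y e \<in> carrier N"
  using m by (simp add: fam_carrier_iff)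

lemma tmap_closed: "y \<in> carrier (fam N J) \<Longrightarrow> tmap N I I' m y \<in> carrier (fam N I)"
  unfolding fam_carrier_finite[OF finI] tmap_def using term_closed by (auto intro!: M.finsum_closed)

lemma tmap_add:
  assumes "y \<in> carrier (fam N J)" "z \<in> carrier (fam N J)"
  shows "tmap N I I' m (y \<oplus>\<^bsub>fam N J\<^esub> z) = tmap N I I' m y \<oplus>\<^bsub>fam N I\<^esub> tmap N I I' m z"
proof
  fix c
  have "(\<Oplus>e\<in>I'. m c e \<odot> (y e \<oplus> z e)) = (\<Oplus>e\<in>I'. m c e \<odot> y e \<oplus> m c e \<odot> z e)" if "c \<in> I"
    using assms m[OF that] by (intro M.finsum_cong') (auto simp: fam_carrier_iff smult_r_distr)
  then show "tmap N I I' m (y \<oplus>\<^bsub>fam N J\<^esub> z) c = (tmap N I I' m y \<oplus>\<^bsub>fam N I\<^esub> tmap N I I' m z) c"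
    using term_closed[OF assms(1)] term_closed[OF assms(2)] by (simp add: tmap_def M.finsum_addf Pi_def)
qed

lemma tmap_smult:
  assumes "y \<in> carrier (fam N J)" "a \<in> carrier R"
  shows "tmap N I I' m (a \<odot>\<^bsub>fam N J\<^esub> y) = a \<odot>\<^bsub>fam N I\<^esub> tmap N I I' m y"
proof
  fix c
  have "(\<Oplus>e\<in>I'. m c e \<odot> (a \<odot> y e)) = (\<Oplus>e\<in>I'. a \<odot> (m c e \<odot> y e))" if "c \<in> I"
    using assms m[OF that] term_closed[OF assms(1) that]
    by (intro M.finsum_cong') (auto simp: fam_carrier_iff smult_assoc1[symmetric] R.m_comm)
  then show "tmap N I I' m (a \<odot>\<^bsub>fam N J\<^esub> y) c = (a \<odot>\<^bsub>fam N I\<^esub> tmap N I I' m y) c"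
    using term_closed[OF assms(1)] assms(2) finsum_smult[of a "\<lambda>e. m c e \<odot> y e" I']
    by (simp add: tmap_def Pi_def)
qed

end

lemma tmap_natural:
  fixes N (structure)
  assumes "matrix_map R N I I' m" "Module.module R N'" and h: "h \<in> carrier N \<rightarrow> carrier N'"
    and add: "\<And>x y. x \<in> carrier N \<Longrightarrow> y \<in> carrier N \<Longrightarrow> h (x \<oplus> y) = h x \<oplus>\<^bsub>N'\<^esub> h y"
    and smult: "\<And>a x. a \<in> carrier R \<Longrightarrow> x \<in> carrier N \<Longrightarrow> h (a \<odot> x) = a \<odot>\<^bsub>N'\<^esub> h x"
    and y: "\<And>e. e \<in> I' \<Longrightarrow> y e \<in> carrier N"
  shows "h (tmap N I I' m y c) = tmap N' I I' m (\<lambda>e. h (y e)) c"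
proof -
  interpret matrix_map R N I I' m by fact
  interpret N': Module.module R N' by fact
  have ab: "abelian_group N" "abelian_group N'" by unfold_locales
  have z: "h \<zero> = \<zero>\<^bsub>N'\<^esub>" by (rule additive_map_zero[OF ab h add])
  show ?thesis
  proof (cases "c \<in> I")
    case True
    have "h (\<Oplus>e\<in>I'. m c e \<odot> y e) = (\<Oplus>\<^bsub>N'\<^esub>e\<in>I'. h (m c e \<odot> y e))"
      by (rule additive_map_finsum[OF ab h add]) (use m[OF True] y in auto)
    also have "\<dots> = (\<Oplus>\<^bsub>N'\<^esub>e\<in>I'. m c e \<odot>\<^bsub>N'\<^esub> h (y e))"
      using m[OF True] y h by (intro N'.M.finsum_cong') (auto simp: smult Pi_iff)
    finally show ?thesis using True by (simp add: tmap_def)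
  qed (simp add: tmap_def z)
qed

text \<open>After interchanging the two sums, the coefficient of each \<open>y f\<close> is an entry
  of the matrix product.\<close>

lemma tmap_tmap_zero:
  fixes N (structure)
  assumes "matrix_map R N I I' m" "matrix_map R N I' I'' m'"
    and mm: "\<And>c f. c \<in> I \<Longrightarrow> f \<in> I'' \<Longrightarrow> (\<Oplus>\<^bsub>R\<^esub>e\<in>I'. m c e \<otimes>\<^bsub>R\<^esub> m' e f) = \<zero>\<^bsub>R\<^esub>"
    and y: "\<And>e. e \<in> I'' \<Longrightarrow> y e \<in> carrier N"
  shows "tmap N I I' m (tmap N I' I'' m' y) c = \<zero>"
proof -
  interpret a: matrix_map R N I I' m by fact
  interpret b: matrix_map R N I' I'' m' by fact
  show ?thesis
  proof (cases "c \<in> I")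
    case True
    note [simp] = a.m[OF True] b.m y
    have "(\<Oplus>e\<in>I'. m c e \<odot> (\<Oplus>f\<in>I''. m' e f \<odot> y f)) =
      (\<Oplus>e\<in>I'. \<Oplus>f\<in>I''. (m c e \<otimes>\<^bsub>R\<^esub> m' e f) \<odot> y f)"
      by (intro a.M.finsum_cong')
        (auto simp: a.finsum_smult a.smult_assoc1 intro!: a.M.finsum_closed a.M.finsum_cong')
    also have "\<dots> = (\<Oplus>f\<in>I''. \<Oplus>e\<in>I'. (m c e \<otimes>\<^bsub>R\<^esub> m' e f) \<odot> y f)"
    proof -
      have "(\<Oplus>e\<in>S. \<Oplus>f\<in>I''. (m c e \<otimes>\<^bsub>R\<^esub> m' e f) \<odot> y f) =
          (\<Oplus>f\<in>I''. \<Oplus>e\<in>S. (m c e \<otimes>\<^bsub>R\<^esub> m' e f) \<odot> y f)" if "finite S" "S \<subseteq> I'" for S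
        using that
      proof (induction S)
        case (insert e S)
        then have [simp]: "e \<in> I'" "\<And>e. e \<in> S \<Longrightarrow> e \<in> I'" by auto
        have "(\<Oplus>f\<in>I''. \<Oplus>e\<in>insert e S. (m c e \<otimes>\<^bsub>R\<^esub> m' e f) \<odot> y f) =
          (\<Oplus>f\<in>I''. (m c e \<otimes>\<^bsub>R\<^esub> m' e f) \<odot> y f \<oplus> (\<Oplus>e\<in>S. (m c e \<otimes>\<^bsub>R\<^esub> m' e f) \<odot> y f))"
          using insert by (intro a.M.finsum_cong') (auto intro!: a.M.finsum_closed simp: Pi_def)
        then show ?case using insert by (simp add: Pi_def a.M.finsum_addf)
      qed simp
      then show ?thesis using a.finI' by blast
    qed
    also have "\<dots> = (\<Oplus>f\<in>I''. (\<Oplus>\<^bsub>R\<^esub>e\<in>I'. m c e \<otimes>\<^bsub>R\<^esub> m' e f) \<odot> y f)"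
      by (intro a.M.finsum_cong') (auto simp: a.finsum_smult_r)
    also have "\<dots> = \<zero>" using mm[OF True] by (intro a.M.add.finprod_one_eqI) simp
    finally have *: "(\<Oplus>e\<in>I'. m c e \<odot> (\<Oplus>f\<in>I''. m' e f \<odot> y f)) = \<zero>" .
    have "(\<Oplus>e\<in>I'. m c e \<odot> tmap N I' I'' m' y e) =
        (\<Oplus>e\<in>I'. m c e \<odot> (\<Oplus>f\<in>I''. m' e f \<odot> y f))"
      by (intro a.M.finsum_cong') (auto simp: tmap_def intro!: a.M.finsum_closed)
    then show ?thesis using True * by (simp add: tmap_def)
  qed (simp add: tmap_def)
qed

text \<open>The degrees \<open>d' e - d c\<close> of an entry and \<open>j - d' e\<close> of a
  coordinate add up to \<open>j - d c\<close>. Whenever one of the two subtractions would be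
  truncated, the corresponding factor is zero.\<close>

lemma (in graded_mod) tmap_grading:
  assumes "matrix_map R N I I' m"
    and hom: "\<And>c e. c \<in> I \<Longrightarrow> e \<in> I' \<Longrightarrow> if d c \<le> d' e then m c e \<in> A (d' e - d c) else m c e = \<zero>\<^bsub>R\<^esub>"
    and y: "y \<in> fam_grading N B I' d' j"
  shows "tmap N I I' m y \<in> fam_grading N B I d j"
proof -
  interpret mm: matrix_map R N I I' m by fact
  have yc: "y \<in> carrier (fam N I')" using y by (simp add: fam_grading_def)
  have t: "m c e \<odot> y e \<in> (if d c \<le> j then B (j - d c) else {\<zero>})" if "c \<in> I" "e \<in> I'" for c e
  proof (cases "d c \<le> d' e \<and> d' e \<le> j")
    case True
    then have "m c e \<odot> y e \<in> B ((d' e - d c) + (j - d' e))"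
      using hom[OF that] y that by (intro AB_smult) (auto simp: fam_grading_def)
    then show ?thesis using True by simp
  next
    case False
    then have "m c e = \<zero>\<^bsub>R\<^esub> \<or> y e = \<zero>" using hom[OF that] y that by (auto simp: fam_grading_def split: if_splits)
    then have "m c e \<odot> y e = \<zero>" using yc mm.m[OF that] by (auto simp: fam_carrier_iff)
    then show ?thesis by auto
  qed
  have "tmap N I I' m y c \<in> B (j - d c)" if "c \<in> I" "d c \<le> j" for c
    using t[OF that(1)] that by (auto simp: tmap_def intro!: B.A_finsum)
  moreover have "tmap N I I' m y c = \<zero>" if "c \<in> I" "\<not> d c \<le> j" for c
    using t[OF that(1)] that by (auto simp: tmap_def intro!: N.M.add.finprod_one_eqI)
  ultimately show ?thesis using mm.tmap_closed[OF yc] by (simp add: fam_grading_def)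
qed

section \<open>Finite generation of submodules\<close>

context Module.module begin

text \<open>Stability is demanded only under a set \<open>X\<close> of scalars. Letting
  \<open>X\<close> grow from the ground field by one generator of the algebra at a time gives an
  induction without intermediate rings.\<close>

definition stab :: "'a set \<Rightarrow> 'c set \<Rightarrow> bool" where
  "stab X N \<longleftrightarrow> N \<subseteq> carrier M \<and> \<zero>\<^bsub>M\<^esub> \<in> N \<and> (\<forall>x\<in>N. \<forall>y\<in>N. x \<oplus>\<^bsub>M\<^esub> y \<in> N) \<and>
     (\<forall>x\<in>N. \<ominus>\<^bsub>M\<^esub> x \<in> N) \<and> (\<forall>a\<in>X. \<forall>x\<in>N. a \<odot>\<^bsub>M\<^esub> x \<in> N)"

definition gens :: "'a set \<Rightarrow> 'c set \<Rightarrow> 'c set \<Rightarrow> bool" where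
  "gens X G P \<longleftrightarrow> finite G \<and> G \<subseteq> P \<and> (\<forall>Q. stab X Q \<longrightarrow> G \<subseteq> Q \<longrightarrow> P \<subseteq> Q)"

definition noeth :: "'a set \<Rightarrow> 'c set \<Rightarrow> bool" where
  "noeth X N \<longleftrightarrow> (\<forall>P. stab X P \<longrightarrow> P \<subseteq> N \<longrightarrow> (\<exists>G. gens X G P))"

lemma stabD:
  assumes "stab X N"
  shows "N \<subseteq> carrier M" "\<zero>\<^bsub>M\<^esub> \<in> N" "x \<in> N \<Longrightarrow> y \<in> N \<Longrightarrow> x \<oplus>\<^bsub>M\<^esub> y \<in> N" "x \<in> N \<Longrightarrow> \<ominus>\<^bsub>M\<^esub> x \<in> N"
    "a \<in> X \<Longrightarrow> x \<in> N \<Longrightarrow> a \<odot>\<^bsub>M\<^esub> x \<in> N" "x \<in> N \<Longrightarrow> y \<in> N \<Longrightarrow> x \<ominus>\<^bsub>M\<^esub> y \<in> N"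
    "x \<in> N \<Longrightarrow> x \<in> carrier M"
  using assms by (auto simp: stab_def a_minus_def)

lemma stabI:
  assumes "N \<subseteq> carrier M" "\<zero>\<^bsub>M\<^esub> \<in> N" "\<And>x y. x \<in> N \<Longrightarrow> y \<in> N \<Longrightarrow> x \<oplus>\<^bsub>M\<^esub> y \<in> N"
    "\<And>x. x \<in> N \<Longrightarrow> \<ominus>\<^bsub>M\<^esub> x \<in> N" "\<And>a x. a \<in> X \<Longrightarrow> x \<in> N \<Longrightarrow> a \<odot>\<^bsub>M\<^esub> x \<in> N"
  shows "stab X N"
  using assms by (auto simp: stab_def)

lemma stab_Int: "stab X N \<Longrightarrow> stab X N' \<Longrightarrow> stab X (N \<inter> N')"
  by (auto simp: stab_def)

lemma minus_add_cancel:
  assumes "x \<in> carrier M" "y \<in> carrier M"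
  shows "(x \<ominus>\<^bsub>M\<^esub> y) \<oplus>\<^bsub>M\<^esub> y = x"
  using assms by (simp add: a_minus_def M.a_assoc M.l_neg)

lemma add_minus_cancel:
  assumes "x \<in> carrier M" "y \<in> carrier M" "z \<in> carrier M"
  shows "(x \<oplus>\<^bsub>M\<^esub> y) \<ominus>\<^bsub>M\<^esub> (z \<oplus>\<^bsub>M\<^esub> y) = x \<ominus>\<^bsub>M\<^esub> z"
proof -
  have "(x \<oplus>\<^bsub>M\<^esub> y) \<ominus>\<^bsub>M\<^esub> (z \<oplus>\<^bsub>M\<^esub> y) = x \<oplus>\<^bsub>M\<^esub> \<ominus>\<^bsub>M\<^esub> z \<oplus>\<^bsub>M\<^esub> (y \<oplus>\<^bsub>M\<^esub> \<ominus>\<^bsub>M\<^esub> y)"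
    using assms by (simp add: a_minus_def M.minus_add M.a_ac del: M.r_neg)
  then show ?thesis using assms by (simp add: M.r_neg a_minus_def)
qed

lemma noeth_zero: "noeth X {\<zero>\<^bsub>M\<^esub>}"
  unfolding noeth_def gens_def using stabD(2) by (intro allI impI exI[of _ "{}"]) auto

text \<open>A stable \<open>P\<close> that is not contained in \<open>N\<close> has an element
  \<open>p\<close> with nonzero coefficient at \<open>e\<close>. Over a field, a multiple of
  \<open>p\<close> removes the coefficient of any other element of \<open>P\<close>, so
  \<open>p\<close> and generators of the intersection of \<open>P\<close> and \<open>N\<close>
  generate \<open>P\<close>.\<close>

lemma noeth_insert:
  assumes k: "subfield k R" and N: "stab k N" "noeth k N" and e: "e \<in> carrier M"
  defines "N' \<equiv> {n \<oplus>\<^bsub>M\<^esub> a \<odot>\<^bsub>M\<^esub> e | n a. n \<in> N \<and> a \<in> k}"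
  shows "stab k N' \<and> noeth k N' \<and> N \<subseteq> N' \<and> e \<in> N'"
proof (intro conjI)
  have kR: "k \<subseteq> carrier R" using subfieldE(3)[OF k] .
  have k1: "\<one> \<in> k" "\<zero> \<in> k" using subdomainE(2,3)[OF subfield.axioms(1)[OF k]] by auto
  have kc: "a \<oplus> b \<in> k" "a \<otimes> b \<in> k" "\<ominus> a \<in> k" if "a \<in> k" "b \<in> k" for a b
    using subdomainE(5-7)[OF subfield.axioms(1)[OF k]] that by auto
  have Nc: "n \<in> carrier M" if "n \<in> N" for n using stabD(7)[OF N(1) that] .
  have kc': "a \<in> carrier R" if "a \<in> k" for a using kR that by auto
  note [simp] = Nc kc' e
  show "N \<subseteq> N'"
  proof
    fix n assume "n \<in> N"
    then have "n = n \<oplus>\<^bsub>M\<^esub> \<zero> \<odot>\<^bsub>M\<^esub> e" by simp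
    then show "n \<in> N'" unfolding N'_def using \<open>n \<in> N\<close> k1 by blast
  qed
  have "e = \<zero>\<^bsub>M\<^esub> \<oplus>\<^bsub>M\<^esub> \<one> \<odot>\<^bsub>M\<^esub> e" by simp
  then show "e \<in> N'" unfolding N'_def using stabD(2)[OF N(1)] k1 by blast
  show "stab k N'"
  proof (rule stabI)
    show "N' \<subseteq> carrier M" by (auto simp: N'_def)
    show "\<zero>\<^bsub>M\<^esub> \<in> N'" using \<open>N \<subseteq> N'\<close> stabD(2)[OF N(1)] by blast
  next
    fix x y assume "x \<in> N'" "y \<in> N'"
    then obtain n a n' a' where *: "n \<in> N" "a \<in> k" "n' \<in> N" "a' \<in> k" "x = n \<oplus>\<^bsub>M\<^esub> a \<odot>\<^bsub>M\<^esub> e" "y = n' \<oplus>\<^bsub>M\<^esub> a' \<odot>\<^bsub>M\<^esub> e"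
      by (auto simp: N'_def)
    then have "x \<oplus>\<^bsub>M\<^esub> y = (n \<oplus>\<^bsub>M\<^esub> n') \<oplus>\<^bsub>M\<^esub> (a \<oplus> a') \<odot>\<^bsub>M\<^esub> e" by (simp add: smult_l_distr M.a_ac)
    then show "x \<oplus>\<^bsub>M\<^esub> y \<in> N'" unfolding N'_def using * kc(1) stabD(3)[OF N(1)] by blast
  next
    fix x assume "x \<in> N'"
    then obtain n a where *: "n \<in> N" "a \<in> k" "x = n \<oplus>\<^bsub>M\<^esub> a \<odot>\<^bsub>M\<^esub> e" by (auto simp: N'_def)
    then have "\<ominus>\<^bsub>M\<^esub> x = (\<ominus>\<^bsub>M\<^esub> n) \<oplus>\<^bsub>M\<^esub> (\<ominus> a) \<odot>\<^bsub>M\<^esub> e" by (simp add: smult_l_minus M.minus_add)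
    then show "\<ominus>\<^bsub>M\<^esub> x \<in> N'" unfolding N'_def using * kc(3) stabD(4)[OF N(1)] by blast
  next
    fix b x assume b: "b \<in> k" and "x \<in> N'"
    then obtain n a where *: "n \<in> N" "a \<in> k" "x = n \<oplus>\<^bsub>M\<^esub> a \<odot>\<^bsub>M\<^esub> e" by (auto simp: N'_def)
    then have "b \<odot>\<^bsub>M\<^esub> x = (b \<odot>\<^bsub>M\<^esub> n) \<oplus>\<^bsub>M\<^esub> (b \<otimes> a) \<odot>\<^bsub>M\<^esub> e" using b by (simp add: smult_r_distr smult_assoc1)
    then show "b \<odot>\<^bsub>M\<^esub> x \<in> N'" unfolding N'_def using * b kc(2) stabD(5)[OF N(1)] by blast
  qed
  show "noeth k N'" unfolding noeth_def
  proof (intro allI impI)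
    fix P assume P: "stab k P" "P \<subseteq> N'"
    obtain G where G: "gens k G (P \<inter> N)"
      using N(2) stab_Int[OF P(1) N(1)] unfolding noeth_def by blast
    show "\<exists>G. gens k G P"
    proof (cases "P \<subseteq> N")
      case True
      then have "P \<inter> N = P" by blast
      then show ?thesis using G by auto
    next
      case False
      then obtain p where p: "p \<in> P" "p \<notin> N" by blast
      then obtain n a where na: "n \<in> N" "a \<in> k" "p = n \<oplus>\<^bsub>M\<^esub> a \<odot>\<^bsub>M\<^esub> e" using P(2) by (auto simp: N'_def)
      have a0: "a \<noteq> \<zero>" using na p by auto
      obtain a' where a': "a' \<in> k" "a' \<otimes> a = \<one>"
        using R.subfield_m_inv[OF k, of a] na(2) a0 by auto
      have "P \<subseteq> Q" if Q: "stab k Q" "insert p G \<subseteq> Q" for Q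
      proof
        fix q assume q: "q \<in> P"
        then obtain n' b where nb: "n' \<in> N" "b \<in> k" "q = n' \<oplus>\<^bsub>M\<^esub> b \<odot>\<^bsub>M\<^esub> e" using P(2) by (auto simp: N'_def)
        define c where "c = b \<otimes> a'"
        have c: "c \<in> k" "c \<otimes> a = b" using a' nb na kc(2) by (simp_all add: c_def R.m_assoc)
        have "c \<odot>\<^bsub>M\<^esub> p = c \<odot>\<^bsub>M\<^esub> n \<oplus>\<^bsub>M\<^esub> b \<odot>\<^bsub>M\<^esub> e"
          using c na by (simp add: smult_r_distr smult_assoc1[symmetric])
        then have "q \<ominus>\<^bsub>M\<^esub> c \<odot>\<^bsub>M\<^esub> p = n' \<ominus>\<^bsub>M\<^esub> c \<odot>\<^bsub>M\<^esub> n"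
          using nb na c add_minus_cancel[of n' "b \<odot>\<^bsub>M\<^esub> e" "c \<odot>\<^bsub>M\<^esub> n"] by simp
        then have "q \<ominus>\<^bsub>M\<^esub> c \<odot>\<^bsub>M\<^esub> p \<in> N" using nb na c stabD(5,6)[OF N(1)] by simp
        moreover have "q \<ominus>\<^bsub>M\<^esub> c \<odot>\<^bsub>M\<^esub> p \<in> P" using q p c stabD(5,6)[OF P(1)] by simp
        ultimately have "q \<ominus>\<^bsub>M\<^esub> c \<odot>\<^bsub>M\<^esub> p \<in> Q" using G Q unfolding gens_def by blast
        then have "(q \<ominus>\<^bsub>M\<^esub> c \<odot>\<^bsub>M\<^esub> p) \<oplus>\<^bsub>M\<^esub> c \<odot>\<^bsub>M\<^esub> p \<in> Q"
          using Q c by (intro stabD(3)[OF Q(1)] stabD(5)[OF Q(1)]) auto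
        then show "q \<in> Q" using q p c stabD(7)[OF P(1)] by (simp add: minus_add_cancel)
      qed
      then have "gens k (insert p G) P" using G p unfolding gens_def by blast
      then show ?thesis by blast
    qed
  qed
qed

text \<open>The polynomials in \<open>y\<close> of degree less than \<open>d\<close> with
  coefficients in \<open>N\<close>, evaluated in \<open>M\<close>.\<close>

primrec poly_part :: "'a \<Rightarrow> 'c set \<Rightarrow> nat \<Rightarrow> 'c set" where
  "poly_part y N 0 = {\<zero>\<^bsub>M\<^esub>}"
| "poly_part y N (Suc d) = {(y [^] d) \<odot>\<^bsub>M\<^esub> n \<oplus>\<^bsub>M\<^esub> u | n u. n \<in> N \<and> u \<in> poly_part y N d}"

text \<open>Hilbert's argument: a submodule of the elements \<open>\<Sum> y\<^sup>i n\<^sub>i\<close> is controlled by the ascending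
  chain of its sets of leading coefficients.\<close>

lemma noeth_adjoin:
  assumes X: "X \<subseteq> carrier R" and N: "stab X N" "noeth X N" and y [simp]: "y \<in> carrier R"
  defines "N' \<equiv> (\<Union>d. poly_part y N d)"
  shows "stab (insert y X) N' \<and> noeth (insert y X) N' \<and> N \<subseteq> N'"
proof (intro conjI)
  let ?L = "poly_part y N"
  have Nc [simp]: "n \<in> carrier M" if "n \<in> N" for n using stabD(7)[OF N(1) that] .
  have Xc [simp]: "a \<in> carrier R" if "a \<in> X" for a using X that by auto
  have LI: "(y [^] d) \<odot>\<^bsub>M\<^esub> n \<oplus>\<^bsub>M\<^esub> u \<in> ?L (Suc d)" if "n \<in> N" "u \<in> ?L d" for n u d using that by auto
  have L: "stab X (?L d)" for d
  proof (induction d)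
    case 0 then show ?case using X by (auto intro!: stabI simp: M_minus_zero)
  next
    case (Suc d)
    note Lc [simp] = stabD(7)[OF Suc]
    show ?case
    proof (rule stabI)
      show "?L (Suc d) \<subseteq> carrier M" by auto
      show "\<zero>\<^bsub>M\<^esub> \<in> ?L (Suc d)" using LI[OF stabD(2)[OF N(1)] stabD(2)[OF Suc]] by simp
    next
      fix a b assume "a \<in> ?L (Suc d)" "b \<in> ?L (Suc d)"
      then obtain n u n' u' where *: "n \<in> N" "u \<in> ?L d" "n' \<in> N" "u' \<in> ?L d"
        "a = (y [^] d) \<odot>\<^bsub>M\<^esub> n \<oplus>\<^bsub>M\<^esub> u" "b = (y [^] d) \<odot>\<^bsub>M\<^esub> n' \<oplus>\<^bsub>M\<^esub> u'" by auto
      then have "a \<oplus>\<^bsub>M\<^esub> b = (y [^] d) \<odot>\<^bsub>M\<^esub> (n \<oplus>\<^bsub>M\<^esub> n') \<oplus>\<^bsub>M\<^esub> (u \<oplus>\<^bsub>M\<^esub> u')"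
        by (simp add: smult_r_distr M.a_ac)
      then show "a \<oplus>\<^bsub>M\<^esub> b \<in> ?L (Suc d)" using LI * stabD(3)[OF N(1)] stabD(3)[OF Suc] by metis
    next
      fix a assume "a \<in> ?L (Suc d)"
      then obtain n u where *: "n \<in> N" "u \<in> ?L d" "a = (y [^] d) \<odot>\<^bsub>M\<^esub> n \<oplus>\<^bsub>M\<^esub> u" by auto
      then have "\<ominus>\<^bsub>M\<^esub> a = (y [^] d) \<odot>\<^bsub>M\<^esub> (\<ominus>\<^bsub>M\<^esub> n) \<oplus>\<^bsub>M\<^esub> (\<ominus>\<^bsub>M\<^esub> u)" by (simp add: smult_r_minus M.minus_add)
      then show "\<ominus>\<^bsub>M\<^esub> a \<in> ?L (Suc d)" using LI * stabD(4)[OF N(1)] stabD(4)[OF Suc] by metis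
    next
      fix x a assume x: "x \<in> X" and "a \<in> ?L (Suc d)"
      then obtain n u where *: "n \<in> N" "u \<in> ?L d" "a = (y [^] d) \<odot>\<^bsub>M\<^esub> n \<oplus>\<^bsub>M\<^esub> u" by auto
      have "x \<odot>\<^bsub>M\<^esub> (y [^] d \<odot>\<^bsub>M\<^esub> n) = y [^] d \<odot>\<^bsub>M\<^esub> (x \<odot>\<^bsub>M\<^esub> n)"
        using x * by (simp add: smult_assoc1[symmetric] R.m_comm)
      then have "x \<odot>\<^bsub>M\<^esub> a = (y [^] d) \<odot>\<^bsub>M\<^esub> (x \<odot>\<^bsub>M\<^esub> n) \<oplus>\<^bsub>M\<^esub> (x \<odot>\<^bsub>M\<^esub> u)"
        using * x by (simp add: smult_r_distr)
      then show "x \<odot>\<^bsub>M\<^esub> a \<in> ?L (Suc d)" using LI * x stabD(5)[OF N(1)] stabD(5)[OF Suc] by metis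
    qed
  qed
  have Lc [simp]: "u \<in> carrier M" if "u \<in> ?L d" for u d using stabD(7)[OF L that] .
  have LS: "?L d \<subseteq> ?L (Suc d)" for d
  proof
    fix u assume "u \<in> ?L d"
    then show "u \<in> ?L (Suc d)" using LI[OF stabD(2)[OF N(1)], of u d] by simp
  qed
  have Lmono: "?L d \<subseteq> ?L d'" if "d \<le> d'" for d d' using that LS by (rule lift_Suc_mono_le[of ?L, rotated])
  have yL: "y \<odot>\<^bsub>M\<^esub> u \<in> ?L (Suc d)" if "u \<in> ?L d" for u d
    using that
  proof (induction d arbitrary: u)
    case 0 then show ?case using stabD(2)[OF L[of "Suc 0"]] by simp
  next
    case (Suc d)
    then obtain n v where *: "n \<in> N" "v \<in> ?L d" "u = (y [^] d) \<odot>\<^bsub>M\<^esub> n \<oplus>\<^bsub>M\<^esub> v" by auto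
    have "y \<odot>\<^bsub>M\<^esub> u = (y [^] Suc d) \<odot>\<^bsub>M\<^esub> n \<oplus>\<^bsub>M\<^esub> (y \<odot>\<^bsub>M\<^esub> v)"
      using * by (simp add: smult_r_distr smult_assoc1 R.m_comm)
    then show ?case using LI[OF *(1) Suc.IH[OF *(2)]] by simp
  qed
  have N'c: "N' \<subseteq> carrier M" unfolding N'_def using Lc by blast
  show "stab (insert y X) N'"
  proof (rule stabI)
    show "\<zero>\<^bsub>M\<^esub> \<in> N'" using stabD(2)[OF L] unfolding N'_def by blast
    fix a b assume "a \<in> N'" "b \<in> N'"
    then obtain d d' where "a \<in> ?L d" "b \<in> ?L d'" unfolding N'_def by blast
    then have "a \<in> ?L (max d d')" "b \<in> ?L (max d d')" using Lmono by (meson max.cobounded1 max.cobounded2 subsetD)+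
    then show "a \<oplus>\<^bsub>M\<^esub> b \<in> N'" using stabD(3)[OF L] unfolding N'_def by blast
  next
    fix a assume "a \<in> N'"
    then show "\<ominus>\<^bsub>M\<^esub> a \<in> N'" using stabD(4)[OF L] unfolding N'_def by blast
    fix x assume "x \<in> insert y X"
    then show "x \<odot>\<^bsub>M\<^esub> a \<in> N'" using \<open>a \<in> N'\<close> stabD(5)[OF L] yL unfolding N'_def by blast
  qed (rule N'c)
  have "n \<in> ?L (Suc 0)" if "n \<in> N" for n using LI[OF that, of "\<zero>\<^bsub>M\<^esub>" 0] that by simp
  then show "N \<subseteq> N'" unfolding N'_def by blast
  show "noeth (insert y X) N'" unfolding noeth_def
  proof (intro allI impI)
    fix P assume P: "stab (insert y X) P" "P \<subseteq> N'"
    \<comment> \<open>The coefficients at \<open>y [^] d\<close> of those elements of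
      \<open>Q\<close> that can be written with degree at most \<open>d\<close>. Representations are
      not unique, so a coefficient counts as soon as one representation has it. Multiplication by
      \<open>y\<close> makes these sets increase with \<open>d\<close>.\<close>
    define E where "E Q d = {n \<in> N. \<exists>u\<in>?L d. (y [^] d) \<odot>\<^bsub>M\<^esub> n \<oplus>\<^bsub>M\<^esub> u \<in> Q}" for Q d
    have EI: "n \<in> E Q d" if "n \<in> N" "u \<in> ?L d" "(y [^] d) \<odot>\<^bsub>M\<^esub> n \<oplus>\<^bsub>M\<^esub> u \<in> Q" for n u Q d
      using that by (auto simp: E_def)
    have E: "stab X (E Q d)" if Q: "stab (insert y X) Q" for Q d
    proof (rule stabI)
      show "\<zero>\<^bsub>M\<^esub> \<in> E Q d" using EI[OF stabD(2)[OF N(1)] stabD(2)[OF L]] stabD(2)[OF Q] by simp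
    next
      fix a b assume "a \<in> E Q d" "b \<in> E Q d"
      then obtain u u' where *: "a \<in> N" "u \<in> ?L d" "(y [^] d) \<odot>\<^bsub>M\<^esub> a \<oplus>\<^bsub>M\<^esub> u \<in> Q"
        "b \<in> N" "u' \<in> ?L d" "(y [^] d) \<odot>\<^bsub>M\<^esub> b \<oplus>\<^bsub>M\<^esub> u' \<in> Q" by (auto simp: E_def)
      then have "(y [^] d) \<odot>\<^bsub>M\<^esub> (a \<oplus>\<^bsub>M\<^esub> b) \<oplus>\<^bsub>M\<^esub> (u \<oplus>\<^bsub>M\<^esub> u') =
        ((y [^] d) \<odot>\<^bsub>M\<^esub> a \<oplus>\<^bsub>M\<^esub> u) \<oplus>\<^bsub>M\<^esub> ((y [^] d) \<odot>\<^bsub>M\<^esub> b \<oplus>\<^bsub>M\<^esub> u')"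
        by (simp add: smult_r_distr M.a_ac)
      then have "(y [^] d) \<odot>\<^bsub>M\<^esub> (a \<oplus>\<^bsub>M\<^esub> b) \<oplus>\<^bsub>M\<^esub> (u \<oplus>\<^bsub>M\<^esub> u') \<in> Q" using * stabD(3)[OF Q] by metis
      then show "a \<oplus>\<^bsub>M\<^esub> b \<in> E Q d" by (intro EI) (use * stabD(3)[OF N(1)] stabD(3)[OF L] in auto)
    next
      fix a assume "a \<in> E Q d"
      then obtain u where *: "a \<in> N" "u \<in> ?L d" "(y [^] d) \<odot>\<^bsub>M\<^esub> a \<oplus>\<^bsub>M\<^esub> u \<in> Q" by (auto simp: E_def)
      then have "(y [^] d) \<odot>\<^bsub>M\<^esub> (\<ominus>\<^bsub>M\<^esub> a) \<oplus>\<^bsub>M\<^esub> (\<ominus>\<^bsub>M\<^esub> u) = \<ominus>\<^bsub>M\<^esub> ((y [^] d) \<odot>\<^bsub>M\<^esub> a \<oplus>\<^bsub>M\<^esub> u)"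
        by (simp add: smult_r_minus M.minus_add)
      then have "(y [^] d) \<odot>\<^bsub>M\<^esub> (\<ominus>\<^bsub>M\<^esub> a) \<oplus>\<^bsub>M\<^esub> (\<ominus>\<^bsub>M\<^esub> u) \<in> Q" using * stabD(4)[OF Q] by metis
      then show "\<ominus>\<^bsub>M\<^esub> a \<in> E Q d" by (intro EI) (use * stabD(4)[OF N(1)] stabD(4)[OF L] in auto)
    next
      fix x a assume x: "x \<in> X" and "a \<in> E Q d"
      then obtain u where *: "a \<in> N" "u \<in> ?L d" "(y [^] d) \<odot>\<^bsub>M\<^esub> a \<oplus>\<^bsub>M\<^esub> u \<in> Q" by (auto simp: E_def)
      have "x \<odot>\<^bsub>M\<^esub> (y [^] d \<odot>\<^bsub>M\<^esub> a) = y [^] d \<odot>\<^bsub>M\<^esub> (x \<odot>\<^bsub>M\<^esub> a)"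
        using x * by (simp add: smult_assoc1[symmetric] R.m_comm)
      then have "(y [^] d) \<odot>\<^bsub>M\<^esub> (x \<odot>\<^bsub>M\<^esub> a) \<oplus>\<^bsub>M\<^esub> (x \<odot>\<^bsub>M\<^esub> u) = x \<odot>\<^bsub>M\<^esub> ((y [^] d) \<odot>\<^bsub>M\<^esub> a \<oplus>\<^bsub>M\<^esub> u)"
        using x * by (simp add: smult_r_distr)
      then have "(y [^] d) \<odot>\<^bsub>M\<^esub> (x \<odot>\<^bsub>M\<^esub> a) \<oplus>\<^bsub>M\<^esub> (x \<odot>\<^bsub>M\<^esub> u) \<in> Q" using * x stabD(5)[OF Q] by (metis insertI2)
      then show "x \<odot>\<^bsub>M\<^esub> a \<in> E Q d" by (intro EI) (use * x stabD(5)[OF N(1)] stabD(5)[OF L] in auto)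
    qed (auto simp: E_def)
    have EN: "E Q d \<subseteq> N" for Q d by (auto simp: E_def)
    have ES: "E Q d \<subseteq> E Q (Suc d)" if Q: "stab (insert y X) Q" for Q d
    proof
      fix n assume "n \<in> E Q d"
      then obtain u where *: "n \<in> N" "u \<in> ?L d" "(y [^] d) \<odot>\<^bsub>M\<^esub> n \<oplus>\<^bsub>M\<^esub> u \<in> Q" by (auto simp: E_def)
      have "(y [^] Suc d) \<odot>\<^bsub>M\<^esub> n \<oplus>\<^bsub>M\<^esub> (y \<odot>\<^bsub>M\<^esub> u) = y \<odot>\<^bsub>M\<^esub> ((y [^] d) \<odot>\<^bsub>M\<^esub> n \<oplus>\<^bsub>M\<^esub> u)"
        using * by (simp add: smult_r_distr smult_assoc1 R.m_comm)
      then have "(y [^] Suc d) \<odot>\<^bsub>M\<^esub> n \<oplus>\<^bsub>M\<^esub> (y \<odot>\<^bsub>M\<^esub> u) \<in> Q" using * stabD(5)[OF Q] by (metis insertI1)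
      then show "n \<in> E Q (Suc d)" by (rule EI[OF *(1) yL[OF *(2)]])
    qed
    have Emono: "E Q d \<subseteq> E Q d'" if "stab (insert y X) Q" "d \<le> d'" for Q d d'
      using ES[OF that(1)] that(2) by (rule lift_Suc_mono_le)
    have "stab X (\<Union>d. E P d)"
    proof (rule stabI)
      show "(\<Union>d. E P d) \<subseteq> carrier M" using EN stabD(1)[OF N(1)] by blast
      show "\<zero>\<^bsub>M\<^esub> \<in> (\<Union>d. E P d)" using stabD(2)[OF E[OF P(1)]] by blast
    next
      fix a b assume "a \<in> (\<Union>d. E P d)" "b \<in> (\<Union>d. E P d)"
      then obtain d d' where "a \<in> E P d" "b \<in> E P d'" by blast
      then have "a \<in> E P (max d d')" "b \<in> E P (max d d')"
        using Emono[OF P(1)] by (meson max.cobounded1 max.cobounded2 subsetD)+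
      then show "a \<oplus>\<^bsub>M\<^esub> b \<in> (\<Union>d. E P d)" using stabD(3)[OF E[OF P(1)]] by blast
    next
      fix a assume "a \<in> (\<Union>d. E P d)"
      then show "\<ominus>\<^bsub>M\<^esub> a \<in> (\<Union>d. E P d)" using stabD(4)[OF E[OF P(1)]] by blast
    next
      fix x a assume "x \<in> X" "a \<in> (\<Union>d. E P d)"
      then show "x \<odot>\<^bsub>M\<^esub> a \<in> (\<Union>d. E P d)" using stabD(5)[OF E[OF P(1)]] by blast
    qed
    moreover have "(\<Union>d. E P d) \<subseteq> N" using EN by blast
    ultimately obtain G0 where G0: "gens X G0 (\<Union>d. E P d)" using N(2) unfolding noeth_def by blast
    \<comment> \<open>The finitely many generators of the union of the chain all occur at one stage
      \<open>D\<close>, so the chain is stationary from there on.\<close>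
    obtain D where D: "G0 \<subseteq> E P D"
    proof -
      have "\<exists>d. g \<in> E P d" if "g \<in> G0" for g using G0 that unfolding gens_def by blast
      then obtain dd where dd: "\<And>g. g \<in> G0 \<Longrightarrow> g \<in> E P (dd g)" by metis
      have "g \<in> E P (Max (dd ` G0))" if "g \<in> G0" for g
        using Emono[OF P(1), of "dd g" "Max (dd ` G0)"] dd[OF that] that G0 by (auto simp: gens_def)
      then show ?thesis using that by blast
    qed
    have "\<exists>G. gens X G (E P d)" for d using N(2) E[OF P(1)] EN unfolding noeth_def by blast
    then obtain G where G: "\<And>d. gens X (G d) (E P d)" by metis
    have "\<exists>p. \<forall>d. \<forall>g\<in>E P d. \<exists>u\<in>?L d. p d g = (y [^] d) \<odot>\<^bsub>M\<^esub> g \<oplus>\<^bsub>M\<^esub> u \<and> p d g \<in> P"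
    proof -
      have "\<forall>d. \<forall>g. \<exists>p. g \<in> E P d \<longrightarrow> (\<exists>u\<in>?L d. p = (y [^] d) \<odot>\<^bsub>M\<^esub> g \<oplus>\<^bsub>M\<^esub> u \<and> p \<in> P)"
        by (auto simp: E_def)
      then show ?thesis unfolding choice_iff Ball_def .
    qed
    then obtain p where p: "\<And>d g. g \<in> E P d \<Longrightarrow> \<exists>u\<in>?L d. p d g = (y [^] d) \<odot>\<^bsub>M\<^esub> g \<oplus>\<^bsub>M\<^esub> u \<and> p d g \<in> P" by metis
    \<comment> \<open>Elements of \<open>P\<close> whose leading coefficients generate
      \<open>E P d\<close>, for each of the finitely many \<open>d \<le> D\<close>.\<close>
    define H where "H = (\<Union>d\<le>D. p d ` G d)"
    have GE: "G d \<subseteq> E P d" "finite (G d)" for d using G unfolding gens_def by auto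
    have "gens (insert y X) H P" unfolding gens_def
    proof (intro conjI allI impI)
      show "finite H" unfolding H_def using GE by auto
      show "H \<subseteq> P" unfolding H_def using GE p by blast
      fix Q assume Q: "stab (insert y X) Q" "H \<subseteq> Q"
      \<comment> \<open>Generation is tested on the intersection of \<open>P\<close> and
        \<open>Q\<close>: once it has the same leading coefficients as \<open>P\<close> in all
        degrees, an induction on the degree subtracts from any element of \<open>P\<close> a member
        of \<open>Q\<close> with equal leading term.\<close>
      note PQ = stab_Int[OF P(1) Q(1)]
      have EG: "E P d \<subseteq> E (P \<inter> Q) d" if d: "d \<le> D" for d
      proof -
        have "G d \<subseteq> E (P \<inter> Q) d"
        proof
          fix g assume g: "g \<in> G d"
          then have "p d g \<in> Q" using Q(2) d unfolding H_def by blast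
          moreover have "g \<in> E P d" using g GE by blast
          moreover obtain u where "u \<in> ?L d" "p d g = (y [^] d) \<odot>\<^bsub>M\<^esub> g \<oplus>\<^bsub>M\<^esub> u" "p d g \<in> P"
            using p[OF \<open>g \<in> E P d\<close>] by blast
          ultimately show "g \<in> E (P \<inter> Q) d" using EN by (intro EI[of g u]) auto
        qed
        then show ?thesis using G[of d] E[OF PQ, of d] unfolding gens_def by blast
      qed
      have Ed: "E P d \<subseteq> E (P \<inter> Q) d" for d
      proof (cases "d \<le> D")
        case False
        have "G0 \<subseteq> E (P \<inter> Q) d" using D EG[of D] Emono[OF PQ, of D d] False by fastforce
        then have "(\<Union>d. E P d) \<subseteq> E (P \<inter> Q) d" using G0 E[OF PQ, of d] unfolding gens_def by blast
        then show ?thesis by blast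
      qed (rule EG)
      have "P \<inter> ?L d \<subseteq> Q" for d
      proof (induction d)
        case 0 then show ?case using stabD(2)[OF Q(1)] by auto
      next
        case (Suc d)
        show ?case
        proof
          fix q assume q: "q \<in> P \<inter> ?L (Suc d)"
          then obtain n u where nu: "n \<in> N" "u \<in> ?L d" "q = (y [^] d) \<odot>\<^bsub>M\<^esub> n \<oplus>\<^bsub>M\<^esub> u" by auto
          then have "n \<in> E P d" using q by (intro EI[of n u]) auto
          then have "n \<in> E (P \<inter> Q) d" using Ed by blast
          then obtain u' where u': "u' \<in> ?L d" "(y [^] d) \<odot>\<^bsub>M\<^esub> n \<oplus>\<^bsub>M\<^esub> u' \<in> P \<inter> Q" by (auto simp: E_def)
          let ?q = "(y [^] d) \<odot>\<^bsub>M\<^esub> n \<oplus>\<^bsub>M\<^esub> u'"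
          have c: "u \<in> carrier M" "u' \<in> carrier M" "(y [^] d) \<odot>\<^bsub>M\<^esub> n \<in> carrier M" using nu u' by auto
          have "q \<ominus>\<^bsub>M\<^esub> ?q = u \<ominus>\<^bsub>M\<^esub> u'"
            using add_minus_cancel[OF c(1,3,2)] c nu by (simp add: M.a_comm)
          then have "q \<ominus>\<^bsub>M\<^esub> ?q \<in> ?L d" using stabD(6)[OF L nu(2) u'(1)] by simp
          moreover have "q \<ominus>\<^bsub>M\<^esub> ?q \<in> P" using q u' stabD(6)[OF P(1)] by blast
          ultimately have "q \<ominus>\<^bsub>M\<^esub> ?q \<in> Q" using Suc by blast
          then have "(q \<ominus>\<^bsub>M\<^esub> ?q) \<oplus>\<^bsub>M\<^esub> ?q \<in> Q" using u' stabD(3)[OF Q(1)] by blast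
          moreover have "(q \<ominus>\<^bsub>M\<^esub> ?q) \<oplus>\<^bsub>M\<^esub> ?q = q" using c nu by (intro minus_add_cancel) auto
          ultimately show "q \<in> Q" by simp
        qed
      qed
      then show "P \<subseteq> Q" using P(2) unfolding N'_def by blast
    qed
    then show "\<exists>G. gens (insert y X) G P" by blast
  qed
qed

text \<open>Starts from the span of \<open>E\<close> over the field, one vector at a time, and then
  adjoins the elements of \<open>S\<close>.\<close>

lemma noeth_exists:
  assumes k: "subfield k R" and E: "finite E" "E \<subseteq> carrier M" and S: "finite S" "S \<subseteq> carrier R"
  shows "\<exists>N. stab (k \<union> S) N \<and> noeth (k \<union> S) N \<and> E \<subseteq> N"
  using S
proof (induction S)
  case empty
  have "\<exists>N. stab k N \<and> noeth k N \<and> E \<subseteq> N" using E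
  proof (induction E)
    case empty
    have "stab k {\<zero>\<^bsub>M\<^esub>}" using subfieldE(3)[OF k] by (intro stabI) (auto simp: M_minus_zero)
    then show ?case using noeth_zero by blast
  next
    case (insert e E)
    then obtain N where "stab k N" "noeth k N" "E \<subseteq> N" by auto
    then show ?case using noeth_insert[OF k, of N e] insert.prems
      by (intro exI[of _ "{n \<oplus>\<^bsub>M\<^esub> a \<odot>\<^bsub>M\<^esub> e | n a. n \<in> N \<and> a \<in> k}"]) auto
  qed
  then show ?case by simp
next
  case (insert y S)
  then obtain N where N: "stab (k \<union> S) N" "noeth (k \<union> S) N" "E \<subseteq> N" by auto
  have "k \<union> S \<subseteq> carrier R" "y \<in> carrier R" using subfieldE(3)[OF k] insert.prems by auto
  from noeth_adjoin[OF this(1) N(1,2) this(2)] N(3) show ?case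
    by (intro exI[of _ "\<Union>d. poly_part y N d"]) auto
qed

text \<open>The scalars that preserve \<open>N\<close> are closed under the ring operations, so it
  is enough to know them on generators of the ring.\<close>

lemma stab_submodule:
  assumes X: "X \<subseteq> carrier R" "generate_ring R X = carrier R"
  shows "stab X N \<longleftrightarrow> submodule R N M"
proof
  assume N: "stab X N"
  have "a \<odot>\<^bsub>M\<^esub> x \<in> N" if "a \<in> generate_ring R X" "x \<in> N" for a x
    using that
  proof (induction a arbitrary: x)
    case (a_inv h)
    then have "h \<in> carrier R" using X by auto
    then show ?case using a_inv stabD[OF N] by (simp add: smult_l_minus)
  next
    case (eng_add h1 h2)
    then have "h1 \<in> carrier R" "h2 \<in> carrier R" using X by auto
    then show ?case using eng_add stabD[OF N] by (simp add: smult_l_distr)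
  next
    case (eng_mult h1 h2)
    then have "h1 \<in> carrier R" "h2 \<in> carrier R" using X by auto
    then show ?case using eng_mult stabD[OF N] by (simp add: smult_assoc1)
  qed (use stabD[OF N] in auto)
  then show "submodule R N M" using stabD[OF N] X(2) module_axioms by (auto simp: submodule_def)
next
  assume N: "submodule R N M"
  then show "stab X N" using X(1) submodule_minus_closed[OF N] by (auto simp: stab_def submodule_def)
qed

end

text \<open>The noetherian submodule built from generators of \<open>M\<close> contains them, hence
  is all of \<open>M\<close>. For a set of scalars that generates the ring, stable subsets are the
  same as submodules.\<close>

lemma submodule_finitely_generated:
  assumes "standard_graded_algebra R A" "Module.module R M" "finitely_generated R M" and P: "submodule R P M"
  shows "\<exists>G. finite G \<and> G \<subseteq> P \<and> (\<forall>Q. submodule R Q M \<longrightarrow> G \<subseteq> Q \<longrightarrow> P \<subseteq> Q)"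
proof -
  interpret M: Module.module R M by fact
  obtain S where S: "finite S" "S \<subseteq> A 1" "generate_ring R (A 0 \<union> S) = carrier R"
    and k: "subfield (A 0) R" and gr: "graded_ring R A"
    using assms(1) by (auto simp: standard_graded_algebra_def)
  interpret graded_alg R A by (intro graded_alg.intro gr k)
  have S': "S \<subseteq> carrier R" "A 0 \<union> S \<subseteq> carrier R" using S(2) A.A_carrier by auto
  note stab = M.stab_submodule[OF S'(2) S(3)]
  obtain E where E: "finite E" "E \<subseteq> carrier M" "M.span E = carrier M"
    using assms(3) unfolding finitely_generated_def by blast
  obtain N where N: "M.stab (A 0 \<union> S) N" "M.noeth (A 0 \<union> S) N" "E \<subseteq> N"
    using M.noeth_exists[OF k E(1,2) S(1) S'(1)] by blast
  have "carrier M \<subseteq> N" using M.span_is_subset[OF N(3)] N(1) E(3) unfolding stab by simp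
  then have "P \<subseteq> N" using P by (auto simp: submodule_def)
  moreover have "M.stab (A 0 \<union> S) P" using P unfolding stab .
  ultimately obtain G where "M.gens (A 0 \<union> S) G P" using N(2) unfolding M.noeth_def by blast
  then show ?thesis unfolding M.gens_def stab by blast
qed

section \<open>Existence of finite graded free resolutions\<close>

definition ev :: "('a, 'b, 'y) module_scheme \<Rightarrow> nat set \<Rightarrow> (nat \<Rightarrow> 'b) \<Rightarrow> (nat \<Rightarrow> 'a) \<Rightarrow> 'b" where
  "ev N I g f = (\<Oplus>\<^bsub>N\<^esub>c\<in>I. f c \<odot>\<^bsub>N\<^esub> g c)"

definition uvec :: "('a, 'x) ring_scheme \<Rightarrow> nat \<Rightarrow> nat \<Rightarrow> 'a" where
  "uvec R e c = (if e = c then \<one>\<^bsub>R\<^esub> else \<zero>\<^bsub>R\<^esub>)"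

lemma mod_homI:
  assumes "Module.module R M" "Module.module R N" "\<And>x. x \<in> carrier M \<Longrightarrow> f x \<in> carrier N"
    "\<And>x y. x \<in> carrier M \<Longrightarrow> y \<in> carrier M \<Longrightarrow> f (x \<oplus>\<^bsub>M\<^esub> y) = f x \<oplus>\<^bsub>N\<^esub> f y"
    "\<And>a x. a \<in> carrier R \<Longrightarrow> x \<in> carrier M \<Longrightarrow> f (a \<odot>\<^bsub>M\<^esub> x) = a \<odot>\<^bsub>N\<^esub> f x"
  shows "mod_hom R M N f"
  using assms by (auto simp: mod_hom_def mod_hom_axioms_def LinearCombinations.module_hom_def)

lemma mod_homD:
  assumes "mod_hom R M N f"
  shows "Module.module R M" "Module.module R N" "x \<in> carrier M \<Longrightarrow> f x \<in> carrier N"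
    "x \<in> carrier M \<Longrightarrow> y \<in> carrier M \<Longrightarrow> f (x \<oplus>\<^bsub>M\<^esub> y) = f x \<oplus>\<^bsub>N\<^esub> f y"
    "a \<in> carrier R \<Longrightarrow> x \<in> carrier M \<Longrightarrow> f (a \<odot>\<^bsub>M\<^esub> x) = a \<odot>\<^bsub>N\<^esub> f x"
  using assms by (auto simp: mod_hom_def mod_hom_axioms_def LinearCombinations.module_hom_def)

lemma free_module_module: "cring R \<Longrightarrow> Module.module R (free_module R I)"
  unfolding free_module_fam by (intro fam_module ring_mod_module)

lemma free_carrier_iff:
  "f \<in> carrier (free_module R I) \<longleftrightarrow> (\<forall>c. f c \<in> carrier R) \<and> (\<forall>c. c \<notin> I \<longrightarrow> f c = \<zero>\<^bsub>R\<^esub>) \<and> finite {c. f c \<noteq> \<zero>\<^bsub>R\<^esub>}"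
  by (simp add: free_module_def)

lemma free_carrier_finite:
  "finite I \<Longrightarrow> f \<in> carrier (free_module R I) \<longleftrightarrow> (\<forall>c. f c \<in> carrier R) \<and> (\<forall>c. c \<notin> I \<longrightarrow> f c = \<zero>\<^bsub>R\<^esub>)"
  using fam_carrier_finite[of I f "ring_mod R"] by (simp add: free_module_fam)

lemma free_simps [simp]:
  "\<zero>\<^bsub>free_module R I\<^esub> = (\<lambda>c. \<zero>\<^bsub>R\<^esub>)" "f \<oplus>\<^bsub>free_module R I\<^esub> g = (\<lambda>c. f c \<oplus>\<^bsub>R\<^esub> g c)"
  "a \<odot>\<^bsub>free_module R I\<^esub> f = (\<lambda>c. a \<otimes>\<^bsub>R\<^esub> f c)"
  by (simp_all add: free_module_def)

lemma finsum_free: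
  assumes "cring R" "\<And>t. t \<in> T \<Longrightarrow> f t \<in> carrier (free_module R I)"
  shows "finsum (free_module R I) f T c = (\<Oplus>\<^bsub>R\<^esub>t\<in>T. f t c)"
  using finsum_fam[OF ring_mod_module[OF assms(1)], of T f I c] assms(2)
  by (simp add: free_module_fam finsum_ring_mod)

context Module.module begin

lemma ev_hom:
  assumes I: "finite I" and g: "\<And>c. c \<in> I \<Longrightarrow> g c \<in> carrier M"
  shows "mod_hom R (free_module R I) M (ev M I g)"
proof (rule mod_homI)
  show "Module.module R (free_module R I)" by (rule free_module_module) unfold_locales
  show "Module.module R M" ..
  have fc: "f c \<in> carrier R" if "f \<in> carrier (free_module R I)" for f c using that by (simp add: free_carrier_iff)
  show "ev M I g f \<in> carrier M" if "f \<in> carrier (free_module R I)" for f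
    unfolding ev_def using fc[OF that] g by (intro M.finsum_closed) auto
  show "ev M I g (f \<oplus>\<^bsub>free_module R I\<^esub> h) = ev M I g f \<oplus>\<^bsub>M\<^esub> ev M I g h"
    if "f \<in> carrier (free_module R I)" "h \<in> carrier (free_module R I)" for f h
  proof -
    have "ev M I g (f \<oplus>\<^bsub>free_module R I\<^esub> h) = (\<Oplus>\<^bsub>M\<^esub>c\<in>I. f c \<odot>\<^bsub>M\<^esub> g c \<oplus>\<^bsub>M\<^esub> h c \<odot>\<^bsub>M\<^esub> g c)"
      unfolding ev_def using fc[OF that(1)] fc[OF that(2)] g by (intro M.finsum_cong') (auto simp: smult_l_distr)
    then show ?thesis unfolding ev_def using fc[OF that(1)] fc[OF that(2)] g by (simp add: M.finsum_addf Pi_def)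
  qed
  show "ev M I g (a \<odot>\<^bsub>free_module R I\<^esub> f) = a \<odot>\<^bsub>M\<^esub> ev M I g f"
    if "a \<in> carrier R" "f \<in> carrier (free_module R I)" for a f
  proof -
    have "ev M I g (a \<odot>\<^bsub>free_module R I\<^esub> f) = (\<Oplus>\<^bsub>M\<^esub>c\<in>I. a \<odot>\<^bsub>M\<^esub> (f c \<odot>\<^bsub>M\<^esub> g c))"
      unfolding ev_def using that(1) fc[OF that(2)] g by (intro M.finsum_cong') (auto simp: smult_assoc1)
    then show ?thesis unfolding ev_def using that(1) fc[OF that(2)] g by (subst finsum_smult) auto
  qed
qed

lemma uvec_carrier: "e \<in> I \<Longrightarrow> uvec R e \<in> carrier (free_module R I)"
  by (auto simp: free_carrier_iff uvec_def)

lemma ev_uvec: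
  assumes I: "finite I" and g: "\<And>c. c \<in> I \<Longrightarrow> g c \<in> carrier M" and e: "e \<in> I"
  shows "ev M I g (uvec R e) = g e"
proof -
  have "ev M I g (uvec R e) = (\<Oplus>\<^bsub>M\<^esub>c\<in>I. if e = c then g c else \<zero>\<^bsub>M\<^esub>)"
    unfolding ev_def using g by (intro M.finsum_cong') (auto simp: uvec_def)
  then show ?thesis using M.add.finprod_singleton[OF e I, of g] g by auto
qed

end

lemma (in cring) free_expand:
  assumes I: "finite I" and f: "f \<in> carrier (free_module R I)"
  shows "ev (free_module R I) I (uvec R) f = f"
proof
  fix c
  have fc: "f c \<in> carrier R" for c using f by (simp add: free_carrier_iff)
  have u: "f e \<odot>\<^bsub>free_module R I\<^esub> uvec R e \<in> carrier (free_module R I)" if "e \<in> I" for e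
    using that fc by (auto simp: free_carrier_iff uvec_def)
  have "ev (free_module R I) I (uvec R) f c = (\<Oplus>e\<in>I. f e \<otimes> uvec R e c)"
    unfolding ev_def by (subst finsum_free[OF is_cring u]) auto
  also have "\<dots> = (\<Oplus>e\<in>I. if c = e then f e else \<zero>)"
    using fc by (intro finsum_cong') (auto simp: uvec_def)
  also have "\<dots> = f c"
  proof (cases "c \<in> I")
    case True then show ?thesis using fc by (intro add.finprod_singleton I) auto
  next
    case False
    then have "(\<Oplus>e\<in>I. if c = e then f e else \<zero>) = (\<Oplus>e\<in>I. \<zero>)" by (intro finsum_cong') auto
    then show ?thesis using f False by (simp add: free_carrier_iff)
  qed
  finally show "ev (free_module R I) I (uvec R) f c = f c" .
qed

lemma free_finitely_generated:
  assumes "cring R" and I: "finite I" shows "finitely_generated R (free_module R I)"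
proof -
  interpret R: cring R by fact
  interpret F: Module.module R "free_module R I" by (rule free_module_module) fact
  have u: "uvec R ` I \<subseteq> carrier (free_module R I)" by (auto intro: F.uvec_carrier)
  have "carrier (free_module R I) \<subseteq> F.span (uvec R ` I)"
  proof
    fix f assume f: "f \<in> carrier (free_module R I)"
    have "ev (free_module R I) I (uvec R) f \<in> F.span (uvec R ` I)" unfolding ev_def
    proof (rule F.submodule_finsum_closed[OF F.span_is_submodule[OF u]])
      fix c assume "c \<in> I"
      then have "uvec R c \<in> F.span (uvec R ` I)" "f c \<in> carrier R"
        using F.in_own_span[OF u] f by (auto simp: free_carrier_iff)
      then show "f c \<odot>\<^bsub>free_module R I\<^esub> uvec R c \<in> F.span (uvec R ` I)"
        using F.span_is_submodule[OF u] unfolding submodule_def by blast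
    qed
    then show "f \<in> F.span (uvec R ` I)" using R.free_expand[OF I f] by simp
  qed
  then have "F.span (uvec R ` I) = carrier (free_module R I)" using F.span_is_subset2[OF u] by blast
  then show ?thesis unfolding finitely_generated_def using u I by blast
qed

lemma standard_graded_alg: "standard_graded_algebra R A \<Longrightarrow> graded_alg R A"
  by (simp add: standard_graded_algebra_def graded_alg_def)

context graded_mod begin

lemma ev_grading:
  assumes g: "\<And>c. c \<in> I \<Longrightarrow> g c \<in> B (d c)" and f: "f \<in> free_grading R A I d j"
  shows "ev N I g f \<in> B j"
  unfolding ev_def
proof (rule B.A_finsum)
  fix c assume c: "c \<in> I"
  have gc: "g c \<in> carrier N" using g[OF c] B.A_carrier by blast
  show "f c \<odot> g c \<in> B j"
  proof (cases "d c \<le> j")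
    case True
    then have "f c \<odot> g c \<in> B ((j - d c) + d c)" using f c g by (intro AB_smult) (auto simp: free_grading_def)
    then show ?thesis using True by simp
  next
    case False
    then show ?thesis using f c gc by (auto simp: free_grading_def)
  qed
qed

text \<open>The homogeneous components of finitely many generators of \<open>P\<close> again lie in
  \<open>P\<close> and generate it. They are arranged in a list because the basis of a free module
  is indexed by natural numbers.\<close>

lemma homog_submodule_cover:
  assumes std: "standard_graded_algebra R A" and fg: "finitely_generated R N"
    and P: "submodule R P N" and hom: "\<And>x i. x \<in> P \<Longrightarrow> B.cmp x i \<in> P"
  shows "\<exists>I d g. finite I \<and> (\<forall>c\<in>I. g c \<in> B (d c)) \<and> ev N I g ` carrier (free_module R I) = P"
proof -
  obtain G where G: "finite G" "G \<subseteq> P" "\<And>Q. submodule R Q N \<Longrightarrow> G \<subseteq> Q \<Longrightarrow> P \<subseteq> Q"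
    using submodule_finitely_generated[OF std N_module fg P] by metis
  have PN: "P \<subseteq> carrier N" using P by (auto simp: submodule_def)
  have "\<exists>n. (\<Oplus>i\<in>{..<n}. B.cmp x i) = x" if "x \<in> G" for x
    using B.comp_bound[of x] G(2) PN that by (metis subsetD)
  then obtain n where n: "\<And>x. x \<in> G \<Longrightarrow> (\<Oplus>i\<in>{..<n x}. B.cmp x i) = x" by metis
  define G' where "G' = (\<Union>x\<in>G. B.cmp x ` {..<n x})"
  have "finite G'" unfolding G'_def using G(1) by auto
  then obtain xs where xs: "set xs = G'" using finite_list by blast
  let ?I = "{..<length xs}"
  have G'P: "G' \<subseteq> P" unfolding G'_def using hom G(2) by blast
  have "\<exists>j. xs ! c \<in> B j" if "c \<in> ?I" for c
  proof -
    have "xs ! c \<in> G'" using that nth_mem[of c xs] unfolding xs by simp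
    then obtain x i where "x \<in> G" "xs ! c = B.cmp x i" unfolding G'_def by auto
    moreover from this(1) have "B.cmp x i \<in> B i" using G(2) PN by (intro B.comp_props(1)) auto
    ultimately show ?thesis by auto
  qed
  then obtain d where d: "\<And>c. c \<in> ?I \<Longrightarrow> xs ! c \<in> B (d c)" by metis
  have gP: "xs ! c \<in> P" if "c \<in> ?I" for c using that nth_mem[of c xs] G'P unfolding xs by auto
  have gN: "xs ! c \<in> carrier N" if "c \<in> ?I" for c using gP[OF that] PN by blast
  interpret e: mod_hom R "free_module R ?I" N "ev N ?I ((!) xs)"
    by (rule N.ev_hom) (use gN in auto)
  have "ev N ?I ((!) xs) ` carrier (free_module R ?I) = P"
  proof
    show "ev N ?I ((!) xs) ` carrier (free_module R ?I) \<subseteq> P"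
    proof (rule image_subsetI)
      fix f assume f: "f \<in> carrier (free_module R ?I)"
      have sm: "a \<odot> x \<in> P" if "a \<in> carrier R" "x \<in> P" for a x using P that by (auto simp: submodule_def)
      show "ev N ?I ((!) xs) f \<in> P" unfolding ev_def
        by (rule N.submodule_finsum_closed[OF P sm[OF _ gP]]) (use f in \<open>auto simp: free_carrier_iff\<close>)
    qed
    have sub: "submodule R (ev N ?I ((!) xs) ` carrier (free_module R ?I)) N"
      using e.im_is_submodule unfolding e.im_def .
    have "G' \<subseteq> ev N ?I ((!) xs) ` carrier (free_module R ?I)"
    proof
      fix x assume "x \<in> G'"
      then obtain c where c: "c \<in> ?I" "xs ! c = x" unfolding xs[symmetric] by (auto simp: in_set_conv_nth)
      have "ev N ?I ((!) xs) (uvec R c) = x" using N.ev_uvec[of ?I "(!) xs" c] gN c by auto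
      then show "x \<in> ev N ?I ((!) xs) ` carrier (free_module R ?I)" using N.uvec_carrier[OF c(1)] by blast
    qed
    then have "B.cmp x i \<in> ev N ?I ((!) xs) ` carrier (free_module R ?I)" if "x \<in> G" "i < n x" for x i
      using that unfolding G'_def by blast
    then have "(\<Oplus>i\<in>{..<n x}. B.cmp x i) \<in> ev N ?I ((!) xs) ` carrier (free_module R ?I)" if "x \<in> G" for x
      using that by (intro N.submodule_finsum_closed[OF sub]) auto
    then have "G \<subseteq> ev N ?I ((!) xs) ` carrier (free_module R ?I)" using n by (metis subsetI)
    then show "P \<subseteq> ev N ?I ((!) xs) ` carrier (free_module R ?I)" by (rule G(3)[OF sub])
  qed
  then show ?thesis using d by (intro exI[of _ ?I] exI[of _ d] exI[of _ "(!) xs"]) simp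
qed

text \<open>\<open>ev\<close> respects degrees and therefore commutes with taking components, so its
  kernel can be covered by homogeneous generators in turn.\<close>

lemma ev_kernel:
  assumes I: "finite I" and g: "\<And>c. c \<in> I \<Longrightarrow> g c \<in> B (d c)"
  defines "Z \<equiv> {x \<in> carrier (free_module R I). ev N I g x = \<zero>}"
  shows "submodule R Z (free_module R I)"
    and "x \<in> Z \<Longrightarrow> component (free_module R I) (free_grading R A I d) x i \<in> Z"
proof -
  have gN: "\<And>c. c \<in> I \<Longrightarrow> g c \<in> carrier N" using g B.A_carrier by blast
  interpret e: mod_hom R "free_module R I" N "ev N I g"
    by (rule N.ev_hom) (use I gN in auto)
  show "submodule R Z (free_module R I)" using e.ker_is_submodule unfolding e.ker_def Z_def .
  interpret F: graded_mod R A "free_module R I" "free_grading R A I d" by (rule free_graded)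
  show "component (free_module R I) (free_grading R A I d) x i \<in> Z" if x: "x \<in> Z"
  proof -
    have xc: "x \<in> carrier (free_module R I)" using x by (simp add: Z_def)
    have "B.cmp (ev N I g x) i = ev N I g (F.B.cmp x i)"
      by (rule comp_map[OF F.B.igrading_axioms B.igrading_axioms])
        (use ev_grading[OF g] xc e.f_im in \<open>auto simp del: free_simps\<close>)
    then show ?thesis using x xc by (simp add: Z_def del: free_simps)
  qed
qed

end

text \<open>A resolution recorded by the images of its basis vectors instead of its maps:
  \<open>g0\<close> and \<open>g\<close> are the columns of the matrices, from which ranks, degrees
  and matrix entries can be read off.\<close>

definition finite_res where
  "finite_res R A N B I d g0 g \<longleftrightarrow>
     (\<forall>i. finite (I i)) \<and> (\<forall>c\<in>I 0. g0 c \<in> B (d 0 c)) \<and>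
     (\<forall>i. \<forall>c\<in>I (Suc i). g i c \<in> free_grading R A (I i) (d i) (d (Suc i) c)) \<and>
     ev N (I 0) g0 ` carrier (free_module R (I 0)) = carrier N \<and>
     {x \<in> carrier (free_module R (I 0)). ev N (I 0) g0 x = \<zero>\<^bsub>N\<^esub>} =
       ev (free_module R (I 0)) (I 1) (g 0) ` carrier (free_module R (I 1)) \<and>
     (\<forall>i. {x \<in> carrier (free_module R (I (Suc i))). ev (free_module R (I i)) (I (Suc i)) (g i) x = \<zero>\<^bsub>free_module R (I i)\<^esub>} =
       ev (free_module R (I (Suc i))) (I (Suc (Suc i))) (g (Suc i)) ` carrier (free_module R (I (Suc (Suc i)))))"

lemma (in graded_mod) finite_res_exists:
  assumes std: "standard_graded_algebra R A" and fg: "finitely_generated R N"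
  shows "\<exists>I d g0 g. finite_res R A N B I d g0 g"
proof -
  define good where "good = (\<lambda>(I, d, Z, g :: nat \<Rightarrow> nat \<Rightarrow> 'a). finite I \<and> submodule R Z (free_module R I) \<and>
    (\<forall>x\<in>Z. \<forall>i. component (free_module R I) (free_grading R A I d) x i \<in> Z))"
  \<comment> \<open>A state carries a free module, the homogeneous kernel \<open>Z\<close> still to
    be covered and the map that led to it. One step covers \<open>Z\<close> by a new free module and
    records the kernel of the covering map.\<close>
  define rel where "rel = (\<lambda>(I :: nat set, d :: nat \<Rightarrow> nat, Z :: (nat \<Rightarrow> 'a) set, g :: nat \<Rightarrow> nat \<Rightarrow> 'a) (I', d', Z', g').
    (\<forall>c\<in>I'. g' c \<in> free_grading R A I d (d' c)) \<and> ev (free_module R I) I' g' ` carrier (free_module R I') = Z \<and>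
    Z' = {x \<in> carrier (free_module R I'). ev (free_module R I) I' g' x = \<zero>\<^bsub>free_module R I\<^esub>})"
  have step: "\<exists>y. good y \<and> rel x y" if "good x" for x
  proof -
    obtain I d Z g where x: "x = (I, d, Z, g)" by (cases x)
    have *: "finite I" "submodule R Z (free_module R I)"
      "\<And>z i. z \<in> Z \<Longrightarrow> component (free_module R I) (free_grading R A I d) z i \<in> Z"
      using that by (auto simp: good_def x)
    interpret F: graded_mod R A "free_module R I" "free_grading R A I d" by (rule free_graded)
    obtain I' d' g' where g': "finite I'" "\<forall>c\<in>I'. g' c \<in> free_grading R A I d (d' c)"
      "ev (free_module R I) I' g' ` carrier (free_module R I') = Z"
      using F.homog_submodule_cover[OF std free_finitely_generated[OF R_cring *(1)] *(2,3)] by blast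
    let ?Z = "{x \<in> carrier (free_module R I'). ev (free_module R I) I' g' x = \<zero>\<^bsub>free_module R I\<^esub>}"
    have "good (I', d', ?Z, g')"
      using F.ev_kernel[OF g'(1), of g' d'] g'(1,2) by (simp add: good_def)
    moreover have "rel x (I', d', ?Z, g')" using g' by (simp add: rel_def x)
    ultimately show ?thesis by blast
  qed
  obtain I0 d0 g0 where g0: "finite I0" "\<forall>c\<in>I0. g0 c \<in> B (d0 c)"
    "ev N I0 g0 ` carrier (free_module R I0) = carrier N"
    using homog_submodule_cover[OF std fg N.submodule_carrier B.comp_carrier] by blast
  let ?Z = "{x \<in> carrier (free_module R I0). ev N I0 g0 x = \<zero>}"
  define x0 where "x0 = (I0, d0, ?Z, (\<lambda>_ _. undefined) :: nat \<Rightarrow> nat \<Rightarrow> 'a)"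
  have good0: "good x0" using ev_kernel[OF g0(1), of g0 d0] g0(1,2) by (simp add: good_def x0_def)
  have "\<exists>s. \<forall>n. (good (s n) \<and> (n = 0 \<longrightarrow> s n = x0)) \<and> rel (s n) (s (Suc n))"
  proof (rule dependent_nat_choice)
    show "\<exists>x. good x \<and> ((0 :: nat) = 0 \<longrightarrow> x = x0)" using good0 by blast
    fix x and n :: nat assume "good x \<and> (n = 0 \<longrightarrow> x = x0)"
    then obtain y where "good y \<and> rel x y" using step by blast
    then show "\<exists>y. (good y \<and> (Suc n = 0 \<longrightarrow> y = x0)) \<and> rel x y" by (intro exI[of _ y]) simp
  qed
  then obtain s where s: "\<And>n. good (s n)" "s 0 = x0" "\<And>n. rel (s n) (s (Suc n))" by blast
  define I where "I n = fst (s n)" for n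
  define d where "d n = fst (snd (s n))" for n
  define Z where "Z n = fst (snd (snd (s n)))" for n
  \<comment> \<open>The map into the \<open>n\<close>-th module is stored in the state of its
    source, hence the shifted index.\<close>
  define g where "g n = snd (snd (snd (s (Suc n))))" for n
  have good: "finite (I n)" for n using s(1)[of n] by (auto simp: good_def I_def split: prod.splits)
  have rel: "(\<forall>c\<in>I (Suc n). g n c \<in> free_grading R A (I n) (d n) (d (Suc n) c)) \<and>
    ev (free_module R (I n)) (I (Suc n)) (g n) ` carrier (free_module R (I (Suc n))) = Z n \<and>
    Z (Suc n) = {x \<in> carrier (free_module R (I (Suc n))). ev (free_module R (I n)) (I (Suc n)) (g n) x = \<zero>\<^bsub>free_module R (I n)\<^esub>}" for n
    using s(3)[of n] unfolding rel_def I_def d_def Z_def g_def by (simp add: case_prod_beta)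
  have 0: "I 0 = I0" "d 0 = d0" "Z 0 = ?Z" by (simp_all add: I_def d_def Z_def s(2) x0_def)
  have "finite_res R A N B I d g0 g"
    unfolding finite_res_def
  proof (intro conjI allI)
    show "\<forall>c\<in>I 0. g0 c \<in> B (d 0 c)" using g0 0 by simp
    show "ev N (I 0) g0 ` carrier (free_module R (I 0)) = carrier N" using g0 0 by simp
    show "{x \<in> carrier (free_module R (I 0)). ev N (I 0) g0 x = \<zero>} =
       ev (free_module R (I 0)) (I 1) (g 0) ` carrier (free_module R (I 1))"
      using rel[of 0] 0 by simp
    fix i
    show "finite (I i)" by (rule good)
    show "\<forall>c\<in>I (Suc i). g i c \<in> free_grading R A (I i) (d i) (d (Suc i) c)" using rel[of i] by blast
    show "{x \<in> carrier (free_module R (I (Suc i))). ev (free_module R (I i)) (I (Suc i)) (g i) x = \<zero>\<^bsub>free_module R (I i)\<^esub>} =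
       ev (free_module R (I (Suc i))) (I (Suc (Suc i))) (g (Suc i)) ` carrier (free_module R (I (Suc (Suc i))))"
      using rel[of i] rel[of "Suc i"] by simp
  qed
  then show ?thesis by blast
qed

lemma finite_resD:
  assumes "finite_res R A N B I d g0 g"
  shows "finite (I i)" "c \<in> I 0 \<Longrightarrow> g0 c \<in> B (d 0 c)"
    "c \<in> I (Suc i) \<Longrightarrow> g i c \<in> free_grading R A (I i) (d i) (d (Suc i) c)"
    "ev N (I 0) g0 ` carrier (free_module R (I 0)) = carrier N"
    "{x \<in> carrier (free_module R (I 0)). ev N (I 0) g0 x = \<zero>\<^bsub>N\<^esub>} =
       ev (free_module R (I 0)) (I 1) (g 0) ` carrier (free_module R (I 1))"
    "{x \<in> carrier (free_module R (I (Suc i))). ev (free_module R (I i)) (I (Suc i)) (g i) x = \<zero>\<^bsub>free_module R (I i)\<^esub>} =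
       ev (free_module R (I (Suc i))) (I (Suc (Suc i))) (g (Suc i)) ` carrier (free_module R (I (Suc (Suc i))))"
proof -
  show "finite (I i)" by (rule assms[unfolded finite_res_def, THEN conjunct1, rule_format])
  show "g0 c \<in> B (d 0 c)" if "c \<in> I 0" by (rule assms[unfolded finite_res_def, THEN conjunct2, THEN conjunct1, rule_format, OF that])
  show "g i c \<in> free_grading R A (I i) (d i) (d (Suc i) c)" if "c \<in> I (Suc i)" by (rule assms[unfolded finite_res_def, THEN conjunct2, THEN conjunct2, THEN conjunct1, rule_format, OF that])
  show "ev N (I 0) g0 ` carrier (free_module R (I 0)) = carrier N" by (rule assms[unfolded finite_res_def, THEN conjunct2, THEN conjunct2, THEN conjunct2, THEN conjunct1])
  show "{x \<in> carrier (free_module R (I 0)). ev N (I 0) g0 x = \<zero>\<^bsub>N\<^esub>} =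
       ev (free_module R (I 0)) (I 1) (g 0) ` carrier (free_module R (I 1))" by (rule assms[unfolded finite_res_def, THEN conjunct2, THEN conjunct2, THEN conjunct2, THEN conjunct2, THEN conjunct1])
  show "{x \<in> carrier (free_module R (I (Suc i))). ev (free_module R (I i)) (I (Suc i)) (g i) x = \<zero>\<^bsub>free_module R (I i)\<^esub>} =
       ev (free_module R (I (Suc i))) (I (Suc (Suc i))) (g (Suc i)) ` carrier (free_module R (I (Suc (Suc i))))"
    by (rule assms[unfolded finite_res_def, THEN conjunct2, THEN conjunct2, THEN conjunct2, THEN conjunct2, THEN conjunct2, THEN spec])
qed

lemma (in graded_mod) finite_res_resolution:
  assumes "finite_res R A N B I d g0 g"
  shows "graded_free_resolution R A N B
    \<lparr>fr_index = I, fr_shift = d, fr_diff = \<lambda>i. ev (free_module R (I i)) (I (Suc i)) (g i), fr_aug = ev N (I 0) g0\<rparr>"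
proof -
  note r = finite_resD[OF assms]
  have m: "mod_hom R (free_module R (I (Suc i))) (free_module R (I i)) (ev (free_module R (I i)) (I (Suc i)) (g i))" for i
  proof -
    interpret F: graded_mod R A "free_module R (I i)" "free_grading R A (I i) (d i)" by (rule free_graded)
    show ?thesis by (rule F.N.ev_hom[OF r(1)]) (rule F.B.A_carrier[OF r(3)])
  qed
  have m0: "mod_hom R (free_module R (I 0)) N (ev N (I 0) g0)"
    by (rule N.ev_hom[OF r(1)]) (rule B.A_carrier[OF r(2)])
  have g: "ev (free_module R (I i)) (I (Suc i)) (g i) ` free_grading R A (I (Suc i)) (d (Suc i)) j
      \<subseteq> free_grading R A (I i) (d i) j" for i j
  proof -
    interpret F: graded_mod R A "free_module R (I i)" "free_grading R A (I i) (d i)" by (rule free_graded)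
    show ?thesis by (rule image_subsetI) (rule F.ev_grading[OF r(3)])
  qed
  have g0: "ev N (I 0) g0 ` free_grading R A (I 0) (d 0) j \<subseteq> B j" for j
    by (rule image_subsetI) (rule ev_grading[OF r(2)])
  show ?thesis unfolding graded_free_resolution_def free_res.simps
    by (intro conjI allI m m0 g g0 r(4,6)) (simp only: One_nat_def r(5)[unfolded One_nat_def])
qed

section \<open>The staircase in a double complex\<close>

text \<open>A first-quadrant double complex with rows exact at \<open>a > 0\<close> and columns
  exact at \<open>b > 0\<close>. All terms are subspaces of one ambient space, so that elements at
  different positions can be related without changing the space.\<close>

locale dcx = vectorspace K V for K :: "('k, 'x) ring_scheme" and V :: "('k, 'v, 'y) module_scheme" (structure) +
  fixes G :: "nat \<Rightarrow> nat \<Rightarrow> 'v set" and hd vd :: "nat \<Rightarrow> nat \<Rightarrow> 'v \<Rightarrow> 'v"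
  assumes G: "submodule K (G a b) V"
    and hd_in: "w \<in> G (Suc a) b \<Longrightarrow> hd a b w \<in> G a b"
    and hd_add: "w \<in> G (Suc a) b \<Longrightarrow> w' \<in> G (Suc a) b \<Longrightarrow> hd a b (w \<oplus> w') = hd a b w \<oplus> hd a b w'"
    and hd_smult: "x \<in> carrier K \<Longrightarrow> w \<in> G (Suc a) b \<Longrightarrow> hd a b (x \<odot> w) = x \<odot> hd a b w"
    and vd_in: "w \<in> G a (Suc b) \<Longrightarrow> vd a b w \<in> G a b"
    and vd_add: "w \<in> G a (Suc b) \<Longrightarrow> w' \<in> G a (Suc b) \<Longrightarrow> vd a b (w \<oplus> w') = vd a b w \<oplus> vd a b w'"
    and vd_smult: "x \<in> carrier K \<Longrightarrow> w \<in> G a (Suc b) \<Longrightarrow> vd a b (x \<odot> w) = x \<odot> vd a b w"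
    and comm: "w \<in> G (Suc a) (Suc b) \<Longrightarrow> hd a b (vd (Suc a) b w) = vd a b (hd a (Suc b) w)"
    and hh: "w \<in> G (Suc (Suc a)) b \<Longrightarrow> hd a b (hd (Suc a) b w) = \<zero>"
    and vv: "w \<in> G a (Suc (Suc b)) \<Longrightarrow> vd a b (vd a (Suc b) w) = \<zero>"
    and hexact: "w \<in> G (Suc a) b \<Longrightarrow> hd a b w = \<zero> \<Longrightarrow> \<exists>t\<in>G (Suc (Suc a)) b. hd (Suc a) b t = w"
    and vexact: "w \<in> G a (Suc b) \<Longrightarrow> vd a b w = \<zero> \<Longrightarrow> \<exists>t\<in>G a (Suc (Suc b)). vd a (Suc b) t = w"
begin

text \<open>The quotients \<open>Zc a b / Bd a b\<close> are all isomorphic along a diagonal, through the relation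
  \<open>hd w = vd w'\<close>; at the two ends of the diagonal they compute the homology of the quotients of
  \<open>G i 0\<close> by vertical and of \<open>G 0 i\<close> by horizontal boundaries.\<close>

definition "imh a b = hd a b ` G (Suc a) b"
definition "imv a b = vd a b ` G a (Suc b)"
definition "Zc a b = {w \<in> G a b. (\<forall>a'. a = Suc a' \<longrightarrow> hd a' b w \<in> imv a' b) \<and> (\<forall>b'. b = Suc b' \<longrightarrow> vd a b' w \<in> imh a b')}"
definition "Bd a b = {hd a b t \<oplus> vd a b s | t s. t \<in> G (Suc a) b \<and> s \<in> G a (Suc b)}"

lemma GD: "\<zero> \<in> G a b" "x \<in> G a b \<Longrightarrow> y \<in> G a b \<Longrightarrow> x \<oplus> y \<in> G a b" "x \<in> G a b \<Longrightarrow> x \<in> carrier V"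
  "c \<in> carrier K \<Longrightarrow> x \<in> G a b \<Longrightarrow> c \<odot> x \<in> G a b"
  using G[of a b] by (auto simp: submodule_def)

lemma G_minus: "x \<in> G a b \<Longrightarrow> \<ominus> x \<in> G a b" by (rule submodule_minus_closed[OF G])

lemma G_diff: "x \<in> G a b \<Longrightarrow> y \<in> G a b \<Longrightarrow> x \<ominus> y \<in> G a b" by (rule submodule_diff_closed[OF G])

lemma minus_eq: "x \<in> carrier V \<Longrightarrow> \<ominus> x = (\<ominus>\<^bsub>K\<^esub> \<one>\<^bsub>K\<^esub>) \<odot> x"
  by (simp add: smult_l_minus)

lemma vd_diff:
  assumes "w \<in> G a (Suc b)" "w' \<in> G a (Suc b)" shows "vd a b (w \<ominus> w') = vd a b w \<ominus> vd a b w'"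
  using vd_add[OF assms(1) G_minus[OF assms(2)]] vd_smult[OF _ assms(2), of "\<ominus>\<^bsub>K\<^esub> \<one>\<^bsub>K\<^esub>"]
    minus_eq[OF GD(3)[OF assms(2)]] minus_eq[OF GD(3)[OF vd_in[OF assms(2)]]] by (simp add: a_minus_def)

lemma hd_zero: "hd a b \<zero> = \<zero>"
  using hd_smult[OF _ GD(1), of "\<zero>\<^bsub>K\<^esub>" a b] GD(3)[OF hd_in[OF GD(1)]] by simp

lemma vd_zero: "vd a b \<zero> = \<zero>"
  using vd_smult[OF _ GD(1), of "\<zero>\<^bsub>K\<^esub>" a b] GD(3)[OF vd_in[OF GD(1)]] by simp

text \<open>Interchanging rows and columns is a symmetry of the assumptions; each half of the
  argument below is proved once and transferred.\<close>

lemma flip: "dcx K V (\<lambda>a b. G b a) (\<lambda>a b. vd b a) (\<lambda>a b. hd b a)"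
  by (intro dcx.intro dcx_axioms.intro vectorspace_axioms)
    (fact G hd_in hd_add hd_smult vd_in vd_add vd_smult comm[symmetric] hh vv hexact vexact)+

lemma imh_submodule: "submodule K (imh a b) V"
  unfolding submodule_def imh_def
proof (intro conjI allI impI)
  show "\<zero> \<in> hd a b ` G (Suc a) b" using imageI[OF GD(1)[of "Suc a" b], of "hd a b"] by (simp add: hd_zero)
  fix x y assume "x \<in> hd a b ` G (Suc a) b" "y \<in> hd a b ` G (Suc a) b"
  then obtain u u' where *: "u \<in> G (Suc a) b" "u' \<in> G (Suc a) b" "x = hd a b u" "y = hd a b u'" by blast
  then have "x \<oplus> y = hd a b (u \<oplus> u')" by (simp add: hd_add)
  then show "x \<oplus> y \<in> hd a b ` G (Suc a) b" using GD(2)[OF *(1,2)] by blast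
next
  fix c x assume c: "c \<in> carrier K" and "x \<in> hd a b ` G (Suc a) b"
  then obtain u where *: "u \<in> G (Suc a) b" "x = hd a b u" by blast
  then have "c \<odot> x = hd a b (c \<odot> u)" using c by (simp add: hd_smult)
  then show "c \<odot> x \<in> hd a b ` G (Suc a) b" using GD(4)[OF c *(1)] by blast
next
  show "hd a b ` G (Suc a) b \<subseteq> carrier V" using hd_in GD(3) by blast
qed (rule module_axioms)

lemma imv_submodule: "submodule K (imv a b) V"
  using dcx.imh_submodule[OF flip, of b a] unfolding dcx.imh_def[OF flip] imv_def .

lemma im_closed:
  "\<zero> \<in> imh a b" "x \<in> imh a b \<Longrightarrow> y \<in> imh a b \<Longrightarrow> x \<oplus> y \<in> imh a b"
  "c \<in> carrier K \<Longrightarrow> x \<in> imh a b \<Longrightarrow> c \<odot> x \<in> imh a b"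
  "\<zero> \<in> imv a b" "x \<in> imv a b \<Longrightarrow> y \<in> imv a b \<Longrightarrow> x \<oplus> y \<in> imv a b"
  "c \<in> carrier K \<Longrightarrow> x \<in> imv a b \<Longrightarrow> c \<odot> x \<in> imv a b"
  using imh_submodule[of a b] imv_submodule[of a b] by (simp_all add: submodule_def)

lemma Zc_submodule: "submodule K (Zc a b) V"
  unfolding submodule_def
proof (intro conjI allI impI)
  show "Zc a b \<subseteq> carrier V" by (auto simp: Zc_def GD(3))
  show "\<zero> \<in> Zc a b" by (simp add: Zc_def GD(1) hd_zero vd_zero im_closed)
  show "x \<oplus> y \<in> Zc a b" if "x \<in> Zc a b" "y \<in> Zc a b" for x y
    using that by (auto simp: Zc_def GD(2) hd_add vd_add im_closed)
  show "c \<odot> x \<in> Zc a b" if "c \<in> carrier K" "x \<in> Zc a b" for c x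
    using that by (auto simp: Zc_def GD(4) hd_smult vd_smult im_closed)
qed (rule module_axioms)

lemma Bd_submodule: "submodule K (Bd a b) V"
proof -
  have "Bd a b = imh a b <+> imv a b" unfolding Bd_def imh_def imv_def set_eq_iff set_add_iff mem_Collect_eq by blast
  then show ?thesis using submodule_set_add[OF imh_submodule imv_submodule] by simp
qed

lemma Bd_half:
  assumes t: "t \<in> G (Suc (Suc a)) b" and s: "s \<in> G (Suc a) (Suc b)"
  shows "hd a b (hd (Suc a) b t \<oplus> vd (Suc a) b s) = vd a b (hd a (Suc b) s)"
  using t s GD(3)[OF vd_in[OF hd_in[OF s]]] by (simp add: hd_add hd_in vd_in hh comm)

lemma Bd_Zc_half: "w \<in> Bd a b \<Longrightarrow> w \<in> G a b \<and> (\<forall>a'. a = Suc a' \<longrightarrow> hd a' b w \<in> imv a' b)"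
  by (auto simp: Bd_def imv_def Bd_half GD hd_in vd_in)

lemma flip_Bd: "dcx.Bd V (\<lambda>a b. G b a) (\<lambda>a b. vd b a) (\<lambda>a b. hd b a) b a = Bd a b"
proof (rule Set.set_eqI)
  have *: "vd a b s \<oplus> hd a b t = hd a b t \<oplus> vd a b s" if "t \<in> G (Suc a) b" "s \<in> G a (Suc b)" for t s
    using GD(3)[OF hd_in[OF that(1)]] GD(3)[OF vd_in[OF that(2)]] by (rule M.a_comm[rotated])
  show "w \<in> dcx.Bd V (\<lambda>a b. G b a) (\<lambda>a b. vd b a) (\<lambda>a b. hd b a) b a \<longleftrightarrow> w \<in> Bd a b" for w
    unfolding dcx.Bd_def[OF flip] Bd_def mem_Collect_eq
  proof
    assume "\<exists>t s. w = vd a b t \<oplus> hd a b s \<and> t \<in> G a (Suc b) \<and> s \<in> G (Suc a) b"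
    then obtain t s where "w = vd a b t \<oplus> hd a b s" "t \<in> G a (Suc b)" "s \<in> G (Suc a) b" by (elim exE conjE)
    then show "\<exists>t s. w = hd a b t \<oplus> vd a b s \<and> t \<in> G (Suc a) b \<and> s \<in> G a (Suc b)"
      using *[of s t] by (intro exI[of _ s] exI[of _ t]) simp
  next
    assume "\<exists>t s. w = hd a b t \<oplus> vd a b s \<and> t \<in> G (Suc a) b \<and> s \<in> G a (Suc b)"
    then obtain t s where "w = hd a b t \<oplus> vd a b s" "t \<in> G (Suc a) b" "s \<in> G a (Suc b)" by (elim exE conjE)
    then show "\<exists>t s. w = vd a b t \<oplus> hd a b s \<and> t \<in> G a (Suc b) \<and> s \<in> G (Suc a) b"
      using *[of t s] by (intro exI[of _ s] exI[of _ t]) simp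
  qed
qed

lemma flip_Zc: "dcx.Zc (\<lambda>a b. G b a) (\<lambda>a b. vd b a) (\<lambda>a b. hd b a) b a = Zc a b"
  unfolding dcx.Zc_def[OF flip] dcx.imh_def[OF flip] dcx.imv_def[OF flip] Zc_def imh_def imv_def by auto

lemma Bd_subset: "Bd a b \<subseteq> Zc a b"
proof
  fix w assume w: "w \<in> Bd a b"
  have "(\<forall>b'. b = Suc b' \<longrightarrow> vd a b' w \<in> imh a b')"
    using dcx.Bd_Zc_half[OF flip, of w b a] w unfolding flip_Bd dcx.imv_def[OF flip] imh_def by blast
  then show "w \<in> Zc a b" using Bd_Zc_half[OF w] unfolding Zc_def by blast
qed

text \<open>A vertical preimage \<open>w'\<close> of \<open>hd w\<close> exists by the definition of
  \<open>Zc\<close>. Its horizontal image is a vertical cycle, as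
  \<open>vd (hd w') = hd (vd w') = hd (hd w) = 0\<close>, hence a vertical boundary by column
  exactness.\<close>

lemma step_ex:
  assumes w: "w \<in> Zc (Suc a) b"
  shows "\<exists>w'\<in>Zc a (Suc b). hd a b w = vd a b w'"
proof -
  have wG: "w \<in> G (Suc a) b" using w by (simp add: Zc_def)
  have "hd a b w \<in> imv a b" using w by (simp add: Zc_def)
  then obtain w' where w': "w' \<in> G a (Suc b)" "hd a b w = vd a b w'" by (auto simp: imv_def)
  have "hd a' (Suc b) w' \<in> imv a' (Suc b)" if a: "a = Suc a'" for a'
  proof -
    have "vd a' b (hd a' (Suc b) w') = \<zero>"
      using comm[of w' a' b] w' hh[of w a' b] wG by (simp add: a)
    moreover have "hd a' (Suc b) w' \<in> G a' (Suc b)" using hd_in[of w' a' "Suc b"] w' a by simp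
    ultimately obtain t where "t \<in> G a' (Suc (Suc b))" "vd a' (Suc b) t = hd a' (Suc b) w'"
      using vexact by blast
    then show ?thesis unfolding imv_def by (metis image_eqI)
  qed
  moreover have "vd a b w' \<in> imh a b" unfolding imh_def w'(2)[symmetric] using wG by blast
  ultimately have "w' \<in> Zc a (Suc b)" using w' by (simp add: Zc_def)
  then show ?thesis using w'(2) by blast
qed

text \<open>For \<open>w = hd t + vd s\<close> the elements \<open>w'\<close> and
  \<open>hd s\<close> have the same vertical image, so they differ by a vertical boundary.\<close>

lemma step_Bd:
  assumes w: "w \<in> Bd (Suc a) b" and w': "w' \<in> G a (Suc b)" and eq: "hd a b w = vd a b w'"
  shows "w' \<in> Bd a (Suc b)"
proof -
  obtain t s where ts: "t \<in> G (Suc (Suc a)) b" "s \<in> G (Suc a) (Suc b)" "w = hd (Suc a) b t \<oplus> vd (Suc a) b s"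
    using w by (auto simp: Bd_def)
  let ?h = "hd a (Suc b) s"
  have h: "?h \<in> G a (Suc b)" using ts by (intro hd_in)
  have "vd a b w' = vd a b ?h" using Bd_half[OF ts(1,2)] eq ts(3) by simp
  then have "vd a b (w' \<ominus> ?h) = \<zero>" using vd_diff[OF w' h] GD(3)[OF vd_in[OF h]] by (simp add: a_minus_def M.r_neg)
  then obtain r where r: "r \<in> G a (Suc (Suc b))" "vd a (Suc b) r = w' \<ominus> ?h"
    using vexact[OF G_diff[OF w' h]] by blast
  have "w' = ?h \<oplus> vd a (Suc b) r"
    unfolding r(2) using GD(3)[OF w'] GD(3)[OF h] by (metis M.a_comm M.minus_closed minus_add_cancel)
  then show ?thesis unfolding Bd_def using r(1) ts(2) by blast
qed

text \<open>One stair of the diagonal. The reverse direction, from columns to rows, is the same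
  argument seen through \<open>flip\<close>.\<close>

lemma staircase_step:
  "finq K V (Zc (Suc a) b) (Bd (Suc a) b) \<longleftrightarrow> finq K V (Zc a (Suc b)) (Bd a (Suc b))"
  "finq K V (Zc (Suc a) b) (Bd (Suc a) b) \<Longrightarrow>
     dimq K V (Zc (Suc a) b) (Bd (Suc a) b) = dimq K V (Zc a (Suc b)) (Bd a (Suc b))"
proof -
  let ?L = "\<lambda>w w'. w \<in> Zc (Suc a) b \<and> w' \<in> Zc a (Suc b) \<and> hd a b w = vd a b w'"
  have ZG: "w \<in> G a b" if "w \<in> Zc a b" for w a b using that by (simp add: Zc_def)
  note Z1 = Zc_submodule[of "Suc a" b, unfolded submodule_def] and Z2 = Zc_submodule[of a "Suc b", unfolded submodule_def]
  have L: "linrel K V V ?L"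
    unfolding linrel_def using Z1 Z2 by (auto simp: hd_add vd_add hd_smult vd_smult ZG)
  have t1: "\<exists>w'\<in>Zc a (Suc b). ?L w w'" if "w \<in> Zc (Suc a) b" for w using step_ex[OF that] that by blast
  have t2: "\<exists>w\<in>Zc (Suc a) b. ?L w w'" if "w' \<in> Zc a (Suc b)" for w'
  proof -
    have "\<exists>w\<in>Zc (Suc a) b. vd a b w' = hd a b w"
      by (rule dcx.step_ex[OF flip, of w' b a, unfolded flip_Zc, OF that])
    then obtain w where "w \<in> Zc (Suc a) b" "vd a b w' = hd a b w" by blast
    then show ?thesis using that by (intro bexI[of _ w]) simp_all
  qed
  have inj: "w \<in> Bd (Suc a) b \<longleftrightarrow> w' \<in> Bd a (Suc b)" if "?L w w'" for w w'
  proof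
    assume "w \<in> Bd (Suc a) b" then show "w' \<in> Bd a (Suc b)" by (rule step_Bd) (use that ZG in simp_all)
  next
    assume "w' \<in> Bd a (Suc b)"
    then show "w \<in> Bd (Suc a) b" by (rule dcx.step_Bd[OF flip, of w' b a w, unfolded flip_Bd]) (use that ZG in simp_all)
  qed
  show "finq K V (Zc (Suc a) b) (Bd (Suc a) b) \<longleftrightarrow> finq K V (Zc a (Suc b)) (Bd a (Suc b))"
    by (rule dimq_eq(1)[OF vectorspace_axioms Zc_submodule Bd_submodule Bd_subset
        vectorspace_axioms Zc_submodule Bd_submodule Bd_subset L t1 t2 inj])
  show "dimq K V (Zc (Suc a) b) (Bd (Suc a) b) = dimq K V (Zc a (Suc b)) (Bd a (Suc b))"
    if "finq K V (Zc (Suc a) b) (Bd (Suc a) b)"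
    by (rule dimq_eq(2)[OF vectorspace_axioms Zc_submodule Bd_submodule Bd_subset
        vectorspace_axioms Zc_submodule Bd_submodule Bd_subset L t1 t2 inj that])
qed

lemma staircase:
  "(finq K V (Zc i 0) (Bd i 0) \<longleftrightarrow> finq K V (Zc 0 i) (Bd 0 i)) \<and>
   (finq K V (Zc i 0) (Bd i 0) \<longrightarrow> dimq K V (Zc i 0) (Bd i 0) = dimq K V (Zc 0 i) (Bd 0 i))"
proof -
  have "(finq K V (Zc (a + b) 0) (Bd (a + b) 0) \<longleftrightarrow> finq K V (Zc a b) (Bd a b)) \<and>
    (finq K V (Zc (a + b) 0) (Bd (a + b) 0) \<longrightarrow> dimq K V (Zc (a + b) 0) (Bd (a + b) 0) = dimq K V (Zc a b) (Bd a b))" for a b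
  proof (induction b arbitrary: a)
    case (Suc b)
    then show ?case using Suc[of "Suc a"] staircase_step[of a b] by simp
  qed simp
  from this[of 0 i] show ?thesis by simp
qed

end

section \<open>Resolutions of the residue field\<close>

text \<open>\<open>J b\<close> indexes the basis of the \<open>b\<close>-th free module, with weights \<open>e b\<close>, and \<open>\<kappa> b\<close> is the matrix of
  its differential from step \<open>b + 1\<close> to step \<open>b\<close>.\<close>

locale kres = graded_alg R A for R :: "('a, 'x) ring_scheme" (structure) and A +
  fixes J :: "nat \<Rightarrow> nat set" and e :: "nat \<Rightarrow> nat \<Rightarrow> nat" and \<kappa> :: "nat \<Rightarrow> nat \<Rightarrow> nat \<Rightarrow> 'a"
  assumes finJ: "finite (J b)" and J0: "J 0 = {0}" and e0: "e 0 0 = 0"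
    and \<kappa>_Irr: "f \<in> J (Suc 0) \<Longrightarrow> \<kappa> 0 0 f \<in> irrelevant_ideal R A"
    and \<kappa>_hom: "c \<in> J b \<Longrightarrow> f \<in> J (Suc b) \<Longrightarrow>
      if e b c \<le> e (Suc b) f then \<kappa> b c f \<in> A (e (Suc b) f - e b c) else \<kappa> b c f = \<zero>"
    and \<kappa>\<kappa>: "c \<in> J b \<Longrightarrow> f \<in> J (Suc (Suc b)) \<Longrightarrow> (\<Oplus>g\<in>J (Suc b). \<kappa> b c g \<otimes> \<kappa> (Suc b) g f) = \<zero>"
    and \<kappa>_exact: "y \<in> fam_grading (ring_mod R) A (J (Suc b)) (e (Suc b)) j \<Longrightarrow>
      (\<And>c. c \<in> J b \<Longrightarrow> (\<Oplus>f\<in>J (Suc b). \<kappa> b c f \<otimes> y f) = \<zero>) \<Longrightarrow>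
      \<exists>z\<in>fam_grading (ring_mod R) A (J (Suc (Suc b))) (e (Suc (Suc b))) j.
        \<forall>f\<in>J (Suc b). (\<Oplus>g\<in>J (Suc (Suc b)). \<kappa> (Suc b) f g \<otimes> z g) = y f"
    and \<kappa>_onto: "a \<in> A j \<Longrightarrow> 0 < j \<Longrightarrow>
      \<exists>z\<in>fam_grading (ring_mod R) A (J (Suc 0)) (e (Suc 0)) j. (\<Oplus>f\<in>J (Suc 0). \<kappa> 0 0 f \<otimes> z f) = a"
begin

abbreviation "C N B b \<equiv> fam_grading N B (J b) (e b)"
abbreviation "dK N b \<equiv> tmap N (J b) (J (Suc b)) (\<kappa> b)"

lemma \<kappa>_carrier: "c \<in> J b \<Longrightarrow> f \<in> J (Suc b) \<Longrightarrow> \<kappa> b c f \<in> carrier R"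
  using \<kappa>_hom[of c b f] A.A_carrier by (auto split: if_splits)

lemma dK_matrix: "Module.module R N \<Longrightarrow> matrix_map R N (J b) (J (Suc b)) (\<kappa> b)"
  by (intro matrix_map.intro matrix_map_axioms.intro finJ \<kappa>_carrier)

lemma C_carrier: "y \<in> C N B b j \<Longrightarrow> y \<in> carrier (fam N (J b))"
  by (simp add: fam_grading_def)

lemma dK_dK:
  assumes "Module.module R N" "y \<in> carrier (fam N (J (Suc (Suc b))))"
  shows "dK N b (dK N (Suc b) y) = (\<lambda>_. \<zero>\<^bsub>N\<^esub>)"
proof
  fix c
  show "dK N b (dK N (Suc b) y) c = \<zero>\<^bsub>N\<^esub>"
    by (rule tmap_tmap_zero[OF dK_matrix dK_matrix \<kappa>\<kappa>]) (use assms in \<open>auto simp: fam_carrier_iff\<close>)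
qed

lemma dK_grading: "graded_mod R A N B \<Longrightarrow> y \<in> C N B (Suc b) j \<Longrightarrow> dK N b y \<in> C N B b j"
  using graded_mod.tmap_grading[of R A N B "J b" "J (Suc b)" "\<kappa> b" "e b" "e (Suc b)" y j] \<kappa>_hom
    dK_matrix graded_mod.N_module by metis

lemma tmap_free:
  assumes "y \<in> carrier (fam (free_module R I) J')" "c' \<in> J b"
  shows "dK (free_module R I) b y c' c = (\<Oplus>f\<in>J (Suc b). \<kappa> b c' f \<otimes> y f c)"
proof -
  interpret F: Module.module R "free_module R I" by (rule free_module_module[OF R_cring])
  have "\<kappa> b c' f \<odot>\<^bsub>free_module R I\<^esub> y f \<in> carrier (free_module R I)" if "f \<in> J (Suc b)" for f
    using assms \<kappa>_carrier[OF assms(2) that] by (intro F.smult_closed) (auto simp: fam_carrier_iff)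
  then show ?thesis using assms(2) by (simp add: tmap_def finsum_free[OF R_cring] del: free_simps(1,2))
qed

text \<open>A coordinate \<open>c\<close> turns a homogeneous family in the free module into one
  over \<open>R\<close> whose degree is lowered by \<open>d c\<close>. Thus a free module tensored
  with \<open>K\<close> is a sum of shifted copies of \<open>K\<close>.\<close>

lemma free_coord:
  assumes "y \<in> C (free_module R I) (free_grading R A I d) b j"
  shows "c \<in> I \<Longrightarrow> d c \<le> j \<Longrightarrow> (\<lambda>f. y f c) \<in> C (ring_mod R) A b (j - d c)"
    and "\<not> (c \<in> I \<and> d c \<le> j) \<Longrightarrow> y f c = \<zero>"
proof -
  have y: "y f \<in> free_grading R A I d (j - e b f)" if "f \<in> J b" "e b f \<le> j" for f
    using assms that by (auto simp: fam_grading_def)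
  have y0: "y f c = \<zero>" if "\<not> (f \<in> J b \<and> e b f \<le> j)" for f c
    using assms that by (cases "f \<in> J b") (auto simp: fam_grading_def fam_carrier_iff)
  have yc: "y f \<in> carrier (free_module R I)" for f using assms by (simp add: fam_grading_def fam_carrier_iff)
  show "y f c = \<zero>" if "\<not> (c \<in> I \<and> d c \<le> j)" for f
  proof (cases "f \<in> J b \<and> e b f \<le> j \<and> c \<in> I")
    case True
    then show ?thesis using y[of f] that by (auto simp: free_grading_def)
  next
    case False
    then show ?thesis using y0 yc[of f] by (auto simp: free_carrier_iff)
  qed
  assume c: "c \<in> I" "d c \<le> j"
  show "(\<lambda>f. y f c) \<in> C (ring_mod R) A b (j - d c)"
    unfolding fam_grading_def
  proof (intro CollectI conjI ballI)
    have "f \<notin> J b \<longrightarrow> y f c = \<zero>" for f using y0 by blast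
    then show "(\<lambda>f. y f c) \<in> carrier (fam (ring_mod R) (J b))"
      unfolding fam_carrier_finite[OF finJ] using yc by (simp add: free_carrier_iff)
    fix f assume f: "f \<in> J b"
    show "if e b f \<le> j - d c then y f c \<in> A (j - d c - e b f) else y f c = \<zero>\<^bsub>ring_mod R\<^esub>"
    proof (cases "e b f \<le> j")
      case True
      have "if d c \<le> j - e b f then y f c \<in> A (j - e b f - d c) else y f c = \<zero>"
        using y[OF f True] c by (simp add: free_grading_def del: diff_diff_left)
      moreover have "d c \<le> j - e b f \<longleftrightarrow> e b f \<le> j - d c" "j - e b f - d c = j - d c - e b f"
        using c True by auto
      ultimately show ?thesis by (metis ring_mod_simps(2))
    next
      case False
      then show ?thesis using y0[of f] by auto
    qed
  qed
qed

text \<open>The converse of \<open>free_coord\<close>. As \<open>I\<close> may be infinite, finite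
  support has to be imposed jointly over all coordinates to make each \<open>z f\<close> a vector of
  the free module.\<close>

lemma free_coordI:
  assumes c: "\<And>c. c \<in> I \<Longrightarrow> d c \<le> j \<Longrightarrow> (\<lambda>f. z f c) \<in> C (ring_mod R) A b (j - d c)"
    and 0: "\<And>c f. \<not> (c \<in> I \<and> d c \<le> j) \<Longrightarrow> z f c = \<zero>"
    and fin: "finite {c. \<exists>f. z f c \<noteq> \<zero>}"
  shows "z \<in> C (free_module R I) (free_grading R A I d) b j"
proof -
  have zc: "z f c \<in> carrier R" for f c
    using c[of c] 0[of c f] by (cases "c \<in> I \<and> d c \<le> j") (auto simp: fam_grading_def fam_carrier_iff)
  have z0: "z f c = \<zero>" if "f \<notin> J b" for f c
    using c[of c] 0[of c f] that by (cases "c \<in> I \<and> d c \<le> j") (auto simp: fam_grading_def fam_carrier_iff)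
  have zf: "z f \<in> carrier (free_module R I)" for f
    unfolding free_carrier_iff using zc 0 by (auto intro: finite_subset[OF _ fin])
  show ?thesis unfolding fam_grading_def
  proof (intro CollectI conjI ballI)
    show "z \<in> carrier (fam (free_module R I) (J b))"
      unfolding fam_carrier_finite[OF finJ] using zf z0 by (auto simp: fun_eq_iff)
    fix f assume f: "f \<in> J b"
    have *: "if e b f \<le> j - d c then z f c \<in> A (j - d c - e b f) else z f c = \<zero>" if "c \<in> I" "d c \<le> j" for c
      using c[OF that] f by (simp add: fam_grading_def del: diff_diff_left)
    show "if e b f \<le> j then z f \<in> free_grading R A I d (j - e b f) else z f = \<zero>\<^bsub>free_module R I\<^esub>"
    proof (cases "e b f \<le> j")
      case True
      have "if d c \<le> j - e b f then z f c \<in> A (j - e b f - d c) else z f c = \<zero>" if "c \<in> I" for c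
      proof (cases "d c \<le> j")
        case True
        then have "d c \<le> j - e b f \<longleftrightarrow> e b f \<le> j - d c" "j - e b f - d c = j - d c - e b f"
          using \<open>e b f \<le> j\<close> by auto
        then show ?thesis using *[OF that True] by metis
      next
        case False then show ?thesis using 0[of c f] by simp
      qed
      then show ?thesis using True zf by (simp add: free_grading_def del: diff_diff_left)
    next
      case False
      have "z f c = \<zero>" for c
        using *[of c] 0[of c f] False by (cases "c \<in> I \<and> d c \<le> j") auto
      then show ?thesis using False by (simp add: fun_eq_iff)
    qed
  qed
qed

text \<open>Tensoring with a free module keeps \<open>K\<close> exact: the equation is solved
  separately in each coordinate. The index set \<open>I\<close> may be infinite; the solution is
  taken to be zero off the finite set of coordinates where \<open>y\<close> is nonzero, so it has
  finite support.\<close>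

lemma free_exact:
  assumes y: "y \<in> C (free_module R I) (free_grading R A I d) (Suc b) j"
    and 0: "dK (free_module R I) b y = (\<lambda>_. \<zero>\<^bsub>free_module R I\<^esub>)"
  shows "\<exists>z\<in>C (free_module R I) (free_grading R A I d) (Suc (Suc b)) j. dK (free_module R I) (Suc b) z = y"
proof -
  let ?S = "{c. \<exists>f. y f c \<noteq> \<zero>}"
  have yc: "y f \<in> carrier (free_module R I)" for f using y by (simp add: fam_grading_def fam_carrier_iff)
  have y0: "y f = (\<lambda>c. \<zero>)" if "f \<notin> J (Suc b)" for f
    using y that by (simp add: fam_grading_def fam_carrier_iff)
  have "?S \<subseteq> (\<Union>f\<in>J (Suc b). {c. y f c \<noteq> \<zero>})" using y0 by force
  moreover have "finite (\<Union>f\<in>J (Suc b). {c. y f c \<noteq> \<zero>})"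
    using yc by (intro finite_UN_I finJ) (simp add: free_carrier_iff)
  ultimately have finS: "finite ?S" by (rule finite_subset)
  have SI: "c \<in> I \<and> d c \<le> j" if "c \<in> ?S" for c using free_coord(2)[OF y, of c] that by blast
  have "\<forall>c\<in>?S. \<exists>z. z \<in> C (ring_mod R) A (Suc (Suc b)) (j - d c) \<and>
    (\<forall>f\<in>J (Suc b). (\<Oplus>g\<in>J (Suc (Suc b)). \<kappa> (Suc b) f g \<otimes> z g) = y f c)"
  proof
    fix c assume that: "c \<in> ?S"
    have "(\<Oplus>f\<in>J (Suc b). \<kappa> b c' f \<otimes> y f c) = \<zero>" if "c' \<in> J b" for c'
      using tmap_free[OF C_carrier[OF y] that, of c] 0 by simp
    with SI[OF that] have "\<exists>z\<in>C (ring_mod R) A (Suc (Suc b)) (j - d c).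
      \<forall>f\<in>J (Suc b). (\<Oplus>g\<in>J (Suc (Suc b)). \<kappa> (Suc b) f g \<otimes> z g) = y f c"
      by (intro \<kappa>_exact[OF free_coord(1)[OF y]]) blast+
    then show "\<exists>z. z \<in> C (ring_mod R) A (Suc (Suc b)) (j - d c) \<and>
      (\<forall>f\<in>J (Suc b). (\<Oplus>g\<in>J (Suc (Suc b)). \<kappa> (Suc b) f g \<otimes> z g) = y f c)"
      unfolding Bex_def .
  qed
  from bchoice[OF this] obtain z where z0: "\<forall>c\<in>?S. z c \<in> C (ring_mod R) A (Suc (Suc b)) (j - d c) \<and>
    (\<forall>f\<in>J (Suc b). (\<Oplus>g\<in>J (Suc (Suc b)). \<kappa> (Suc b) f g \<otimes> z c g) = y f c)" ..
  note z = z0[THEN bspec, THEN conjunct1] z0[THEN bspec, THEN conjunct2, THEN bspec]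
  define w where "w g c = (if c \<in> ?S then z c g else \<zero>)" for g c
  interpret RM: graded_mod R A "ring_mod R" A
    by (intro graded_mod.intro graded_mod_axioms.intro graded_alg_axioms graded_ring_mod)
  interpret RF: graded_mod R A "fam (ring_mod R) (J (Suc (Suc b)))" "C (ring_mod R) A (Suc (Suc b))"
    by (rule RM.fam_graded)
  have w: "w \<in> C (free_module R I) (free_grading R A I d) (Suc (Suc b)) j"
  proof (rule free_coordI)
    show "(\<lambda>f. w f c) \<in> C (ring_mod R) A (Suc (Suc b)) (j - d c)" if "c \<in> I" "d c \<le> j" for c
      using z(1)[of c] RF.B.A_zero[of "j - d c"] by (cases "c \<in> ?S") (auto simp: w_def[abs_def])
    show "w f c = \<zero>" if "\<not> (c \<in> I \<and> d c \<le> j)" for c f using SI[of c] that by (auto simp: w_def)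
    show "finite {c. \<exists>f. w f c \<noteq> \<zero>}" by (rule finite_subset[OF _ finS]) (auto simp: w_def)
  qed
  have "dK (free_module R I) (Suc b) w = y"
  proof (intro ext)
    fix f c
    show "dK (free_module R I) (Suc b) w f c = y f c"
    proof (cases "f \<in> J (Suc b)")
      case True
      have eq: "dK (free_module R I) (Suc b) w f c = (\<Oplus>g\<in>J (Suc (Suc b)). \<kappa> (Suc b) f g \<otimes> w g c)"
        by (rule tmap_free[OF C_carrier[OF w] True])
      show ?thesis
      proof (cases "c \<in> ?S")
        case S: True
        then have "w g c = z c g" for g unfolding w_def by (rule if_P)
        then show ?thesis using eq z(2)[OF S True] by simp
      next
        case False
        then have "w g c = \<zero>" for g unfolding w_def by (rule if_not_P)
        then have "(\<Oplus>g\<in>J (Suc (Suc b)). \<kappa> (Suc b) f g \<otimes> w g c) = \<zero>"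
          using \<kappa>_carrier[OF True] by (intro R.add.finprod_one_eqI) simp
        then show ?thesis using eq False by simp
      qed
    next
      case False
      then show ?thesis using y0[OF False] by (simp add: tmap_def)
    qed
  qed
  then show ?thesis using w by blast
qed

lemma irrelevant_iff:
  assumes "a \<in> A j" shows "a \<in> irrelevant_ideal R A \<longleftrightarrow> 0 < j \<or> a = \<zero>"
  using assms A.comp_homog[OF assms, of 0] A.A_carrier[OF assms] by (auto simp: irrelevant_ideal_def)

text \<open>Nonzero homogeneous coordinates in the irrelevant ideal have positive degree, so
  \<open>\<kappa>_onto\<close> applies to each of them. This identifies the cokernel of the last
  differential of \<open>F \<otimes> K\<close> with \<open>F\<close> modulo the irrelevant
  ideal.\<close>

lemma free_onto:
  assumes x: "x \<in> free_grading R A I d j" and m: "\<And>c. x c \<in> irrelevant_ideal R A"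
  shows "\<exists>z\<in>C (free_module R I) (free_grading R A I d) (Suc 0) j. dK (free_module R I) 0 z = (\<lambda>c. if c = 0 then x else (\<lambda>_. \<zero>))"
proof -
  have xc: "x \<in> carrier (free_module R I)" using x by (simp add: free_grading_def)
  let ?S = "{c. x c \<noteq> \<zero>}"
  have finS: "finite ?S" using xc by (simp add: free_carrier_iff)
  have SI: "c \<in> I \<and> d c < j \<and> x c \<in> A (j - d c)" if c: "c \<in> ?S" for c
  proof -
    have "c \<in> I" using c xc by (auto simp: free_carrier_iff)
    then have 1: "d c \<le> j \<and> x c \<in> A (j - d c)" using x c by (auto simp: free_grading_def split: if_splits)
    then have "0 < j - d c" using irrelevant_iff[of "x c" "j - d c"] m[of c] c by auto
    then show ?thesis using 1 \<open>c \<in> I\<close> by auto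
  qed
  have "\<forall>c\<in>?S. \<exists>z. z \<in> C (ring_mod R) A (Suc 0) (j - d c) \<and> (\<Oplus>g\<in>J (Suc 0). \<kappa> 0 0 g \<otimes> z g) = x c"
  proof
    fix c assume "c \<in> ?S"
    from SI[OF this] have "\<exists>z\<in>C (ring_mod R) A (Suc 0) (j - d c). (\<Oplus>g\<in>J (Suc 0). \<kappa> 0 0 g \<otimes> z g) = x c"
      by (intro \<kappa>_onto) simp_all
    then show "\<exists>z. z \<in> C (ring_mod R) A (Suc 0) (j - d c) \<and> (\<Oplus>g\<in>J (Suc 0). \<kappa> 0 0 g \<otimes> z g) = x c"
      unfolding Bex_def .
  qed
  from bchoice[OF this] obtain z where z0: "\<forall>c\<in>?S. z c \<in> C (ring_mod R) A (Suc 0) (j - d c) \<and>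
    (\<Oplus>g\<in>J (Suc 0). \<kappa> 0 0 g \<otimes> z c g) = x c" ..
  note z = z0[THEN bspec, THEN conjunct1] z0[THEN bspec, THEN conjunct2]
  define w where "w g c = (if c \<in> ?S then z c g else \<zero>)" for g c
  interpret RM: graded_mod R A "ring_mod R" A
    by (intro graded_mod.intro graded_mod_axioms.intro graded_alg_axioms graded_ring_mod)
  interpret RF: graded_mod R A "fam (ring_mod R) (J (Suc 0))" "C (ring_mod R) A (Suc 0)"
    by (rule RM.fam_graded)
  have w: "w \<in> C (free_module R I) (free_grading R A I d) (Suc 0) j"
  proof (rule free_coordI)
    show "(\<lambda>f. w f c) \<in> C (ring_mod R) A (Suc 0) (j - d c)" if "c \<in> I" "d c \<le> j" for c
      using z(1)[of c] RF.B.A_zero[of "j - d c"] by (cases "c \<in> ?S") (auto simp: w_def[abs_def])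
    show "w f c = \<zero>" if "\<not> (c \<in> I \<and> d c \<le> j)" for c f using SI[of c] that by (auto simp: w_def)
    show "finite {c. \<exists>f. w f c \<noteq> \<zero>}" by (rule finite_subset[OF _ finS]) (auto simp: w_def)
  qed
  have 0: "0 \<in> J 0" by (simp add: J0)
  have "dK (free_module R I) 0 w = (\<lambda>c. if c = 0 then x else (\<lambda>_. \<zero>))"
  proof (intro ext)
    fix f c
    show "dK (free_module R I) 0 w f c = (if f = 0 then x else (\<lambda>_. \<zero>)) c"
    proof (cases "f = 0")
      case True
      have eq: "dK (free_module R I) 0 w 0 c = (\<Oplus>g\<in>J (Suc 0). \<kappa> 0 0 g \<otimes> w g c)"
        by (rule tmap_free[OF C_carrier[OF w] 0])
      show ?thesis
      proof (cases "c \<in> ?S")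
        case S: True
        then have "w g c = z c g" for g unfolding w_def by (rule if_P)
        then show ?thesis using eq z(2)[OF S] True by simp
      next
        case False
        then have "w g c = \<zero>" for g unfolding w_def by (rule if_not_P)
        then have "(\<Oplus>g\<in>J (Suc 0). \<kappa> 0 0 g \<otimes> w g c) = \<zero>"
          using \<kappa>_carrier[OF 0] by (intro R.add.finprod_one_eqI) simp
        then show ?thesis using eq False True by simp
      qed
    qed (simp add: tmap_def J0)
  qed
  then show ?thesis using w by blast
qed

end

section \<open>Computing Tor with a resolution of the residue field\<close>

lemma image_presentation:
  fixes X (structure)
  assumes V: "vectorspace K V" and Z: "submodule K Z V" and X: "vectorspace K X"
    and cl: "\<And>x. x \<in> Z \<Longrightarrow> \<pi> x \<in> carrier X"
    and add: "\<And>x y. x \<in> Z \<Longrightarrow> y \<in> Z \<Longrightarrow> \<pi> (x \<oplus>\<^bsub>V\<^esub> y) = \<pi> x \<oplus> \<pi> y"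
    and smult: "\<And>a x. a \<in> carrier K \<Longrightarrow> x \<in> Z \<Longrightarrow> \<pi> (a \<odot>\<^bsub>V\<^esub> x) = a \<odot> \<pi> x"
    and B: "submodule K B V" and BZ: "B \<subseteq> Z" and ker: "\<And>x. x \<in> Z \<Longrightarrow> \<pi> x = \<zero> \<longleftrightarrow> x \<in> B"
  shows "vectorspace.fin_dim K (X\<lparr>carrier := \<pi> ` Z\<rparr>) \<longleftrightarrow> finq K V Z B"
    and "finq K V Z B \<Longrightarrow> vectorspace.dim K (X\<lparr>carrier := \<pi> ` Z\<rparr>) = dimq K V Z B"
proof -
  interpret V: vectorspace K V by fact
  interpret X: vectorspace K X by fact
  note Z' = Z[unfolded submodule_def]
  have "submodule K (\<pi> ` Z) X" unfolding submodule_def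
  proof (intro conjI allI impI)
    show "\<pi> ` Z \<subseteq> carrier X" using cl by blast
    have "\<pi> \<zero>\<^bsub>V\<^esub> = \<zero>" using ker[of "\<zero>\<^bsub>V\<^esub>"] Z' B by (simp add: submodule_def)
    then show "\<zero> \<in> \<pi> ` Z" using Z' by (metis image_eqI)
  next
    fix x y assume "x \<in> \<pi> ` Z" "y \<in> \<pi> ` Z"
    then obtain u u' where "u \<in> Z" "u' \<in> Z" "x = \<pi> u" "y = \<pi> u'" by blast
    then show "x \<oplus> y \<in> \<pi> ` Z" using add[of u u'] Z' by (metis image_eqI)
  next
    fix c x assume c: "c \<in> carrier K" and "x \<in> \<pi> ` Z"
    then obtain u where "u \<in> Z" "x = \<pi> u" by blast
    then show "c \<odot> x \<in> \<pi> ` Z" using smult[OF c, of u] Z' c by (metis image_eqI)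
  qed (rule X.module_axioms)
  then have X': "vectorspace K (X\<lparr>carrier := \<pi> ` Z\<rparr>)" by (rule X.submodule_vectorspace)
  show "vectorspace.fin_dim K (X\<lparr>carrier := \<pi> ` Z\<rparr>) \<longleftrightarrow> finq K V Z B"
    by (rule dim_presentation(1)[OF V Z B BZ X', of \<pi>]) (simp_all add: add smult ker)
  show "vectorspace.dim K (X\<lparr>carrier := \<pi> ` Z\<rparr>) = dimq K V Z B" if "finq K V Z B"
    by (rule dim_presentation(2)[OF V Z B BZ X', of \<pi>]) (simp_all add: add smult ker that)
qed

lemma (in graded_alg) module_vectorspace: "Module.module R M \<Longrightarrow> vectorspace K M"
proof -
  assume "Module.module R M"
  then interpret M: Module.module R M .
  show "vectorspace K M"
  proof (rule vectorspaceI[OF K_field], rule moduleI)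
    show "cring K" using K_field by (simp add: field_def domain_def)
  qed (auto simp: M.smult_l_distr M.smult_r_distr M.smult_assoc1 A.A_carrier intro: M.M.abelian_group_axioms)
qed

lemma (in graded_alg) submodule_ground: "submodule R U M \<Longrightarrow> submodule K U M"
  using module_vectorspace[of M] by (auto simp: submodule_def vectorspace_def A.A_carrier)

context graded_alg begin

abbreviation "Irr \<equiv> irrelevant_ideal R A"

lemma ring_graded_mod: "graded_mod R A (ring_mod R) A"
  by (intro graded_mod.intro graded_mod_axioms.intro graded_alg_axioms graded_ring_mod)

lemma Irr_carrier: "a \<in> Irr \<Longrightarrow> a \<in> carrier R"
  by (simp add: irrelevant_ideal_def)

lemma Irr_zero: "\<zero> \<in> Irr"
  by (simp add: irrelevant_ideal_def)

lemma Irr_add: "a \<in> Irr \<Longrightarrow> b \<in> Irr \<Longrightarrow> a \<oplus> b \<in> Irr"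
  by (simp add: irrelevant_ideal_def A.comp_add)

lemma Irr_mult:
  assumes a: "a \<in> carrier R" and b: "b \<in> Irr" shows "a \<otimes> b \<in> Irr"
proof -
  interpret RM: graded_mod R A "ring_mod R" A by (rule ring_graded_mod)
  have bc: "b \<in> carrier R" "A.cmp b 0 = \<zero>" using b by (simp_all add: irrelevant_ideal_def)
  obtain n where n: "(\<Oplus>i\<in>{..<n}. A.cmp a i) = a" using A.comp_bound[OF a] by metis
  have z: "A.cmp (A.cmp a i \<otimes> b) 0 = \<zero>" for i
    using RM.comp_smult[OF A.comp_props(1)[OF a, of i], of b 0] bc a by (simp add: component_ring_mod)
  have "a \<otimes> b = (\<Oplus>i\<in>{..<n}. A.cmp a i \<otimes> b)"
    using R.finsum_ldistr[of "{..<n}" b "A.cmp a"] a bc n by (simp add: Pi_def)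
  then have "A.cmp (a \<otimes> b) 0 = (\<Oplus>i\<in>{..<n}. A.cmp (A.cmp a i \<otimes> b) 0)"
    using a bc by (simp add: A.comp_finsum)
  also have "\<dots> = \<zero>" by (simp add: z)
  finally show ?thesis using a bc by (simp add: irrelevant_ideal_def)
qed

lemma Irr_comp:
  assumes "a \<in> Irr" shows "A.cmp a i \<in> Irr"
proof -
  have a: "a \<in> carrier R" "A.cmp a 0 = \<zero>" using assms by (simp_all add: irrelevant_ideal_def)
  show ?thesis
    using A.comp_homog[OF A.comp_props(1)[OF a(1), of i], of 0] a by (cases "i = 0") (simp_all add: irrelevant_ideal_def)
qed

lemma Irr_homog: "a \<in> A j \<Longrightarrow> 0 < j \<Longrightarrow> a \<in> Irr"
  using A.comp_homog[of a j 0] by (auto simp: irrelevant_ideal_def A.A_carrier)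

lemma free_expand_support:
  assumes f: "f \<in> carrier (free_module R I)" and S: "finite S" "S \<subseteq> I" "\<And>c. c \<notin> S \<Longrightarrow> f c = \<zero>"
  shows "ev (free_module R I) S (uvec R) f = f"
proof
  fix c
  have fc: "f c \<in> carrier R" for c using f by (simp add: free_carrier_iff)
  have fS: "f \<in> carrier (free_module R S)" using S fc by (simp add: free_carrier_finite)
  have u: "f c \<odot>\<^bsub>free_module R I\<^esub> uvec R c \<in> carrier (free_module R I)" "f c \<odot>\<^bsub>free_module R S\<^esub> uvec R c \<in> carrier (free_module R S)"
    if "c \<in> S" for c
    using that S(2) fc by (auto simp: free_carrier_iff uvec_def)
  have "ev (free_module R I) S (uvec R) f c = ev (free_module R S) S (uvec R) f c"
    unfolding ev_def by (subst finsum_free[OF R_cring u(1)], assumption, subst finsum_free[OF R_cring u(2)], assumption) simp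
  then show "ev (free_module R I) S (uvec R) f c = f c" using R.free_expand[OF S(1) fS] by simp
qed

text \<open>Vectors with all coordinates in the irrelevant ideal form a submodule, and such a vector
  is the finite sum of its coordinates times basis vectors. This trades the span in
  \<open>mP\<close> for a condition on coordinates.\<close>

lemma mP_iff: "x \<in> mP R A P i \<longleftrightarrow> x \<in> carrier (fr_mod R P i) \<and> (\<forall>c. x c \<in> Irr)"
proof -
  let ?F = "fr_mod R P i"
  interpret F: Module.module R ?F by (rule free_module_module[OF R_cring])
  let ?S = "{a \<odot>\<^bsub>?F\<^esub> x | a x. a \<in> Irr \<and> x \<in> carrier ?F}"
  have Sc: "?S \<subseteq> carrier ?F" using F.smult_closed Irr_carrier by blast
  have mP: "mP R A P i = F.span ?S" by (simp add: mP_def ideal_smult_def)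
  show ?thesis
  proof
    let ?N = "{x \<in> carrier ?F. \<forall>c. x c \<in> Irr}"
    have "submodule R ?N ?F" unfolding submodule_def
    proof (intro conjI allI impI)
      show "v \<oplus>\<^bsub>?F\<^esub> w \<in> ?N" if "v \<in> ?N" "w \<in> ?N" for v w
        using F.M.add.m_closed[of v w] that by (simp add: Irr_add)
      show "a \<odot>\<^bsub>?F\<^esub> v \<in> ?N" if "a \<in> carrier R" "v \<in> ?N" for a v
        using F.smult_closed[of a v] that by (simp add: Irr_mult)
      show "\<zero>\<^bsub>?F\<^esub> \<in> ?N" using F.M.zero_closed by (simp add: Irr_zero)
    qed (auto intro: F.module_axioms)
    moreover have "?S \<subseteq> ?N"
    proof
      fix y assume "y \<in> ?S"
      then obtain a x where ax: "a \<in> Irr" "x \<in> carrier ?F" "y = a \<odot>\<^bsub>?F\<^esub> x" by blast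
      have "y c \<in> Irr" for c
        using Irr_mult[of "x c" a] ax Irr_carrier[OF ax(1)] R.m_comm[of a "x c"] by (simp add: free_carrier_iff)
      moreover have "y \<in> carrier ?F" using Sc \<open>y \<in> ?S\<close> by blast
      ultimately show "y \<in> ?N" by blast
    qed
    ultimately have "F.span ?S \<subseteq> ?N" by (intro F.span_is_subset)
    then show "x \<in> mP R A P i \<Longrightarrow> x \<in> carrier ?F \<and> (\<forall>c. x c \<in> Irr)" unfolding mP by blast
  next
    assume x: "x \<in> carrier ?F \<and> (\<forall>c. x c \<in> Irr)"
    let ?T = "{c. x c \<noteq> \<zero>}"
    have T: "finite ?T" "?T \<subseteq> fr_index P i" using x by (auto simp: free_carrier_iff)
    have "ev ?F ?T (uvec R) x \<in> F.span ?S" unfolding ev_def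
    proof (rule F.submodule_finsum_closed[OF F.span_is_submodule[OF Sc]])
      fix c assume "c \<in> ?T"
      then have "uvec R c \<in> carrier ?F" using T by (intro F.uvec_carrier) auto
      then have "x c \<odot>\<^bsub>?F\<^esub> uvec R c \<in> ?S" using x by blast
      then show "x c \<odot>\<^bsub>?F\<^esub> uvec R c \<in> F.span ?S" using F.in_own_span[OF Sc] by blast
    qed
    moreover have "ev ?F ?T (uvec R) x = x" by (rule free_expand_support[OF _ T]) (use x in auto)
    ultimately show "x \<in> mP R A P i" unfolding mP by argo
  qed
qed

end

section \<open>Tor from an arbitrary graded free resolution\<close>

locale resolved = graded_mod R A N B
  for R :: "('a, 'x) ring_scheme" and A and N :: "('a, 'b, 'y) module_scheme" (structure) and B +
  fixes P :: "('a, 'b) free_res"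
  assumes res: "graded_free_resolution R A N B P"
begin

abbreviation "F a \<equiv> fr_mod R P a"
abbreviation "gF a \<equiv> fr_grading R A P a"
abbreviation "bd a \<equiv> fr_diff P a"
abbreviation "aug \<equiv> fr_aug P"
abbreviation "m a \<equiv> mP R A P a"

lemma Fgm: "graded_mod R A (F a) (gF a)" by (rule free_graded)
lemma Fm: "Module.module R (F a)" by (rule free_module_module[OF R_cring])
lemma Fig: "igrading (F a) (gF a)"
proof -
  interpret Fa: graded_mod R A "F a" "gF a" by (rule Fgm)
  show ?thesis by (rule Fa.B.igrading_axioms)
qed

lemma res_props:
  "mod_hom R (F (Suc a)) (F a) (bd a)" "mod_hom R (F 0) N aug"
  "x \<in> gF (Suc a) j \<Longrightarrow> bd a x \<in> gF a j" "x \<in> gF 0 j \<Longrightarrow> aug x \<in> B j"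
  "aug ` carrier (F 0) = carrier N"
  "{x \<in> carrier (F 0). aug x = \<zero>} = bd 0 ` carrier (F (Suc 0))"
  "{x \<in> carrier (F (Suc a)). bd a x = \<zero>\<^bsub>F a\<^esub>} = bd (Suc a) ` carrier (F (Suc (Suc a)))"
proof -
  note r = res[unfolded graded_free_resolution_def]
  show "mod_hom R (F (Suc a)) (F a) (bd a)" using r[THEN conjunct1] by (rule spec)
  show "mod_hom R (F 0) N aug" by (rule r[THEN conjunct2, THEN conjunct1])
  show "bd a x \<in> gF a j" if "x \<in> gF (Suc a) j"
    using r[THEN conjunct2, THEN conjunct2, THEN conjunct1, THEN spec, THEN spec, of a j] that by (rule subsetD[OF _ imageI])
  show "aug x \<in> B j" if "x \<in> gF 0 j"
    using r[THEN conjunct2, THEN conjunct2, THEN conjunct2, THEN conjunct1, THEN spec, of j] that by (rule subsetD[OF _ imageI])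
  show "aug ` carrier (F 0) = carrier N"
    by (rule r[THEN conjunct2, THEN conjunct2, THEN conjunct2, THEN conjunct2, THEN conjunct1])
  show "{x \<in> carrier (F 0). aug x = \<zero>} = bd 0 ` carrier (F (Suc 0))"
    by (rule r[THEN conjunct2, THEN conjunct2, THEN conjunct2, THEN conjunct2, THEN conjunct2, THEN conjunct1, unfolded One_nat_def])
  show "{x \<in> carrier (F (Suc a)). bd a x = \<zero>\<^bsub>F a\<^esub>} = bd (Suc a) ` carrier (F (Suc (Suc a)))"
    by (rule r[THEN conjunct2, THEN conjunct2, THEN conjunct2, THEN conjunct2, THEN conjunct2, THEN conjunct2, THEN spec])
qed

lemmas bd_hom = mod_homD(3-5)[OF res_props(1)]
lemmas aug_hom = mod_homD(3-5)[OF res_props(2)]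

lemma gF_carrier: "x \<in> gF a j \<Longrightarrow> x \<in> carrier (F a)"
  by (simp add: free_grading_def)

lemma bd_bd: "x \<in> carrier (F (Suc (Suc a))) \<Longrightarrow> bd a (bd (Suc a) x) = (\<lambda>_. \<zero>\<^bsub>R\<^esub>)"
  using res_props(7)[of a] by (auto simp: set_eq_iff)

lemma aug_bd: "x \<in> carrier (F (Suc 0)) \<Longrightarrow> aug (bd 0 x) = \<zero>"
  using res_props(6) by (auto simp: set_eq_iff)

lemma bd_comp:
  assumes "x \<in> carrier (F (Suc a))"
  shows "component (F a) (gF a) (bd a x) j = bd a (component (F (Suc a)) (gF (Suc a)) x j)"
  by (rule comp_map[OF Fig Fig]) (use assms bd_hom res_props(3) in \<open>auto simp del: free_simps\<close>)

lemma aug_comp: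
  assumes "x \<in> carrier (F 0)"
  shows "B.cmp (aug x) j = aug (component (F 0) (gF 0) x j)"
  by (rule comp_map[OF Fig B.igrading_axioms]) (use assms aug_hom res_props(4) in \<open>auto simp del: free_simps\<close>)

lemma comp_in: "x \<in> carrier (F a) \<Longrightarrow> component (F a) (gF a) x j \<in> gF a j"
  using igrading.comp_props(1)[OF Fig] .

lemma comp_self: "x \<in> gF a j \<Longrightarrow> component (F a) (gF a) x j = x"
  using igrading.comp_homog[OF Fig, of x a j j] by simp

text \<open>Exactness of a resolution is stated without reference to degrees; the degree
  \<open>j\<close> component of a preimage is a homogeneous preimage.\<close>

lemma bd_exact:
  assumes x: "x \<in> gF (Suc a) j" and 0: "bd a x = (\<lambda>_. \<zero>\<^bsub>R\<^esub>)"
  shows "\<exists>t\<in>gF (Suc (Suc a)) j. bd (Suc a) t = x"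
proof -
  have "x \<in> bd (Suc a) ` carrier (F (Suc (Suc a)))"
    unfolding res_props(7)[symmetric] using gF_carrier[OF x] 0 by simp
  then obtain t where t: "t \<in> carrier (F (Suc (Suc a)))" "x = bd (Suc a) t" by blast
  have "bd (Suc a) (component (F (Suc (Suc a))) (gF (Suc (Suc a))) t j) = x"
    using bd_comp[OF t(1), of j] comp_self[OF x] t(2) by simp
  then show ?thesis using comp_in[OF t(1)] by blast
qed

lemma aug_exact:
  assumes x: "x \<in> gF 0 j" and 0: "aug x = \<zero>"
  shows "\<exists>t\<in>gF (Suc 0) j. bd 0 t = x"
proof -
  have "x \<in> bd 0 ` carrier (F (Suc 0))"
    unfolding res_props(6)[symmetric] using gF_carrier[OF x] 0 by simp
  then obtain t where t: "t \<in> carrier (F (Suc 0))" "x = bd 0 t" by blast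
  have "bd 0 (component (F (Suc 0)) (gF (Suc 0)) t j) = x"
    using bd_comp[OF t(1), of j] comp_self[OF x] t(2) by simp
  then show ?thesis using comp_in[OF t(1)] by blast
qed

lemma aug_surj:
  assumes y: "y \<in> B j" shows "\<exists>t\<in>gF 0 j. aug t = y"
proof -
  obtain t where t: "t \<in> carrier (F 0)" "y = aug t" using res_props(5) B.A_carrier[OF y] by blast
  have "aug (component (F 0) (gF 0) t j) = y"
    using aug_comp[OF t(1), of j] B.comp_homog[OF y, of j] t(2) by simp
  then show ?thesis using comp_in[OF t(1)] by blast
qed

lemma bd_zero: "bd a (\<lambda>_. \<zero>\<^bsub>R\<^esub>) = (\<lambda>_. \<zero>\<^bsub>R\<^esub>)"
  using mod_hom.f0_is_0[OF res_props(1)] by simp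

lemma aug_zero: "aug (\<lambda>_. \<zero>\<^bsub>R\<^esub>) = \<zero>"
  using mod_hom.f0_is_0[OF res_props(2)] by simp

lemma m_submodule: "submodule R (m a) (F a)"
proof -
  interpret Fa: Module.module R "F a" by (rule Fm)
  have "{b \<odot>\<^bsub>F a\<^esub> x | b x. b \<in> Irr \<and> x \<in> carrier (F a)} \<subseteq> carrier (F a)"
    using Fa.smult_closed Irr_carrier by blast
  then show ?thesis unfolding mP_def ideal_smult_def by (rule Fa.span_is_submodule)
qed

lemma m_carrier: "x \<in> m a \<Longrightarrow> x \<in> carrier (F a)" by (simp add: mP_iff)

lemma m_smult: "b \<in> Irr \<Longrightarrow> x \<in> carrier (F a) \<Longrightarrow> b \<odot>\<^bsub>F a\<^esub> x \<in> m a"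
proof -
  assume b: "b \<in> Irr" and x: "x \<in> carrier (F a)"
  interpret Fa: Module.module R "F a" by (rule Fm)
  have "b \<otimes>\<^bsub>R\<^esub> x c \<in> Irr" for c
    using Irr_mult[of "x c" b] b x Irr_carrier[OF b] R.m_comm[of b "x c"] by (simp add: free_carrier_iff)
  then show ?thesis using Fa.smult_closed[OF Irr_carrier[OF b] x] by (simp add: mP_iff)
qed

lemma m_comp:
  assumes x: "x \<in> m a" shows "component (F a) (gF a) x j \<in> m a"
proof -
  have xc: "x \<in> carrier (F a)" using x by (simp add: mP_iff)
  interpret RM: graded_mod R A "ring_mod R" A by (rule ring_graded_mod)
  have "component (F a) (gF a) x = (\<lambda>j c. if c \<in> fr_index P a \<and> fr_shift P a c \<le> j then A.cmp (x c) (j - fr_shift P a c) else \<zero>\<^bsub>R\<^esub>)"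
    using fam_igrading(2)[OF RM.N_module RM.B.igrading_axioms xc[unfolded free_module_fam], of "fr_shift P a"]
    unfolding free_module_fam free_grading_fam[abs_def] component_ring_mod ring_mod_simps .
  then have "component (F a) (gF a) x j c \<in> Irr" for c
    using Irr_comp[of "x c"] x by (simp add: mP_iff Irr_zero)
  then show ?thesis using gF_carrier[OF comp_in[OF xc]] by (simp add: mP_iff)
qed

lemma bd_m:
  assumes "x \<in> m (Suc a)" shows "bd a x \<in> m a"
proof -
  interpret h: mod_hom R "F (Suc a)" "F a" "bd a" by (rule res_props(1))
  let ?S = "{b \<odot>\<^bsub>F (Suc a)\<^esub> x | b x. b \<in> Irr \<and> x \<in> carrier (F (Suc a))}"
  let ?N = "{x \<in> carrier (F (Suc a)). bd a x \<in> m a}"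
  note ms = m_submodule[of a, unfolded submodule_def]
  have "submodule R ?N (F (Suc a))" unfolding submodule_def
  proof (intro conjI allI impI)
    show "v \<oplus>\<^bsub>F (Suc a)\<^esub> w \<in> ?N" if "v \<in> ?N" "w \<in> ?N" for v w
      using that ms bd_hom(2)[of v a w] h.M.M.add.m_closed[of v w] by (simp del: free_simps)
    show "c \<odot>\<^bsub>F (Suc a)\<^esub> v \<in> ?N" if "c \<in> carrier R" "v \<in> ?N" for c v
      using that ms bd_hom(3)[of c v a] h.M.smult_closed[of c v] by (simp del: free_simps)
    show "\<zero>\<^bsub>F (Suc a)\<^esub> \<in> ?N" using ms h.M.M.zero_closed h.f0_is_0 by (simp del: free_simps)
  qed (auto intro: h.M.module_axioms)
  moreover have "?S \<subseteq> ?N"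
  proof
    fix y assume "y \<in> ?S"
    then obtain b x where bx: "b \<in> Irr" "x \<in> carrier (F (Suc a))" "y = b \<odot>\<^bsub>F (Suc a)\<^esub> x" by blast
    then show "y \<in> ?N"
      using m_smult[OF bx(1) bd_hom(1)[OF bx(2)]] bd_hom(3)[of b x a] Irr_carrier[OF bx(1)] h.M.smult_closed[of b x]
      by (simp del: free_simps)
  qed
  ultimately have "h.M.span ?S \<subseteq> ?N" by (intro h.M.span_is_subset)
  then show ?thesis using assms unfolding mP_def[of R A P "Suc a"] ideal_smult_def by blast
qed

text \<open>\<open>Zx\<close> and \<open>Bx\<close> are the preimages in \<open>F i\<close> of the
  cycles and boundaries of the resolution modulo the irrelevant ideal. With them Tor becomes a
  single subquotient of \<open>F i\<close> instead of a quotient of a quotient. The implication on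
  \<open>i\<close> leaves \<open>Zx 0\<close> unrestricted.\<close>

definition "Zx i = {x \<in> carrier (F i). \<forall>a. i = Suc a \<longrightarrow> bd a x \<in> m a}"
definition "Bx i = {x \<in> carrier (F i). \<exists>t\<in>carrier (F (Suc i)). x \<ominus>\<^bsub>F i\<^esub> bd i t \<in> m i}"

lemma Zx_submodule: "submodule R (Zx i) (F i)"
proof -
  interpret Fi: Module.module R "F i" by (rule Fm)
  show ?thesis unfolding submodule_def Zx_def
  proof (intro conjI allI impI)
    show "v \<oplus>\<^bsub>F i\<^esub> w \<in> {x \<in> carrier (F i). \<forall>a. i = Suc a \<longrightarrow> bd a x \<in> m a}"
      if "v \<in> {x \<in> carrier (F i). \<forall>a. i = Suc a \<longrightarrow> bd a x \<in> m a}" "w \<in> {x \<in> carrier (F i). \<forall>a. i = Suc a \<longrightarrow> bd a x \<in> m a}" for v w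
      using that Fi.M.add.m_closed[of v w] m_submodule by (auto simp: bd_hom submodule_def simp del: free_simps)
    show "c \<odot>\<^bsub>F i\<^esub> v \<in> {x \<in> carrier (F i). \<forall>a. i = Suc a \<longrightarrow> bd a x \<in> m a}"
      if "c \<in> carrier R" "v \<in> {x \<in> carrier (F i). \<forall>a. i = Suc a \<longrightarrow> bd a x \<in> m a}" for c v
      using that Fi.smult_closed[of c v] m_submodule by (auto simp: bd_hom submodule_def simp del: free_simps)
    show "\<zero>\<^bsub>F i\<^esub> \<in> {x \<in> carrier (F i). \<forall>a. i = Suc a \<longrightarrow> bd a x \<in> m a}"
      using Fi.M.zero_closed m_submodule by (auto simp: bd_zero submodule_def)
  qed (auto intro: Fi.module_axioms)
qed

lemma im_bd_submodule: "submodule R (bd i ` carrier (F (Suc i))) (F i)"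
  using mod_hom.im_is_submodule[OF res_props(1)] unfolding mod_hom.im_def[OF res_props(1)] .

lemma Bx_eq: "Bx i = (bd i ` carrier (F (Suc i))) <+>\<^bsub>F i\<^esub> m i"
proof -
  interpret Fi: Module.module R "F i" by (rule Fm)
  show ?thesis
  proof (rule Set.set_eqI, unfold set_add_iff)
    fix x
    show "x \<in> Bx i \<longleftrightarrow> (\<exists>u\<in>bd i ` carrier (F (Suc i)). \<exists>y\<in>m i. x = u \<oplus>\<^bsub>F i\<^esub> y)"
    proof
      assume "x \<in> Bx i"
      then obtain t where t: "x \<in> carrier (F i)" "t \<in> carrier (F (Suc i))" "x \<ominus>\<^bsub>F i\<^esub> bd i t \<in> m i" by (auto simp: Bx_def)
      have bt: "bd i t \<in> carrier (F i)" using t(2) by (rule bd_hom(1))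
      have "x = bd i t \<oplus>\<^bsub>F i\<^esub> (x \<ominus>\<^bsub>F i\<^esub> bd i t)"
        using Fi.minus_add_cancel[OF t(1) bt] Fi.M.a_comm[OF bt Fi.M.minus_closed[OF t(1) bt]] by metis
      then show "\<exists>u\<in>bd i ` carrier (F (Suc i)). \<exists>y\<in>m i. x = u \<oplus>\<^bsub>F i\<^esub> y" using t by blast
    next
      assume "\<exists>u\<in>bd i ` carrier (F (Suc i)). \<exists>y\<in>m i. x = u \<oplus>\<^bsub>F i\<^esub> y"
      then obtain t y where t: "t \<in> carrier (F (Suc i))" "y \<in> m i" "x = bd i t \<oplus>\<^bsub>F i\<^esub> y" by blast
      have bt: "bd i t \<in> carrier (F i)" and yc: "y \<in> carrier (F i)" using bd_hom(1)[OF t(1)] m_carrier[OF t(2)] .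
      have "x \<ominus>\<^bsub>F i\<^esub> bd i t = y"
        unfolding t(3) Fi.M.a_comm[OF bt yc] using bt yc by (simp add: a_minus_def Fi.M.a_assoc Fi.M.r_neg del: free_simps)
      then have "x \<ominus>\<^bsub>F i\<^esub> bd i t \<in> m i" using t(2) by simp
      moreover have "x \<in> carrier (F i)" unfolding t(3) by (rule Fi.M.add.m_closed[OF bt yc])
      ultimately show "x \<in> Bx i" unfolding Bx_def using t(1) by blast
    qed
  qed
qed

lemma Bx_submodule: "submodule R (Bx i) (F i)"
  unfolding Bx_eq using module.submodule_set_add[OF Fm im_bd_submodule m_submodule] .

lemma Bx_Zx: "Bx i \<subseteq> Zx i"
proof
  fix x assume x: "x \<in> Bx i"
  then obtain t y where t: "t \<in> carrier (F (Suc i))" "y \<in> m i" "x = bd i t \<oplus>\<^bsub>F i\<^esub> y"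
    unfolding Bx_eq set_add_iff by blast
  have "bd a x \<in> m a" if i: "i = Suc a" for a
  proof -
    interpret Fa: Module.module R "F a" by (rule Fm)
    have "bd a x = bd a (bd i t) \<oplus>\<^bsub>F a\<^esub> bd a y"
      unfolding t(3) i by (rule bd_hom(2)) (use t i bd_hom(1) m_carrier in auto)
    also have "\<dots> = bd a y"
      using bd_bd[of t a] t i bd_hom(1)[OF m_carrier, of y a] by (simp add: free_carrier_iff)
    finally show ?thesis using bd_m[of y a] t i by simp
  qed
  then show "x \<in> Zx i" using x by (auto simp: Zx_def Bx_def)
qed

lemma Zx_comp: "x \<in> Zx i \<Longrightarrow> component (F i) (gF i) x j \<in> Zx i"
  using gF_carrier[OF comp_in, of x i j] m_comp by (auto simp: Zx_def bd_comp[symmetric])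

lemma Bx_comp:
  assumes "x \<in> Bx i" shows "component (F i) (gF i) x j \<in> Bx i"
proof -
  obtain t y where t: "t \<in> carrier (F (Suc i))" "y \<in> m i" "x = bd i t \<oplus>\<^bsub>F i\<^esub> y"
    using assms unfolding Bx_eq set_add_iff by blast
  interpret Fi: igrading "F i" "gF i" by (rule Fig)
  have "Fi.cmp x j = bd i (component (F (Suc i)) (gF (Suc i)) t j) \<oplus>\<^bsub>F i\<^esub> Fi.cmp y j"
    using Fi.comp_add[OF bd_hom(1)[OF t(1)] m_carrier[OF t(2)]] bd_comp[OF t(1)] t(3) by simp
  then show ?thesis unfolding Bx_eq set_add_iff using gF_carrier[OF comp_in[OF t(1)]] m_comp[OF t(2)] by blast
qed

text \<open>The module \<open>Tor\<close> with the chosen resolution replaced by \<open>P\<close>;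
  the finite resolution constructed above and the chosen one are both instances.\<close>

definition "TorP i = quotient_module ((red_mod R A P i)\<lparr>carrier := red_cycles R A P i\<rparr>) (red_boundaries R A P i)"
definition "TorP_grading i j =
  {red_boundaries R A P i +>\<^bsub>red_mod R A P i\<^esub> X | X. X \<in> red_cycles R A P i \<inter> red_grading R A P i j}"

text \<open>The composite \<open>\<pi>\<close> of the two quotient maps sends \<open>Zx i\<close>
  onto Tor with kernel \<open>Bx i\<close>, and its restriction to degree \<open>j\<close> has image
  \<open>TorP_grading i j\<close>.\<close>

lemma TorP_dim:
  shows "vectorspace.fin_dim K (TorP i) \<longleftrightarrow> finq K (F i) (Zx i) (Bx i)"
    and "finq K (F i) (Zx i) (Bx i) \<Longrightarrow> vectorspace.dim K (TorP i) = dimq K (F i) (Zx i) (Bx i)"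
    and "finq K (F i) (Zx i \<inter> gF i j) (Bx i \<inter> gF i j) \<Longrightarrow>
      vectorspace.dim K ((TorP i)\<lparr>carrier := TorP_grading i j\<rparr>) = dimq K (F i) (Zx i \<inter> gF i j) (Bx i \<inter> gF i j)"
proof -
  let ?Q = "red_mod R A P i" and ?Zr = "red_cycles R A P i" and ?Br = "red_boundaries R A P i"
  interpret Fi: graded_mod R A "F i" "gF i" by (rule Fgm)
  have cl_red: "red_diff R A P a (m (Suc a) +>\<^bsub>F (Suc a)\<^esub> x) = m a +>\<^bsub>F a\<^esub> bd a x" if x: "x \<in> carrier (F (Suc a))" for a x
    unfolding red_diff_def
  proof (rule module.coset_Union[where h = "bd a", OF Fm m_submodule x m_submodule Fm bd_hom(1)[OF x]])
    fix y assume y: "y \<in> carrier (F (Suc a))" "y \<ominus>\<^bsub>F (Suc a)\<^esub> x \<in> m (Suc a)"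
    have "bd a y \<ominus>\<^bsub>F a\<^esub> bd a x = bd a (y \<ominus>\<^bsub>F (Suc a)\<^esub> x)"
      using mod_hom.f_minus[OF res_props(1) y(1) x] by simp
    then show "m a +>\<^bsub>F a\<^esub> bd a y = m a +>\<^bsub>F a\<^esub> bd a x"
      using bd_m[OF y(2)] module.coset_eq_iff[OF Fm m_submodule bd_hom(1)[OF y(1)] bd_hom(1)[OF x]] by simp
  qed
  let ?cl = "\<lambda>x. m i +>\<^bsub>F i\<^esub> x"
  have Qm: "Module.module R ?Q" unfolding red_mod_def by (rule Fi.N.quotient_module_is_module[OF m_submodule])
  interpret Q: Module.module R ?Q by (rule Qm)
  have Qc: "carrier ?Q = ?cl ` carrier (F i)" unfolding red_mod_def Fi.N.quotient_carrier by blast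
  have Qadd: "?cl x \<oplus>\<^bsub>?Q\<^esub> ?cl y = ?cl (x \<oplus>\<^bsub>F i\<^esub> y)" if "x \<in> carrier (F i)" "y \<in> carrier (F i)" for x y
    unfolding red_mod_def Fi.N.quotient_add by (rule Fi.N.coset_add[OF m_submodule that])
  have Qsm: "b \<odot>\<^bsub>?Q\<^esub> ?cl x = ?cl (b \<odot>\<^bsub>F i\<^esub> x)" if "b \<in> carrier R" "x \<in> carrier (F i)" for b x
    unfolding red_mod_def by (rule Fi.N.quotient_smult[OF m_submodule that])
  have Q0: "\<zero>\<^bsub>?Q\<^esub> = m i" unfolding red_mod_def by (rule Fi.N.quotient_zero)
  have sub: "submodule R (?cl ` U) ?Q" if U: "submodule R U (F i)" for U
  proof -
    note U' = U[unfolded submodule_def]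
    have Uc: "u \<in> carrier (F i)" if "u \<in> U" for u using U' that by blast
    show ?thesis unfolding submodule_def
    proof (intro conjI allI impI)
      show "?cl ` U \<subseteq> carrier ?Q" unfolding Qc using U' by blast
      have "?cl \<zero>\<^bsub>F i\<^esub> = m i" using Fi.N.coset_zero_iff[OF m_submodule Fi.N.M.zero_closed] m_submodule[of i, unfolded submodule_def] by simp
      then show "\<zero>\<^bsub>?Q\<^esub> \<in> ?cl ` U" unfolding Q0 using U' by (metis image_eqI)
    next
      fix v w assume "v \<in> ?cl ` U" "w \<in> ?cl ` U"
      then obtain x y where xy: "x \<in> U" "y \<in> U" "v = ?cl x" "w = ?cl y" by blast
      then have "v \<oplus>\<^bsub>?Q\<^esub> w = ?cl (x \<oplus>\<^bsub>F i\<^esub> y)" using Qadd Uc by blast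
      moreover have "x \<oplus>\<^bsub>F i\<^esub> y \<in> U" using U' xy by blast
      ultimately show "v \<oplus>\<^bsub>?Q\<^esub> w \<in> ?cl ` U" by blast
    next
      fix b v assume b: "b \<in> carrier R" and "v \<in> ?cl ` U"
      then obtain x where x: "x \<in> U" "v = ?cl x" by blast
      then have "b \<odot>\<^bsub>?Q\<^esub> v = ?cl (b \<odot>\<^bsub>F i\<^esub> x)" using Qsm b Uc by blast
      moreover have "b \<odot>\<^bsub>F i\<^esub> x \<in> U" using U' x b by blast
      ultimately show "b \<odot>\<^bsub>?Q\<^esub> v \<in> ?cl ` U" by blast
    qed (rule Qm)
  qed
  have Zr: "?Zr = ?cl ` Zx i"
  proof (cases i)
    case 0
    then show ?thesis using Qc by (simp add: red_cycles_def Zx_def)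
  next
    case (Suc a)
    have Q0a: "\<zero>\<^bsub>red_mod R A P a\<^esub> = m a" unfolding red_mod_def by (simp add: quotient_module_def)
    have "m a +>\<^bsub>F a\<^esub> bd a x = m a \<longleftrightarrow> bd a x \<in> m a" if "x \<in> carrier (F (Suc a))" for x
      by (rule module.coset_zero_iff[OF Fm m_submodule bd_hom(1)[OF that]])
    then have *: "red_diff R A P a (?cl x) = m a \<longleftrightarrow> bd a x \<in> m a" if "x \<in> carrier (F i)" for x
      using cl_red[of x a] that Suc by simp
    have "?Zr = {X \<in> carrier ?Q. red_diff R A P a X = m a}" using Suc by (simp add: red_cycles_def Q0a)
    also have "\<dots> = ?cl ` {x \<in> carrier (F i). bd a x \<in> m a}" unfolding Qc using * by blast
    also have "{x \<in> carrier (F i). bd a x \<in> m a} = Zx i" using Suc by (auto simp: Zx_def)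
    finally show ?thesis .
  qed
  have Br: "?Br = ?cl ` Bx i"
  proof -
    have "carrier (red_mod R A P (Suc i)) = (\<lambda>x. m (Suc i) +>\<^bsub>F (Suc i)\<^esub> x) ` carrier (F (Suc i))"
      unfolding red_mod_def module.quotient_carrier[OF Fm] by blast
    then have "?Br = (\<lambda>t. red_diff R A P i (m (Suc i) +>\<^bsub>F (Suc i)\<^esub> t)) ` carrier (F (Suc i))"
      unfolding red_boundaries_def by (simp add: image_image)
    also have "\<dots> = (\<lambda>t. ?cl (bd i t)) ` carrier (F (Suc i))" using cl_red by (intro image_cong) auto
    also have "\<dots> = ?cl ` Bx i"
    proof (intro equalityI subsetI)
      fix X assume "X \<in> (\<lambda>t. ?cl (bd i t)) ` carrier (F (Suc i))"
      then obtain t where t: "t \<in> carrier (F (Suc i))" "X = ?cl (bd i t)" by blast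
      have "bd i t \<ominus>\<^bsub>F i\<^esub> bd i t \<in> m i"
        using bd_hom(1)[OF t(1)] m_submodule[of i, unfolded submodule_def] by (simp add: a_minus_def Fi.N.M.r_neg del: free_simps)
      then have "bd i t \<in> Bx i" using t bd_hom(1)[OF t(1)] by (auto simp: Bx_def)
      then show "X \<in> ?cl ` Bx i" using t by blast
    next
      fix X assume "X \<in> ?cl ` Bx i"
      then obtain x t where t: "x \<in> carrier (F i)" "X = ?cl x" "t \<in> carrier (F (Suc i))" "x \<ominus>\<^bsub>F i\<^esub> bd i t \<in> m i"
        by (auto simp: Bx_def)
      then have "X = ?cl (bd i t)" using Fi.N.coset_eq_iff[OF m_submodule t(1) bd_hom(1)[OF t(3)]] by simp
      then show "X \<in> (\<lambda>t. ?cl (bd i t)) ` carrier (F (Suc i))" using t by blast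
    qed
    finally show ?thesis .
  qed
  have Zs: "submodule R ?Zr ?Q" and Bs: "submodule R ?Br ?Q" unfolding Zr Br by (intro sub Zx_submodule Bx_submodule)+
  have BZ: "?Br \<subseteq> ?Zr" unfolding Zr Br using Bx_Zx by blast
  interpret Qz: Module.module R "?Q\<lparr>carrier := ?Zr\<rparr>" using Zs by (rule Q.submodule_is_module)
  note Bs' = Q.submodule_submodule[OF Zs Bs BZ]
  have Tm: "Module.module R (TorP i)" unfolding TorP_def by (rule Qz.quotient_module_is_module[OF Bs'])
  have TK: "vectorspace K (TorP i)" by (rule module_vectorspace[OF Tm])
  define \<pi> where "\<pi> x = ?Br +>\<^bsub>?Q\<^esub> ?cl x" for x
  have clZ: "?cl x \<in> ?Zr" "x \<in> carrier (F i)" if "x \<in> Zx i" for x unfolding Zr using that by (auto simp: Zx_def)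
  have pi_cl: "\<pi> x \<in> carrier (TorP i)" if "x \<in> Zx i" for x
    unfolding TorP_def Qz.quotient_carrier \<pi>_def using clZ[OF that] by auto
  have pi_add: "\<pi> (x \<oplus>\<^bsub>F i\<^esub> y) = \<pi> x \<oplus>\<^bsub>TorP i\<^esub> \<pi> y" if "x \<in> Zx i" "y \<in> Zx i" for x y
    using Qz.coset_add[OF Bs', of "?cl x" "?cl y"] clZ[OF that(1)] clZ[OF that(2)] Qadd[of x y]
    unfolding TorP_def Qz.quotient_add \<pi>_def by (simp del: free_simps)
  have pi_sm: "\<pi> (b \<odot>\<^bsub>F i\<^esub> x) = b \<odot>\<^bsub>TorP i\<^esub> \<pi> x" if "b \<in> carrier K" "x \<in> Zx i" for b x
    using Qz.quotient_smult[OF Bs', of b "?cl x"] clZ[OF that(2)] Qsm[of b x] that(1)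
    unfolding TorP_def \<pi>_def by (simp add: A.A_carrier del: free_simps)
  have ker: "\<pi> x = \<zero>\<^bsub>TorP i\<^esub> \<longleftrightarrow> x \<in> Bx i" if x: "x \<in> Zx i" for x
  proof -
    have "\<pi> x = \<zero>\<^bsub>TorP i\<^esub> \<longleftrightarrow> ?cl x \<in> ?Br"
      using Qz.coset_zero_iff[OF Bs', of "?cl x"] clZ[OF x] unfolding TorP_def Qz.quotient_zero \<pi>_def by simp
    also have "\<dots> \<longleftrightarrow> x \<in> Bx i"
    proof
      assume "?cl x \<in> ?Br"
      then obtain y where y: "y \<in> Bx i" "?cl x = ?cl y" unfolding Br by blast
      have yc: "y \<in> carrier (F i)" using y by (simp add: Bx_def)
      have "x \<ominus>\<^bsub>F i\<^esub> y \<in> m i" using y(2) Fi.N.coset_eq_iff[OF m_submodule clZ(2)[OF x] yc] by simp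
      moreover have "m i \<subseteq> Bx i"
      proof
        fix u assume u: "u \<in> m i"
        have "u = bd i \<zero>\<^bsub>F (Suc i)\<^esub> \<oplus>\<^bsub>F i\<^esub> u" using m_carrier[OF u] by (simp add: bd_zero free_carrier_iff)
        then show "u \<in> Bx i" unfolding Bx_eq set_add_iff using u module.submodule_carrier[OF Fm] by (auto simp: submodule_def simp del: free_simps)
      qed
      ultimately have "(x \<ominus>\<^bsub>F i\<^esub> y) \<oplus>\<^bsub>F i\<^esub> y \<in> Bx i" using y Bx_submodule unfolding submodule_def by blast
      then show "x \<in> Bx i" using Fi.N.minus_add_cancel[OF clZ(2)[OF x] yc] by (simp del: free_simps)
    qed (auto simp: Br)
    finally show ?thesis .
  qed
  have im: "\<pi> ` Zx i = carrier (TorP i)"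
    unfolding TorP_def Qz.quotient_carrier \<pi>_def using Zr by auto
  have FK: "vectorspace K (F i)" by (rule module_vectorspace[OF Fm])
  note ZK = submodule_ground[OF Zx_submodule] and BK = submodule_ground[OF Bx_submodule]
  have T: "(TorP i)\<lparr>carrier := \<pi> ` Zx i\<rparr> = TorP i" unfolding im by simp
  show "vectorspace.fin_dim K (TorP i) \<longleftrightarrow> finq K (F i) (Zx i) (Bx i)"
    using image_presentation(1)[OF FK ZK TK pi_cl pi_add pi_sm BK Bx_Zx ker] T by simp
  show "vectorspace.dim K (TorP i) = dimq K (F i) (Zx i) (Bx i)" if "finq K (F i) (Zx i) (Bx i)"
    using image_presentation(2)[OF FK ZK TK pi_cl pi_add pi_sm BK Bx_Zx ker that] T by simp
  have gK: "submodule K (gF i j) (F i)" by (rule Fi.B_submodule_K)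

  have imj: "\<pi> ` (Zx i \<inter> gF i j) = TorP_grading i j"
  proof (intro equalityI subsetI)
    fix X assume "X \<in> \<pi> ` (Zx i \<inter> gF i j)"
    then obtain x where "x \<in> Zx i" "x \<in> gF i j" "X = \<pi> x" by blast
    then show "X \<in> TorP_grading i j" unfolding TorP_grading_def red_grading_def \<pi>_def using clZ(1) by blast
  next
    fix X assume "X \<in> TorP_grading i j"
    then obtain x where x: "x \<in> gF i j" "?cl x \<in> ?Zr" "X = \<pi> x"
      unfolding TorP_grading_def red_grading_def \<pi>_def by blast
    \<comment> \<open>Only the class of \<open>x\<close> is known to be a cycle: \<open>x\<close>
      differs from a member of \<open>Zx i\<close> by an element of \<open>m i\<close>, and
      \<open>m i\<close> lies in \<open>Zx i\<close>.\<close>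
    then obtain y where y: "y \<in> Zx i" "?cl x = ?cl y" unfolding Zr by blast
    have "x \<ominus>\<^bsub>F i\<^esub> y \<in> m i"
      using y Fi.N.coset_eq_iff[OF m_submodule gF_carrier[OF x(1)] clZ(2)[OF y(1)]] by simp
    moreover have "m i \<subseteq> Zx i" using bd_m by (auto simp: Zx_def m_carrier)
    ultimately have "(x \<ominus>\<^bsub>F i\<^esub> y) \<oplus>\<^bsub>F i\<^esub> y \<in> Zx i" using y Zx_submodule unfolding submodule_def by blast
    then have "x \<in> Zx i" using Fi.N.minus_add_cancel[OF gF_carrier[OF x(1)] clZ(2)[OF y(1)]] by (simp del: free_simps)
    then show "X \<in> \<pi> ` (Zx i \<inter> gF i j)" using x by blast
  qed
  have ker': "\<pi> x = \<zero>\<^bsub>TorP i\<^esub> \<longleftrightarrow> x \<in> Bx i \<inter> gF i j" if "x \<in> Zx i \<inter> gF i j" for x using ker that by blast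
  show "vectorspace.dim K ((TorP i)\<lparr>carrier := TorP_grading i j\<rparr>) = dimq K (F i) (Zx i \<inter> gF i j) (Bx i \<inter> gF i j)"
    if "finq K (F i) (Zx i \<inter> gF i j) (Bx i \<inter> gF i j)"
  proof -
    have 1: "\<pi> x \<in> carrier (TorP i)" if "x \<in> Zx i \<inter> gF i j" for x using pi_cl[of x] that by simp
    have 2: "\<pi> (x \<oplus>\<^bsub>F i\<^esub> y) = \<pi> x \<oplus>\<^bsub>TorP i\<^esub> \<pi> y" if "x \<in> Zx i \<inter> gF i j" "y \<in> Zx i \<inter> gF i j" for x y
      using pi_add[of x y] that by (simp del: free_simps)
    have 3: "\<pi> (b \<odot>\<^bsub>F i\<^esub> x) = b \<odot>\<^bsub>TorP i\<^esub> \<pi> x" if "b \<in> carrier K" "x \<in> Zx i \<inter> gF i j" for b x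
      using pi_sm[of b x] that by (simp del: free_simps)
    have 4: "Bx i \<inter> gF i j \<subseteq> Zx i \<inter> gF i j" using Bx_Zx by blast
    show ?thesis
      using image_presentation(2)[OF FK Fi.NK.submodule_Int[OF ZK gK] TK 1 2 3 Fi.NK.submodule_Int[OF BK gK] 4 ker' that]
      unfolding imj .
  qed
qed

end

section \<open>Homology of a module tensored with the resolution of the residue field\<close>

context kres begin

lemma C_gr: "w \<in> C M D b j \<Longrightarrow> f \<in> J b \<Longrightarrow> e b f \<le> j \<Longrightarrow> w f \<in> D (j - e b f)"
  by (auto simp: fam_grading_def)

lemma C_zero: "w \<in> C M D b j \<Longrightarrow> \<not> (f \<in> J b \<and> e b f \<le> j) \<Longrightarrow> w f = \<zero>\<^bsub>M\<^esub>"
  by (cases "f \<in> J b") (auto simp: fam_grading_def fam_carrier_iff)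

lemma CI:
  assumes "graded_mod R A M D" "\<And>f. f \<in> J b \<Longrightarrow> e b f \<le> j \<Longrightarrow> w f \<in> D (j - e b f)"
    "\<And>f. \<not> (f \<in> J b \<and> e b f \<le> j) \<Longrightarrow> w f = \<zero>\<^bsub>M\<^esub>"
  shows "w \<in> C M D b j"
proof -
  interpret M: graded_mod R A M D by fact
  have "w f \<in> carrier M" for f using assms(2,3)[of f] M.B.A_carrier by (cases "f \<in> J b \<and> e b f \<le> j") auto
  then show ?thesis using assms(2,3) by (auto simp: fam_grading_def fam_carrier_finite[OF finJ])
qed

end

locale kmod = kres R A J e \<kappa> + graded_mod R A N B
  for R :: "('a, 'x) ring_scheme" and A J e \<kappa> and N :: "('a, 'b, 'y) module_scheme" (structure) and B
begin

lemma dK_zero: "dK N b (\<lambda>_. \<zero>) = (\<lambda>_. \<zero>)"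
proof
  fix c
  have "(\<Oplus>f\<in>J (Suc b). \<kappa> b c f \<odot> \<zero>) = (\<Oplus>f\<in>J (Suc b). \<zero>)" if "c \<in> J b"
    using \<kappa>_carrier[OF that] by (intro N.M.finsum_cong') auto
  then show "dK N b (\<lambda>_. \<zero>) c = \<zero>" by (simp add: tmap_def)
qed

text \<open>Cycles and boundaries of \<open>N \<otimes> K\<close> in homological degree
  \<open>i\<close> and internal degree \<open>j\<close>; for \<open>i = 0\<close> everything is a
  cycle.\<close>

definition "Zt i j = {y \<in> C N B i j. \<forall>b. i = Suc b \<longrightarrow> dK N b y = (\<lambda>_. \<zero>)}"
definition "Bt i j = dK N i ` C N B (Suc i) j"

lemma famN: "graded_mod R A (fam N (J i)) (C N B i)" by (rule fam_graded)

lemma Zt_submodule: "submodule K (Zt i j) (fam N (J i))"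
proof -
  interpret FC: graded_mod R A "fam N (J i)" "C N B i" by (rule famN)
  note s = FC.B_submodule_K[of j, unfolded submodule_def]
  show ?thesis unfolding submodule_def
  proof (intro conjI allI impI)
    show "Zt i j \<subseteq> carrier (fam N (J i))" using C_carrier unfolding Zt_def by blast
    show "v \<oplus>\<^bsub>fam N (J i)\<^esub> w \<in> Zt i j" if "v \<in> Zt i j" "w \<in> Zt i j" for v w
    proof -
      have c: "v \<in> C N B i j" "w \<in> C N B i j" using that by (auto simp: Zt_def)
      then have "v \<oplus>\<^bsub>fam N (J i)\<^esub> w \<in> C N B i j" using s by blast
      moreover have "dK N b (v \<oplus>\<^bsub>fam N (J i)\<^esub> w) = (\<lambda>_. \<zero>)" if i: "i = Suc b" for b
        using matrix_map.tmap_add[OF dK_matrix[OF N_module] C_carrier[OF c(1)] C_carrier[OF c(2)], of b] \<open>v \<in> Zt i j\<close> \<open>w \<in> Zt i j\<close> i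
        by (simp add: Zt_def)
      ultimately show ?thesis by (simp add: Zt_def)
    qed
    show "x \<odot>\<^bsub>fam N (J i)\<^esub> v \<in> Zt i j" if x: "x \<in> carrier K" and v: "v \<in> Zt i j" for x v
    proof -
      have c: "v \<in> C N B i j" using v by (auto simp: Zt_def)
      then have "x \<odot>\<^bsub>fam N (J i)\<^esub> v \<in> C N B i j" using s x by blast
      moreover have "dK N b (x \<odot>\<^bsub>fam N (J i)\<^esub> v) = (\<lambda>_. \<zero>)" if i: "i = Suc b" for b
        using matrix_map.tmap_smult[OF dK_matrix[OF N_module] C_carrier[OF c], of x b] v i x
        by (simp add: Zt_def A.A_carrier)
      ultimately show ?thesis by (simp add: Zt_def)
    qed
    have "dK N b (\<lambda>_. \<zero>) = (\<lambda>_. \<zero>)" if "i = Suc b" for b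
      by (rule dK_zero)
    moreover have "(\<lambda>_. \<zero>) \<in> C N B i j" using s by simp
    ultimately show "\<zero>\<^bsub>fam N (J i)\<^esub> \<in> Zt i j" by (simp add: Zt_def)
  qed (rule FC.NK.module_axioms)
qed

lemma Bt_submodule: "submodule K (Bt i j) (fam N (J i))"
proof -
  interpret FC: graded_mod R A "fam N (J i)" "C N B i" by (rule famN)
  interpret FD: graded_mod R A "fam N (J (Suc i))" "C N B (Suc i)" by (rule famN)
  interpret mm: matrix_map R N "J i" "J (Suc i)" "\<kappa> i" by (rule dK_matrix[OF N_module])
  note s = FD.B_submodule_K[of j, unfolded submodule_def]
  show ?thesis unfolding submodule_def Bt_def
  proof (intro conjI allI impI)
    show "dK N i ` C N B (Suc i) j \<subseteq> carrier (fam N (J i))" using mm.tmap_closed[OF C_carrier] by blast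
    fix v w assume "v \<in> dK N i ` C N B (Suc i) j" "w \<in> dK N i ` C N B (Suc i) j"
    then obtain x y where xy: "x \<in> C N B (Suc i) j" "y \<in> C N B (Suc i) j" "v = dK N i x" "w = dK N i y" by blast
    have "v \<oplus>\<^bsub>fam N (J i)\<^esub> w = dK N i (x \<oplus>\<^bsub>fam N (J (Suc i))\<^esub> y)"
      unfolding xy(3,4) by (rule mm.tmap_add[OF C_carrier[OF xy(1)] C_carrier[OF xy(2)], symmetric])
    moreover have "x \<oplus>\<^bsub>fam N (J (Suc i))\<^esub> y \<in> C N B (Suc i) j" by (rule FD.B.A_add[OF xy(1,2)])
    ultimately show "v \<oplus>\<^bsub>fam N (J i)\<^esub> w \<in> dK N i ` C N B (Suc i) j" by (rule image_eqI)
  next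
    fix x v assume x: "x \<in> carrier K" and "v \<in> dK N i ` C N B (Suc i) j"
    then obtain y where y: "y \<in> C N B (Suc i) j" "v = dK N i y" by blast
    have "x \<odot>\<^bsub>fam N (J i)\<^esub> v = dK N i (x \<odot>\<^bsub>fam N (J (Suc i))\<^esub> y)"
      unfolding y(2) by (rule mm.tmap_smult[OF C_carrier[OF y(1)], symmetric]) (use x in \<open>simp add: A.A_carrier\<close>)
    moreover have "x \<odot>\<^bsub>fam N (J (Suc i))\<^esub> y \<in> C N B (Suc i) j" using s x y(1) by (simp del: fam_simps)
    ultimately show "x \<odot>\<^bsub>fam N (J i)\<^esub> v \<in> dK N i ` C N B (Suc i) j" by (rule image_eqI)
  next
    have "dK N i (\<lambda>_. \<zero>) = (\<lambda>_. \<zero>)"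
      by (rule dK_zero)
    moreover have "(\<lambda>_. \<zero>) \<in> C N B (Suc i) j" using s by simp
    ultimately have "(\<lambda>_. \<zero>) \<in> dK N i ` C N B (Suc i) j" by (intro image_eqI[OF sym])
    then show "\<zero>\<^bsub>fam N (J i)\<^esub> \<in> dK N i ` C N B (Suc i) j" by simp
  qed (rule FC.NK.module_axioms)
qed

lemma Bt_Zt: "Bt i j \<subseteq> Zt i j"
proof
  fix y assume "y \<in> Bt i j"
  then obtain z where z: "z \<in> C N B (Suc i) j" "y = dK N i z" by (auto simp: Bt_def)
  have "dK N b y = (\<lambda>_. \<zero>)" if "i = Suc b" for b
    using dK_dK[OF N_module, of z b] C_carrier[OF z(1)] z(2) that by simp
  then show "y \<in> Zt i j" using dK_grading[OF graded_mod_axioms z(1)] z(2) by (simp add: Zt_def)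
qed

end

locale tor_setup = kmod R A J e \<kappa> N B + resolved R A N B P
  for R :: "('a, 'x) ring_scheme" and A J e \<kappa> and N :: "('a, 'b, 'y) module_scheme" (structure) and B P
begin

text \<open>The ambient space for the double complex of all \<open>F a\<close> tensored with the
  modules of \<open>K\<close>. The index sets vary with the position, so both are enlarged to all
  natural numbers.\<close>

abbreviation "Amb \<equiv> fam (free_module R UNIV) UNIV"
text \<open>The identification of a free module \<open>F\<close> with the bottom term of
  \<open>F \<otimes> K\<close>, where the only basis element of \<open>K\<close> has index 0 and
  degree 0.\<close>

definition "single x = (\<lambda>f :: nat. if f = 0 then x else (\<lambda>_ :: nat. \<zero>\<^bsub>R\<^esub>))"

lemma Amb_vectorspace: "vectorspace K Amb"
  by (intro module_vectorspace fam_module free_module_module R_cring)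

lemma Amb_simps [simp]:
  "\<zero>\<^bsub>Amb\<^esub> = (\<lambda>_ _. \<zero>\<^bsub>R\<^esub>)" "v \<oplus>\<^bsub>Amb\<^esub> w = (\<lambda>f c. v f c \<oplus>\<^bsub>R\<^esub> w f c)" "a \<odot>\<^bsub>Amb\<^esub> v = (\<lambda>f c. a \<otimes>\<^bsub>R\<^esub> v f c)"
  by simp_all

lemma Camb: "C (F a) (gF a) b j \<subseteq> carrier Amb"
  by (auto simp: fam_grading_def fam_carrier_iff free_carrier_iff)

lemma C_submodule: "submodule K (C (F a) (gF a) b j) Amb"
proof -
  interpret FC: graded_mod R A "fam (F a) (J b)" "C (F a) (gF a) b"
    by (rule graded_mod.fam_graded[OF Fgm])
  have "submodule K (C (F a) (gF a) b j) (fam (F a) (J b))" by (rule FC.B_submodule_K)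
  then show ?thesis
    using Camb[of a b j] Amb_vectorspace by (simp add: submodule_def vectorspace_def)
qed

lemma C_apply: "w \<in> C (F a) (gF a) b j \<Longrightarrow> w f \<in> carrier (F a)"
  by (simp add: fam_grading_def fam_carrier_iff)

lemma bd_C:
  assumes w: "w \<in> C (F (Suc a)) (gF (Suc a)) b j" shows "(\<lambda>f. bd a (w f)) \<in> C (F a) (gF a) b j"
proof (rule CI[OF Fgm])
  show "bd a (w f) \<in> gF a (j - e b f)" if "f \<in> J b" "e b f \<le> j" for f
    by (rule res_props(3)[OF C_gr[OF w that]])
  show "bd a (w f) = \<zero>\<^bsub>F a\<^esub>" if "\<not> (f \<in> J b \<and> e b f \<le> j)" for f
    using C_zero[OF w that] bd_zero by simp
qed

lemma aug_C:
  assumes w: "w \<in> C (F 0) (gF 0) b j" shows "(\<lambda>f. aug (w f)) \<in> C N B b j"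
proof (rule CI[OF graded_mod_axioms])
  show "aug (w f) \<in> B (j - e b f)" if "f \<in> J b" "e b f \<le> j" for f
    by (rule res_props(4)[OF C_gr[OF w that]])
  show "aug (w f) = \<zero>" if "\<not> (f \<in> J b \<and> e b f \<le> j)" for f
    using C_zero[OF w that] aug_zero by simp
qed

text \<open>Tensoring with a finite free module of \<open>K\<close> preserves exactness of the other
  complex: preimages are chosen coordinatewise, with zero in the coordinates that must
  vanish.\<close>

lemma lift_C:
  assumes w: "w \<in> C M D b j" and M': "graded_mod R A M' D'" and h0: "h \<zero>\<^bsub>M'\<^esub> = \<zero>\<^bsub>M\<^esub>"
    and ex: "\<And>f. f \<in> J b \<Longrightarrow> e b f \<le> j \<Longrightarrow> \<exists>t\<in>D' (j - e b f). h t = w f"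
  shows "\<exists>t\<in>C M' D' b j. \<forall>f. h (t f) = w f"
proof -
  have "\<forall>f. \<exists>t. (f \<in> J b \<and> e b f \<le> j \<longrightarrow> t \<in> D' (j - e b f) \<and> h t = w f) \<and> (\<not> (f \<in> J b \<and> e b f \<le> j) \<longrightarrow> t = \<zero>\<^bsub>M'\<^esub>)"
  proof
    fix f
    show "\<exists>t. (f \<in> J b \<and> e b f \<le> j \<longrightarrow> t \<in> D' (j - e b f) \<and> h t = w f) \<and> (\<not> (f \<in> J b \<and> e b f \<le> j) \<longrightarrow> t = \<zero>\<^bsub>M'\<^esub>)"
      using ex[of f] by (cases "f \<in> J b \<and> e b f \<le> j") auto
  qed
  from choice[OF this] obtain t where t: "\<forall>f. (f \<in> J b \<and> e b f \<le> j \<longrightarrow> t f \<in> D' (j - e b f) \<and> h (t f) = w f) \<and>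
    (\<not> (f \<in> J b \<and> e b f \<le> j) \<longrightarrow> t f = \<zero>\<^bsub>M'\<^esub>)" ..
  have "t \<in> C M' D' b j" by (rule CI[OF M']) (use t in auto)
  moreover have "h (t f) = w f" for f
    using t h0 C_zero[OF w, of f] by (cases "f \<in> J b \<and> e b f \<le> j") auto
  ultimately show ?thesis by blast
qed

lemma dK_bd:
  assumes w: "w \<in> C (F (Suc a)) (gF (Suc a)) (Suc b) j"
  shows "(\<lambda>f. bd a (dK (F (Suc a)) b w f)) = dK (F a) b (\<lambda>f. bd a (w f))"
proof
  fix f
  show "bd a (dK (F (Suc a)) b w f) = dK (F a) b (\<lambda>f. bd a (w f)) f"
    by (rule tmap_natural[OF dK_matrix[OF Fm] Fm])
      (use bd_hom C_apply[OF w] in \<open>auto simp del: free_simps\<close>)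
qed

lemma dK_aug:
  assumes w: "w \<in> C (F 0) (gF 0) (Suc b) j"
  shows "(\<lambda>f. aug (dK (F 0) b w f)) = dK N b (\<lambda>f. aug (w f))"
proof
  fix f
  show "aug (dK (F 0) b w f) = dK N b (\<lambda>f. aug (w f)) f"
    by (rule tmap_natural[OF dK_matrix[OF Fm] N_module])
      (use aug_hom C_apply[OF w] in \<open>auto simp del: free_simps\<close>)
qed

text \<open>In each degree \<open>j\<close>, rows are exact because the modules of \<open>K\<close>
  are free, columns because the modules \<open>F a\<close> are free.\<close>

lemma staircase_dcx: "dcx K Amb (\<lambda>a b. C (F a) (gF a) b j) (\<lambda>a b w f. bd a (w f)) (\<lambda>a b. dK (F a) b)"
proof (intro dcx.intro dcx_axioms.intro Amb_vectorspace)
  show "submodule K (C (F a) (gF a) b j) Amb" for a b by (rule C_submodule)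
  show "(\<lambda>f. bd a (w f)) \<in> C (F a) (gF a) b j" if "w \<in> C (F (Suc a)) (gF (Suc a)) b j" for a b w
    using that by (rule bd_C)
  show "(\<lambda>f. bd a ((w \<oplus>\<^bsub>Amb\<^esub> w') f)) = (\<lambda>f. bd a (w f)) \<oplus>\<^bsub>Amb\<^esub> (\<lambda>f. bd a (w' f))"
    if "w \<in> C (F (Suc a)) (gF (Suc a)) b j" "w' \<in> C (F (Suc a)) (gF (Suc a)) b j" for a b w w'
    using bd_hom(2)[OF C_apply[OF that(1)] C_apply[OF that(2)]] by simp
  show "(\<lambda>f. bd a ((x \<odot>\<^bsub>Amb\<^esub> w) f)) = x \<odot>\<^bsub>Amb\<^esub> (\<lambda>f. bd a (w f))"
    if "x \<in> carrier K" "w \<in> C (F (Suc a)) (gF (Suc a)) b j" for a b w x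
    using bd_hom(3)[OF _ C_apply[OF that(2)], of x] that(1) by (simp add: A.A_carrier)
  show "dK (F a) b w \<in> C (F a) (gF a) b j" if "w \<in> C (F a) (gF a) (Suc b) j" for a b w
    by (rule dK_grading[OF Fgm that])
  show "dK (F a) b (w \<oplus>\<^bsub>Amb\<^esub> w') = dK (F a) b w \<oplus>\<^bsub>Amb\<^esub> dK (F a) b w'"
    if "w \<in> C (F a) (gF a) (Suc b) j" "w' \<in> C (F a) (gF a) (Suc b) j" for a b w w'
    using matrix_map.tmap_add[OF dK_matrix[OF Fm] C_carrier[OF that(1)] C_carrier[OF that(2)]] by simp
  show "dK (F a) b (x \<odot>\<^bsub>Amb\<^esub> w) = x \<odot>\<^bsub>Amb\<^esub> dK (F a) b w"
    if "x \<in> carrier K" "w \<in> C (F a) (gF a) (Suc b) j" for a b w x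
    using matrix_map.tmap_smult[OF dK_matrix[OF Fm] C_carrier[OF that(2)], of x] that(1) by (simp add: A.A_carrier)
  show "(\<lambda>f. bd a (dK (F (Suc a)) b w f)) = dK (F a) b (\<lambda>f. bd a (w f))"
    if "w \<in> C (F (Suc a)) (gF (Suc a)) (Suc b) j" for a b w using that by (rule dK_bd)
  show "(\<lambda>f. bd a (bd (Suc a) (w f))) = \<zero>\<^bsub>Amb\<^esub>" if "w \<in> C (F (Suc (Suc a))) (gF (Suc (Suc a))) b j" for a b w
    using bd_bd[OF C_apply[OF that]] by simp
  show "dK (F a) b (dK (F a) (Suc b) w) = \<zero>\<^bsub>Amb\<^esub>" if "w \<in> C (F a) (gF a) (Suc (Suc b)) j" for a b w
    using dK_dK[OF Fm C_carrier[OF that]] by simp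
  show "\<exists>t\<in>C (F (Suc (Suc a))) (gF (Suc (Suc a))) b j. (\<lambda>f. bd (Suc a) (t f)) = w"
    if w: "w \<in> C (F (Suc a)) (gF (Suc a)) b j" "(\<lambda>f. bd a (w f)) = \<zero>\<^bsub>Amb\<^esub>" for a b w
  proof -
    have "bd a (w f) = (\<lambda>_. \<zero>\<^bsub>R\<^esub>)" for f using fun_cong[OF w(2), of f] by simp
    then have "\<exists>t\<in>C (F (Suc (Suc a))) (gF (Suc (Suc a))) b j. \<forall>f. bd (Suc a) (t f) = w f"
      by (intro lift_C[OF w(1) Fgm] bd_exact C_gr[OF w(1)]) (simp_all add: bd_zero)
    then show ?thesis by (auto simp: fun_eq_iff)
  qed
  show "\<exists>t\<in>C (F a) (gF a) (Suc (Suc b)) j. dK (F a) (Suc b) t = w"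
    if "w \<in> C (F a) (gF a) (Suc b) j" "dK (F a) b w = \<zero>\<^bsub>Amb\<^esub>" for a b w
    using free_exact[OF that(1)] that(2) by simp
qed

lemma single_C: "x \<in> gF a j \<Longrightarrow> single x \<in> C (F a) (gF a) 0 j"
  by (rule CI[OF Fgm]) (auto simp: single_def J0 e0)

lemma C_single: "w \<in> C (F a) (gF a) 0 j \<Longrightarrow> w 0 \<in> gF a j \<and> w = single (w 0)"
  using C_gr[of w "F a" "gF a" 0 j 0] C_zero[of w "F a" "gF a" 0 j] by (auto simp: single_def J0 e0)

text \<open>The vertical boundaries on the edge \<open>b = 0\<close> come from the irrelevant ideal
  times \<open>F a\<close>, so this edge carries the resolution \<open>P\<close> modulo that ideal.
  \<open>\<kappa>_Irr\<close> gives one inclusion, \<open>free_onto\<close> the other.\<close>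

lemma imv_single:
  "dK (F a) 0 ` C (F a) (gF a) (Suc 0) j = single ` (m a \<inter> gF a j)"
proof (intro equalityI subsetI)
  fix w assume "w \<in> dK (F a) 0 ` C (F a) (gF a) (Suc 0) j"
  then obtain z where z: "z \<in> C (F a) (gF a) (Suc 0) j" "w = dK (F a) 0 z" by blast
  have w: "w 0 \<in> gF a j" "w = single (w 0)" using C_single[OF dK_grading[OF Fgm z(1)]] z(2) by auto
  interpret Fa: Module.module R "F a" by (rule Fm)
  have "w 0 = (\<Oplus>\<^bsub>F a\<^esub>f\<in>J (Suc 0). \<kappa> 0 0 f \<odot>\<^bsub>F a\<^esub> z f)" by (simp add: z(2) tmap_def J0)
  also have "\<dots> \<in> m a"
  proof (rule Fa.submodule_finsum_closed[OF m_submodule])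
    fix f assume f: "f \<in> J (Suc 0)"
    then have "\<kappa> 0 0 f \<in> Irr" by (rule \<kappa>_Irr)
    then show "\<kappa> 0 0 f \<odot>\<^bsub>F a\<^esub> z f \<in> m a" by (rule m_smult[OF _ C_apply[OF z(1)]])
  qed
  finally show "w \<in> single ` (m a \<inter> gF a j)" using w by blast
next
  fix w assume "w \<in> single ` (m a \<inter> gF a j)"
  then obtain x where x: "x \<in> m a" "x \<in> gF a j" "w = single x" by blast
  have "\<exists>z\<in>C (F a) (gF a) (Suc 0) j. dK (F a) 0 z = w"
    unfolding x(3) single_def using free_onto[OF x(2)] x(1) by (simp add: mP_iff)
  then show "w \<in> dK (F a) 0 ` C (F a) (gF a) (Suc 0) j" by blast
qed

lemma bd_single: "(\<lambda>f. bd a (single x f)) = single (bd a x)"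
  by (auto simp: single_def bd_zero)

lemma single_inj: "single x = single y \<longleftrightarrow> x = y"
  by (auto simp: single_def fun_eq_iff)

text \<open>Balance of Tor: at the end \<open>b = 0\<close> of the diagonal, \<open>single\<close>
  turns the staircase quotient into \<open>Zx / Bx\<close> in degree \<open>j\<close>; at the end
  \<open>a = 0\<close>, the augmentation turns it into \<open>Zt / Bt\<close>. The latter does not
  mention \<open>P\<close>, so all resolutions give the same dimension.\<close>

theorem Tor_via_residue_field:
  "(finq K (F i) (Zx i \<inter> gF i j) (Bx i \<inter> gF i j) \<longleftrightarrow> finq K (fam N (J i)) (Zt i j) (Bt i j)) \<and>
   (finq K (F i) (Zx i \<inter> gF i j) (Bx i \<inter> gF i j) \<longrightarrow>
     dimq K (F i) (Zx i \<inter> gF i j) (Bx i \<inter> gF i j) = dimq K (fam N (J i)) (Zt i j) (Bt i j))"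
proof -
  let ?G = "\<lambda>a b. C (F a) (gF a) b j"
  interpret D: dcx K Amb ?G "\<lambda>a b w f. bd a (w f)" "\<lambda>a b. dK (F a) b" by (rule staircase_dcx)
  interpret Fi: graded_mod R A "F i" "gF i" by (rule Fgm)
  interpret FC: graded_mod R A "fam N (J i)" "C N B i" by (rule famN)
  have imv: "D.imv a 0 = single ` (m a \<inter> gF a j)" for a unfolding D.imv_def by (rule imv_single)
  have Zc0: "single x \<in> D.Zc i 0 \<longleftrightarrow> x \<in> Zx i" if x: "x \<in> gF i j" for x
  proof -
    have "single (bd a x) \<in> single ` (m a \<inter> gF a j) \<longleftrightarrow> bd a x \<in> m a" if "i = Suc a" for a
      using res_props(3)[of x a j] x that by (auto simp: single_inj)
    then show ?thesis using single_C[OF x] gF_carrier[OF x] by (auto simp: D.Zc_def imv bd_single Zx_def)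
  qed
  have Bd0: "single x \<in> D.Bd i 0 \<longleftrightarrow> x \<in> Bx i" if x: "x \<in> gF i j" for x
  proof
    assume "single x \<in> D.Bd i 0"
    then obtain t s where ts: "t \<in> ?G (Suc i) 0" "s \<in> ?G i (Suc 0)" "single x = (\<lambda>f. bd i (t f)) \<oplus>\<^bsub>Amb\<^esub> dK (F i) 0 s"
      unfolding D.Bd_def by blast
    obtain y where y: "y \<in> m i" "dK (F i) 0 s = single y" using imv_single[of i j] ts(2) by blast
    have "x = bd i (t 0) \<oplus>\<^bsub>F i\<^esub> y" using fun_cong[OF ts(3), of 0] y(2) by (simp add: single_def)
    then show "x \<in> Bx i" unfolding Bx_eq set_add_iff using y(1) C_apply[OF ts(1)] by blast
  next
    assume "x \<in> Bx i"
    then obtain t y where t: "t \<in> carrier (F (Suc i))" "y \<in> m i" "x = bd i t \<oplus>\<^bsub>F i\<^esub> y"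
      unfolding Bx_eq set_add_iff by blast
    let ?t = "component (F (Suc i)) (gF (Suc i)) t j" and ?y = "Fi.B.cmp y j"
    have "x = bd i ?t \<oplus>\<^bsub>F i\<^esub> ?y"
      using Fi.B.comp_add[OF bd_hom(1)[OF t(1)] m_carrier[OF t(2)], of j] bd_comp[OF t(1), of j] comp_self[OF x] t(3) by simp
    then have "single x = (\<lambda>f. bd i (single ?t f)) \<oplus>\<^bsub>Amb\<^esub> single ?y" by (auto simp: single_def bd_zero fun_eq_iff)
    moreover from t have "single ?y \<in> dK (F i) 0 ` ?G i (Suc 0)"
      unfolding imv_single using m_comp[OF t(2)] comp_in[OF m_carrier[OF t(2)]] by blast
    then obtain s where s: "s \<in> ?G i (Suc 0)" "single ?y = dK (F i) 0 s" by blast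
    ultimately have "single x = (\<lambda>f. bd i (single ?t f)) \<oplus>\<^bsub>Amb\<^esub> dK (F i) 0 s" by simp
    moreover have "single ?t \<in> ?G (Suc i) 0" by (rule single_C[OF comp_in[OF t(1)]])
    ultimately show "single x \<in> D.Bd i 0" unfolding D.Bd_def using s(1) by blast
  qed
  have FK: "vectorspace K (F i)" by (rule Fi.N_vectorspace)
  note Zs = Fi.NK.submodule_Int[OF submodule_ground[OF Zx_submodule[of i]] Fi.B_submodule_K[of j]]
    and Bs = Fi.NK.submodule_Int[OF submodule_ground[OF Bx_submodule[of i]] Fi.B_submodule_K[of j]]
  have BZ: "Bx i \<inter> gF i j \<subseteq> Zx i \<inter> gF i j" using Bx_Zx by blast
  let ?L = "\<lambda>x w. x \<in> gF i j \<and> w = single x"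
  have L: "linrel K (F i) Amb ?L"
    unfolding linrel_def
  proof (intro conjI allI impI)
    note g = Fi.B_submodule_K[of j, unfolded submodule_def]
    show "v \<in> carrier (F i)" "w \<in> carrier Amb" if "?L v w" for v w
      using that gF_carrier[of v i j] single_C[of v i j] Camb by auto
    show "v \<oplus>\<^bsub>F i\<^esub> v' \<in> gF i j" "w \<oplus>\<^bsub>Amb\<^esub> w' = single (v \<oplus>\<^bsub>F i\<^esub> v')" if "?L v w" "?L v' w'" for v w v' w'
      using that g by (auto simp: single_def fun_eq_iff)
    show "x \<odot>\<^bsub>F i\<^esub> v \<in> gF i j" "x \<odot>\<^bsub>Amb\<^esub> w = single (x \<odot>\<^bsub>F i\<^esub> v)" if "x \<in> carrier K" "?L v w" for x v w
      using that g A.A_carrier[of x 0] by (auto simp: single_def fun_eq_iff)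
  qed
  have t1: "\<exists>w\<in>D.Zc i 0. ?L x w" if "x \<in> Zx i \<inter> gF i j" for x using Zc0[of x] that by blast
  have t2: "\<exists>x\<in>Zx i \<inter> gF i j. ?L x w" if w: "w \<in> D.Zc i 0" for w
  proof -
    have "w 0 \<in> gF i j" "w = single (w 0)" using C_single[of w i j] w by (auto simp: D.Zc_def)
    then show ?thesis using Zc0[of "w 0"] w by (intro bexI[of _ "w 0"]) auto
  qed
  have inj: "x \<in> Bx i \<inter> gF i j \<longleftrightarrow> w \<in> D.Bd i 0" if "?L x w" for x w using Bd0[of x] that by auto
  have 1: "finq K (F i) (Zx i \<inter> gF i j) (Bx i \<inter> gF i j) \<longleftrightarrow> finq K Amb (D.Zc i 0) (D.Bd i 0)"
    by (rule dimq_eq(1)[OF FK Zs Bs BZ Amb_vectorspace D.Zc_submodule D.Bd_submodule D.Bd_subset L t1 t2 inj])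
  have 2: "dimq K (F i) (Zx i \<inter> gF i j) (Bx i \<inter> gF i j) = dimq K Amb (D.Zc i 0) (D.Bd i 0)"
    if "finq K (F i) (Zx i \<inter> gF i j) (Bx i \<inter> gF i j)"
    by (rule dimq_eq(2)[OF FK Zs Bs BZ Amb_vectorspace D.Zc_submodule D.Bd_submodule D.Bd_subset L t1 t2 inj that])

  \<comment> \<open>Exactness of \<open>P\<close> at \<open>F 0\<close>, tensored with
    \<open>K\<close>: modulo horizontal boundaries the column \<open>a = 0\<close> is
    \<open>N \<otimes> K\<close>.\<close>
  have ker: "w \<in> D.imh 0 b \<longleftrightarrow> (\<forall>f. aug (w f) = \<zero>)" if w: "w \<in> ?G 0 b" for w b
  proof
    assume "w \<in> D.imh 0 b"
    then show "\<forall>f. aug (w f) = \<zero>" unfolding D.imh_def using aug_bd[OF C_apply] by auto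
  next
    assume "\<forall>f. aug (w f) = \<zero>"
    then have "\<exists>t\<in>?G (Suc 0) b. \<forall>f. bd 0 (t f) = w f"
      by (intro lift_C[OF w Fgm] aug_exact C_gr[OF w]) (simp_all add: bd_zero)
    then obtain t where "t \<in> ?G (Suc 0) b" "w = (\<lambda>f. bd 0 (t f))" by (auto simp: fun_eq_iff)
    then show "w \<in> D.imh 0 b" unfolding D.imh_def by blast
  qed
  let ?M = "\<lambda>w y. w \<in> ?G 0 i \<and> y = (\<lambda>f. aug (w f))"
  have M: "linrel K Amb (fam N (J i)) ?M"
    unfolding linrel_def
  proof (intro conjI allI impI)
    note g = C_submodule[of 0 i j, unfolded submodule_def]
    show "v \<in> carrier Amb" "w \<in> carrier (fam N (J i))" if "?M v w" for v w
      using that Camb aug_C C_carrier by blast+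
    show "v \<oplus>\<^bsub>Amb\<^esub> v' \<in> ?G 0 i" "w \<oplus>\<^bsub>fam N (J i)\<^esub> w' = (\<lambda>f. aug ((v \<oplus>\<^bsub>Amb\<^esub> v') f))" if "?M v w" "?M v' w'" for v w v' w'
    proof -
      show "v \<oplus>\<^bsub>Amb\<^esub> v' \<in> ?G 0 i" using that g by blast
      show "w \<oplus>\<^bsub>fam N (J i)\<^esub> w' = (\<lambda>f. aug ((v \<oplus>\<^bsub>Amb\<^esub> v') f))"
        using that aug_hom(2)[OF C_apply[OF that(1)[THEN conjunct1]] C_apply[OF that(2)[THEN conjunct1]]] by simp
    qed
    show "x \<odot>\<^bsub>Amb\<^esub> v \<in> ?G 0 i" "x \<odot>\<^bsub>fam N (J i)\<^esub> w = (\<lambda>f. aug ((x \<odot>\<^bsub>Amb\<^esub> v) f))" if "x \<in> carrier K" "?M v w" for x v w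
    proof -
      show "x \<odot>\<^bsub>Amb\<^esub> v \<in> ?G 0 i" using that g by blast
      show "x \<odot>\<^bsub>fam N (J i)\<^esub> w = (\<lambda>f. aug ((x \<odot>\<^bsub>Amb\<^esub> v) f))"
        using that aug_hom(3)[OF _ C_apply[OF that(2)[THEN conjunct1]], of x] by (simp add: A.A_carrier)
    qed
  qed
  have ZtI: "(\<lambda>f. aug (w f)) \<in> Zt i j \<longleftrightarrow> w \<in> D.Zc 0 i" if w: "w \<in> ?G 0 i" for w
  proof -
    have "dK N b (\<lambda>f. aug (w f)) = (\<lambda>_. \<zero>) \<longleftrightarrow> dK (F 0) b w \<in> D.imh 0 b" if i: "i = Suc b" for b
    proof -
      have w': "w \<in> ?G 0 (Suc b)" using w i by simp
      show ?thesis unfolding ker[OF dK_grading[OF Fgm w']] dK_aug[OF w', symmetric] fun_eq_iff ..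
    qed
    then show ?thesis using aug_C[OF w] w by (auto simp: Zt_def D.Zc_def)
  qed
  have BtI: "(\<lambda>f. aug (w f)) \<in> Bt i j \<longleftrightarrow> w \<in> D.Bd 0 i" if w: "w \<in> ?G 0 i" for w
  proof
    assume "(\<lambda>f. aug (w f)) \<in> Bt i j"
    then obtain z where z: "z \<in> C N B (Suc i) j" "(\<lambda>f. aug (w f)) = dK N i z" unfolding Bt_def by blast
    \<comment> \<open>The chain \<open>z\<close> lifts along the surjective augmentation to
      \<open>s\<close>; then \<open>w\<close> minus the vertical boundary of \<open>s\<close> is
      killed by the augmentation and hence is a horizontal boundary.\<close>
    have "\<exists>s\<in>?G 0 (Suc i). \<forall>f. aug (s f) = z f"
      by (intro lift_C[OF z(1) Fgm] aug_surj C_gr[OF z(1)]) (simp_all add: aug_zero)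
    then obtain s where s: "s \<in> ?G 0 (Suc i)" "z = (\<lambda>f. aug (s f))" by (auto simp: fun_eq_iff)
    let ?u = "dK (F 0) i s"
    have u: "?u \<in> ?G 0 i" by (rule dK_grading[OF Fgm s(1)])
    have eq: "aug (w f) = aug (?u f)" for f
      using fun_cong[OF z(2), of f] fun_cong[OF dK_aug[OF s(1)], of f] s(2) by simp
    interpret h: mod_hom R "F 0" N aug by (rule res_props(2))
    interpret AmbK: vectorspace K Amb by (rule Amb_vectorspace)
    have wu: "w \<ominus>\<^bsub>Amb\<^esub> ?u \<in> ?G 0 i" by (rule D.G_diff[OF w u])
    have cancel_zero: "x = \<zero>" if "y = x \<oplus> y" "x \<in> carrier N" "y \<in> carrier N" for x y
      using trans[OF N.M.l_zero[OF that(3)] that(1), unfolded N.M.add.right_cancel[OF that(3) N.M.zero_closed that(2)]]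
      by (rule sym)
    have weq: "w = (w \<ominus>\<^bsub>Amb\<^esub> ?u) \<oplus>\<^bsub>Amb\<^esub> ?u"
      by (rule D.minus_add_cancel[OF subsetD[OF Camb w] subsetD[OF Camb u], symmetric])
    have wf: "w f = (w \<ominus>\<^bsub>Amb\<^esub> ?u) f \<oplus>\<^bsub>F 0\<^esub> ?u f" for f
      by (rule trans[OF fun_cong[OF weq, of f]]) simp
    have "aug (w f) = aug ((w \<ominus>\<^bsub>Amb\<^esub> ?u) f) \<oplus> aug (?u f)" for f
      by (rule trans[OF arg_cong[OF wf[of f], of aug] aug_hom(2)[OF C_apply[OF wu] C_apply[OF u]]])
    then have aw: "aug (?u f) = aug ((w \<ominus>\<^bsub>Amb\<^esub> ?u) f) \<oplus> aug (?u f)" for f unfolding eq .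
    have "aug ((w \<ominus>\<^bsub>Amb\<^esub> ?u) f) = \<zero>" for f
      by (rule cancel_zero[OF aw[of f] aug_hom(1)[OF C_apply[OF wu]] aug_hom(1)[OF C_apply[OF u]]])
    then have "w \<ominus>\<^bsub>Amb\<^esub> ?u \<in> D.imh 0 i" using ker[OF wu] by blast
    then obtain t where t: "t \<in> ?G (Suc 0) i" "w \<ominus>\<^bsub>Amb\<^esub> ?u = (\<lambda>f. bd 0 (t f))" unfolding D.imh_def by blast
    have "w = (\<lambda>f. bd 0 (t f)) \<oplus>\<^bsub>Amb\<^esub> ?u"
      using D.minus_add_cancel[OF subsetD[OF Camb w] subsetD[OF Camb u]] unfolding t(2) by (rule sym)
    then show "w \<in> D.Bd 0 i" unfolding D.Bd_def using t(1) s(1) by blast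
  next
    assume "w \<in> D.Bd 0 i"
    then obtain t s where ts: "t \<in> ?G (Suc 0) i" "s \<in> ?G 0 (Suc i)" "w = (\<lambda>f. bd 0 (t f)) \<oplus>\<^bsub>Amb\<^esub> dK (F 0) i s"
      unfolding D.Bd_def by blast
    have "aug (w f) = dK N i (\<lambda>f. aug (s f)) f" for f
    proof -
      have u: "dK (F 0) i s f \<in> carrier (F 0)" by (rule C_apply[OF dK_grading[OF Fgm ts(2)]])
      have "w f = bd 0 (t f) \<oplus>\<^bsub>F 0\<^esub> dK (F 0) i s f" using fun_cong[OF ts(3), of f] by simp
      then have "aug (w f) = aug (bd 0 (t f)) \<oplus> aug (dK (F 0) i s f)"
        using aug_hom(2)[OF bd_hom(1)[OF C_apply[OF ts(1)]] u, of f] by metis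
      then show ?thesis
        using aug_bd[OF C_apply[OF ts(1)], of f] aug_hom(1)[OF u] fun_cong[OF dK_aug[OF ts(2)], of f] by simp
    qed
    then have "(\<lambda>f. aug (w f)) = dK N i (\<lambda>f. aug (s f))" by blast
    then show "(\<lambda>f. aug (w f)) \<in> Bt i j" unfolding Bt_def using aug_C[OF ts(2)] by blast
  qed
  have u1: "\<exists>y\<in>Zt i j. ?M w y" if w: "w \<in> D.Zc 0 i" for w
  proof -
    have "w \<in> ?G 0 i" using w by (simp add: D.Zc_def)
    then show ?thesis using ZtI[of w] w by blast
  qed
  have u2: "\<exists>w\<in>D.Zc 0 i. ?M w y" if y: "y \<in> Zt i j" for y
  proof -
    have yC: "y \<in> C N B i j" using y by (simp add: Zt_def)
    have "\<exists>s\<in>?G 0 i. \<forall>f. aug (s f) = y f"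
      by (intro lift_C[OF yC Fgm] aug_surj C_gr[OF yC]) (simp_all add: aug_zero)
    then obtain s where s: "s \<in> ?G 0 i" "y = (\<lambda>f. aug (s f))" by (auto simp: fun_eq_iff)
    then show ?thesis using ZtI[OF s(1)] y by blast
  qed
  have inj': "w \<in> D.Bd 0 i \<longleftrightarrow> y \<in> Bt i j" if "?M w y" for w y using BtI[of w] that by blast
  have FN: "vectorspace K (fam N (J i))" by (rule FC.N_vectorspace)
  have 3: "finq K Amb (D.Zc 0 i) (D.Bd 0 i) \<longleftrightarrow> finq K (fam N (J i)) (Zt i j) (Bt i j)"
    by (rule dimq_eq(1)[OF Amb_vectorspace D.Zc_submodule D.Bd_submodule D.Bd_subset FN Zt_submodule Bt_submodule Bt_Zt M u1 u2 inj'])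
  have 4: "dimq K Amb (D.Zc 0 i) (D.Bd 0 i) = dimq K (fam N (J i)) (Zt i j) (Bt i j)" if "finq K Amb (D.Zc 0 i) (D.Bd 0 i)"
    by (rule dimq_eq(2)[OF Amb_vectorspace D.Zc_submodule D.Bd_submodule D.Bd_subset FN Zt_submodule Bt_submodule Bt_Zt M u1 u2 inj' that])
  show ?thesis using 1 2 3 4 D.staircase[of i] by argo
qed

end

section \<open>Betti numbers\<close>

text \<open>Serves to treat the irrelevant ideal as a graded module of its own, which can then be
  resolved.\<close>

lemma (in graded_mod) submodule_graded:
  assumes U: "submodule R U N" and hom: "\<And>x j. x \<in> U \<Longrightarrow> B.cmp x j \<in> U"
  shows "graded_mod R A (N\<lparr>carrier := U\<rparr>) (\<lambda>j. B j \<inter> U)"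
proof -
  interpret U: Module.module R "N\<lparr>carrier := U\<rparr>" using U by (rule N.submodule_is_module)
  have UN: "U \<subseteq> carrier N" using U by (auto simp: submodule_def)
  note fs = N.submodule_finsum_eq[OF U]
  have ig: "igrading (N\<lparr>carrier := U\<rparr>) (\<lambda>j. B j \<inter> U)"
  proof (rule igradingI(1)[where pr = B.cmp])
    show "abelian_group (N\<lparr>carrier := U\<rparr>)" ..
    show "additive_subgroup (B i \<inter> U) (N\<lparr>carrier := U\<rparr>)" for i
    proof (rule additive_subgroup.intro, unfold_locales)
      show "inv\<^bsub>add_monoid (N\<lparr>carrier := U\<rparr>)\<^esub> x \<in> B i \<inter> U" if "x \<in> B i \<inter> U" for x
      proof -
        have "\<ominus> x \<in> B i \<inter> U" using that B.A_minus[of x i] N.submodule_minus_closed[OF U] by blast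
        moreover have "(\<ominus> x) \<oplus>\<^bsub>N\<lparr>carrier := U\<rparr>\<^esub> x = \<zero>\<^bsub>N\<lparr>carrier := U\<rparr>\<^esub>"
          using that UN by (auto simp: N.M.l_neg)
        ultimately have "\<ominus>\<^bsub>N\<lparr>carrier := U\<rparr>\<^esub> x = \<ominus> x"
          using that by (intro U.M.minus_equality) auto
        then show ?thesis using \<open>\<ominus> x \<in> B i \<inter> U\<close> by (simp add: a_inv_def)
      qed
    qed (use U in \<open>auto simp: submodule_def B.A_add\<close>)
    show "B.cmp x i \<in> B i \<inter> U" if "x \<in> carrier (N\<lparr>carrier := U\<rparr>)" for x i
      using that hom UN B.comp_props(1) by auto
    show "B.cmp (x \<oplus>\<^bsub>N\<lparr>carrier := U\<rparr>\<^esub> y) i = B.cmp x i \<oplus>\<^bsub>N\<lparr>carrier := U\<rparr>\<^esub> B.cmp y i"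
      if "x \<in> carrier (N\<lparr>carrier := U\<rparr>)" "y \<in> carrier (N\<lparr>carrier := U\<rparr>)" for x y i
      using that UN B.comp_add[of x y i] by auto
    show "B.cmp x i = (if i = j then x else \<zero>\<^bsub>N\<lparr>carrier := U\<rparr>\<^esub>)" if "x \<in> B j \<inter> U" for x i j
      using that B.comp_homog[of x j i] by simp
    show "\<exists>n. (\<forall>i\<ge>n. B.cmp x i = \<zero>\<^bsub>N\<lparr>carrier := U\<rparr>\<^esub>) \<and> (\<Oplus>\<^bsub>N\<lparr>carrier := U\<rparr>\<^esub>i\<in>{..<n}. B.cmp x i) = x"
      if "x \<in> carrier (N\<lparr>carrier := U\<rparr>)" for x
    proof -
      have xU: "x \<in> U" using that by simp
      obtain n where n: "\<And>i. i \<ge> n \<Longrightarrow> B.cmp x i = \<zero>" "(\<Oplus>i\<in>{..<n}. B.cmp x i) = x"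
        using B.comp_bound[of x] xU UN by blast
      have "(\<Oplus>\<^bsub>N\<lparr>carrier := U\<rparr>\<^esub>i\<in>{..<n}. B.cmp x i) = x" using fs[of "{..<n}" "B.cmp x"] hom[OF xU] n(2) by simp
      then show ?thesis using n(1) by auto
    qed
  qed
  show ?thesis
  proof (intro graded_mod.intro graded_mod_axioms.intro graded_alg_axioms, unfold graded_module_def, intro conjI allI ballI)
    show "Module.module R (N\<lparr>carrier := U\<rparr>)" ..
    show "internal_direct_sum (N\<lparr>carrier := U\<rparr>) (\<lambda>j. B j \<inter> U)"
      using ig by (simp add: igrading_def igrading_axioms_def)
    fix i j a x assume "a \<in> A i" "x \<in> B j \<inter> U"
    then show "a \<odot>\<^bsub>N\<lparr>carrier := U\<rparr>\<^esub> x \<in> B (i + j) \<inter> U"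
      using AB_smult[of a i x j] U A.A_carrier[of a i] by (auto simp: submodule_def)
  qed
qed

lemma (in graded_alg) ring_mod_finitely_generated: "finitely_generated R (ring_mod R)"
proof -
  interpret RM: graded_mod R A "ring_mod R" A by (rule ring_graded_mod)
  have "carrier R \<subseteq> RM.N.span {\<one>}"
  proof
    fix a assume a: "a \<in> carrier R"
    have s: "submodule R (RM.N.span {\<one>}) (ring_mod R)" by (rule RM.N.span_is_submodule) simp
    have "\<one> \<in> RM.N.span {\<one>}" using RM.N.in_own_span[of "{\<one>}"] by simp
    moreover have "a \<odot>\<^bsub>ring_mod R\<^esub> y \<in> RM.N.span {\<one>}" if "y \<in> RM.N.span {\<one>}" for y
      using s a that unfolding submodule_def by blast
    ultimately have "a \<odot>\<^bsub>ring_mod R\<^esub> \<one> \<in> RM.N.span {\<one>}" by blast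
    then show "a \<in> RM.N.span {\<one>}" using a by simp
  qed
  then have "RM.N.span {\<one>} = carrier (ring_mod R)" using RM.N.span_is_subset2[of "{\<one>}"] by auto
  then show ?thesis unfolding finitely_generated_def by (intro exI[of _ "{\<one>}"]) simp
qed

lemma finitely_generated_submodule:
  assumes std: "standard_graded_algebra R A" and N: "Module.module R N" "finitely_generated R N" and U: "submodule R U N"
  shows "finitely_generated R (N\<lparr>carrier := U\<rparr>)"
proof -
  interpret N: Module.module R N by fact
  interpret U: Module.module R "N\<lparr>carrier := U\<rparr>" using U by (rule N.submodule_is_module)
  obtain G where G: "finite G" "G \<subseteq> U" and G3: "\<forall>Q. submodule R Q N \<longrightarrow> G \<subseteq> Q \<longrightarrow> U \<subseteq> Q"
    using submodule_finitely_generated[OF std N U] by (elim exE conjE) (rule that)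
  have GN: "G \<subseteq> carrier N" using G(2) U by (auto simp: submodule_def)
  have "U \<subseteq> N.span G" using G3 N.span_is_submodule[OF GN] N.in_own_span[OF GN] by blast
  moreover have "N.span G \<subseteq> U" using N.span_is_subset[OF G(2) U] .
  ultimately have "U.span G = carrier (N\<lparr>carrier := U\<rparr>)" using N.span_li_not_depend(1)[OF G(2) U] by simp
  then show ?thesis unfolding finitely_generated_def using G by auto
qed

text \<open>Resolves the irrelevant ideal as a module and puts \<open>R\<close> in front. The first
  differential is then given by generators of the ideal, which yields \<open>\<kappa>_Irr\<close>
  and \<open>\<kappa>_onto\<close> directly.\<close>

lemma kres_exists:
  fixes R (structure)
  assumes std: "standard_graded_algebra R A"
  shows "\<exists>J e \<kappa>. kres R A J e \<kappa>"
proof -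
  interpret graded_alg R A by (rule standard_graded_alg[OF std])
  interpret RM: graded_mod R A "ring_mod R" A by (rule ring_graded_mod)
  have U: "submodule R Irr (ring_mod R)"
    using RM.N_module by (auto simp: submodule_def Irr_zero Irr_add Irr_mult Irr_carrier)
  define M where "M = (ring_mod R)\<lparr>carrier := Irr\<rparr>"
  define D where "D j = A j \<inter> Irr" for j
  have gM: "graded_mod R A M D"
    unfolding M_def D_def by (rule RM.submodule_graded[OF U]) (simp add: component_ring_mod Irr_comp)
  have fgM: "finitely_generated R M"
    unfolding M_def by (rule finitely_generated_submodule[OF std RM.N_module ring_mod_finitely_generated U])
  interpret M: graded_mod R A M D by (rule gM)
  obtain I d g0 g where fr: "finite_res R A M D I d g0 g" using M.finite_res_exists[OF std fgM] by blast
  note r = finite_resD[OF fr]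
  define P where "P = \<lparr>fr_index = I, fr_shift = d, fr_diff = \<lambda>i. ev (free_module R (I i)) (I (Suc i)) (g i), fr_aug = ev M (I 0) g0\<rparr>"
  interpret P: resolved R A M D P
    by (intro resolved.intro resolved_axioms.intro gM) (unfold P_def, rule M.finite_res_resolution[OF fr])
  have Pi: "fr_index P = I" "fr_shift P = d" "fr_diff P i = ev (free_module R (I i)) (I (Suc i)) (g i)" "fr_aug P = ev M (I 0) g0" for i
    by (simp_all add: P_def)
  have evM: "ev M S h f = (\<Oplus>c\<in>S. f c \<otimes> h c)" if "\<And>c. c \<in> S \<Longrightarrow> h c \<in> Irr" "\<And>c. c \<in> S \<Longrightarrow> f c \<in> carrier R" for S h f
    unfolding ev_def M_def using RM.N.submodule_finsum_eq[OF U, of S "\<lambda>c. f c \<otimes> h c"] that Irr_mult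
    by (simp add: finsum_ring_mod)
  have g0I: "g0 c \<in> Irr" "g0 c \<in> A (d 0 c)" if "c \<in> I 0" for c using r(2)[OF that] by (auto simp: D_def)
  have gc: "g b f \<in> carrier (free_module R (I b))" if "f \<in> I (Suc b)" for b f
    using r(3)[OF that] by (simp add: free_grading_def)
  have gcc: "g b f c \<in> carrier R" if "f \<in> I (Suc b)" for b f c using gc[OF that] by (simp add: free_carrier_iff)
  have evF: "ev (free_module R (I b)) (I (Suc b)) (g b) y c = (\<Oplus>f\<in>I (Suc b). g b f c \<otimes> y f)"
    if "\<And>f. f \<in> I (Suc b) \<Longrightarrow> y f \<in> carrier R" for b y c
  proof -
    interpret Fb: Module.module R "free_module R (I b)" by (rule free_module_module[OF R_cring])
    have "ev (free_module R (I b)) (I (Suc b)) (g b) y c = (\<Oplus>f\<in>I (Suc b). (y f \<odot>\<^bsub>free_module R (I b)\<^esub> g b f) c)"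
      unfolding ev_def by (rule finsum_free[OF R_cring Fb.smult_closed[OF that gc]])
    also have "\<dots> = (\<Oplus>f\<in>I (Suc b). g b f c \<otimes> y f)"
      using that gcc by (intro R.finsum_cong') (auto simp: R.m_comm)
    finally show ?thesis .
  qed
  have ev0: "ev M (I 0) g0 y = (\<Oplus>f\<in>I 0. g0 f \<otimes> y f)" if "\<And>f. f \<in> I 0 \<Longrightarrow> y f \<in> carrier R" for y
    using evM[of "I 0" g0 y] g0I(1) that Irr_carrier
    by (simp, intro R.finsum_cong') (auto simp: R.m_comm)
  have gimg: "ev (free_module R (I b)) (I (Suc b)) (g b) (uvec R f) = g b f" if "f \<in> I (Suc b)" for b f
  proof -
    interpret Fb: Module.module R "free_module R (I b)" by (rule free_module_module[OF R_cring])
    show ?thesis by (rule Fb.ev_uvec[OF r(1) gc that])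
  qed
  have uc: "uvec R f \<in> carrier (free_module R (I b))" if "f \<in> I b" for f b
    by (rule M.N.uvec_carrier[OF that])
  \<comment> \<open>Homological degrees move up by one to make room for \<open>R\<close>, with its
    basis element 0 of degree 0. The augmentation onto the ideal becomes the matrix in step
    0.\<close>
  define J where "J b = (case b of 0 \<Rightarrow> {0} | Suc b' \<Rightarrow> I b')" for b :: nat
  define e where "e b = (case b of 0 \<Rightarrow> (\<lambda>_. 0) | Suc b' \<Rightarrow> d b')" for b :: nat
  define \<kappa> where "\<kappa> b c f = (case b of 0 \<Rightarrow> g0 f | Suc b' \<Rightarrow> g b' f c)" for b c f :: nat
  have [simp]: "J 0 = {0}" "J (Suc b) = I b" "e 0 = (\<lambda>_. 0)" "e (Suc b) = d b" "\<kappa> 0 c f = g0 f" "\<kappa> (Suc b) c f = g b f c" for b c f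
    by (simp_all add: J_def e_def \<kappa>_def)
  have fg: "fam_grading (ring_mod R) A (I b) (d b) j = free_grading R A (I b) (d b) j" for b j
    by (simp add: free_grading_fam)
  have "kres R A J e \<kappa>"
  proof (intro kres.intro kres_axioms.intro graded_alg_axioms)
    show "finite (J b)" for b using r(1) by (cases b) simp_all
    show "J 0 = {0}" "e 0 0 = 0" by simp_all
    show "\<kappa> 0 0 f \<in> irrelevant_ideal R A" if "f \<in> J (Suc 0)" for f using g0I(1)[of f] that by simp
    show "if e b c \<le> e (Suc b) f then \<kappa> b c f \<in> A (e (Suc b) f - e b c) else \<kappa> b c f = \<zero>"
      if "c \<in> J b" "f \<in> J (Suc b)" for b c f
    proof (cases b)
      case 0 then show ?thesis using g0I(2)[of f] that by simp
    next
      case (Suc b')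
      then have "g b' f \<in> free_grading R A (I b') (d b') (d (Suc b') f)" using r(3)[of f b'] that by simp
      then show ?thesis using that Suc by (simp add: free_grading_def)
    qed
    show "(\<Oplus>x\<in>J (Suc b). \<kappa> b c x \<otimes> \<kappa> (Suc b) x f) = \<zero>" if "c \<in> J b" "f \<in> J (Suc (Suc b))" for b c f
    proof -
      have f: "f \<in> I (Suc b)" using that by simp
      show ?thesis
      proof (cases b)
        case 0
        have f0: "f \<in> I (Suc 0)" using f 0 by simp
        have "P.aug (P.bd 0 (uvec R f)) = \<zero>\<^bsub>M\<^esub>" by (rule P.aug_bd) (use uc[OF f0] in \<open>simp add: Pi\<close>)
        then have "ev M (I 0) g0 (g 0 f) = \<zero>" using gimg[OF f0] by (simp add: Pi M_def)
        then show ?thesis using ev0[of "g 0 f"] gcc[OF f0] 0 by simp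
      next
        case (Suc b')
        have f1: "f \<in> I (Suc (Suc b'))" using f Suc by simp
        have "P.bd b' (P.bd (Suc b') (uvec R f)) = (\<lambda>_. \<zero>)" by (rule P.bd_bd) (use uc[OF f1] in \<open>simp add: Pi\<close>)
        then have "ev (free_module R (I b')) (I (Suc b')) (g b') (g (Suc b') f) c = \<zero>" using gimg[OF f1] by (simp add: Pi)
        then show ?thesis using evF[of b' "g (Suc b') f" c] gcc[OF f1] Suc by simp
      qed
    qed
    show "\<exists>z\<in>fam_grading (ring_mod R) A (J (Suc (Suc b))) (e (Suc (Suc b))) j.
        \<forall>f\<in>J (Suc b). (\<Oplus>x\<in>J (Suc (Suc b)). \<kappa> (Suc b) f x \<otimes> z x) = y f"
      if y: "y \<in> fam_grading (ring_mod R) A (J (Suc b)) (e (Suc b)) j"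
        and 0: "\<And>c. c \<in> J b \<Longrightarrow> (\<Oplus>f\<in>J (Suc b). \<kappa> b c f \<otimes> y f) = \<zero>" for y b j
    proof -
      have y': "y \<in> free_grading R A (I b) (d b) j" using y by (simp add: fg)
      have yc: "y f \<in> carrier R" for f using y' by (simp add: free_grading_def free_carrier_iff)
      have "\<exists>t\<in>free_grading R A (I (Suc b)) (d (Suc b)) j. ev (free_module R (I b)) (I (Suc b)) (g b) t = y"
      proof (cases b)
        case b: 0
        have "P.aug y = \<zero>\<^bsub>M\<^esub>" using 0[of 0] ev0[of y] yc b by (simp add: Pi M_def)
        then show ?thesis using P.aug_exact[of y j] y' b by (simp add: Pi)
      next
        case (Suc b')
        have "ev (free_module R (I b')) (I (Suc b')) (g b') y c = \<zero>" for c
        proof (cases "c \<in> I b'")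
          case True then show ?thesis using 0[of c] evF[of b' y c] yc Suc by simp
        next
          case False
          have yF: "y \<in> carrier (free_module R (I (Suc b')))" using y' Suc by (simp add: free_grading_def)
          then have "P.bd b' y \<in> carrier (free_module R (I b'))" using P.bd_hom(1)[of y b'] by (simp add: Pi)
          then show ?thesis using False by (simp add: Pi free_carrier_iff)
        qed
        then have "P.bd b' y = (\<lambda>_. \<zero>)" by (simp add: Pi fun_eq_iff)
        then show ?thesis using P.bd_exact[of y b' j] y' Suc by (simp add: Pi)
      qed
      then obtain t where t: "t \<in> free_grading R A (I (Suc b)) (d (Suc b)) j" "ev (free_module R (I b)) (I (Suc b)) (g b) t = y" by blast
      have tc: "t f \<in> carrier R" for f using t(1) by (simp add: free_grading_def free_carrier_iff)
      have "(\<Oplus>x\<in>I (Suc b). g b x f \<otimes> t x) = y f" for f using evF[of b t f] tc t(2) by simp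
      then show ?thesis using t(1) by (intro bexI[of _ t]) (simp_all add: fg)
    qed
    show "\<exists>z\<in>fam_grading (ring_mod R) A (J (Suc 0)) (e (Suc 0)) j. (\<Oplus>f\<in>J (Suc 0). \<kappa> 0 0 f \<otimes> z f) = a"
      if a: "a \<in> A j" "0 < j" for a j
    proof -
      have "a \<in> D j" using a Irr_homog by (simp add: D_def)
      then obtain t where t: "t \<in> free_grading R A (I 0) (d 0) j" "ev M (I 0) g0 t = a" using P.aug_surj[of a j] by (auto simp: Pi)
      have "t f \<in> carrier R" for f using t(1) by (simp add: free_grading_def free_carrier_iff)
      then have "(\<Oplus>f\<in>I 0. g0 f \<otimes> t f) = a" using ev0[of t] t(2) by simp
      then show ?thesis using t(1) by (intro bexI[of _ t]) (simp_all add: fg)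
    qed
  qed
  then show ?thesis by blast
qed

lemma dimq_zero_imp:
  assumes V: "vectorspace K V" and Z: "submodule K Z V" and B: "submodule K B V" and BZ: "B \<subseteq> Z"
    and fin: "finq K V Z B" and 0: "dimq K V Z B = 0"
  shows "Z \<subseteq> B"
proof -
  interpret V: vectorspace K V by fact
  interpret Z: vectorspace K "V\<lparr>carrier := Z\<rparr>" using Z by (rule V.submodule_vectorspace)
  note B' = V.submodule_submodule[OF Z B BZ]
  let ?Q = "quotient_module (V\<lparr>carrier := Z\<rparr>) B"
  interpret Q: vectorspace K ?Q using B' by (rule Z.quotient_vectorspace)
  obtain b where b: "finite b" "Q.basis b" using Q.finite_basis_exists fin by (auto simp: finq_def)
  have "card b = 0" using Q.dim_basis[OF b] 0 by (simp add: dimq_def)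
  then have "b = {}" using b(1) by simp
  then have c: "carrier ?Q = {\<zero>\<^bsub>?Q\<^esub>}" using b(2) Q.span_empty by (simp add: Q.basis_def)
  show "Z \<subseteq> B"
  proof
    fix z assume z: "z \<in> Z"
    have "B +>\<^bsub>V\<^esub> z \<in> carrier ?Q" unfolding Z.quotient_carrier using z by auto
    then have "B +>\<^bsub>V\<^esub> z = B" unfolding c Z.quotient_zero by simp
    moreover have "z \<in> carrier V" using z Z by (auto simp: submodule_def)
    ultimately show "z \<in> B" using V.coset_zero_iff[OF B] by simp
  qed
qed

context resolved begin

lemma m_Bx: "m i \<subseteq> Bx i"
proof
  fix u assume u: "u \<in> m i"
  interpret Fs: Module.module R "F (Suc i)" by (rule Fm)
  have "u = bd i (\<lambda>_. \<zero>\<^bsub>R\<^esub>) \<oplus>\<^bsub>F i\<^esub> u" using m_carrier[OF u] by (simp add: bd_zero free_carrier_iff)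
  moreover have "(\<lambda>_. \<zero>\<^bsub>R\<^esub>) \<in> carrier (F (Suc i))" using Fs.M.zero_closed by simp
  ultimately show "u \<in> Bx i" unfolding Bx_eq set_add_iff using u by blast
qed

text \<open>Modulo the irrelevant ideal only basis vectors of degree exactly \<open>j\<close>
  contribute in degree \<open>j\<close>: coefficients at smaller shifts have positive degree, those
  at larger shifts vanish.\<close>

lemma finite_rank_finq:
  assumes I: "finite (fr_index P i)"
  shows "finq K (F i) (Zx i \<inter> gF i j) (Bx i \<inter> gF i j)"
    and "(\<And>c. c \<in> fr_index P i \<Longrightarrow> fr_shift P i c < j) \<Longrightarrow> Zx i \<inter> gF i j \<subseteq> Bx i"
proof -
  interpret Fi: graded_mod R A "F i" "gF i" by (rule Fgm)
  let ?I = "fr_index P i" and ?d = "fr_shift P i"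
  have xe: "x = (\<Oplus>\<^bsub>F i\<^esub>c\<in>?I. x c \<odot>\<^bsub>F i\<^esub> uvec R c)" if "x \<in> gF i j" for x
    using R.free_expand[OF I gF_carrier[OF that]] by (simp add: ev_def del: free_simps)
  have low: "x c \<odot>\<^bsub>F i\<^esub> uvec R c \<in> m i \<inter> gF i j" if x: "x \<in> gF i j" and c: "c \<in> ?I" "?d c < j" for x c
  proof -
    have xc: "x c \<in> A (j - ?d c)" using x c by (auto simp: free_grading_def)
    have "x c \<odot>\<^bsub>F i\<^esub> uvec R c \<in> m i" using Irr_homog[OF xc] c(2) N.uvec_carrier[OF c(1)] by (intro m_smult) auto
    moreover have "uvec R c \<in> gF i (?d c)"
      using N.uvec_carrier[OF c(1)] one_A0 by (auto simp: free_grading_def uvec_def)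
    then have "x c \<odot>\<^bsub>F i\<^esub> uvec R c \<in> gF i ((j - ?d c) + ?d c)" by (rule Fi.AB_smult[OF xc])
    ultimately show ?thesis using c(2) by simp
  qed
  have FK: "vectorspace K (F i)" by (rule Fi.N_vectorspace)
  note gK = Fi.B_submodule_K[of j]
  note Zs = Fi.NK.submodule_Int[OF submodule_ground[OF Zx_submodule[of i]] gK]
    and Bs = Fi.NK.submodule_Int[OF submodule_ground[OF Bx_submodule[of i]] gK]
    and ms = Fi.NK.submodule_Int[OF submodule_ground[OF m_submodule[of i]] gK]
  have "finq K (F i) (gF i j) (m i \<inter> gF i j)"
    unfolding finq_iff[OF FK gK ms Int_lower2]
  proof (intro exI[of _ "uvec R ` {c \<in> ?I. ?d c = j}"] conjI allI impI)
    show "finite (uvec R ` {c \<in> ?I. ?d c = j})" using I by simp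
    show "uvec R ` {c \<in> ?I. ?d c = j} \<subseteq> gF i j"
      using N.uvec_carrier[of _ ?I] one_A0 by (auto simp: free_grading_def uvec_def)
    fix W assume W: "submodule K W (F i) \<and> m i \<inter> gF i j \<subseteq> W \<and> uvec R ` {c \<in> ?I. ?d c = j} \<subseteq> W"
    show "gF i j \<subseteq> W"
    proof
      fix x assume x: "x \<in> gF i j"
      have "(\<Oplus>\<^bsub>F i\<^esub>c\<in>?I. x c \<odot>\<^bsub>F i\<^esub> uvec R c) \<in> W"
      proof (rule Fi.NK.submodule_finsum_closed)
        show "submodule K W (F i)" using W by blast
        fix c assume c: "c \<in> ?I"
        consider "?d c < j" | "?d c = j" | "?d c > j" by linarith
        then show "x c \<odot>\<^bsub>F i\<^esub> uvec R c \<in> W"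
        proof cases
          case 1 then show ?thesis using low[OF x c] W by blast
        next
          case 2
          then have "x c \<in> A 0" using x c by (auto simp: free_grading_def)
          moreover have "uvec R c \<in> W" using W c 2 by blast
          ultimately show ?thesis using W by (simp add: submodule_def del: free_simps)
        next
          case 3
          then have "x c = \<zero>\<^bsub>R\<^esub>" using x c by (auto simp: free_grading_def)
          then have "x c \<odot>\<^bsub>F i\<^esub> uvec R c = \<zero>\<^bsub>F i\<^esub>" using Fi.N.smult_l_null[OF N.uvec_carrier[OF c]] by simp
          then show ?thesis using W by (simp add: submodule_def del: free_simps)
        qed
      qed
      then show "x \<in> W" using xe[OF x] by simp
    qed
  qed
  then have "finq K (F i) (Zx i \<inter> gF i j) (m i \<inter> gF i j)"
    using dimq_add(1)[OF FK gK Zs ms _ Int_lower2] m_Bx Bx_Zx by blast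
  then show "finq K (F i) (Zx i \<inter> gF i j) (Bx i \<inter> gF i j)"
    using dimq_add(1)[OF FK Zs Bs ms] m_Bx Bx_Zx by blast
  assume d: "\<And>c. c \<in> ?I \<Longrightarrow> ?d c < j"
  show "Zx i \<inter> gF i j \<subseteq> Bx i"
  proof
    fix x assume "x \<in> Zx i \<inter> gF i j"
    then have x: "x \<in> gF i j" by blast
    have "(\<Oplus>\<^bsub>F i\<^esub>c\<in>?I. x c \<odot>\<^bsub>F i\<^esub> uvec R c) \<in> m i"
      by (rule Fi.N.submodule_finsum_closed[OF m_submodule]) (use low[OF x] d in blast)
    then show "x \<in> Bx i" using xe[OF x] m_Bx by auto
  qed
qed

end

text \<open>Finiteness and vanishing in high degrees are visible on a resolution of finite rank.
  Balance carries them to \<open>N \<otimes> K\<close>, and from there they reach every other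
  resolution.\<close>

lemma (in kmod) Tor_finite:
  assumes std: "standard_graded_algebra R A" and fg: "finitely_generated R N"
  shows "finq K (fam N (J i)) (Zt i j) (Bt i j)"
    and "\<exists>j0. \<forall>j\<ge>j0. dimq K (fam N (J i)) (Zt i j) (Bt i j) = 0"
proof -
  obtain I d g0 g where fr: "finite_res R A N B I d g0 g" using finite_res_exists[OF std fg] by blast
  define P where "P = \<lparr>fr_index = I, fr_shift = d, fr_diff = \<lambda>i. ev (free_module R (I i)) (I (Suc i)) (g i), fr_aug = ev N (I 0) g0\<rparr>"
  interpret P: tor_setup R A J e \<kappa> N B P
    by (intro tor_setup.intro resolved.intro resolved_axioms.intro graded_mod_axioms kmod_axioms)
      (unfold P_def, rule finite_res_resolution[OF fr])
  have I: "finite (fr_index P i)" using finite_resD(1)[OF fr] by (simp add: P_def)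
  note T = P.Tor_via_residue_field[of i]
  show "finq K (fam N (J i)) (Zt i j) (Bt i j)" using T[of j] P.finite_rank_finq(1)[OF I, of j] by blast
  have FK: "vectorspace K (P.F i)" by (rule module_vectorspace[OF P.Fm])
  define j0 where "j0 = Suc (Max (fr_shift P i ` fr_index P i))"
  have "dimq K (fam N (J i)) (Zt i j) (Bt i j) = 0" if j: "j \<ge> j0" for j
  proof -
    interpret Fi: graded_mod R A "P.F i" "P.gF i" by (rule P.Fgm)
    have "fr_shift P i c < j" if "c \<in> fr_index P i" for c
      using Max_ge[OF finite_imageI[OF I] imageI[OF that], of "fr_shift P i"] j by (simp add: j0_def)
    then have "P.Zx i \<inter> P.gF i j = P.Bx i \<inter> P.gF i j" using P.finite_rank_finq(2)[OF I] P.Bx_Zx by blast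
    then have "dimq K (P.F i) (P.Zx i \<inter> P.gF i j) (P.Bx i \<inter> P.gF i j) = 0"
      using dimq_self(2)[OF FK Fi.NK.submodule_Int[OF submodule_ground[OF P.Bx_submodule[of i]] Fi.B_submodule_K[of j]]] by simp
    then show ?thesis using T[of j] P.finite_rank_finq(1)[OF I, of j] by simp
  qed
  then show "\<exists>j0. \<forall>j\<ge>j0. dimq K (fam N (J i)) (Zt i j) (Bt i j) = 0" by blast
qed

text \<open>The chosen resolution may have infinite rank; its homology is nevertheless
  finite-dimensional in each degree by \<open>Tor_finite\<close>. From \<open>j0\<close> on all
  cycles are boundaries, so \<open>graded_subquotient\<close> turns the total Betti number into a
  finite sum.\<close>

lemma (in kmod) betti_eq:
  assumes std: "standard_graded_algebra R A" and fg: "finitely_generated R N"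
  shows "graded_betti R A N B i j = dimq K (fam N (J i)) (Zt i j) (Bt i j)"
    and "\<exists>j0. (\<forall>j\<ge>j0. graded_betti R A N B i j = 0) \<and> betti R A N B i = (\<Sum>j<j0. graded_betti R A N B i j)"
proof -
  obtain I d g0 g where fr: "finite_res R A N B I d g0 g" using finite_res_exists[OF std fg] by blast
  define P where "P = chosen_res R A N B"
  have "graded_free_resolution R A N B P"
    unfolding P_def chosen_res_def by (rule someI, rule finite_res_resolution[OF fr])
  then interpret P: tor_setup R A J e \<kappa> N B P
    by (intro tor_setup.intro resolved.intro resolved_axioms.intro graded_mod_axioms kmod_axioms)
  note T = P.Tor_via_residue_field[of i]
  have fin: "finq K (P.F i) (P.Zx i \<inter> P.gF i j) (P.Bx i \<inter> P.gF i j)" for j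
    using T[of j] Tor_finite(1)[OF std fg, of i j] by blast
  have Tor: "Tor R A N B i = P.TorP i" "Tor_grading R A N B i j = P.TorP_grading i j" for j
    unfolding Tor_def Tor_grading_def P.TorP_def P.TorP_grading_def unfolding P_def Let_def by (rule refl)+
  have gb: "graded_betti R A N B i j = dimq K (P.F i) (P.Zx i \<inter> P.gF i j) (P.Bx i \<inter> P.gF i j)" for j
    unfolding graded_betti_def Tor by (rule P.TorP_dim(3)[OF fin])
  then have gb': "graded_betti R A N B i j = dimq K (fam N (J i)) (Zt i j) (Bt i j)" for j using T[of j] fin[of j] by simp
  then show "graded_betti R A N B i j = dimq K (fam N (J i)) (Zt i j) (Bt i j)" .
  obtain j0 where j0: "\<forall>j\<ge>j0. dimq K (fam N (J i)) (Zt i j) (Bt i j) = 0" using Tor_finite(2)[OF std fg] by blast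
  interpret Fi: graded_mod R A "P.F i" "P.gF i" by (rule P.Fgm)
  have FK: "vectorspace K (P.F i)" by (rule module_vectorspace[OF P.Fm])
  note gK = Fi.B_submodule_K
  have sub: "P.Zx i \<inter> P.gF i j \<subseteq> P.Bx i" if "j \<ge> j0" for j
  proof -
    have 0: "dimq K (P.F i) (P.Zx i \<inter> P.gF i j) (P.Bx i \<inter> P.gF i j) = 0" using gb[of j] gb'[of j] j0 that by simp
    have "P.Bx i \<inter> P.gF i j \<subseteq> P.Zx i \<inter> P.gF i j" using P.Bx_Zx by blast
    from dimq_zero_imp[OF FK Fi.NK.submodule_Int[OF submodule_ground[OF P.Zx_submodule[of i]] gK[of j]]
        Fi.NK.submodule_Int[OF submodule_ground[OF P.Bx_submodule[of i]] gK[of j]] this fin 0]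
    show ?thesis by blast
  qed
  have "finq K (P.F i) (P.Zx i) (P.Bx i) \<and> dimq K (P.F i) (P.Zx i) (P.Bx i) =
    (\<Sum>j<j0. dimq K (P.F i) (P.Zx i \<inter> P.gF i j) (P.Bx i \<inter> P.gF i j))"
    by (rule graded_subquotient(3)[OF FK P.Fig gK submodule_ground[OF P.Zx_submodule] submodule_ground[OF P.Bx_submodule]
        P.Bx_Zx P.Zx_comp P.Bx_comp fin sub])
  then have "betti R A N B i = (\<Sum>j<j0. graded_betti R A N B i j)"
    unfolding betti_def Tor using P.TorP_dim(2)[of i] gb by simp
  moreover have "\<forall>j\<ge>j0. graded_betti R A N B i j = 0" using j0 gb' by simp
  ultimately show "\<exists>j0. (\<forall>j\<ge>j0. graded_betti R A N B i j = 0) \<and> betti R A N B i = (\<Sum>j<j0. graded_betti R A N B i j)" by blast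
qed

section \<open>The associated graded ring and module\<close>

lemma (in graded_mod) comp_smult_sum:
  assumes a: "a \<in> carrier R" and x: "x \<in> carrier N"
  shows "B.cmp (a \<odot> x) n = (\<Oplus>i\<in>{..n}. A.cmp a i \<odot> B.cmp x (n - i))"
proof -
  obtain k where k: "\<And>i. i \<ge> k \<Longrightarrow> A.cmp a i = \<zero>\<^bsub>R\<^esub>" using A.comp_bound[OF a] by blast
  let ?T = "{..<max k (Suc n)}"
  have cs: "B.cmp (A.cmp a i \<odot> x) n = (if i \<le> n then A.cmp a i \<odot> B.cmp x (n - i) else \<zero>)" for i
    using comp_smult[OF A.comp_props(1)[OF a, of i] x] by simp
  have "(\<Oplus>\<^bsub>R\<^esub>i\<in>?T. A.cmp a i) = a" using k by (intro A.comp_sum) (auto simp: a)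
  then have "a \<odot> x = (\<Oplus>i\<in>?T. A.cmp a i \<odot> x)"
    using N.finsum_smult_r[of x "A.cmp a" ?T] a x by (simp add: Pi_def)
  then have "B.cmp (a \<odot> x) n = (\<Oplus>i\<in>?T. B.cmp (A.cmp a i \<odot> x) n)"
    using B.comp_finsum[of ?T "\<lambda>i. A.cmp a i \<odot> x" n] a x by simp
  also have "\<dots> = (\<Oplus>i\<in>?T. if i \<le> n then A.cmp a i \<odot> B.cmp x (n - i) else \<zero>)"
    using cs a x by (intro N.M.finsum_cong') auto
  also have "\<dots> = (\<Oplus>i\<in>{..n}. if i \<le> n then A.cmp a i \<odot> B.cmp x (n - i) else \<zero>)"
    using a x by (intro N.M.add.finprod_mono_neutral_cong_right) (auto simp: Pi_def)
  also have "\<dots> = (\<Oplus>i\<in>{..n}. A.cmp a i \<odot> B.cmp x (n - i))"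
    using a x by (intro N.M.finsum_cong') auto
  finally show ?thesis .
qed

section \<open>Powers of the irrelevant ideal\<close>

locale std_alg = graded_alg R A for R :: "('a, 'x) ring_scheme" (structure) and A +
  assumes std: "standard_graded_algebra R A"
begin

abbreviation "mp \<equiv> m_power R A"

lemma Irr_ideal: "ideal Irr R"
proof (rule idealI)
  show "ring R" ..
  show "subgroup Irr (add_monoid R)"
  proof (rule R.add.subgroupI)
    fix a assume a: "a \<in> Irr"
    then show "\<ominus> a \<in> Irr"
      using A.comp_minus[of a 0] by (simp add: irrelevant_ideal_def)
  qed (auto simp: Irr_carrier Irr_add intro: Irr_zero)
  fix a x assume a: "a \<in> Irr" and x: "x \<in> carrier R"
  show "x \<otimes> a \<in> Irr" using x a by (rule Irr_mult)
  then show "a \<otimes> x \<in> Irr" using R.m_comm[OF x Irr_carrier[OF a]] by simp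
qed

lemma mp_ideal: "ideal (mp p) R"
  by (induction p) (simp_all add: R.oneideal R.ideal_prod_is_ideal Irr_ideal)

lemma mp_mult: "a \<in> mp i \<Longrightarrow> b \<in> mp j \<Longrightarrow> a \<otimes> b \<in> mp (i + j)"
proof (induction i arbitrary: a)
  case 0
  then show ?case using ideal.I_l_closed[OF mp_ideal, of b j a] by simp
next
  case (Suc i)
  note bc = ideal.Icarr[OF mp_ideal Suc.prems(2)]
  from Suc.prems(1) have "a \<in> carrier R \<and> a \<otimes> b \<in> mp (Suc (i + j))" unfolding ideal_power.simps
  proof (induction a rule: ideal_prod.induct)
    case (prod x y)
    note c = Irr_carrier[OF prod(1)] ideal.Icarr[OF mp_ideal prod(2)]
    then have "(x \<otimes> y) \<otimes> b = x \<otimes> (y \<otimes> b)" using bc by (simp add: R.m_assoc)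
    then show ?case using prod Suc.IH[OF prod(2) Suc.prems(2)] c by (simp add: ideal_prod.prod)
  next
    case (sum s1 s2)
    then show ?case using bc by (simp add: R.l_distr ideal_prod.sum)
  qed
  then show ?case by simp
qed

lemma mp_finsum: "(\<And>t. t \<in> T \<Longrightarrow> f t \<in> mp p) \<Longrightarrow> finsum R f T \<in> mp p"
proof (induction T rule: infinite_finite_induct)
  case (insert t T)
  then show ?case using mp_ideal[of p]
    by (subst R.finsum_insert) (auto simp: ideal.Icarr additive_subgroup.a_closed ideal.axioms(1))
qed (simp_all add: mp_ideal additive_subgroup.zero_closed ideal.axioms(1))

lemma comp_mult:
  "a \<in> carrier R \<Longrightarrow> b \<in> carrier R \<Longrightarrow>
    A.cmp (a \<otimes> b) n = (\<Oplus>i\<in>{..n}. A.cmp a i \<otimes> A.cmp b (n - i))"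
  using graded_mod.comp_smult_sum[OF ring_graded_mod, of a b n] by (simp add: component_ring_mod finsum_ring_mod)

text \<open>The elements whose degree \<open>n\<close> part lies in \<open>\<mm>\<^sup>n\<close> for all \<open>n\<close> form a subring containing the
  generators.\<close>

lemma homog_mp:
  assumes a: "a \<in> A n" shows "a \<in> mp n"
proof -
  obtain S where S: "S \<subseteq> A 1" "generate_ring R (A 0 \<union> S) = carrier R"
    using std unfolding standard_graded_algebra_def by blast
  have m1: "A 1 \<subseteq> mp 1"
  proof
    fix x assume x: "x \<in> A 1"
    then have "x \<otimes> \<one> \<in> mp 1" unfolding One_nat_def ideal_power.simps
      by (intro ideal_prod.prod Irr_homog[of x 1]) auto
    then show "x \<in> mp 1" using A.A_carrier[OF x] by simp
  qed
  have "x \<in> carrier R \<and> (\<forall>n. A.cmp x n \<in> mp n)" if "x \<in> generate_ring R (A 0 \<union> S)" for x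
    using that
  proof (induction x rule: generate_ring.induct)
    case one
    then show ?case using A.comp_homog[OF one_A0] ideal.axioms(1)[OF mp_ideal]
      by (auto simp: additive_subgroup.zero_closed)
  next
    case (incl h)
    then consider "h \<in> A 0" | "h \<in> A 1" using S by blast
    then show ?case
      by cases (use A.comp_homog[of h] A.A_carrier[of h] m1 ideal.axioms(1)[OF mp_ideal] in
          \<open>auto simp: additive_subgroup.zero_closed\<close>)
  next
    case (a_inv h)
    then show ?case using ideal.axioms(1)[OF mp_ideal]
      by (auto simp: A.comp_minus intro: additive_subgroup.a_inv_closed)
  next
    case (eng_add h1 h2)
    then show ?case using ideal.axioms(1)[OF mp_ideal] by (auto simp: A.comp_add additive_subgroup.a_closed)
  next
    case (eng_mult h1 h2)
    have "A.cmp h1 i \<otimes> A.cmp h2 (n - i) \<in> mp n" if "i \<le> n" for n i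
      using mp_mult[of "A.cmp h1 i" i "A.cmp h2 (n - i)" "n - i"] eng_mult that by simp
    then show ?case using eng_mult by (auto simp: comp_mult intro!: mp_finsum)
  qed
  then have "A.cmp a n \<in> mp n" using S(2) A.A_carrier[OF a] by blast
  then show ?thesis using A.comp_homog[OF a, of n] by simp
qed

lemma mp_Suc: "mp (Suc p) \<subseteq> mp p"
proof
  fix a assume "a \<in> mp (Suc p)"
  then show "a \<in> mp p" unfolding ideal_power.simps
    by (induction rule: ideal_prod.induct)
      (auto simp: Irr_carrier ideal.I_l_closed[OF mp_ideal] additive_subgroup.a_closed[OF ideal.axioms(1)[OF mp_ideal]])
qed

lemma mp_antimono: "p \<le> q \<Longrightarrow> mp q \<subseteq> mp p"
  using lift_Suc_antimono_le[of mp p q] mp_Suc by blast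

text \<open>Multiplication by positive degrees pushes components upwards, which gives one inclusion;
  the other is \<open>homog_mp\<close>, where generation in degree one enters.\<close>

lemma mp_iff: "a \<in> mp p \<longleftrightarrow> a \<in> carrier R \<and> (\<forall>i<p. A.cmp a i = \<zero>)"
proof
  assume "a \<in> mp p"
  then show "a \<in> carrier R \<and> (\<forall>i<p. A.cmp a i = \<zero>)"
  proof (induction p arbitrary: a)
    case (Suc p)
    from Suc.prems show ?case unfolding ideal_power.simps
    proof (induction a rule: ideal_prod.induct)
      case (prod x y)
      have c: "x \<in> carrier R" "y \<in> carrier R" "A.cmp x 0 = \<zero>"
        using prod(1) Irr_carrier[OF prod(1)] Suc.IH[OF prod(2)] by (simp_all add: irrelevant_ideal_def)
      have "A.cmp x i \<otimes> A.cmp y (n - i) = \<zero>" if "i \<le> n" "n < Suc p" for i n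
        using Suc.IH[OF prod(2)] c that by (cases "i = 0") auto
      then show ?case using c by (auto simp: comp_mult intro!: R.add.finprod_one_eqI)
    qed (auto simp: A.comp_add)
  qed simp
next
  assume a: "a \<in> carrier R \<and> (\<forall>i<p. A.cmp a i = \<zero>)"
  then have "a \<in> carrier R" by simp
  then obtain n where n: "(\<Oplus>i\<in>{..<n}. A.cmp a i) = a" using A.comp_bound by blast
  have "A.cmp a i \<in> mp p" for i
  proof (cases "i < p")
    case True
    then show ?thesis using a ideal.axioms(1)[OF mp_ideal] by (simp add: additive_subgroup.zero_closed)
  next
    case False
    have "A.cmp a i \<in> mp i" using a by (intro homog_mp A.comp_props) simp
    then show ?thesis using mp_antimono[of p i] False by auto
  qed
  then have "(\<Oplus>i\<in>{..<n}. A.cmp a i) \<in> mp p" by (rule mp_finsum)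
  then show "a \<in> mp p" using n by simp
qed

text \<open>The identification of \<open>R\<close> with its associated graded ring: as m^p/m^(p+1)
  is represented by the part of degree \<open>p\<close>, an element goes to the classes of its
  components.\<close>

definition "gr_iso r = (\<lambda>p. mp (Suc p) +> A.cmp r p)"

lemma coset_ring_mod: "X +>\<^bsub>ring_mod R\<^esub> x = X +> x"
  by (simp add: a_r_coset_def r_coset_def)

lemma mp_submodule: "submodule R (mp p) (ring_mod R)"
  using ring_mod_module[OF R_cring] by (auto simp: submodule_def mp_iff A.comp_add comp_mult intro!: R.add.finprod_one_eqI)

lemma mp_coset_iff:
  assumes "x \<in> carrier R" "y \<in> carrier R"
  shows "mp p +> x = mp p +> y \<longleftrightarrow> (\<forall>i<p. A.cmp x i = A.cmp y i)"
proof -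
  interpret RM: graded_mod R A "ring_mod R" A by (rule ring_graded_mod)
  have "mp p +> x = mp p +> y \<longleftrightarrow> x \<ominus>\<^bsub>ring_mod R\<^esub> y \<in> mp p"
    using RM.N.coset_eq_iff[OF mp_submodule, of x y p] assms by (simp add: coset_ring_mod)
  moreover have m: "\<ominus>\<^bsub>ring_mod R\<^esub> y = \<ominus> y"
    using RM.N.M.minus_equality[of "\<ominus> y" y] assms by (simp add: R.l_neg)
  moreover have "A.cmp x i \<oplus> \<ominus> A.cmp y i = \<zero> \<longleftrightarrow> A.cmp x i = A.cmp y i" for i
    using R.r_right_minus_eq[of "A.cmp x i" "A.cmp y i"] assms by (simp add: a_minus_def)
  ultimately show ?thesis using assms by (simp add: a_minus_def mp_iff A.comp_add A.comp_minus)
qed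

end

text \<open>What the construction of gr requires of a filtration, stated through homogeneous
  scalars. It covers \<open>M\<close> and also \<open>R\<close> with the powers of the irrelevant
  ideal, so that gr of the ring and of the module are treated together.\<close>

locale filtered_mod = std_alg R A for R :: "('a, 'x) ring_scheme" and A +
  fixes N :: "('a, 'b, 'y) module_scheme" (structure) and F :: "nat \<Rightarrow> 'b set"
  assumes Nm: "Module.module R N" and F_sub: "submodule R (F p) N"
    and F_0: "F 0 = carrier N" and F_Suc: "F (Suc p) \<subseteq> F p"
    and F_smult: "a \<in> A i \<Longrightarrow> x \<in> F p \<Longrightarrow> a \<odot> x \<in> F (i + p)"
begin

sublocale N: Module.module R N by (rule Nm)

lemma F_carrier: "x \<in> F p \<Longrightarrow> x \<in> carrier N"
  using F_sub[of p] by (auto simp: submodule_def)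

lemma F_antimono: "p \<le> q \<Longrightarrow> F q \<subseteq> F p"
  using lift_Suc_antimono_le[of F p q] F_Suc by blast

lemma F_zero: "\<zero> \<in> F p" and F_add: "x \<in> F p \<Longrightarrow> y \<in> F p \<Longrightarrow> x \<oplus> y \<in> F p"
  using F_sub[of p] by (auto simp: submodule_def)

lemma mp_F:
  assumes a: "a \<in> mp i" and x: "x \<in> F p"
  shows "a \<odot> x \<in> F (i + p)"
proof -
  have ac: "a \<in> carrier R" "\<And>k. k < i \<Longrightarrow> A.cmp a k = \<zero>\<^bsub>R\<^esub>" using a by (auto simp: mp_iff)
  obtain n where n: "(\<Oplus>\<^bsub>R\<^esub>k\<in>{..<n}. A.cmp a k) = a" using A.comp_bound[OF ac(1)] by blast
  have t: "A.cmp a k \<odot> x \<in> F (i + p)" for k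
  proof (cases "k < i")
    case True then show ?thesis using ac F_carrier[OF x] by (simp add: F_zero)
  next
    case False
    then show ?thesis using F_smult[OF A.comp_props(1)[OF ac(1)] x, of k] F_antimono[of "i + p" "k + p"] by auto
  qed
  have "a \<odot> x = (\<Oplus>k\<in>{..<n}. A.cmp a k \<odot> x)"
    using N.finsum_smult_r[of x "A.cmp a" "{..<n}"] n ac(1) F_carrier[OF x] by (simp add: Pi_def)
  then show ?thesis using N.submodule_finsum_closed[OF F_sub, of "{..<n}"] t by simp
qed

text \<open>Elements of gr are handled through sequences of representatives. These form an
  \<open>R\<close>-module \<open>W\<close> under the Cauchy product \<open>conv\<close>, and
  \<open>cls\<close> maps it onto gr; module laws are proved for sequences and pushed forward rather
  than checked on cosets.\<close>

definition "X = {x \<in> carrier (fam N UNIV). \<forall>p. x p \<in> F p}"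
definition "conv r x p = (\<Oplus>i\<in>{..p}. A.cmp r i \<odot> x (p - i))"
definition "cls x p = F (Suc p) +> x p"
definition "W = (fam N UNIV)\<lparr>carrier := X, smult := conv\<rparr>"

lemma XD: "x \<in> X \<Longrightarrow> x p \<in> F p" "x \<in> X \<Longrightarrow> x p \<in> carrier N" "x \<in> X \<Longrightarrow> finite {p. x p \<noteq> \<zero>}"
  by (auto simp: X_def fam_carrier_iff F_carrier)

lemma XI: "(\<And>p. x p \<in> F p) \<Longrightarrow> finite {p. x p \<noteq> \<zero>} \<Longrightarrow> x \<in> X"
  by (auto simp: X_def fam_carrier_iff intro: F_carrier)

lemma conv_F:
  assumes r: "r \<in> carrier R" and x: "\<And>p. x p \<in> F p" shows "conv r x p \<in> F p"
  unfolding conv_def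
proof (rule N.submodule_finsum_closed[OF F_sub])
  fix i assume "i \<in> {..p}"
  then show "A.cmp r i \<odot> x (p - i) \<in> F p" using F_smult[OF A.comp_props(1)[OF r, of i] x[of "p - i"]] by simp
qed

lemma conv_X:
  assumes r: "r \<in> carrier R" and x: "x \<in> X" shows "conv r x \<in> X"
proof (rule XI)
  show "conv r x p \<in> F p" for p using r XD(1)[OF x] by (rule conv_F)
  obtain n where n: "\<And>i. i \<ge> n \<Longrightarrow> A.cmp r i = \<zero>\<^bsub>R\<^esub>" using A.comp_bound[OF r] by blast
  obtain k where k: "\<And>i. i \<ge> k \<Longrightarrow> x i = \<zero>"
    using XD(3)[OF x] by (metis (mono_tags, lifting) finite_nat_set_iff_bounded mem_Collect_eq not_le)
  have "conv r x p = \<zero>" if "p \<ge> n + k" for p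
  proof -
    have "A.cmp r i \<odot> x (p - i) = \<zero>" for i
      using n[of i] k[of "p - i"] that XD(2)[OF x] r by (cases "i < n") auto
    then show ?thesis unfolding conv_def by (intro N.M.add.finprod_one_eqI) simp
  qed
  then have "{p. conv r x p \<noteq> \<zero>} \<subseteq> {..<n + k}" by (auto simp: not_le[symmetric])
  then show "finite {p. conv r x p \<noteq> \<zero>}" by (rule finite_subset) simp
qed

text \<open>Both sides sum over the triples of degrees that add up to \<open>n\<close>. The
  induction cuts the triangle of index pairs at \<open>k\<close>, while the subscript of
  \<open>x\<close> stays tied to \<open>n\<close>.\<close>

lemma conv_conv:
  assumes r: "r \<in> carrier R" and s: "s \<in> carrier R" and x: "x \<in> X"
  shows "conv (r \<otimes>\<^bsub>R\<^esub> s) x = conv r (conv s x)"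
proof
  fix n
  have a: "k \<le> n \<Longrightarrow>
      (\<Oplus>j\<in>{..k}. (\<Oplus>\<^bsub>R\<^esub>i\<in>{..j}. A.cmp r i \<otimes>\<^bsub>R\<^esub> A.cmp s (j - i)) \<odot> x (n - j)) =
      (\<Oplus>j\<in>{..k}. A.cmp r j \<odot> (\<Oplus>i\<in>{..k - j}. A.cmp s i \<odot> x (n - j - i)))" for k
  proof (induction k)
    case 0
    then show ?case using r s XD(2)[OF x] by (simp add: N.smult_assoc1)
  next
    case (Suc k)
    have xc: "x p \<in> carrier N" for p by (rule XD(2)[OF x])
    have sd: "(\<Oplus>\<^bsub>R\<^esub>i\<in>{..Suc k}. A.cmp r i \<otimes>\<^bsub>R\<^esub> A.cmp s (Suc k - i)) \<odot> x (n - Suc k) =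
      (\<Oplus>j\<in>{..Suc k}. A.cmp r j \<odot> (A.cmp s (Suc k - j) \<odot> x (n - Suc k)))"
      using N.finsum_smult_r[of "x (n - Suc k)" "\<lambda>i. A.cmp r i \<otimes>\<^bsub>R\<^esub> A.cmp s (Suc k - i)" "{..Suc k}"] r s xc
      by (simp add: Pi_def N.smult_assoc1 del: N.M.finsum_Suc R.finsum_Suc cong: N.M.finsum_cong)
    have t: "A.cmp r j \<odot> (\<Oplus>i\<in>{..Suc k - j}. A.cmp s i \<odot> x (n - j - i)) =
        A.cmp r j \<odot> (A.cmp s (Suc k - j) \<odot> x (n - Suc k)) \<oplus>
        A.cmp r j \<odot> (\<Oplus>i\<in>{..k - j}. A.cmp s i \<odot> x (n - j - i))" if "j \<le> k" for j
      using that r s xc Suc.prems by (simp add: Suc_diff_le N.smult_r_distr)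
    have "(\<Oplus>j\<in>{..Suc k}. A.cmp r j \<odot> (\<Oplus>i\<in>{..Suc k - j}. A.cmp s i \<odot> x (n - j - i))) =
       A.cmp r (Suc k) \<odot> (A.cmp s 0 \<odot> x (n - Suc k)) \<oplus>
       (\<Oplus>j\<in>{..k}. A.cmp r j \<odot> (A.cmp s (Suc k - j) \<odot> x (n - Suc k)) \<oplus>
        A.cmp r j \<odot> (\<Oplus>i\<in>{..k - j}. A.cmp s i \<odot> x (n - j - i)))"
      using t r s xc by (simp add: Pi_def cong: N.M.finsum_cong)
    also have "\<dots> = A.cmp r (Suc k) \<odot> (A.cmp s 0 \<odot> x (n - Suc k)) \<oplus>
       ((\<Oplus>j\<in>{..k}. A.cmp r j \<odot> (A.cmp s (Suc k - j) \<odot> x (n - Suc k))) \<oplus>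
        (\<Oplus>j\<in>{..k}. A.cmp r j \<odot> (\<Oplus>i\<in>{..k - j}. A.cmp s i \<odot> x (n - j - i))))"
      using r s xc by (subst N.M.finsum_addf) (auto simp: Pi_def)
    also have "\<dots> = (\<Oplus>j\<in>{..Suc k}. A.cmp r j \<odot> (A.cmp s (Suc k - j) \<odot> x (n - Suc k))) \<oplus>
        (\<Oplus>j\<in>{..k}. A.cmp r j \<odot> (\<Oplus>i\<in>{..k - j}. A.cmp s i \<odot> x (n - j - i)))"
      using r s xc by (simp add: Pi_def N.M.a_assoc)
    also have "\<dots> = (\<Oplus>\<^bsub>R\<^esub>i\<in>{..Suc k}. A.cmp r i \<otimes>\<^bsub>R\<^esub> A.cmp s (Suc k - i)) \<odot> x (n - Suc k) \<oplus>
        (\<Oplus>j\<in>{..k}. (\<Oplus>\<^bsub>R\<^esub>i\<in>{..j}. A.cmp r i \<otimes>\<^bsub>R\<^esub> A.cmp s (j - i)) \<odot> x (n - j))"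
      unfolding sd using Suc by simp
    also have "\<dots> = (\<Oplus>j\<in>{..Suc k}. (\<Oplus>\<^bsub>R\<^esub>i\<in>{..j}. A.cmp r i \<otimes>\<^bsub>R\<^esub> A.cmp s (j - i)) \<odot> x (n - j))"
      using r s xc by (intro N.M.finsum_Suc[symmetric]) (auto simp: Pi_def)
    finally show ?case by (rule sym)
  qed
  show "conv (r \<otimes>\<^bsub>R\<^esub> s) x n = conv r (conv s x) n"
    unfolding conv_def using a[of n] r s by (simp add: comp_mult diff_diff_left)
qed

lemma W_module: "Module.module R W"
proof (rule Module.module.intro)
  interpret FN: Module.module R "fam N UNIV" by (rule fam_module[OF Nm])
  show "cring R" ..
  have Wc: "carrier W = X" "\<zero>\<^bsub>W\<^esub> = (\<lambda>p. \<zero>)" "x \<oplus>\<^bsub>W\<^esub> y = (\<lambda>p. x p \<oplus> y p)" "r \<odot>\<^bsub>W\<^esub> x = conv r x" for x y r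
    by (simp_all add: W_def fam_def)
  have fin: "finite {p. x p \<oplus> y p \<noteq> \<zero>}" if "x \<in> X" "y \<in> X" for x y
    by (rule finite_subset[OF _ finite_UnI[OF XD(3)[OF that(1)] XD(3)[OF that(2)]]]) auto
  show "abelian_group W"
  proof (rule abelian_groupI, unfold Wc)
    show "\<exists>y\<in>X. (\<lambda>p. y p \<oplus> x p) = (\<lambda>p. \<zero>)" if x: "x \<in> X" for x
    proof (rule bexI)
      show "(\<lambda>p. \<ominus> x p) \<in> X"
        using N.submodule_minus_closed[OF F_sub XD(1)[OF x]] XD(3)[OF x]
        by (intro XI) (auto elim!: rev_finite_subset)
    qed (use XD(2)[OF x] in \<open>simp add: N.M.l_neg\<close>)
    show "(\<lambda>p. \<zero>) \<in> X" by (rule XI) (simp_all add: F_zero)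
    fix x y z assume x: "x \<in> X" and y: "y \<in> X"
    show "(\<lambda>p. x p \<oplus> y p) \<in> X" by (rule XI[OF F_add[OF XD(1)[OF x] XD(1)[OF y]] fin[OF x y]])
    show "(\<lambda>p. x p \<oplus> y p) = (\<lambda>p. y p \<oplus> x p)" by (rule ext, rule N.M.a_comm[OF XD(2)[OF x] XD(2)[OF y]])
    show "(\<lambda>p. \<zero> \<oplus> x p) = x" by (rule ext, rule N.M.l_zero[OF XD(2)[OF x]])
    assume z: "z \<in> X"
    show "(\<lambda>p. x p \<oplus> y p \<oplus> z p) = (\<lambda>p. x p \<oplus> (y p \<oplus> z p))"
      by (rule ext, rule N.M.a_assoc[OF XD(2)[OF x] XD(2)[OF y] XD(2)[OF z]])
  qed
  show "Module.module_axioms R W"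
  proof (rule Module.module_axioms.intro, unfold Wc)
    show "conv a x \<in> X" if "a \<in> carrier R" "x \<in> X" for a x using that by (rule conv_X)
    show "conv \<one>\<^bsub>R\<^esub> x = x" if x: "x \<in> X" for x
    proof
      fix p
      have "conv \<one>\<^bsub>R\<^esub> x p = (\<Oplus>i\<in>{..p}. if i = 0 then x (p - 0) else \<zero>)"
        unfolding conv_def using XD(2)[OF x] by (intro N.M.finsum_cong') (auto simp: A.comp_homog[OF one_A0])
      also have "\<dots> = x p" using N.M.finsum_singleton[of 0 "{..p}" "\<lambda>i. x (p - 0)"] XD(2)[OF x]
        by (simp add: Pi_def eq_commute[of 0])
      finally show "conv \<one>\<^bsub>R\<^esub> x p = x p" .
    qed
    show "conv a (\<lambda>p. x p \<oplus> y p) = (\<lambda>p. conv a x p \<oplus> conv a y p)"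
      if "a \<in> carrier R" "x \<in> X" "y \<in> X" for a x y
      unfolding conv_def using that(1) XD(2)[OF that(2)] XD(2)[OF that(3)]
      by (subst N.M.finsum_addf[symmetric]) (auto simp: Pi_def N.smult_r_distr)
    show "conv (a \<otimes>\<^bsub>R\<^esub> b) x = conv a (conv b x)" if "a \<in> carrier R" "b \<in> carrier R" "x \<in> X" for a b x
      using that by (rule conv_conv)
    show "conv (a \<oplus>\<^bsub>R\<^esub> b) x = (\<lambda>p. conv a x p \<oplus> conv b x p)"
      if "a \<in> carrier R" "b \<in> carrier R" "x \<in> X" for a b x
      unfolding conv_def using that(1,2) XD(2)[OF that(3)]
      by (subst N.M.finsum_addf[symmetric]) (auto simp: Pi_def N.smult_l_distr A.comp_add)
  qed
qed

lemma gr_carrier: "gr_carrier N F = cls ` X"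
proof (intro equalityI subsetI)
  fix \<xi> assume \<xi>: "\<xi> \<in> gr_carrier N F"
  then have "\<forall>p. \<exists>x. x \<in> F p \<and> \<xi> p = F (Suc p) +> x" by (auto simp: gr_carrier_def)
  then obtain x where x: "\<forall>p. x p \<in> F p \<and> \<xi> p = F (Suc p) +> x p" by (elim choice[THEN exE]) (rule that)
  \<comment> \<open>A representative of the zero coset may be nonzero; replacing it by zero makes
    the support finite.\<close>
  define y where "y p = (if x p \<in> F (Suc p) then \<zero> else x p)" for p
  have c: "\<xi> p = cls y p" for p
    using N.coset_zero_iff[OF F_sub, of "x p" "Suc p"] N.coset_zero_iff[OF F_sub, of "\<zero>" "Suc p"] x F_carrier[of "x p" p]
    by (auto simp: y_def cls_def F_zero)
  have "finite {p. \<xi> p \<noteq> F (Suc p)}" using \<xi> by (simp add: gr_carrier_def)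
  moreover have "{p. y p \<noteq> \<zero>} \<subseteq> {p. \<xi> p \<noteq> F (Suc p)}"
  proof
    fix p assume "p \<in> {p. y p \<noteq> \<zero>}"
    then have "x p \<notin> F (Suc p)" by (auto simp: y_def)
    then show "p \<in> {p. \<xi> p \<noteq> F (Suc p)}"
      using N.coset_zero_iff[OF F_sub, of "x p" "Suc p"] x F_carrier[of "x p" p] by simp
  qed
  ultimately have "finite {p. y p \<noteq> \<zero>}" by (rule rev_finite_subset)
  then have "y \<in> X" by (rule XI[rotated]) (use x in \<open>simp add: y_def F_zero\<close>)
  then show "\<xi> \<in> cls ` X" using c by (intro image_eqI[of _ _ y]) auto
next
  fix \<xi> assume "\<xi> \<in> cls ` X"
  then obtain x where x: "x \<in> X" "\<xi> = cls x" by blast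
  have "{p. \<xi> p \<noteq> F (Suc p)} \<subseteq> {p. x p \<noteq> \<zero>}"
    using N.coset_zero_iff[OF F_sub, of "\<zero>" "Suc _"] F_zero by (auto simp: x cls_def)
  then show "\<xi> \<in> gr_carrier N F" using XD[OF x(1)] unfolding gr_carrier_def x(2) cls_def
    by (auto elim: rev_finite_subset)
qed

lemma cls_add: "x \<in> X \<Longrightarrow> y \<in> X \<Longrightarrow> cls (\<lambda>p. x p \<oplus> y p) p = cls x p <+> cls y p"
  unfolding cls_def using N.coset_add[OF F_sub, of "x p" "y p" "Suc p"] XD(2) by simp

lemma cls_zero: "cls (\<lambda>p. \<zero>) = (\<lambda>p. F (Suc p))"
  using N.coset_zero_iff[OF F_sub, of "\<zero>" "Suc _"] F_zero by (auto simp: cls_def)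

lemma cls_eq_iff: "x \<in> X \<Longrightarrow> y \<in> X \<Longrightarrow> cls x = cls y \<longleftrightarrow> (\<forall>p. x p \<ominus> y p \<in> F (Suc p))"
  unfolding cls_def fun_eq_iff using N.coset_eq_iff[OF F_sub XD(2) XD(2)] by simp

text \<open>\<open>gr_product\<close> is a union over all choices of representatives; they all give
  the same coset, so the Cauchy product of one choice computes it.\<close>

lemma gr_product_cls:
  assumes r: "r \<in> carrier R" and x: "x \<in> X"
  shows "gr_product N F (smult N) (gr_iso r) (cls x) = cls (conv r x)"
proof
  fix p
  interpret RM: graded_mod R A "ring_mod R" A by (rule ring_graded_mod)
  have eq: "F (Suc p) +> (\<Oplus>i\<in>{..p}. a i \<odot> y (p - i)) = cls (conv r x) p"
    if a: "\<forall>i. a i \<in> gr_iso r i" and y: "\<forall>i. y i \<in> cls x i" for a y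
  proof -
    have d: "\<exists>u\<in>mp (Suc i). a i = u \<oplus>\<^bsub>R\<^esub> A.cmp r i" "\<exists>u\<in>F (Suc i). y i = u \<oplus> x i" for i
      using a[rule_format, of i] y[rule_format, of i] by (auto simp: gr_iso_def cls_def a_r_coset_def r_coset_def)
    obtain u where u: "\<And>i. u i \<in> mp (Suc i)" "\<And>i. a i = u i \<oplus>\<^bsub>R\<^esub> A.cmp r i" using d(1) by metis
    obtain v where v: "\<And>i. v i \<in> F (Suc i)" "\<And>i. y i = v i \<oplus> x i" using d(2) by metis
    have c: "u i \<in> carrier R" "A.cmp r i \<in> carrier R" "v i \<in> carrier N" "x i \<in> carrier N" for i
      using u(1)[of i] F_carrier[OF v(1)[of i]] XD(2)[OF x, of i] r ideal.Icarr[OF mp_ideal u(1)[of i]] by simp_all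
    \<comment> \<open>The error in the \<open>i\<close>-th term when other representatives are
      taken. Each of its two summands has a factor from one filtration step further, so it lies in
      \<open>F (Suc p)\<close>.\<close>
    define w where "w i = u i \<odot> (v (p - i) \<oplus> x (p - i)) \<oplus> A.cmp r i \<odot> v (p - i)" for i
    have w: "w i \<in> F (Suc p)" if i: "i \<le> p" for i
    proof -
      have "v (p - i) \<oplus> x (p - i) \<in> F (p - i)" using v(1)[of "p - i"] F_Suc XD(1)[OF x] by (auto intro: F_add)
      from mp_F[OF u(1)[of i] this] F_smult[OF A.comp_props(1)[OF r, of i] v(1)[of "p - i"]]
      show ?thesis using i by (auto simp: w_def intro: F_add)
    qed
    have e: "a i \<odot> y (p - i) = w i \<oplus> A.cmp r i \<odot> x (p - i)" for i
      using c by (simp add: w_def u(2) v(2) N.smult_l_distr N.smult_r_distr N.M.a_ac)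
    have "(\<Oplus>i\<in>{..p}. a i \<odot> y (p - i)) = (\<Oplus>i\<in>{..p}. w i) \<oplus> conv r x p"
      unfolding e conv_def using c by (intro N.M.finsum_addf) (auto simp: w_def Pi_def)
    moreover have wF: "(\<Oplus>i\<in>{..p}. w i) \<in> F (Suc p)" using w by (intro N.submodule_finsum_closed[OF F_sub]) auto
    moreover have cc: "conv r x p \<in> carrier N" using F_carrier[OF conv_F[OF r XD(1)[OF x]]] .
    ultimately show ?thesis unfolding cls_def
      using N.coset_eq_iff[OF F_sub, of "(\<Oplus>i\<in>{..p}. w i) \<oplus> conv r x p" "conv r x p" "Suc p"]
        F_carrier[OF wF] by (simp add: a_minus_def N.M.a_assoc N.M.r_neg)
  qed
  have "A.cmp r i \<in> gr_iso r i" for i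
    using RM.N.coset_mem_iff[OF mp_submodule, of "A.cmp r i" "A.cmp r i" "Suc i"] RM.N.M.r_neg[of "A.cmp r i"] r mp_submodule[of "Suc i"]
    by (simp add: gr_iso_def coset_ring_mod submodule_def a_minus_def RM.N.M.r_neg)
  moreover have "x i \<in> cls x i" for i
    using N.coset_mem_iff[OF F_sub, of "x i" "x i" "Suc i"] XD(2)[OF x, of i] F_zero
    by (simp add: cls_def a_minus_def N.M.r_neg)
  ultimately show "gr_product N F (smult N) (gr_iso r) (cls x) p = cls (conv r x) p"
    unfolding gr_product_def using eq by blast
qed

end

text \<open>The module laws pass to a surjective image, here with the scalars mapped by
  \<open>\<phi>\<close> as well; negatives are images of negatives.\<close>

lemma module_image:
  fixes Y (structure)
  assumes "Module.module R W" "cring S" and \<phi>: "\<phi> ` carrier R = carrier S"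
    and \<phi>_hom: "\<And>a b. a \<in> carrier R \<Longrightarrow> b \<in> carrier R \<Longrightarrow> \<phi> (a \<oplus>\<^bsub>R\<^esub> b) = \<phi> a \<oplus>\<^bsub>S\<^esub> \<phi> b"
      "\<And>a b. a \<in> carrier R \<Longrightarrow> b \<in> carrier R \<Longrightarrow> \<phi> (a \<otimes>\<^bsub>R\<^esub> b) = \<phi> a \<otimes>\<^bsub>S\<^esub> \<phi> b" "\<phi> \<one>\<^bsub>R\<^esub> = \<one>\<^bsub>S\<^esub>"
    and h: "h ` carrier W = carrier Y" "h \<zero>\<^bsub>W\<^esub> = \<zero>"
      "\<And>x y. x \<in> carrier W \<Longrightarrow> y \<in> carrier W \<Longrightarrow> h (x \<oplus>\<^bsub>W\<^esub> y) = h x \<oplus> h y"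
      "\<And>a x. a \<in> carrier R \<Longrightarrow> x \<in> carrier W \<Longrightarrow> h (a \<odot>\<^bsub>W\<^esub> x) = \<phi> a \<odot> h x"
  shows "Module.module S Y"
proof -
  interpret W: Module.module R W by fact
  note hs = h(3,4)[symmetric] and ps = \<phi>_hom(1,2)[symmetric]
  show ?thesis
  proof (rule Module.module.intro)
    show "cring S" by fact
    show "abelian_group Y"
    proof (rule abelian_groupI, unfold h(1,2)[symmetric])
      show "\<exists>y\<in>h ` carrier W. y \<oplus> x = h \<zero>\<^bsub>W\<^esub>" if "x \<in> h ` carrier W" for x
      proof -
        from that obtain w where w: "w \<in> carrier W" "x = h w" by blast
        then have "h (\<ominus>\<^bsub>W\<^esub> w) \<oplus> x = h \<zero>\<^bsub>W\<^esub>" by (simp add: hs W.M.l_neg)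
        then show ?thesis using w(1) by (intro bexI[of _ "h (\<ominus>\<^bsub>W\<^esub> w)"]) simp_all
      qed
      show "x \<oplus> y \<in> h ` carrier W" "x \<oplus> y = y \<oplus> x" if "x \<in> h ` carrier W" "y \<in> h ` carrier W" for x y
        using that by (auto simp: hs W.M.a_comm)
      show "x \<oplus> y \<oplus> z = x \<oplus> (y \<oplus> z)"
        if "x \<in> h ` carrier W" "y \<in> h ` carrier W" "z \<in> h ` carrier W" for x y z
        using that by (auto simp: hs W.M.a_assoc)
      show "h \<zero>\<^bsub>W\<^esub> \<in> h ` carrier W" by simp
      show "h \<zero>\<^bsub>W\<^esub> \<oplus> x = x" if "x \<in> h ` carrier W" for x using that by (auto simp: hs)
    qed
    show "Module.module_axioms S Y"
      by (rule Module.module_axioms.intro, unfold h(1)[symmetric] \<phi>[symmetric] \<phi>_hom(3)[symmetric])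
        (auto simp: hs ps W.smult_l_distr W.smult_r_distr W.smult_assoc1)
  qed
qed

lemma igrading_image:
  fixes H (structure)
  assumes G: "igrading G A" and H: "abelian_group H" and bij: "bij_betw h (carrier G) (carrier H)"
    and add: "\<And>x y. x \<in> carrier G \<Longrightarrow> y \<in> carrier G \<Longrightarrow> h (x \<oplus>\<^bsub>G\<^esub> y) = h x \<oplus> h y"
  shows "igrading H (\<lambda>p. h ` A p)"
proof -
  interpret G: igrading G A by fact
  interpret H: abelian_group H by fact
  let ?g = "inv_into (carrier G) h"
  have hc: "h x \<in> carrier H" if "x \<in> carrier G" for x using bij that by (auto simp: bij_betw_def)
  have g: "?g y \<in> carrier G" "h (?g y) = y" if "y \<in> carrier H" for y
    using bij that by (auto simp: bij_betw_def inv_into_into f_inv_into_f)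
  have gh: "?g (h x) = x" if "x \<in> carrier G" for x using bij that by (simp add: bij_betw_def inv_into_f_f)
  have h: "h \<in> carrier G \<rightarrow> carrier H" using hc by blast
  have h0: "h \<zero>\<^bsub>G\<^esub> = \<zero>" by (rule additive_map_zero[OF G.abelian_group_axioms H h]) (rule add)
  have hm: "h (\<ominus>\<^bsub>G\<^esub> x) = \<ominus> h x" if "x \<in> carrier G" for x
    by (rule additive_map_minus[OF G.abelian_group_axioms H h _ that]) (rule add)
  show ?thesis
  proof (rule igradingI(1)[OF H, of _ "\<lambda>y i. h (G.cmp (?g y) i)"])
    fix i
    show "additive_subgroup (h ` A i) H"
    proof (intro additive_subgroup.intro H.add.subgroupI)
      show "h ` A i \<subseteq> carrier H" using hc G.A_carrier by blast
      show "h ` A i \<noteq> {}" using G.A_zero by blast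
      show "\<ominus> a \<in> h ` A i" if "a \<in> h ` A i" for a
      proof -
        from that obtain x where x: "x \<in> A i" "a = h x" by blast
        then show ?thesis using hm[OF G.A_carrier[OF x(1)]] G.A_minus[OF x(1)] by (intro image_eqI[of _ _ "\<ominus>\<^bsub>G\<^esub> x"]) simp_all
      qed
      show "a \<oplus> b \<in> h ` A i" if "a \<in> h ` A i" "b \<in> h ` A i" for a b
      proof -
        from that obtain x y where x: "x \<in> A i" "a = h x" and y: "y \<in> A i" "b = h y" by blast
        then show ?thesis using add[OF G.A_carrier[OF x(1)] G.A_carrier[OF y(1)]] G.A_add[OF x(1) y(1)]
          by (intro image_eqI[of _ _ "x \<oplus>\<^bsub>G\<^esub> y"]) simp_all
      qed
    qed
  next
    fix y i assume y: "y \<in> carrier H"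
    show "h (G.cmp (?g y) i) \<in> h ` A i" using g(1)[OF y] by (intro imageI G.comp_props)
    {
      fix z assume z: "z \<in> carrier H"
      have "y \<oplus> z = h (?g y \<oplus>\<^bsub>G\<^esub> ?g z)" using g[OF y] g[OF z] add by simp
      then have "?g (y \<oplus> z) = ?g y \<oplus>\<^bsub>G\<^esub> ?g z" using gh g(1)[OF y] g(1)[OF z] by simp
      then show "h (G.cmp (?g (y \<oplus> z)) i) = h (G.cmp (?g y) i) \<oplus> h (G.cmp (?g z) i)"
        using add G.comp_add g(1)[OF y] g(1)[OF z] by simp
    }
  next
    fix y i j assume "y \<in> h ` A j"
    then obtain x where x: "x \<in> A j" "y = h x" by blast
    show "h (G.cmp (?g y) i) = (if i = j then y else \<zero>)"
      using gh[OF G.A_carrier[OF x(1)]] G.comp_homog[OF x(1), of i] h0 x(2) by simp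
  next
    fix y assume y: "y \<in> carrier H"
    obtain n where n: "\<And>i. i \<ge> n \<Longrightarrow> G.cmp (?g y) i = \<zero>\<^bsub>G\<^esub>" "(\<Oplus>\<^bsub>G\<^esub>i\<in>{..<n}. G.cmp (?g y) i) = ?g y"
      using G.comp_bound[OF g(1)[OF y]] by blast
    have "h (\<Oplus>\<^bsub>G\<^esub>i\<in>{..<n}. G.cmp (?g y) i) = (\<Oplus>i\<in>{..<n}. h (G.cmp (?g y) i))"
      by (rule additive_map_finsum[OF G.abelian_group_axioms H h add]) (use g(1)[OF y] in auto)
    then show "\<exists>n. (\<forall>i\<ge>n. h (G.cmp (?g y) i) = \<zero>) \<and> (\<Oplus>i\<in>{..<n}. h (G.cmp (?g y) i)) = y"
      using n g[OF y] h0 by (intro exI[of _ n]) simp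
  qed
qed

section \<open>Transport along an isomorphism of algebras\<close>

locale alg_iso = std_alg R A for R :: "('a, 'x) ring_scheme" (structure) and A +
  fixes S :: "('s, 'z) ring_scheme" and h :: "'a \<Rightarrow> 's"
  assumes S_cring: "cring S" and iso: "h \<in> ring_iso R S"
begin

sublocale S: cring S by (rule S_cring)

abbreviation "AS p \<equiv> h ` A p"

lemma hom: "h \<in> ring_hom R S" and bij: "bij_betw h (carrier R) (carrier S)"
  using iso by (auto simp: ring_iso_def)

lemma h_carrier [simp]: "r \<in> carrier R \<Longrightarrow> h r \<in> carrier S" by (rule ring_hom_closed[OF hom])
lemma h_add: "r \<in> carrier R \<Longrightarrow> s \<in> carrier R \<Longrightarrow> h (r \<oplus> s) = h r \<oplus>\<^bsub>S\<^esub> h s" by (rule ring_hom_add[OF hom])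
lemma h_mult: "r \<in> carrier R \<Longrightarrow> s \<in> carrier R \<Longrightarrow> h (r \<otimes> s) = h r \<otimes>\<^bsub>S\<^esub> h s" by (rule ring_hom_mult[OF hom])
lemma h_one: "h \<one> = \<one>\<^bsub>S\<^esub>" by (rule ring_hom_one[OF hom])

lemma h_map: "h \<in> carrier R \<rightarrow> carrier S" by simp

lemma h_zero: "h \<zero> = \<zero>\<^bsub>S\<^esub>"
  by (rule additive_map_zero[OF R.abelian_group_axioms S.abelian_group_axioms h_map h_add])

lemma h_finsum: "(\<And>t. t \<in> T \<Longrightarrow> f t \<in> carrier R) \<Longrightarrow> h (finsum R f T) = finsum S (\<lambda>t. h (f t)) T"
  by (rule additive_map_finsum[OF R.abelian_group_axioms S.abelian_group_axioms h_map h_add])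

lemma h_eq_iff: "r \<in> carrier R \<Longrightarrow> s \<in> carrier R \<Longrightarrow> h r = h s \<longleftrightarrow> r = s"
  using bij by (auto simp: bij_betw_def inj_on_def)

lemma h_A_iff: "r \<in> carrier R \<Longrightarrow> h r \<in> AS p \<longleftrightarrow> r \<in> A p"
  using h_eq_iff A.A_carrier by blast

lemma AS_grading: "igrading S AS"
  by (rule igrading_image[OF A.igrading_axioms S.abelian_group_axioms bij h_add])

lemma h_comp: "r \<in> carrier R \<Longrightarrow> component S AS (h r) n = h (A.cmp r n)"
  by (rule comp_map[OF A.igrading_axioms AS_grading h_map h_add]) auto

lemma S_graded: "graded_ring S AS"
proof -
  have "h a \<otimes>\<^bsub>S\<^esub> h b \<in> AS (i + j)" if "a \<in> A i" "b \<in> A j" for a b i j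
    using h_mult[symmetric] A.A_carrier[OF that(1)] A.A_carrier[OF that(2)] A_mult[OF that] by simp
  moreover have "\<one>\<^bsub>S\<^esub> \<in> AS 0" using one_A0 h_one by (intro image_eqI[of _ _ "\<one>"]) auto
  ultimately show ?thesis
    using AS_grading S_cring by (auto simp: graded_ring_def igrading_def igrading_axioms_def)
qed

lemma S_standard: "standard_graded_algebra S AS"
  unfolding standard_graded_algebra_def
proof (intro conjI)
  interpret h: ring_hom_ring R S h
    by (intro ring_hom_ringI2 hom) (rule R.ring_axioms, rule S.ring_axioms)
  show "graded_ring S AS" by (rule S_graded)
  have "\<one> \<noteq> \<zero>" using subfieldE(6)[OF subf] .
  then have "\<one>\<^bsub>S\<^esub> \<noteq> \<zero>\<^bsub>S\<^esub>" using h_eq_iff[of "\<one>" "\<zero>"] h_one h_zero by simp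
  then show "subfield (AS 0) S" by (rule h.img_is_subfield(2)[OF subf])
  obtain G where G: "finite G" "G \<subseteq> A 1" "generate_ring R (A 0 \<union> G) = carrier R"
    using std unfolding standard_graded_algebra_def by blast
  have c: "A 0 \<union> G \<subseteq> carrier R" using G(2) A.A_carrier by blast
  have "x \<in> carrier R \<and> h x \<in> generate_ring S (AS 0 \<union> h ` G)" if "x \<in> generate_ring R (A 0 \<union> G)" for x
    using that
  proof (induction x rule: generate_ring.induct)
    case (incl x)
    then have "h x \<in> AS 0 \<union> h ` G" by blast
    then show ?case using incl c by (auto intro: generate_ring.incl)
  qed (auto simp: h_one h_add h_mult intro: generate_ring.intros)
  then have "h ` carrier R \<subseteq> generate_ring S (AS 0 \<union> h ` G)" using G(3) by blast
  then have "carrier S \<subseteq> generate_ring S (AS 0 \<union> h ` G)" using bij by (simp add: bij_betw_def)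
  moreover have "AS 0 \<union> h ` G \<subseteq> carrier S" using c by auto
  ultimately have "generate_ring S (AS 0 \<union> h ` G) = carrier S" using S.generate_ring_in_carrier by blast
  then show "\<exists>T. finite T \<and> T \<subseteq> AS 1 \<and> generate_ring S (AS 0 \<union> T) = carrier S"
    using G by (intro exI[of _ "h ` G"]) auto
qed

lemma irrelevant_image: "r \<in> carrier R \<Longrightarrow> h r \<in> irrelevant_ideal S AS \<longleftrightarrow> r \<in> Irr"
  using h_eq_iff[of "A.cmp r 0" "\<zero>"] by (simp add: irrelevant_ideal_def h_comp h_zero)

lemma fam_lift:
  assumes y: "y \<in> fam_grading (ring_mod S) AS I d j"
  shows "\<exists>x\<in>fam_grading (ring_mod R) A I d j. y = (\<lambda>c. h (x c))"
proof -
  have "\<forall>c. \<exists>r. r \<in> carrier R \<and> y c = h r"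
    using y bij by (auto simp: fam_grading_def fam_carrier_iff bij_betw_def)
  then obtain x where x: "\<forall>c. x c \<in> carrier R \<and> y c = h (x c)" by (elim choice[THEN exE]) (rule that)
  have z: "h (x c) = \<zero>\<^bsub>S\<^esub> \<longleftrightarrow> x c = \<zero>" for c using x h_eq_iff[of "x c" "\<zero>"] h_zero by simp
  have "x \<in> fam_grading (ring_mod R) A I d j"
    using y x z by (simp add: fam_grading_def fam_carrier_iff h_A_iff cong: if_cong)
  then show ?thesis using x by blast
qed

lemma fam_push:
  assumes x: "x \<in> fam_grading (ring_mod R) A I d j"
  shows "(\<lambda>c. h (x c)) \<in> fam_grading (ring_mod S) AS I d j"
proof -
  have "finite {c. h (x c) \<noteq> \<zero>\<^bsub>S\<^esub>}"
    by (rule finite_subset[of _ "{c. x c \<noteq> \<zero>}"]) (use x h_zero in \<open>auto simp: fam_grading_def fam_carrier_iff\<close>)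
  then show ?thesis using x by (simp add: fam_grading_def fam_carrier_iff h_zero h_A_iff cong: if_cong)
qed

text \<open>Applied to \<open>gr_iso\<close>, this makes the images of the entries of
  \<open>K\<close> a resolution of the residue field over the associated graded ring, with the same
  index sets and weights. Tor over both rings is thus computed by corresponding matrices.\<close>

lemma kres_image:
  assumes "kres R A J e \<kappa>"
  shows "kres S AS J e (\<lambda>b c f. h (\<kappa> b c f))"
proof -
  interpret k: kres R A J e \<kappa> by fact
  have sum: "(\<Oplus>\<^bsub>S\<^esub>f\<in>J (Suc b). h (\<kappa> b c f) \<otimes>\<^bsub>S\<^esub> h (x f)) = h (\<Oplus>f\<in>J (Suc b). \<kappa> b c f \<otimes> x f)"
    if c: "c \<in> J b" and x: "\<And>f. f \<in> J (Suc b) \<Longrightarrow> x f \<in> carrier R" for b c x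
  proof -
    have "h (\<Oplus>f\<in>J (Suc b). \<kappa> b c f \<otimes> x f) = (\<Oplus>\<^bsub>S\<^esub>f\<in>J (Suc b). h (\<kappa> b c f \<otimes> x f))"
      using k.\<kappa>_carrier[OF c] x by (intro h_finsum) simp
    also have "\<dots> = (\<Oplus>\<^bsub>S\<^esub>f\<in>J (Suc b). h (\<kappa> b c f) \<otimes>\<^bsub>S\<^esub> h (x f))"
      using k.\<kappa>_carrier[OF c] x by (intro S.finsum_cong') (auto simp: h_mult)
    finally show ?thesis by (rule sym)
  qed
  have sc: "(\<Oplus>f\<in>J (Suc b). \<kappa> b c f \<otimes> x f) \<in> carrier R"
    if "c \<in> J b" "\<And>f. f \<in> J (Suc b) \<Longrightarrow> x f \<in> carrier R" for b c x
    using k.\<kappa>_carrier[OF that(1)] that(2) by (intro R.finsum_closed) simp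
  have xc: "x c \<in> carrier R" if "x \<in> fam_grading (ring_mod R) A I d j" for x c I d j
    using that by (simp add: fam_grading_def fam_carrier_iff)
  show ?thesis
  proof (intro kres.intro kres_axioms.intro standard_graded_alg[OF S_standard])
    fix b c f j
    show "finite (J b)" by (rule k.finJ)
    show "J 0 = {0}" "e 0 0 = 0" by (rule k.J0 k.e0)+
    show "h (\<kappa> 0 0 f) \<in> irrelevant_ideal S AS" if "f \<in> J (Suc 0)"
      using k.\<kappa>_Irr[OF that] Irr_carrier irrelevant_image by blast
    show "if e b c \<le> e (Suc b) f then h (\<kappa> b c f) \<in> AS (e (Suc b) f - e b c) else h (\<kappa> b c f) = \<zero>\<^bsub>S\<^esub>"
      if "c \<in> J b" "f \<in> J (Suc b)"
      using k.\<kappa>_hom[OF that] h_zero by (auto split: if_splits)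
    show "(\<Oplus>\<^bsub>S\<^esub>g\<in>J (Suc b). h (\<kappa> b c g) \<otimes>\<^bsub>S\<^esub> h (\<kappa> (Suc b) g f)) = \<zero>\<^bsub>S\<^esub>" if "c \<in> J b" "f \<in> J (Suc (Suc b))"
      using sum[OF that(1), of "\<lambda>g. \<kappa> (Suc b) g f"] k.\<kappa>_carrier[OF _ that(2)] k.\<kappa>\<kappa>[OF that] h_zero by simp
  next
    fix y b j assume y: "y \<in> fam_grading (ring_mod S) AS (J (Suc b)) (e (Suc b)) j"
      and 0: "\<And>c. c \<in> J b \<Longrightarrow> (\<Oplus>\<^bsub>S\<^esub>f\<in>J (Suc b). h (\<kappa> b c f) \<otimes>\<^bsub>S\<^esub> y f) = \<zero>\<^bsub>S\<^esub>"
    obtain x where x: "x \<in> fam_grading (ring_mod R) A (J (Suc b)) (e (Suc b)) j" "y = (\<lambda>c. h (x c))" using fam_lift[OF y] by blast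
    have "(\<Oplus>f\<in>J (Suc b). \<kappa> b c f \<otimes> x f) = \<zero>" if c: "c \<in> J b" for c
      using 0[OF c] sum[OF c xc[OF x(1)]] h_eq_iff[OF sc[OF c xc[OF x(1)]], of "\<zero>"] h_zero x(2) by simp
    from k.\<kappa>_exact[OF x(1) this] obtain z where
      z: "z \<in> fam_grading (ring_mod R) A (J (Suc (Suc b))) (e (Suc (Suc b))) j"
        "\<forall>f\<in>J (Suc b). (\<Oplus>g\<in>J (Suc (Suc b)). \<kappa> (Suc b) f g \<otimes> z g) = x f" by blast
    show "\<exists>z\<in>fam_grading (ring_mod S) AS (J (Suc (Suc b))) (e (Suc (Suc b))) j.
        \<forall>f\<in>J (Suc b). (\<Oplus>\<^bsub>S\<^esub>g\<in>J (Suc (Suc b)). h (\<kappa> (Suc b) f g) \<otimes>\<^bsub>S\<^esub> z g) = y f"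
      by (rule bexI[OF _ fam_push[OF z(1)]]) (use z(2) sum xc[OF z(1)] x(2) in simp)
  next
    fix s j assume "s \<in> AS j" and j: "0 < j"
    then obtain a where a: "a \<in> A j" "s = h a" by blast
    obtain z where z: "z \<in> fam_grading (ring_mod R) A (J (Suc 0)) (e (Suc 0)) j" "(\<Oplus>f\<in>J (Suc 0). \<kappa> 0 0 f \<otimes> z f) = a"
      using k.\<kappa>_onto[OF a(1) j] by blast
    show "\<exists>z\<in>fam_grading (ring_mod S) AS (J (Suc 0)) (e (Suc 0)) j. (\<Oplus>\<^bsub>S\<^esub>f\<in>J (Suc 0). h (\<kappa> 0 0 f) \<otimes>\<^bsub>S\<^esub> z f) = s"
      by (rule bexI[OF _ fam_push[OF z(1)]]) (use z(2) sum[of 0 0 z] xc[OF z(1)] k.J0 a(2) in simp)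
  qed
qed

end

context std_alg begin

lemma ring_filtered: "filtered_mod R A (ring_mod R) mp"
proof (intro filtered_mod.intro filtered_mod_axioms.intro std_alg_axioms)
  show "Module.module R (ring_mod R)" by (rule ring_mod_module[OF R_cring])
  show "submodule R (mp p) (ring_mod R)" "mp (Suc p) \<subseteq> mp p" for p by (rule mp_submodule, rule mp_Suc)
  show "a \<odot>\<^bsub>ring_mod R\<^esub> x \<in> mp (i + p)" if "a \<in> A i" "x \<in> mp p" for a x i p
    using mp_mult[OF homog_mp[OF that(1)] that(2)] by simp
qed simp

abbreviation "gR \<equiv> gr_ring R A"
abbreviation "gA \<equiv> gr_ring_grading R A"

text \<open>The ring is a filtered module over itself, so additivity and multiplicativity are
  instances of \<open>cls_add\<close> and \<open>gr_product_cls\<close> for sequences of components.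
  Injectivity holds because a homogeneous element of degree \<open>p\<close> in m^(p+1) is
  zero.\<close>

lemma gr_iso_props:
  shows "gr_iso ` carrier R = carrier gR"
    and "r \<in> carrier R \<Longrightarrow> s \<in> carrier R \<Longrightarrow> gr_iso (r \<oplus> s) = gr_iso r \<oplus>\<^bsub>gR\<^esub> gr_iso s"
    and "r \<in> carrier R \<Longrightarrow> s \<in> carrier R \<Longrightarrow> gr_iso (r \<otimes> s) = gr_iso r \<otimes>\<^bsub>gR\<^esub> gr_iso s"
    and "gr_iso \<one> = \<one>\<^bsub>gR\<^esub>" "gr_iso \<zero> = \<zero>\<^bsub>gR\<^esub>"
    and "r \<in> carrier R \<Longrightarrow> s \<in> carrier R \<Longrightarrow> gr_iso r = gr_iso s \<Longrightarrow> r = s"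
    and "gA p = gr_iso ` A p"
proof -
  interpret F: filtered_mod R A "ring_mod R" mp by (rule ring_filtered)
  have X: "A.cmp r \<in> F.X" if "r \<in> carrier R" for r
    using A.comp_props[OF that] homog_mp by (intro F.XI) auto
  have cls: "F.cls (A.cmp r) = gr_iso r" for r by (simp add: F.cls_def gr_iso_def coset_ring_mod fun_eq_iff)
  have sa: "Y <+>\<^bsub>ring_mod R\<^esub> Z = Y <+> Z" for Y Z by (auto simp: set_add_iff)
  have gc: "carrier gR = F.cls ` F.X"
    using F.gr_carrier by (simp add: gr_ring_def gr_carrier_def coset_ring_mod)
  show "gr_iso ` carrier R = carrier gR" unfolding gc
  proof (intro equalityI subsetI)
    fix \<xi> assume "\<xi> \<in> F.cls ` F.X"
    then obtain x where x: "x \<in> F.X" "\<xi> = F.cls x" by blast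
    have xc: "x p \<in> carrier R" for p using F.XD(2)[OF x(1), of p] by simp
    have fin: "finite {p. x p \<noteq> \<zero>}" using F.XD(3)[OF x(1)] by simp
    \<comment> \<open>Modulo m^(p+1) an element of m^p is determined by its component of degree
      \<open>p\<close>; adding up these components over all \<open>p\<close> gives the preimage
      \<open>r\<close>.\<close>
    define f where "f p = A.cmp (x p) p" for p
    define r where "r = (\<Oplus>p\<in>{p. x p \<noteq> \<zero>}. f p)"
    have fA: "f p \<in> A p" for p unfolding f_def by (rule A.comp_props[OF xc])
    have rc: "r \<in> carrier R" unfolding r_def using A.A_carrier[OF fA] by (intro R.finsum_closed) simp
    have "A.cmp r = f" by (rule A.comp_unique[OF fA fin _ r_def]) (simp add: f_def)
    then have "A.cmp (x p) i = A.cmp (A.cmp r p) i" if "i < Suc p" for p i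
      using F.XD(1)[OF x(1), of p] that A.comp_homog[OF A.comp_props(1)[OF rc, of p], of i] by (auto simp: mp_iff f_def less_Suc_eq)
    then have "mp (Suc p) +> x p = mp (Suc p) +> A.cmp r p" for p
      using mp_coset_iff[OF xc[of p] A.comp_carrier[OF rc, of p], of "Suc p"] by blast
    then have "\<xi> = gr_iso r" by (simp add: x(2) F.cls_def gr_iso_def coset_ring_mod fun_eq_iff)
    then show "\<xi> \<in> gr_iso ` carrier R" using rc by blast
  next
    fix \<xi> assume "\<xi> \<in> gr_iso ` carrier R"
    then obtain r where "r \<in> carrier R" "\<xi> = gr_iso r" by blast
    then show "\<xi> \<in> F.cls ` F.X" using X[of r] cls[of r] by (intro image_eqI[of _ _ "A.cmp r"]) simp_all
  qed
  show "gr_iso (r \<oplus> s) = gr_iso r \<oplus>\<^bsub>gR\<^esub> gr_iso s" if "r \<in> carrier R" "s \<in> carrier R"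
  proof
    fix p
    have "A.cmp (r \<oplus> s) = (\<lambda>p. A.cmp r p \<oplus>\<^bsub>ring_mod R\<^esub> A.cmp s p)" using A.comp_add[OF that] by (simp add: fun_eq_iff)
    then show "gr_iso (r \<oplus> s) p = (gr_iso r \<oplus>\<^bsub>gR\<^esub> gr_iso s) p"
      unfolding cls[symmetric] using F.cls_add[OF X[OF that(1)] X[OF that(2)], of p] by (simp add: sa gr_ring_def)
  qed
  show "gr_iso (r \<otimes> s) = gr_iso r \<otimes>\<^bsub>gR\<^esub> gr_iso s" if "r \<in> carrier R" "s \<in> carrier R"
  proof -
    have "F.conv r (A.cmp s) = A.cmp (r \<otimes> s)"
      using comp_mult[OF that] by (simp add: F.conv_def finsum_ring_mod fun_eq_iff)
    moreover have "gr_product (ring_mod R) mp f \<rho> \<xi> = gr_product R mp f \<rho> \<xi>" for f :: "'a \<Rightarrow> 'a \<Rightarrow> 'a" and \<rho> \<xi>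
      unfolding gr_product_def coset_ring_mod finsum_ring_mod by (rule refl)
    ultimately show ?thesis using F.gr_product_cls[OF that(1) X[OF that(2)]] by (simp add: cls gr_ring_def)
  qed
  have hom: "gr_class R mp p r = gr_iso r" if "r \<in> A p" for p r
    using A.comp_homog[OF that] by (simp add: gr_class_def gr_iso_def fun_eq_iff)
  show "gr_iso \<one> = \<one>\<^bsub>gR\<^esub>" using hom[OF one_A0] by (simp add: gr_ring_def)
  show "gr_iso \<zero> = \<zero>\<^bsub>gR\<^esub>"
  proof -
    have "A.cmp \<zero> = (\<lambda>p. \<zero>)" by (simp add: fun_eq_iff)
    then show ?thesis using F.cls_zero cls[of "\<zero>"] by (simp add: gr_ring_def)
  qed
  show "r = s" if "r \<in> carrier R" "s \<in> carrier R" "gr_iso r = gr_iso s"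
  proof (rule A.comp_eqI[OF that(1,2)])
    fix p
    have "mp (Suc p) +> A.cmp r p = mp (Suc p) +> A.cmp s p" using fun_cong[OF that(3), of p] by (simp add: gr_iso_def)
    then have "A.cmp (A.cmp r p) p = A.cmp (A.cmp s p) p" using mp_coset_iff[of "A.cmp r p" "A.cmp s p" "Suc p"] that by simp
    then show "A.cmp r p = A.cmp s p" using A.comp_homog[OF A.comp_props(1)] that(1,2) by simp
  qed
  show "gA p = gr_iso ` A p"
  proof (intro equalityI subsetI)
    fix \<xi> assume "\<xi> \<in> gA p"
    then obtain x where x: "x \<in> mp p" "\<xi> = gr_class R mp p x" by (auto simp: gr_grading_def)
    have xc: "x \<in> carrier R" using x(1) by (simp add: mp_iff)
    have "A.cmp x i = A.cmp (A.cmp x p) i" if "i < Suc p" for i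
      using x(1) that A.comp_homog[OF A.comp_props(1)[OF xc, of p], of i] by (auto simp: mp_iff less_Suc_eq)
    then have "mp (Suc p) +> x = mp (Suc p) +> A.cmp x p"
      unfolding mp_coset_iff[OF xc A.comp_carrier[OF xc]] by blast
    then have "\<xi> = gr_class R mp p (A.cmp x p)"
      unfolding x(2) gr_class_def by (intro ext) simp
    then show "\<xi> \<in> gr_iso ` A p" using hom[OF A.comp_props(1)[OF xc, of p]] A.comp_props(1)[OF xc, of p] by simp
  next
    fix \<xi> assume "\<xi> \<in> gr_iso ` A p"
    then obtain r where r: "r \<in> A p" "\<xi> = gr_iso r" by blast
    have "\<xi> = gr_class R mp p r \<and> r \<in> mp p" using hom[OF r(1)] homog_mp[OF r(1)] r(2) by simp
    then show "\<xi> \<in> gA p" unfolding gr_grading_def by blast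
  qed
qed

lemma gr_alg_iso: "alg_iso R A gR gr_iso"
proof (intro alg_iso.intro alg_iso_axioms.intro std_alg_axioms)
  show iso: "gr_iso \<in> ring_iso R gR"
    using gr_iso_props(2-4,6) imageI[of _ "carrier R" gr_iso]
    by (simp add: ring_iso_def ring_hom_def bij_betw_def inj_on_def gr_iso_props(1))
  show "cring gR" using R.ring_iso_imp_img_cring[OF iso] gr_iso_props(5) by (simp add: gr_ring_def)
qed

lemma gA_image: "gA = (\<lambda>p. gr_iso ` A p)" using gr_iso_props(7) by blast

end

section \<open>The associated graded module\<close>

context filtered_mod begin

abbreviation "gM \<equiv> gr_module N F"
abbreviation "gB \<equiv> gr_grading N F"

lemma gM_cls: "cls ` X = carrier gM" using gr_carrier by (simp add: gr_module_def)

lemma gM_module: "Module.module gR gM"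
proof -
  interpret gr: alg_iso R A gR gr_iso by (rule gr_alg_iso)
  show ?thesis
  proof (rule module_image[OF W_module gr.S_cring gr_iso_props(1)])
    show "cls ` carrier W = carrier gM" using gM_cls by (simp add: W_def)
    show "cls \<zero>\<^bsub>W\<^esub> = \<zero>\<^bsub>gM\<^esub>" using cls_zero by (simp add: W_def gr_module_def fam_def)
    show "cls (x \<oplus>\<^bsub>W\<^esub> y) = cls x \<oplus>\<^bsub>gM\<^esub> cls y" if "x \<in> carrier W" "y \<in> carrier W" for x y
      using cls_add[of x y] that by (simp add: W_def gr_module_def fam_def fun_eq_iff)
    show "cls (a \<odot>\<^bsub>W\<^esub> x) = gr_iso a \<odot>\<^bsub>gM\<^esub> cls x" if "a \<in> carrier R" "x \<in> carrier W" for a x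
      using gr_product_cls[of a x] that by (simp add: W_def gr_module_def)
  qed (auto simp: gr.h_add gr.h_mult gr.h_one)
qed

sublocale gM: Module.module gR gM by (rule gM_module)

definition "delta p x = (\<lambda>q. if q = p then x else \<zero>)"

lemma delta_X: "x \<in> F p \<Longrightarrow> delta p x \<in> X"
  by (rule XI) (auto simp: delta_def F_zero)

lemma gr_class_delta: "gr_class N F p x = cls (delta p x)"
  by (simp add: gr_class_def cls_def delta_def fun_eq_iff)

lemma gr_class_carrier: "x \<in> F p \<Longrightarrow> gr_class N F p x \<in> carrier gM"
  using gM_cls delta_X gr_class_delta by blast

lemma gr_class_eq_iff:
  assumes "x \<in> F p" "y \<in> F p"
  shows "gr_class N F p x = gr_class N F p y \<longleftrightarrow> x \<ominus> y \<in> F (Suc p)"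
  unfolding gr_class_delta cls_eq_iff[OF delta_X[OF assms(1)] delta_X[OF assms(2)]]
  using F_zero by (auto simp: delta_def a_minus_def)

lemma gr_class_zero: "\<zero>\<^bsub>gM\<^esub> = gr_class N F p \<zero>"
  unfolding gr_class_delta using cls_zero by (simp add: delta_def gr_module_def)

lemma gr_class_zero_iff: "x \<in> F p \<Longrightarrow> gr_class N F p x = \<zero>\<^bsub>gM\<^esub> \<longleftrightarrow> x \<in> F (Suc p)"
  using gr_class_eq_iff[of x p "\<zero>"] F_zero F_carrier[of x p] by (simp add: gr_class_zero[of p] a_minus_def)

lemma gr_class_add:
  assumes "x \<in> F p" "y \<in> F p"
  shows "gr_class N F p (x \<oplus> y) = gr_class N F p x \<oplus>\<^bsub>gM\<^esub> gr_class N F p y"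
proof
  fix q
  have "delta p (x \<oplus> y) = (\<lambda>q. delta p x q \<oplus> delta p y q)" by (simp add: delta_def fun_eq_iff)
  then show "gr_class N F p (x \<oplus> y) q = (gr_class N F p x \<oplus>\<^bsub>gM\<^esub> gr_class N F p y) q"
    using cls_add[OF delta_X[OF assms(1)] delta_X[OF assms(2)], of q] by (simp add: gr_class_delta gr_module_def)
qed

lemma gr_class_smult:
  assumes a: "a \<in> A i" and x: "x \<in> F p"
  shows "gr_iso a \<odot>\<^bsub>gM\<^esub> gr_class N F p x = gr_class N F (i + p) (a \<odot> x)"
proof -
  have ac: "a \<in> carrier R" by (rule A.A_carrier[OF a])
  have "conv a (delta p x) q = delta (i + p) (a \<odot> x) q" for q
  proof -
    have "conv a (delta p x) q = (\<Oplus>k\<in>{..q}. if k = i then (if q - k = p then a \<odot> x else \<zero>) else \<zero>)"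
      unfolding conv_def using ac F_carrier[OF x]
      by (intro N.M.finsum_cong') (auto simp: A.comp_homog[OF a] delta_def)
    also have "\<dots> = delta (i + p) (a \<odot> x) q"
    proof (cases "i \<le> q")
      case True
      then show ?thesis using N.M.finsum_singleton[of i "{..q}" "\<lambda>k. if q - k = p then a \<odot> x else \<zero>"] ac F_carrier[OF x]
        by (auto simp: delta_def Pi_def eq_commute[of i])
    next
      case False
      then show ?thesis by (auto simp: delta_def intro!: N.M.add.finprod_one_eqI)
    qed
    finally show ?thesis .
  qed
  then have "conv a (delta p x) = delta (i + p) (a \<odot> x)" ..
  then show ?thesis using gr_product_cls[OF ac delta_X[OF x]] by (simp add: gr_class_delta gr_module_def)
qed

lemma cls_component: "x \<in> X \<Longrightarrow> (\<lambda>q. if q = p then cls x q else F (Suc q)) = gr_class N F p (x p)"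
  using N.coset_zero_iff[OF F_sub, of "\<zero>" "Suc _"] F_zero by (auto simp: gr_class_def cls_def fun_eq_iff)

lemma gr_class_sum:
  assumes x: "\<And>p. x p \<in> F p"
  shows "(\<Oplus>\<^bsub>gM\<^esub>i\<in>{..<n}. gr_class N F i (x i)) = cls (\<lambda>p. if p < n then x p else \<zero>)"
proof (induction n)
  case 0
  have "\<zero>\<^bsub>gM\<^esub> = (\<lambda>p. F (Suc p))" by (simp add: gr_module_def)
  then show ?case using cls_zero by simp
next
  case (Suc n)
  let ?y = "\<lambda>n p. if p < n then x p else \<zero>"
  have yX: "?y n \<in> X" for n by (rule XI) (use x F_zero in auto)
  have "?y (Suc n) = (\<lambda>p. ?y n p \<oplus> delta n (x n) p)"
    using F_carrier[OF x] by (auto simp: delta_def fun_eq_iff less_Suc_eq)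
  then have "cls (?y (Suc n)) = cls (?y n) \<oplus>\<^bsub>gM\<^esub> gr_class N F n (x n)"
    using cls_add[OF yX[of n] delta_X[OF x[of n]]] by (simp add: gr_class_delta gr_module_def fun_eq_iff)
  moreover have "gr_class N F i (x i) \<in> carrier gM" for i by (rule gr_class_carrier[OF x])
  moreover have "cls (?y n) \<in> carrier gM" using gM_cls yX by blast
  ultimately show ?case using Suc gM.M.a_comm[of "gr_class N F n (x n)" "cls (?y n)"] by (simp add: lessThan_Suc Pi_def)
qed

lemma X_bound:
  assumes "x \<in> X" obtains n where "\<And>p. p \<ge> n \<Longrightarrow> x p = \<zero>" "(\<Oplus>\<^bsub>gM\<^esub>i\<in>{..<n}. gr_class N F i (x i)) = cls x"
proof -
  obtain n where n: "\<forall>p\<in>{p. x p \<noteq> \<zero>}. p < n" using XD(3)[OF assms] finite_nat_set_iff_bounded by blast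
  then have "\<forall>p\<ge>n. x p = \<zero>" by (auto simp: not_le[symmetric])
  moreover from this have "(\<lambda>p. if p < n then x p else \<zero>) = x" by (auto simp: fun_eq_iff)
  ultimately show thesis using gr_class_sum[OF XD(1)[OF assms], of n] by (intro that[of n]) simp_all
qed

text \<open>The projection to degree \<open>i\<close> keeps the \<open>i\<close>-th coset and
  replaces all others by the zero cosets.\<close>

lemma gM_igrading: "igrading gM gB"
proof -
  have rep: "\<exists>x\<in>X. \<xi> = cls x" if "\<xi> \<in> carrier gM" for \<xi> using that gM_cls by blast
  have add: "cls (\<lambda>p. x p \<oplus> y p) = cls x \<oplus>\<^bsub>gM\<^esub> cls y" if "x \<in> X" "y \<in> X" for x y
    using cls_add[OF that] by (simp add: gr_module_def fun_eq_iff)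
  have addX: "(\<lambda>p. x p \<oplus> y p) \<in> X" if "x \<in> X" "y \<in> X" for x y
  proof (rule XI)
    show "finite {p. x p \<oplus> y p \<noteq> \<zero>}"
      by (rule finite_subset[OF _ finite_UnI[OF XD(3)[OF that(1)] XD(3)[OF that(2)]]]) auto
  qed (rule F_add[OF XD(1)[OF that(1)] XD(1)[OF that(2)]])
  show ?thesis
  proof (rule igradingI(1)[of gM gB "\<lambda>\<xi> p q. if q = p then \<xi> q else F (Suc q)"])
    show "abelian_group gM" ..
    fix i
    show "additive_subgroup (gB i) gM"
    proof (intro additive_subgroup.intro gM.M.add.subgroupI)
      show "gB i \<subseteq> carrier gM" using gr_class_carrier by (auto simp: gr_grading_def)
      show "gB i \<noteq> {}" using F_zero by (auto simp: gr_grading_def)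
      show "\<ominus>\<^bsub>gM\<^esub> a \<in> gB i" if "a \<in> gB i" for a
      proof -
        from that obtain x where x: "x \<in> F i" "a = gr_class N F i x" by (auto simp: gr_grading_def)
        note mx = N.submodule_minus_closed[OF F_sub x(1)]
        have "gr_class N F i (\<ominus> x) \<oplus>\<^bsub>gM\<^esub> a = \<zero>\<^bsub>gM\<^esub>"
          using gr_class_add[OF mx x(1)] N.M.l_neg[OF F_carrier[OF x(1)]] gr_class_zero[of i] x(2) by simp
        then have "\<ominus>\<^bsub>gM\<^esub> a = gr_class N F i (\<ominus> x)"
          using gM.M.minus_equality gr_class_carrier[OF mx] gr_class_carrier[OF x(1)] x(2) by blast
        then show ?thesis using mx unfolding gr_grading_def by blast
      qed
      show "a \<oplus>\<^bsub>gM\<^esub> b \<in> gB i" if "a \<in> gB i" "b \<in> gB i" for a b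
      proof -
        from that obtain x y where x: "x \<in> F i" "a = gr_class N F i x" and y: "y \<in> F i" "b = gr_class N F i y"
          by (auto simp: gr_grading_def)
        have "a \<oplus>\<^bsub>gM\<^esub> b = gr_class N F i (x \<oplus> y)" using gr_class_add[OF x(1) y(1)] x(2) y(2) by simp
        then show ?thesis using F_add[OF x(1) y(1)] unfolding gr_grading_def by blast
      qed
    qed
  next
    fix \<xi> i assume "\<xi> \<in> carrier gM"
    then obtain x where x: "x \<in> X" "\<xi> = cls x" using rep by blast
    show "(\<lambda>q. if q = i then \<xi> q else F (Suc q)) \<in> gB i"
      using cls_component[OF x(1), of i] XD(1)[OF x(1), of i] x(2) by (auto simp: gr_grading_def)
    {
      fix \<eta> assume "\<eta> \<in> carrier gM"
      then obtain y where y: "y \<in> X" "\<eta> = cls y" using rep by blast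
      show "(\<lambda>q. if q = i then (\<xi> \<oplus>\<^bsub>gM\<^esub> \<eta>) q else F (Suc q)) =
        (\<lambda>q. if q = i then \<xi> q else F (Suc q)) \<oplus>\<^bsub>gM\<^esub> (\<lambda>q. if q = i then \<eta> q else F (Suc q))"
        unfolding x(2) y(2) add[OF x(1) y(1), symmetric] cls_component[OF x(1)] cls_component[OF y(1)] cls_component[OF addX[OF x(1) y(1)]]
        by (rule gr_class_add[OF XD(1)[OF x(1)] XD(1)[OF y(1)]])
    }
  next
    fix \<xi> i j assume "\<xi> \<in> gB j"
    then obtain x where x: "x \<in> F j" "\<xi> = gr_class N F j x" by (auto simp: gr_grading_def)
    show "(\<lambda>q. if q = i then \<xi> q else F (Suc q)) = (if i = j then \<xi> else \<zero>\<^bsub>gM\<^esub>)"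
      unfolding x(2) gr_class_delta cls_component[OF delta_X[OF x(1)]] gr_class_zero[of i] by (auto simp: delta_def)
  next
    fix \<xi> assume "\<xi> \<in> carrier gM"
    then obtain x where x: "x \<in> X" "\<xi> = cls x" using rep by blast
    obtain n where n: "\<And>p. p \<ge> n \<Longrightarrow> x p = \<zero>" "(\<Oplus>\<^bsub>gM\<^esub>i\<in>{..<n}. gr_class N F i (x i)) = cls x"
      using X_bound[OF x(1)] by blast
    show "\<exists>n. (\<forall>i\<ge>n. (\<lambda>q. if q = i then \<xi> q else F (Suc q)) = \<zero>\<^bsub>gM\<^esub>) \<and>
        (\<Oplus>\<^bsub>gM\<^esub>i\<in>{..<n}. (\<lambda>q. if q = i then \<xi> q else F (Suc q))) = \<xi>"
      unfolding x(2) cls_component[OF x(1)] using n gr_class_zero[symmetric] by (intro exI[of _ n]) simp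
  qed
qed

lemma gM_graded: "graded_mod gR gA gM gB"
proof (intro graded_mod.intro graded_mod_axioms.intro)
  interpret gr: alg_iso R A gR gr_iso by (rule gr_alg_iso)
  show "graded_alg gR gA" unfolding gA_image by (rule standard_graded_alg[OF gr.S_standard])
  show "graded_module gR gA gM gB" unfolding graded_module_def
  proof (intro conjI allI ballI)
    show "Module.module gR gM" by (rule gM_module)
    show "internal_direct_sum gM gB" using gM_igrading by (simp add: igrading_def igrading_axioms_def)
    fix i j \<rho> \<xi> assume "\<rho> \<in> gA i" "\<xi> \<in> gB j"
    then obtain a x where a: "a \<in> A i" "\<rho> = gr_iso a" and x: "x \<in> F j" "\<xi> = gr_class N F j x"
      unfolding gA_image by (auto simp: gr_grading_def)
    then show "\<rho> \<odot>\<^bsub>gM\<^esub> \<xi> \<in> gB (i + j)"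
      using gr_class_smult[OF a(1) x(1)] F_smult[OF a(1) x(1)] by (auto simp: gr_grading_def)
  qed
qed

text \<open>A scalar from m^i acts on gr through its component of degree \<open>i\<close> alone, as
  the remainder lies in m^(i+1).\<close>

lemma gr_class_mp:
  assumes a: "a \<in> mp i" and x: "x \<in> F p"
  shows "gr_class N F (i + p) (a \<odot> x) = gr_iso (A.cmp a i) \<odot>\<^bsub>gM\<^esub> gr_class N F p x"
proof -
  have ac: "a \<in> carrier R" "A.cmp a i \<in> A i" "A.cmp a i \<in> carrier R" using a A.comp_props(1)[of a i] by (auto simp: mp_iff)
  have "a \<ominus>\<^bsub>R\<^esub> A.cmp a i \<in> mp (Suc i)"
    using a ac A.comp_homog[OF ac(2)] by (auto simp: mp_iff a_minus_def A.comp_add A.comp_minus R.r_neg less_Suc_eq simp del: ideal_power.simps)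
  then have "(a \<ominus>\<^bsub>R\<^esub> A.cmp a i) \<odot> x \<in> F (Suc (i + p))" using mp_F[OF _ x, of _ "Suc i"] by simp
  moreover have "(a \<ominus>\<^bsub>R\<^esub> A.cmp a i) \<odot> x = a \<odot> x \<ominus> A.cmp a i \<odot> x"
    using ac F_carrier[OF x] by (simp add: a_minus_def N.smult_l_distr N.smult_l_minus)
  ultimately have "gr_class N F (i + p) (a \<odot> x) = gr_class N F (i + p) (A.cmp a i \<odot> x)"
    using gr_class_eq_iff[OF mp_F[OF a x] F_smult[OF ac(2) x]] by simp
  then show ?thesis using gr_class_smult[OF ac(2) x] by simp
qed

lemma Irr_mp1: "a \<in> Irr \<longleftrightarrow> a \<in> mp 1"
  unfolding mp_iff by (simp add: irrelevant_ideal_def)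

end

section \<open>Standard bases\<close>

text \<open>Stability speaks only of multiplication by the irrelevant ideal. Induction extends it to
  the powers, and homogeneous scalars of degree \<open>i\<close> lie in the \<open>i\<close>-th
  power.\<close>

lemma stable_filtered:
  fixes N (structure)
  assumes "std_alg R A" "Module.module R N" and st: "stable_filtration R A N F"
  shows "filtered_mod R A N F"
proof -
  interpret std_alg R A by fact
  interpret N: Module.module R N by fact
  have F: "submodule R (F p) N" "F 0 = carrier N" "F (Suc p) \<subseteq> F p" "ideal_smult R N Irr (F p) \<subseteq> F (Suc p)" for p
    using st by (auto simp: stable_filtration_def)
  have Fc: "x \<in> carrier N" if "x \<in> F p" for x p using F(1)[of p] that by (auto simp: submodule_def)
  have I: "a \<odot> x \<in> F (Suc p)" if "a \<in> Irr" "x \<in> F p" for a x p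
  proof -
    have "{a \<odot> x | a x. a \<in> Irr \<and> x \<in> F p} \<subseteq> carrier N" using Irr_carrier Fc by auto
    then have "a \<odot> x \<in> ideal_smult R N Irr (F p)" unfolding ideal_smult_def using that N.in_own_span by blast
    then show ?thesis using F(4) by blast
  qed
  have "a \<in> carrier R \<and> (\<forall>p. \<forall>x\<in>F p. a \<odot> x \<in> F (i + p))" if "a \<in> mp i" for a i
    using that
  proof (induction i arbitrary: a)
    case 0
    have "b \<odot> x \<in> F p" if "b \<in> carrier R" "x \<in> F p" for b x p
      using F(1)[of p] that unfolding submodule_def by blast
    then show ?case using 0 by simp
  next
    case (Suc i)
    from Suc.prems show ?case unfolding ideal_power.simps
    proof (induction a rule: ideal_prod.induct)
      case (prod a b)
      have c: "a \<in> carrier R" "b \<in> carrier R" "\<forall>p. \<forall>x\<in>F p. b \<odot> x \<in> F (i + p)" using prod Suc.IH Irr_carrier by blast+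
      then show ?case using I[OF prod(1)] Fc by (simp add: N.smult_assoc1)
    next
      case (sum a b)
      have "a \<odot> x \<oplus> b \<odot> x \<in> F (Suc i + p)" if "x \<in> F p" for x p
      proof -
        have "a \<odot> x \<in> F (Suc i + p)" "b \<odot> x \<in> F (Suc i + p)" using sum.IH that by simp_all
        then show ?thesis using F(1)[of "Suc i + p"] unfolding submodule_def by simp
      qed
      then show ?case using sum Fc by (simp add: N.smult_l_distr)
    qed
  qed
  then have sm: "a \<odot> x \<in> F (i + p)" if "a \<in> A i" "x \<in> F p" for a i x p using homog_mp[OF that(1)] that(2) by blast
  show ?thesis
  proof (intro filtered_mod.intro filtered_mod_axioms.intro)
    show "std_alg R A" "Module.module R N" by fact+
    show "submodule R (F p) N" "F 0 = carrier N" "F (Suc p) \<subseteq> F p" for p by (rule F(1), rule F(2), rule F(3))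
  qed (rule sm)
qed

locale stable_mod = graded_mod R A N B
  for R :: "('a, 'x) ring_scheme" and A and N :: "('a, 'b, 'y) module_scheme" (structure) and B +
  fixes F :: "nat \<Rightarrow> 'b set"
  assumes stdR: "standard_graded_algebra R A" and fgN: "finitely_generated R N"
    and gsf: "graded_stable_filtration R A N B F"
begin

lemma std_alg: "std_alg R A"
  by (intro std_alg.intro std_alg_axioms.intro graded_alg_axioms stdR)

sublocale filtered_mod R A N F
  by (rule stable_filtered[OF std_alg N_module]) (use gsf in \<open>simp add: graded_stable_filtration_def\<close>)

lemma F_comp: "x \<in> F p \<Longrightarrow> B.cmp x i \<in> F p"
  using gsf by (auto simp: graded_stable_filtration_def graded_submodule_def)

text \<open>A fixed stage from which each step is multiplication by the irrelevant ideal; it enters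
  the explicit bounds on the filtration index below.\<close>

definition "pst = (SOME p0. \<forall>p\<ge>p0. ideal_smult R N Irr (F p) = F (Suc p))"

lemma F_stable: "pst \<le> p \<Longrightarrow> ideal_smult R N Irr (F p) = F (Suc p)"
proof -
  have "\<exists>p0. \<forall>p\<ge>p0. ideal_smult R N Irr (F p) = F (Suc p)"
    using gsf by (simp add: graded_stable_filtration_def stable_filtration_def)
  from someI_ex[OF this] show "pst \<le> p \<Longrightarrow> ideal_smult R N Irr (F p) = F (Suc p)" by (simp add: pst_def)
qed

text \<open>Beyond \<open>pst\<close> the products span the next filtration step, so it is enough to
  find them in \<open>Q\<close>.\<close>

lemma F_Suc_induct:
  assumes p: "pst \<le> p" and Q: "submodule R Q N" "\<And>a y. a \<in> Irr \<Longrightarrow> y \<in> F p \<Longrightarrow> a \<odot> y \<in> Q"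
  shows "F (Suc p) \<subseteq> Q"
proof -
  have "{a \<odot> y | a y. a \<in> Irr \<and> y \<in> F p} \<subseteq> Q" using Q(2) by blast
  then show ?thesis unfolding F_stable[OF p, symmetric] ideal_smult_def by (rule N.span_is_subset) (rule Q(1))
qed

text \<open>Beyond \<open>pst\<close> every step raises degrees by at least one, and the degrees of
  \<open>M\<close> start at 0. So the filtration is separated, and in each degree it reaches zero
  after finitely many steps.\<close>

lemma F_low: "x \<in> F (pst + n) \<Longrightarrow> j < n \<Longrightarrow> B.cmp x j = \<zero>"
proof (induction n arbitrary: x j)
  case (Suc n)
  define Q where "Q = {x \<in> carrier N. \<forall>j<Suc n. B.cmp x j = \<zero>}"
  have "F (Suc (pst + n)) \<subseteq> Q"
  proof (rule F_Suc_induct)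
    show "submodule R Q N"
      using N_module by (auto simp: submodule_def Q_def B.comp_add comp_smult_sum intro!: N.M.add.finprod_one_eqI)
    fix a y assume a: "a \<in> Irr" and y: "y \<in> F (pst + n)"
    have c: "a \<in> carrier R" "y \<in> carrier N" "A.cmp a 0 = \<zero>\<^bsub>R\<^esub>" using a F_carrier[OF y] by (auto simp: irrelevant_ideal_def)
    have "A.cmp a i \<odot> B.cmp y (k - i) = \<zero>" if "k < Suc n" "i \<le> k" for k i
      using Suc.IH[OF y, of "k - i"] c that by (cases "i = 0") auto
    then show "a \<odot> y \<in> Q" using c by (auto simp: Q_def comp_smult_sum intro!: N.M.add.finprod_one_eqI)
  qed simp
  then show ?case using Suc.prems by (auto simp: Q_def)
qed simp

lemma F_B_zero:
  assumes "x \<in> F p" "x \<in> B j" "pst + j < p" shows "x = \<zero>"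
proof -
  have "x \<in> F (pst + Suc j)" using F_antimono[of "pst + Suc j" p] assms by auto
  from F_low[OF this, of j] show ?thesis using B.comp_homog[OF assms(2), of j] by simp
qed

lemma valuation_eq:
  assumes "x \<in> F p" "x \<notin> F (Suc p)" shows "valuation F x = p"
  unfolding valuation_def
proof (rule Greatest_equality)
  show "q \<le> p" if "x \<in> F q" for q using F_antimono[of "Suc p" q] that assms(2) by (auto simp: not_less_eq_eq[symmetric])
qed (rule assms)

text \<open>Otherwise \<open>x\<close> would lie in every \<open>F p\<close> and have no nonzero
  component. The greatest index in the definition of \<open>valuation\<close> therefore
  exists.\<close>

lemma valuation_ex:
  assumes "x \<in> carrier N" "x \<noteq> \<zero>" shows "\<exists>p. x \<in> F p \<and> x \<notin> F (Suc p)"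
proof (rule ccontr)
  assume "\<nexists>p. x \<in> F p \<and> x \<notin> F (Suc p)"
  then have "x \<in> F p" for p by (induction p) (use assms F_0 in auto)
  then have "B.cmp x j = \<zero>" for j using F_low[of x "Suc j" j] by simp
  then have "x = \<zero>" using B.comp_eqI[OF assms(1) N.M.zero_closed] by simp
  then show False using assms by simp
qed

lemma homogeneous_generators:
  "\<exists>G. finite G \<and> G \<subseteq> F p \<and> (\<forall>g\<in>G. \<exists>j. g \<in> B j) \<and> (\<forall>Q. submodule R Q N \<longrightarrow> G \<subseteq> Q \<longrightarrow> F p \<subseteq> Q)"
proof -
  obtain G where G: "finite G" "G \<subseteq> F p" and G3: "\<forall>Q. submodule R Q N \<longrightarrow> G \<subseteq> Q \<longrightarrow> F p \<subseteq> Q"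
    using submodule_finitely_generated[OF stdR N_module fgN F_sub[of p]] by (elim exE conjE) (rule that)
  let ?G = "\<Union>g\<in>G. B.cmp g ` {i. B.cmp g i \<noteq> \<zero>}"
  have Gc: "g \<in> carrier N" if "g \<in> G" for g using G(2) F_carrier that by blast
  show ?thesis
  proof (intro exI[of _ ?G] conjI ballI allI impI)
    show "finite ?G" using G(1) B.comp_props(2)[OF Gc] by blast
    show "?G \<subseteq> F p" using G(2) F_comp by blast
    show "\<exists>j. g \<in> B j" if "g \<in> ?G" for g using that B.comp_props(1)[OF Gc] by blast
    fix Q assume Q: "submodule R Q N" "?G \<subseteq> Q"
    have "g \<in> Q" if g: "g \<in> G" for g
    proof -
      have "(\<Oplus>i\<in>{i. B.cmp g i \<noteq> \<zero>}. B.cmp g i) \<in> Q"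
        by (rule N.submodule_finsum_closed[OF Q(1)]) (use g Q(2) in blast)
      then show ?thesis using B.comp_props(3)[OF Gc[OF g]] by simp
    qed
    then show "F p \<subseteq> Q" using G3 Q(1) by blast
  qed
qed

lemma initial_form_carrier:
  assumes "x \<in> carrier N" "x \<noteq> \<zero>" shows "initial_form N F x \<in> carrier gM"
  using valuation_ex[OF assms] valuation_eq gr_class_carrier by (auto simp: initial_form_def)

text \<open>gr is generated in degrees up to \<open>pst\<close>, since afterwards
  \<open>F (Suc p)\<close> is the irrelevant ideal times \<open>F p\<close>. The basis consists of
  homogeneous generators of the \<open>F p\<close> with \<open>p \<le> pst\<close>, without those
  that lie one step further and have class zero.\<close>

lemma standard_basis_exists: "\<exists>S. standard_basis R A N F S \<and> (\<forall>f\<in>S. \<exists>j. f \<in> B j)"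
proof -
  obtain G where G: "\<And>p. finite (G p)" "\<And>p. G p \<subseteq> F p" "\<And>p g. g \<in> G p \<Longrightarrow> \<exists>j. g \<in> B j"
    "\<And>p Q. submodule R Q N \<Longrightarrow> G p \<subseteq> Q \<Longrightarrow> F p \<subseteq> Q" using homogeneous_generators by metis
  define S where "S = (\<Union>p\<in>{..pst}. {g \<in> G p. g \<notin> F (Suc p)})"
  have S: "S \<subseteq> carrier N - {\<zero>}" using G(2) F_carrier F_zero by (fastforce simp: S_def)
  have ic: "initial_form N F ` S \<subseteq> carrier gM" using S initial_form_carrier by blast
  define U where "U = gM.span (initial_form N F ` S)"
  have U: "submodule gR U gM" "initial_form N F ` S \<subseteq> U"
    unfolding U_def using gM.span_is_submodule[OF ic] gM.in_own_span[OF ic] by blast+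
  have Us: "gr_iso a \<odot>\<^bsub>gM\<^esub> \<xi> \<in> U" if "a \<in> carrier R" "\<xi> \<in> U" for a \<xi>
    using U(1) that gr_iso_props(1) unfolding submodule_def by blast
  \<comment> \<open>The elements of \<open>F p\<close> whose class is reached. As a submodule
    containing generators of \<open>F p\<close> it will be all of \<open>F p\<close>.\<close>
  define Q where "Q p = {x \<in> F p. gr_class N F p x \<in> U}" for p
  have Q: "submodule R (Q p) N" for p
  proof -
    have "gr_class N F p (a \<odot> x) \<in> U" if "a \<in> carrier R" "x \<in> F p" "gr_class N F p x \<in> U" for a x
      using gr_class_mp[of a 0 x p] Us[OF _ that(3)] that by simp
    then show ?thesis using F_sub[of p] U(1) gr_class_zero[of p] gr_class_add[of _ p] F_carrier
      unfolding submodule_def Q_def by auto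
  qed
  have low: "G p \<subseteq> Q p" if p: "p \<le> pst" for p
  proof
    fix g assume g: "g \<in> G p"
    then have gF: "g \<in> F p" using G(2) by blast
    have "gr_class N F p g \<in> U"
    proof (cases "g \<in> F (Suc p)")
      case True
      then have "gr_class N F p g = \<zero>\<^bsub>gM\<^esub>" using gr_class_zero_iff[OF gF] by blast
      then show ?thesis using U(1) by (simp add: submodule_def)
    next
      case False
      then have "g \<in> S" using g p by (auto simp: S_def)
      then show ?thesis using U(2) valuation_eq[OF gF False] by (auto simp: initial_form_def)
    qed
    then show "g \<in> Q p" using gF by (simp add: Q_def)
  qed
  have all: "F p \<subseteq> Q p" for p
  proof (induction p)
    case 0
    show ?case by (rule G(4)[OF Q low]) simp
  next
    case (Suc p)
    show ?case
    proof (cases "Suc p \<le> pst")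
      case True
      then show ?thesis by (intro G(4)[OF Q low])
    next
      case False
      show ?thesis
      proof (rule F_Suc_induct[OF _ Q])
        fix a y assume a: "a \<in> Irr" and y: "y \<in> F p"
        have a1: "a \<in> mp 1" using a Irr_mp1 by blast
        have "gr_class N F p y \<in> U" using y Suc by (auto simp: Q_def)
        then have "gr_class N F (1 + p) (a \<odot> y) \<in> U"
          unfolding gr_class_mp[OF a1 y] using Irr_carrier[OF a] by (intro Us) simp_all
        then show "a \<odot> y \<in> Q (Suc p)" using mp_F[OF a1 y] by (simp add: Q_def del: ideal_power.simps)
      qed (use False in simp)
    qed
  qed
  have "carrier gM \<subseteq> U"
  proof
    fix \<xi> assume "\<xi> \<in> carrier gM"
    then obtain x where x: "x \<in> X" "\<xi> = cls x" using gM_cls by blast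
    obtain n where n: "(\<Oplus>\<^bsub>gM\<^esub>i\<in>{..<n}. gr_class N F i (x i)) = cls x" using X_bound[OF x(1)] by blast
    have "(\<Oplus>\<^bsub>gM\<^esub>i\<in>{..<n}. gr_class N F i (x i)) \<in> U"
    proof (rule gM.submodule_finsum_closed[OF U(1)])
      fix i show "gr_class N F i (x i) \<in> U" using all[of i] XD(1)[OF x(1), of i] by (auto simp: Q_def)
    qed
    then show "\<xi> \<in> U" using n x(2) by simp
  qed
  then have "U = carrier gM" using U(1) by (auto simp: submodule_def)
  moreover have "finite S" using G(1) by (simp add: S_def)
  moreover have "\<forall>f\<in>S. \<exists>j. f \<in> B j" using G(3) by (auto simp: S_def)
  ultimately show ?thesis using S unfolding standard_basis_def U_def by blast
qed

abbreviation "S0 \<equiv> SOME S. minimal_homogeneous_standard_basis R A N B F S"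

text \<open>A homogeneous standard basis with the fewest elements among the subsets of a given one
  is minimal. This gives meaning to the choice in \<open>Delta\<close>.\<close>

lemma minimal_basis: "minimal_homogeneous_standard_basis R A N B F S0"
proof (rule someI_ex)
  obtain S where S: "standard_basis R A N F S" "\<forall>f\<in>S. \<exists>j. f \<in> B j" using standard_basis_exists by blast
  obtain T where T: "T \<subseteq> S \<and> standard_basis R A N F T"
    and min: "\<And>T'. T' \<subseteq> S \<and> standard_basis R A N F T' \<Longrightarrow> card T \<le> card T'"
    using ex_has_least_nat[of "\<lambda>T. T \<subseteq> S \<and> standard_basis R A N F T" S card] S(1) by blast
  have "finite T" using T by (simp add: standard_basis_def)
  then have "\<not> standard_basis R A N F T'" if "T' \<subset> T" for T'
    using psubset_card_mono[OF _ that] min[of T'] T that by fastforce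
  then show "\<exists>S. minimal_homogeneous_standard_basis R A N B F S"
    using T S(2) unfolding minimal_homogeneous_standard_basis_def by blast
qed

lemma S0_props:
  "finite S0" "f \<in> S0 \<Longrightarrow> f \<in> carrier N \<and> f \<noteq> \<zero>" "f \<in> S0 \<Longrightarrow> \<exists>j. f \<in> B j"
  "LinearCombinations.module.span gR gM (initial_form N F ` S0) = carrier gM"
  using minimal_basis unfolding minimal_homogeneous_standard_basis_def standard_basis_def by blast+

lemma gM_finitely_generated: "finitely_generated gR gM"
proof -
  have "initial_form N F ` S0 \<subseteq> carrier gM" using S0_props(2) initial_form_carrier by blast
  then show ?thesis unfolding finitely_generated_def using S0_props(1,4) by blast
qed

text \<open>The elements all of whose components sit in bidegrees with difference in \<open>\<Delta>\<close> form a
  submodule of the associated graded module that contains the initial forms.\<close>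

lemma jump_Delta:
  assumes x: "x \<in> F p" "x \<in> B j" "x \<notin> F (Suc p)"
  shows "int j - int p \<in> Delta R A N B F"
proof (rule ccontr)
  assume nd: "int j - int p \<notin> Delta R A N B F"
  \<comment> \<open>The formal gr has no internal grading, so the condition is put on
    representatives: the degree \<open>j\<close> component of \<open>y p\<close> has class zero
    unless \<open>j - p\<close> is allowed.\<close>
  define Y where "Y = {y \<in> X. \<forall>p j. int j - int p \<notin> Delta R A N B F \<longrightarrow> B.cmp (y p) j \<in> F (Suc p)}"
  have "submodule gR (cls ` Y) gM"
    unfolding submodule_def
  proof (intro conjI allI impI)
    show "Module.module gR gM" by (rule gM_module)
    show "cls ` Y \<subseteq> carrier gM" using gM_cls by (auto simp: Y_def)
    have "(\<lambda>p. \<zero>) \<in> Y" using F_zero by (auto simp: Y_def intro!: XI)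
    then show "\<zero>\<^bsub>gM\<^esub> \<in> cls ` Y" using cls_zero by (intro image_eqI[of _ _ "\<lambda>p. \<zero>"]) (simp_all add: gr_module_def)
    {
      fix \<xi> \<eta> assume "\<xi> \<in> cls ` Y" "\<eta> \<in> cls ` Y"
      then obtain y z where y: "y \<in> Y" "\<xi> = cls y" and z: "z \<in> Y" "\<eta> = cls z" by blast
      have yX: "y \<in> X" "z \<in> X" using y z by (auto simp: Y_def)
      interpret W: Module.module R W by (rule W_module)
      have e: "y \<oplus>\<^bsub>W\<^esub> z = (\<lambda>p. y p \<oplus> z p)" by (simp add: W_def fam_def)
      have "(\<lambda>p. y p \<oplus> z p) \<in> X" using W.M.a_closed[of y z] yX unfolding e by (simp add: W_def)
      then have "(\<lambda>p. y p \<oplus> z p) \<in> Y"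
        using y(1) z(1) XD(2)[OF yX(1)] XD(2)[OF yX(2)] by (simp add: Y_def B.comp_add F_add)
      moreover have "cls (\<lambda>p. y p \<oplus> z p) = \<xi> \<oplus>\<^bsub>gM\<^esub> \<eta>"
        using cls_add[OF yX] y(2) z(2) by (simp add: gr_module_def fun_eq_iff)
      ultimately show "\<xi> \<oplus>\<^bsub>gM\<^esub> \<eta> \<in> cls ` Y" by (intro image_eqI[of _ _ "\<lambda>p. y p \<oplus> z p"]) simp_all
    }
    fix \<rho> \<xi> assume "\<rho> \<in> carrier gR" "\<xi> \<in> cls ` Y"
    then obtain a y where a: "a \<in> carrier R" "\<rho> = gr_iso a" and y: "y \<in> Y" "\<xi> = cls y"
      using gr_iso_props(1) by blast
    have yX: "y \<in> X" using y by (auto simp: Y_def)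
    have "B.cmp (conv a y p) j \<in> F (Suc p)" if d: "int j - int p \<notin> Delta R A N B F" for p j
    proof -
      have t: "B.cmp (A.cmp a i \<odot> y (p - i)) j \<in> F (Suc p)" if i: "i \<le> p" for i
      proof (cases "i \<le> j")
        case True
        \<comment> \<open>A scalar of degree \<open>i\<close> shifts both indices by
          \<open>i\<close>, so their difference is unchanged.\<close>
        have "int (j - i) - int (p - i) = int j - int p" using i True by simp
        then have "B.cmp (y (p - i)) (j - i) \<in> F (Suc (p - i))" using y(1) d by (simp add: Y_def)
        from F_smult[OF A.comp_props(1)[OF a(1), of i] this] show ?thesis
          using comp_smult[OF A.comp_props(1)[OF a(1), of i] XD(2)[OF yX], of "p - i" j] i True by simp
      next
        case False
        then show ?thesis using comp_smult[OF A.comp_props(1)[OF a(1), of i] XD(2)[OF yX], of "p - i" j] F_zero by simp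
      qed
      have "B.cmp (conv a y p) j = (\<Oplus>i\<in>{..p}. B.cmp (A.cmp a i \<odot> y (p - i)) j)"
        unfolding conv_def using a(1) XD(2)[OF yX] by (intro B.comp_finsum) simp
      then show ?thesis using t N.submodule_finsum_closed[OF F_sub, of "{..p}"] by simp
    qed
    then have "conv a y \<in> Y" using conv_X[OF a(1) yX] by (simp add: Y_def)
    then show "\<rho> \<odot>\<^bsub>gM\<^esub> \<xi> \<in> cls ` Y"
      using gr_product_cls[OF a(1) yX] a(2) y(2) by (intro image_eqI[of _ _ "conv a y"]) (simp_all add: gr_module_def)
  qed
  moreover have "initial_form N F ` S0 \<subseteq> cls ` Y"
  proof
    fix \<xi> assume "\<xi> \<in> initial_form N F ` S0"
    then obtain f where f: "f \<in> S0" "\<xi> = initial_form N F f" by blast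
    obtain d where d: "f \<in> B d" using S0_props(3)[OF f(1)] by blast
    have f0: "f \<in> carrier N" "f \<noteq> \<zero>" using S0_props(2)[OF f(1)] by blast+
    obtain v where v: "f \<in> F v" "f \<notin> F (Suc v)" using valuation_ex[OF f0] by blast
    have "degree_of B f = d" unfolding degree_of_def

    proof (rule the_equality)
      show "f \<in> B d" by (rule d)
      show "j = d" if "f \<in> B j" for j
        using B.comp_homog[OF d, of d] B.comp_homog[OF that, of d] f0(2) by (auto split: if_splits)
    qed
    then have D: "int d - int v \<in> Delta R A N B F" unfolding Delta_def using f(1) valuation_eq[OF v] by (intro image_eqI[of _ _ f]) simp_all
    have "delta v f \<in> Y" using delta_X[OF v(1)] D B.comp_homog[OF d] F_zero by (auto simp: Y_def delta_def)
    then show "\<xi> \<in> cls ` Y" using f(2) valuation_eq[OF v] by (simp add: initial_form_def gr_class_delta)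
  qed
  ultimately have "gM.span (initial_form N F ` S0) \<subseteq> cls ` Y" by (intro gM.span_is_subset)
  \<comment> \<open>As the initial forms generate gr, the class of \<open>x\<close> is represented
    by a member of \<open>Y\<close>; comparing components of degree \<open>j\<close> forces
    \<open>x\<close> into \<open>F (Suc p)\<close>.\<close>
  then obtain y where y: "y \<in> Y" "gr_class N F p x = cls y" using S0_props(4) gr_class_carrier[OF x(1)] by blast
  have yX: "y \<in> X" using y by (simp add: Y_def)
  have "x \<ominus> y p \<in> F (Suc p)"
    using y(2) cls_eq_iff[OF delta_X[OF x(1)] yX] unfolding gr_class_delta by (auto simp: delta_def dest: spec[of _ p])
  then have "B.cmp (x \<ominus> y p) j \<in> F (Suc p)" by (rule F_comp)
  moreover have "B.cmp (x \<ominus> y p) j = x \<ominus> B.cmp (y p) j"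
    using F_carrier[OF x(1)] XD(2)[OF yX] B.comp_homog[OF x(2), of j] by (simp add: a_minus_def B.comp_add B.comp_minus)
  moreover have "B.cmp (y p) j \<in> F (Suc p)" using y(1) nd by (simp add: Y_def)
  ultimately have "(x \<ominus> B.cmp (y p) j) \<oplus> B.cmp (y p) j \<in> F (Suc p)" by (simp add: F_add)
  then show False using x(3) N.minus_add_cancel[OF F_carrier[OF x(1)], of "B.cmp (y p) j"] XD(2)[OF yX] by simp
qed

lemma jump:
  assumes "x \<in> F p" "x \<in> B j" "x \<notin> F (Suc p)"
  shows "u_inv R A N B F \<le> int j - int p" "int j - int p \<le> v_inv R A N B F"
proof -
  have "finite (Delta R A N B F)" unfolding Delta_def using S0_props(1) by blast
  then show "u_inv R A N B F \<le> int j - int p" "int j - int p \<le> v_inv R A N B F"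
    unfolding u_inv_def v_inv_def using jump_Delta[OF assms] by simp_all
qed

end

section \<open>The filtered complex\<close>

text \<open>The ground field of the associated graded ring is a copy of that of \<open>R\<close> of
  a different type, while \<open>dimq_le\<close> and \<open>dimq_eq\<close> compare spaces over one
  field. Along \<open>gr_iso\<close>, spaces over the copy become spaces over the ground field of
  \<open>R\<close>.\<close>

definition restrict_scalars :: "('s \<Rightarrow> 't) \<Rightarrow> ('t, 'v, 'z) module_scheme \<Rightarrow> ('s, 'v) module" where
  "restrict_scalars \<phi> V = \<lparr>carrier = carrier V, mult = undefined, one = undefined, zero = \<zero>\<^bsub>V\<^esub>, add = add V,
     smult = \<lambda>a x. \<phi> a \<odot>\<^bsub>V\<^esub> x\<rparr>"

lemma restrict_scalars_simps [simp]:
  "carrier (restrict_scalars \<phi> V) = carrier V" "\<zero>\<^bsub>restrict_scalars \<phi> V\<^esub> = \<zero>\<^bsub>V\<^esub>"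
  "add (restrict_scalars \<phi> V) = add V" "a \<odot>\<^bsub>restrict_scalars \<phi> V\<^esub> x = \<phi> a \<odot>\<^bsub>V\<^esub> x"
  by (simp_all add: restrict_scalars_def)

lemma restrict_scalars_quotient:
  fixes U :: "('t, 'v, 'z) module_scheme"
  shows "quotient_module ((restrict_scalars \<phi> U)\<lparr>carrier := Z\<rparr>) Y = restrict_scalars \<phi> (quotient_module (U\<lparr>carrier := Z\<rparr>) Y)"
  by (simp add: quotient_module_def restrict_scalars_def A_RCOSETS_def RCOSETS_def a_r_coset_def r_coset_def
      set_add_def set_mult_def fun_eq_iff)

text \<open>A bijection of fields leaves the notion of subspace unchanged, hence also spans and the
  size of generating sets.\<close>

lemma restrict_scalars_dim:
  fixes V (structure)
  assumes "vectorspace K' V" and K: "field K" and bij: "bij_betw \<phi> (carrier K) (carrier K')"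
    and hom: "\<phi> \<in> ring_hom K K'"
  defines "W \<equiv> restrict_scalars \<phi> V"
  shows "vectorspace K W" "vectorspace.dim K W = vectorspace.dim K' V"
    "vectorspace.fin_dim K W \<longleftrightarrow> vectorspace.fin_dim K' V"
proof -
  interpret V: vectorspace K' V by fact
  interpret K: field K by fact
  have [simp]: "\<phi> a \<in> carrier K'" if "a \<in> carrier K" for a using that hom by (rule ring_hom_closed[rotated])
  have [simp]: "carrier W = carrier V" "a \<odot>\<^bsub>W\<^esub> x = \<phi> a \<odot> x" "add W = add V" "\<zero>\<^bsub>W\<^esub> = \<zero>" for a x
    by (simp_all add: W_def)
  have ab: "abelian_group W"
    by (rule abelian_groupI) (use V.M.l_neg V.M.a_inv_closed in \<open>auto simp: V.M.a_ac intro: exI[of _ "\<ominus> _"]\<close>)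
  show W: "vectorspace K W"
  proof (rule vectorspaceI[OF K], rule moduleI)
    show "cring K" ..
  qed (use hom in \<open>auto simp: ab ring_hom_add ring_hom_mult ring_hom_one V.smult_l_distr V.smult_r_distr V.smult_assoc1\<close>)
  interpret W: vectorspace K W by fact
  have sub: "submodule K U W \<longleftrightarrow> submodule K' U V" for U
  proof -
    have "(\<forall>c. c \<in> carrier K \<longrightarrow> (\<forall>v. v \<in> U \<longrightarrow> \<phi> c \<odot> v \<in> U)) \<longleftrightarrow>
      (\<forall>c. c \<in> carrier K' \<longrightarrow> (\<forall>v. v \<in> U \<longrightarrow> c \<odot> v \<in> U))"
      unfolding bij_betw_imp_surj_on[OF bij, symmetric] by blast
    then show ?thesis using V.module_axioms W.module_axioms by (simp add: submodule_def)
  qed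
  have span: "W.span S = V.span S" if "S \<subseteq> carrier V" for S
  proof (rule equalityI)
    show "W.span S \<subseteq> V.span S"
      by (rule W.span_is_subset[OF V.in_own_span[OF that]]) (simp add: sub V.span_is_submodule[OF that])
    show "V.span S \<subseteq> W.span S"
      by (rule V.span_is_subset[OF W.in_own_span]) (use that W.span_is_submodule[of S] in \<open>simp_all add: sub\<close>)
  qed
  then have "finite A \<and> card A = n \<and> A \<subseteq> carrier W \<and> W.gen_set A \<longleftrightarrow>
    finite A \<and> card A = n \<and> A \<subseteq> carrier V \<and> V.gen_set A" for A n by auto
  then show "W.dim = V.dim" unfolding W.dim_def V.dim_def by simp
  show "W.fin_dim \<longleftrightarrow> V.fin_dim" unfolding W.fin_dim_def V.fin_dim_def using span by auto
qed

locale filtered_kmod = kmod R A J e \<kappa> N B + stable_mod R A N B F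
  for R :: "('a, 'x) ring_scheme" and A J e \<kappa> and N :: "('a, 'b, 'y) module_scheme" (structure) and B and F
begin

abbreviation "V i \<equiv> fam N (J i)"

text \<open>Since \<open>F 0\<close> is everything, the truncated subtraction puts no condition on the coordinates
  of weight \<open>e i c \<ge> p\<close>.\<close>

definition "Phi p i = {x \<in> carrier (V i). \<forall>c\<in>J i. x c \<in> F (p - e i c)}"
text \<open>\<open>ZPhi\<close> and \<open>BPhi\<close> are the preimages in \<open>Phi p i\<close>
  of the cycles and boundaries of the associated graded complex in degree \<open>p\<close>; their
  quotient is a term of the first page of the spectral sequence of the filtration.\<close>

definition "ZPhi i p = {x \<in> Phi p i. \<forall>b. i = Suc b \<longrightarrow> dK N b x \<in> Phi (Suc p) b}"
definition "BPhi i p = dK N i ` Phi p (Suc i) <+>\<^bsub>V i\<^esub> Phi (Suc p) i"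

lemma V_iff: "x \<in> carrier (V i) \<longleftrightarrow> (\<forall>c. x c \<in> carrier N) \<and> (\<forall>c. c \<notin> J i \<longrightarrow> x c = \<zero>)"
  by (rule fam_carrier_finite[OF finJ])

lemma Phi_carrier: "x \<in> Phi p i \<Longrightarrow> x \<in> carrier (V i)" by (simp add: Phi_def)

lemma Phi_Suc: "Phi (Suc p) i \<subseteq> Phi p i"
proof -
  have "F (Suc p - e i c) \<subseteq> F (p - e i c)" for c by (rule F_antimono) simp
  then show ?thesis unfolding Phi_def by blast
qed

lemma Phi_submodule: "submodule R (Phi p i) (V i)"
proof -
  interpret V: graded_mod R A "V i" "C N B i" by (rule famN)
  have s: "a \<odot> x \<in> F q" if "a \<in> carrier R" "x \<in> F q" for a x q
    using F_sub[of q] that by (simp add: submodule_def)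
  show ?thesis unfolding submodule_def Phi_def
    using V.N_module V.N.M.zero_closed F_zero F_add s V.N.M.a_closed V.N.smult_closed by auto
qed

lemma Phi_K: "submodule K (Phi p i) (V i)"
  by (rule submodule_ground[OF Phi_submodule])

lemma V_vectorspace: "vectorspace K (V i)"
  by (rule graded_mod.N_vectorspace[OF famN])

lemma dK_closed: "y \<in> carrier (V (Suc b)) \<Longrightarrow> dK N b y \<in> carrier (V b)"
  by (rule matrix_map.tmap_closed[OF dK_matrix[OF N_module]])

lemma dK_add: "y \<in> carrier (V (Suc b)) \<Longrightarrow> z \<in> carrier (V (Suc b)) \<Longrightarrow>
    dK N b (y \<oplus>\<^bsub>V (Suc b)\<^esub> z) = dK N b y \<oplus>\<^bsub>V b\<^esub> dK N b z"
  by (rule matrix_map.tmap_add[OF dK_matrix[OF N_module]])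

lemma dK_smult: "y \<in> carrier (V (Suc b)) \<Longrightarrow> a \<in> carrier R \<Longrightarrow> dK N b (a \<odot>\<^bsub>V (Suc b)\<^esub> y) = a \<odot>\<^bsub>V b\<^esub> dK N b y"
  by (rule matrix_map.tmap_smult[OF dK_matrix[OF N_module]])

text \<open>The degree of the entry compensates the change of weight. In the second part the
  truncated subtraction leaves \<open>x\<close> unrestricted, but then the entry alone pushes the
  product one step beyond \<open>p - e b c\<close>, so its class in that degree vanishes.\<close>

lemma \<kappa>_term:
  assumes c: "c \<in> J b" and f: "f \<in> J (Suc b)" and x: "x \<in> F (p - e (Suc b) f)"
  shows "\<kappa> b c f \<odot> x \<in> F (p - e b c)" "p < e (Suc b) f \<Longrightarrow> \<kappa> b c f \<odot> x \<in> F (Suc (p - e b c)) \<or> p < e b c"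
proof -
  have "\<kappa> b c f \<odot> x \<in> F (p - e b c) \<and> (p < e (Suc b) f \<longrightarrow> \<kappa> b c f \<odot> x \<in> F (Suc (p - e b c)) \<or> p < e b c)"
  proof (cases "e b c \<le> e (Suc b) f")
    case True
    then have k: "\<kappa> b c f \<odot> x \<in> F ((e (Suc b) f - e b c) + (p - e (Suc b) f))"
      using \<kappa>_hom[OF c f] by (intro F_smult[OF _ x]) simp
    have "\<kappa> b c f \<odot> x \<in> F (p - e b c)" by (rule subsetD[OF F_antimono k]) linarith
    moreover have "\<kappa> b c f \<odot> x \<in> F (Suc (p - e b c))" if "p < e (Suc b) f" "\<not> p < e b c"
      by (rule subsetD[OF F_antimono k]) (use that True in linarith)
    ultimately show ?thesis by blast
  next
    case False
    then have "\<kappa> b c f \<odot> x = \<zero>" using \<kappa>_hom[OF c f] F_carrier[OF x] by simp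
    then show ?thesis using F_zero by simp
  qed
  then show "\<kappa> b c f \<odot> x \<in> F (p - e b c)" "p < e (Suc b) f \<Longrightarrow> \<kappa> b c f \<odot> x \<in> F (Suc (p - e b c)) \<or> p < e b c" by blast+
qed

lemma dK_Phi: "y \<in> Phi p (Suc b) \<Longrightarrow> dK N b y \<in> Phi p b"
  using dK_closed[of y b] \<kappa>_term(1)
  by (auto simp: Phi_def tmap_def intro!: N.submodule_finsum_closed[OF F_sub])

lemma Phi_zero: "(\<lambda>_. \<zero>) \<in> Phi p i"
  using F_zero by (simp add: Phi_def V_iff)

lemma ZPhi_submodule: "submodule K (ZPhi i p) (V i)"
proof -
  interpret K: field K by (rule K_field)
  show ?thesis unfolding submodule_def ZPhi_def
  proof (intro conjI allI impI)
    show "Module.module K (V i)" using V_vectorspace by (simp add: vectorspace_def)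
    show "{x \<in> Phi p i. \<forall>b. i = Suc b \<longrightarrow> dK N b x \<in> Phi (Suc p) b} \<subseteq> carrier (V i)" using Phi_carrier by blast
    show "\<zero>\<^bsub>V i\<^esub> \<in> {x \<in> Phi p i. \<forall>b. i = Suc b \<longrightarrow> dK N b x \<in> Phi (Suc p) b}" using Phi_zero by (simp add: dK_zero)
    fix v w assume vw: "v \<in> {x \<in> Phi p i. \<forall>b. i = Suc b \<longrightarrow> dK N b x \<in> Phi (Suc p) b}"
      "w \<in> {x \<in> Phi p i. \<forall>b. i = Suc b \<longrightarrow> dK N b x \<in> Phi (Suc p) b}"
    then show "v \<oplus>\<^bsub>V i\<^esub> w \<in> {x \<in> Phi p i. \<forall>b. i = Suc b \<longrightarrow> dK N b x \<in> Phi (Suc p) b}"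
      using Phi_submodule[of p i] Phi_submodule[of "Suc p" "i - 1"] Phi_carrier
      by (auto simp: dK_add submodule_def simp del: fam_simps)
  next
    fix a v assume "a \<in> carrier K" "v \<in> {x \<in> Phi p i. \<forall>b. i = Suc b \<longrightarrow> dK N b x \<in> Phi (Suc p) b}"
    then show "a \<odot>\<^bsub>V i\<^esub> v \<in> {x \<in> Phi p i. \<forall>b. i = Suc b \<longrightarrow> dK N b x \<in> Phi (Suc p) b}"
      using Phi_submodule[of p i] Phi_submodule[of "Suc p" "i - 1"] Phi_carrier A.A_carrier
      by (auto simp: dK_smult submodule_def simp del: fam_simps)
  qed
qed

lemma dK_image_submodule:
  assumes U: "submodule K U (V (Suc i))" shows "submodule K (dK N i ` U) (V i)"
proof -
  have Uc: "u \<in> carrier (V (Suc i))" if "u \<in> U" for u using U that by (auto simp: submodule_def)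
  have "dK N i u \<oplus>\<^bsub>V i\<^esub> dK N i w \<in> dK N i ` U" if "u \<in> U" "w \<in> U" for u w
    using dK_add[OF Uc Uc, OF that] U that unfolding submodule_def by (metis imageI)
  moreover have "a \<odot>\<^bsub>V i\<^esub> dK N i u \<in> dK N i ` U" if "a \<in> carrier K" "u \<in> U" for a u
  proof -
    have "a \<odot>\<^bsub>V (Suc i)\<^esub> u \<in> U" using U that unfolding submodule_def by blast
    moreover have "dK N i (a \<odot>\<^bsub>V (Suc i)\<^esub> u) = a \<odot>\<^bsub>V i\<^esub> dK N i u"
      using that(1) A.A_carrier by (intro dK_smult Uc that(2)) simp
    ultimately show ?thesis by (metis imageI)
  qed
  moreover have "\<zero>\<^bsub>V i\<^esub> \<in> dK N i ` U"
    using dK_zero[of i] U by (intro image_eqI[of _ _ "\<lambda>_. \<zero>"]) (simp_all add: submodule_def)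
  ultimately show ?thesis using V_vectorspace[of i] dK_closed[OF Uc] unfolding submodule_def vectorspace_def by blast
qed

lemma BPhi_submodule: "submodule K (BPhi i p) (V i)"
proof -
  interpret VK: vectorspace K "V i" by (rule V_vectorspace)
  show ?thesis unfolding BPhi_def by (rule VK.submodule_set_add[OF dK_image_submodule[OF Phi_K] Phi_K])
qed

lemma Phi_sum: "x \<in> Phi p i \<Longrightarrow> y \<in> Phi p i \<Longrightarrow> x \<oplus>\<^bsub>V i\<^esub> y \<in> Phi p i"
  using Phi_submodule[of p i] by (simp add: submodule_def del: fam_simps)

lemma BPhi_ZPhi: "BPhi i p \<subseteq> ZPhi i p"
proof
  fix x assume "x \<in> BPhi i p"
  then obtain y z where y: "y \<in> Phi p (Suc i)" and z: "z \<in> Phi (Suc p) i" and x: "x = dK N i y \<oplus>\<^bsub>V i\<^esub> z"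
    by (auto simp: BPhi_def set_add_iff simp del: fam_simps)
  have xp: "x \<in> Phi p i" unfolding x using dK_Phi[OF y] z Phi_Suc by (intro Phi_sum) blast+
  have "dK N b x \<in> Phi (Suc p) b" if i: "i = Suc b" for b
  proof -
    have "dK N b x = dK N b (dK N i y) \<oplus>\<^bsub>V b\<^esub> dK N b z"
      unfolding x i using dK_closed[OF Phi_carrier[OF y]] Phi_carrier[OF z] by (intro dK_add) (simp_all add: i)
    also have "\<dots> = (\<lambda>_. \<zero>) \<oplus>\<^bsub>V b\<^esub> dK N b z" using dK_dK[OF N_module, of y b] Phi_carrier[OF y] i by simp
    also have "\<dots> \<in> Phi (Suc p) b" using Phi_zero dK_Phi[of z "Suc p" b] z i by (intro Phi_sum) simp_all
    finally show ?thesis .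
  qed
  then show "x \<in> ZPhi i p" using xp by (simp add: ZPhi_def)
qed

abbreviation "\<kappa>g \<equiv> \<lambda>b c f. gr_iso (\<kappa> b c f)"
abbreviation "Kg \<equiv> ground_field gR gA"

lemma G_kmod: "kmod gR gA J e \<kappa>g gM gB"
proof (intro kmod.intro gM_graded)
  interpret gr: alg_iso R A gR gr_iso by (rule gr_alg_iso)
  show "kres gR gA J e \<kappa>g" unfolding gA_image by (rule gr.kres_image) (rule kres_axioms)
qed

text \<open>Leading forms: the map from \<open>Phi p i\<close> onto the degree \<open>p\<close> part
  of the associated graded complex, with kernel \<open>Phi (Suc p) i\<close>. Coordinates of weight
  above \<open>p\<close> would sit in negative degree and are set to zero.\<close>

definition "tau p i x c = (if c \<in> J i \<and> e i c \<le> p then gr_class N F (p - e i c) (x c) else \<zero>\<^bsub>gM\<^esub>)"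

abbreviation "Cg i p \<equiv> fam_grading gM gB (J i) (e i) p"
abbreviation "dKg b \<equiv> tmap gM (J b) (J (Suc b)) (\<kappa>g b)"

lemma tau_C:
  assumes x: "x \<in> Phi p i" shows "tau p i x \<in> Cg i p"
proof -
  have xF: "x c \<in> F (p - e i c)" if "c \<in> J i" for c using x that by (simp add: Phi_def)
  have "tau p i x c \<in> carrier gM" for c using gr_class_carrier[OF xF] by (simp add: tau_def)
  moreover have "gr_class N F (p - e i c) (x c) \<in> gB (p - e i c)" if "c \<in> J i" for c
    using xF[OF that] by (auto simp: gr_grading_def)
  ultimately show ?thesis by (simp add: fam_grading_def fam_carrier_finite[OF finJ] tau_def)
qed

lemma tau_onto:
  assumes y: "y \<in> Cg i p" shows "\<exists>x\<in>Phi p i. tau p i x = y"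
proof -
  have y0: "y c = \<zero>\<^bsub>gM\<^esub>" if "\<not> (c \<in> J i \<and> e i c \<le> p)" for c
    using y that by (cases "c \<in> J i") (auto simp: fam_grading_def fam_carrier_iff)
  have "\<forall>c. \<exists>x. x \<in> F (p - e i c) \<and> (c \<in> J i \<and> e i c \<le> p \<longrightarrow> y c = gr_class N F (p - e i c) x)"
  proof
    fix c
    show "\<exists>x. x \<in> F (p - e i c) \<and> (c \<in> J i \<and> e i c \<le> p \<longrightarrow> y c = gr_class N F (p - e i c) x)"
    proof (cases "c \<in> J i \<and> e i c \<le> p")
      case True
      then have "y c \<in> gB (p - e i c)" using y by (auto simp: fam_grading_def)
      then show ?thesis unfolding gr_grading_def by blast
    qed (use F_zero in blast)
  qed
  then obtain x where x: "\<forall>c. x c \<in> F (p - e i c) \<and> (c \<in> J i \<and> e i c \<le> p \<longrightarrow> y c = gr_class N F (p - e i c) (x c))"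
    by (elim choice[THEN exE]) (rule that)
  define z where "z c = (if c \<in> J i then x c else \<zero>)" for c
  have "x c \<in> carrier N" for c using x F_carrier by blast
  then have "z \<in> Phi p i" using x by (simp add: Phi_def V_iff z_def)
  moreover have "tau p i z = y" using x y0 by (auto simp: tau_def z_def fun_eq_iff)
  ultimately show ?thesis by blast
qed

lemma tau_zero:
  assumes x: "x \<in> Phi p i" shows "tau p i x = (\<lambda>_. \<zero>\<^bsub>gM\<^esub>) \<longleftrightarrow> x \<in> Phi (Suc p) i"
proof -
  have xF: "x c \<in> F (p - e i c)" if "c \<in> J i" for c using x that by (simp add: Phi_def)
  have "tau p i x c = \<zero>\<^bsub>gM\<^esub> \<longleftrightarrow> x c \<in> F (Suc p - e i c)" if "c \<in> J i" for c
    using gr_class_zero_iff[OF xF[OF that]] xF[OF that] that by (auto simp: tau_def Suc_diff_le)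
  moreover have "tau p i x c = \<zero>\<^bsub>gM\<^esub>" if "c \<notin> J i" for c using that by (simp add: tau_def)
  ultimately show ?thesis using Phi_carrier[OF x] by (auto simp: Phi_def fun_eq_iff)
qed

lemma tau_add:
  assumes x: "x \<in> Phi p i" and y: "y \<in> Phi p i"
  shows "tau p i (x \<oplus>\<^bsub>V i\<^esub> y) = tau p i x \<oplus>\<^bsub>fam gM (J i)\<^esub> tau p i y"
proof -
  show ?thesis using x y gr_class_add by (auto simp: tau_def Phi_def fun_eq_iff)
qed

lemma tau_smult:
  assumes a: "a \<in> A 0" and x: "x \<in> Phi p i"
  shows "tau p i (a \<odot>\<^bsub>V i\<^esub> x) = gr_iso a \<odot>\<^bsub>fam gM (J i)\<^esub> tau p i x"
proof -
  have "gr_iso a \<in> carrier gR" using gr_iso_props(1) A.A_carrier[OF a] by blast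
  then show ?thesis using x gr_class_smult[OF a] by (auto simp: tau_def Phi_def fun_eq_iff)
qed

lemma gr_class_finsum:
  assumes "finite T" "\<And>t. t \<in> T \<Longrightarrow> x t \<in> F p"
  shows "gr_class N F p (\<Oplus>t\<in>T. x t) = (\<Oplus>\<^bsub>gM\<^esub>t\<in>T. gr_class N F p (x t))"
  using assms
proof (induction T rule: finite_induct)
  case empty
  show ?case using gr_class_zero[of p] by simp
next
  case (insert t T)
  have "(\<Oplus>t\<in>T. x t) \<in> F p" using insert.prems by (intro N.submodule_finsum_closed[OF F_sub]) simp
  moreover have "(\<Oplus>t\<in>insert t T. x t) = x t \<oplus> (\<Oplus>t\<in>T. x t)"
    using insert.hyps F_carrier[OF insert.prems] by (intro N.M.finsum_insert) auto
  moreover have "(\<Oplus>\<^bsub>gM\<^esub>t\<in>insert t T. gr_class N F p (x t)) =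
      gr_class N F p (x t) \<oplus>\<^bsub>gM\<^esub> (\<Oplus>\<^bsub>gM\<^esub>t\<in>T. gr_class N F p (x t))"
    using insert.hyps gr_class_carrier[OF insert.prems] by (intro gM.M.finsum_insert) auto
  ultimately show ?case using insert gr_class_add[of "x t" p] by simp
qed

lemma tau_dK:
  assumes x: "x \<in> Phi p (Suc b)" shows "dKg b (tau p (Suc b) x) = tau p b (dK N b x)"
proof
  fix c
  have xF: "x f \<in> F (p - e (Suc b) f)" if "f \<in> J (Suc b)" for f using x that by (simp add: Phi_def)
  have kc: "gr_iso (\<kappa> b c f) \<in> carrier gR" if "c \<in> J b" "f \<in> J (Suc b)" for f
    using gr_iso_props(1) \<kappa>_carrier[OF that] by blast
  have k0: "gr_iso \<zero>\<^bsub>R\<^esub> \<odot>\<^bsub>gM\<^esub> \<xi> = \<zero>\<^bsub>gM\<^esub>" if "\<xi> \<in> carrier gM" for \<xi>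
    unfolding gr_iso_props(5) using that by (rule gM.smult_l_null)
  have tc: "tau p (Suc b) x f \<in> carrier gM" for f using gr_class_carrier[OF xF] by (simp add: tau_def)
  show "dKg b (tau p (Suc b) x) c = tau p b (dK N b x) c"
  proof (cases "c \<in> J b")
    case c: True
    show ?thesis
    proof (cases "e b c \<le> p")
      case True
      have t: "gr_iso (\<kappa> b c f) \<odot>\<^bsub>gM\<^esub> tau p (Suc b) x f = gr_class N F (p - e b c) (\<kappa> b c f \<odot> x f)" if f: "f \<in> J (Suc b)" for f
      proof (cases "e (Suc b) f \<le> p")
        case fp: True
        show ?thesis
        proof (cases "e b c \<le> e (Suc b) f")
          case ef: True
          then have "(e (Suc b) f - e b c) + (p - e (Suc b) f) = p - e b c" using fp by simp
          then show ?thesis using gr_class_smult[of "\<kappa> b c f" "e (Suc b) f - e b c", OF _ xF[OF f]] \<kappa>_hom[OF c f] ef fp f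
            by (simp add: tau_def)
        next
          case False
          then have "\<kappa> b c f = \<zero>\<^bsub>R\<^esub>" using \<kappa>_hom[OF c f] by simp
          then show ?thesis using k0[OF tc] gr_class_zero F_carrier[OF xF[OF f]] by simp
        qed
      next
        case False
        \<comment> \<open>\<open>tau\<close> drops this coordinate, so its contribution to the image
          has to vanish in gr as well; the second part of \<open>\<kappa>_term\<close> provides
          this.\<close>
        then have "gr_class N F (p - e b c) (\<kappa> b c f \<odot> x f) = \<zero>\<^bsub>gM\<^esub>"
          using gr_class_zero_iff[OF \<kappa>_term(1)[OF c f xF[OF f]]] \<kappa>_term(2)[OF c f xF[OF f]] True by simp
        then show ?thesis using False kc[OF c f] by (simp add: tau_def)
      qed
      have "(\<Oplus>\<^bsub>gM\<^esub>f\<in>J (Suc b). gr_iso (\<kappa> b c f) \<odot>\<^bsub>gM\<^esub> tau p (Suc b) x f) =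
          (\<Oplus>\<^bsub>gM\<^esub>f\<in>J (Suc b). gr_class N F (p - e b c) (\<kappa> b c f \<odot> x f))"
        using t gr_class_carrier[OF \<kappa>_term(1)[OF c _ xF]] by (intro gM.M.finsum_cong') auto
      also have "\<dots> = gr_class N F (p - e b c) (\<Oplus>f\<in>J (Suc b). \<kappa> b c f \<odot> x f)"
        using \<kappa>_term(1)[OF c _ xF] by (intro gr_class_finsum[symmetric] finJ)
      finally show ?thesis using c True by (simp add: tmap_def tau_def)
    next
      case False
      have "gr_iso (\<kappa> b c f) \<odot>\<^bsub>gM\<^esub> tau p (Suc b) x f = \<zero>\<^bsub>gM\<^esub>" if f: "f \<in> J (Suc b)" for f
      proof (cases "e (Suc b) f \<le> p")
        case True
        then have "\<kappa> b c f = \<zero>\<^bsub>R\<^esub>" using \<kappa>_hom[OF c f] False by simp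
        then show ?thesis using k0[OF tc] by simp
      qed (use kc[OF c f] in \<open>simp add: tau_def\<close>)
      then show ?thesis using c False by (simp add: tmap_def tau_def gM.M.add.finprod_one_eqI)
    qed
  qed (simp add: tmap_def tau_def)
qed

text \<open>\<open>tau\<close> commutes with the differentials, so it identifies
  \<open>ZPhi / BPhi\<close> with the homology of gr M tensored with the transported
  \<open>K\<close> in degree \<open>p\<close>. Over the associated graded ring,
  \<open>betti_eq\<close> equates the dimension with the graded Betti number.\<close>

lemma gr_betti_Phi:
  "finq K (V i) (ZPhi i p) (BPhi i p) \<and> dimq K (V i) (ZPhi i p) (BPhi i p) = graded_betti gR gA gM gB i p"
proof -
  interpret gr: alg_iso R A gR gr_iso by (rule gr_alg_iso)
  interpret G: kmod gR gA J e \<kappa>g gM gB by (rule G_kmod)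
  have gstd: "standard_graded_algebra gR gA" unfolding gA_image by (rule gr.S_standard)
  note gfin = G.Tor_finite(1)[OF gstd gM_finitely_generated, of i p]
    and gbetti = G.betti_eq(1)[OF gstd gM_finitely_generated, of i p]
  let ?Vg = "fam gM (J i)"
  let ?V' = "restrict_scalars gr_iso ?Vg"
  let ?Q = "quotient_module (?Vg\<lparr>carrier := G.Zt i p\<rparr>) (G.Bt i p)"
  have bij: "bij_betw gr_iso (carrier K) (carrier Kg)"
    using gr.bij unfolding gA_image bij_betw_def by (auto intro: inj_on_subset simp: A.A_carrier)
  have hom: "gr_iso \<in> ring_hom K Kg"
    unfolding ring_hom_def gA_image using gr.h_add gr.h_mult gr.h_one A.A_carrier by auto
  interpret Vg: vectorspace Kg ?Vg by (rule graded_mod.N_vectorspace[OF G.famN])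
  interpret Zg: vectorspace Kg "?Vg\<lparr>carrier := G.Zt i p\<rparr>" by (rule Vg.submodule_vectorspace[OF G.Zt_submodule])
  have Q: "vectorspace Kg ?Q"
    by (rule Zg.quotient_vectorspace[OF Vg.submodule_submodule[OF G.Zt_submodule G.Bt_submodule G.Bt_Zt]])
  have V': "vectorspace K ?V'" by (rule restrict_scalars_dim(1)[OF Vg.vectorspace_axioms K_field bij hom])
  have QV: "quotient_module (?V'\<lparr>carrier := G.Zt i p\<rparr>) (G.Bt i p) = restrict_scalars gr_iso ?Q"
    by (rule restrict_scalars_quotient)
  have fin': "finq K ?V' (G.Zt i p) (G.Bt i p)"
    and dim': "dimq K ?V' (G.Zt i p) (G.Bt i p) = dimq Kg ?Vg (G.Zt i p) (G.Bt i p)"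
    using restrict_scalars_dim(2,3)[OF Q K_field bij hom] gfin unfolding finq_def dimq_def QV by simp_all
  have sub': "submodule K U ?V'" if U: "submodule Kg U ?Vg" for U
  proof -
    have "gr_iso a \<in> carrier Kg" if "a \<in> carrier K" for a using bij that by (rule bij_betwE[THEN bspec])
    then have "a \<odot>\<^bsub>?V'\<^esub> x \<in> U" if "a \<in> carrier K" "x \<in> U" for a x
      using U that unfolding submodule_def restrict_scalars_simps by blast
    then show ?thesis using U V' unfolding submodule_def vectorspace_def restrict_scalars_simps(1-3) by blast
  qed
  define L where "L x y \<longleftrightarrow> x \<in> Phi p i \<and> y = tau p i x" for x y
  have L: "linrel K (V i) ?V' L"
    unfolding linrel_def
  proof (intro conjI allI impI)
    fix v w v' w' assume "L v w" "L v' w'"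
    then show "L (v \<oplus>\<^bsub>V i\<^esub> v') (w \<oplus>\<^bsub>?V'\<^esub> w')"
      unfolding L_def using Phi_sum[of v p i v'] tau_add[of v p i v'] by simp
  next
    fix a v w assume "a \<in> carrier K" "L v w"
    then show "L (a \<odot>\<^bsub>V i\<^esub> v) (a \<odot>\<^bsub>?V'\<^esub> w)"
      unfolding L_def using Phi_K[of p i] tau_smult[of a v p i] unfolding submodule_def by simp
  next
    fix v w assume "L v w"
    then show "v \<in> carrier (V i)" "w \<in> carrier ?V'"
      unfolding L_def using Phi_carrier[of v p i] tau_C[of v p i] G.C_carrier by auto
  qed
  have Zt_iff: "tau p i x \<in> G.Zt i p \<longleftrightarrow> x \<in> ZPhi i p" if x: "x \<in> Phi p i" for x
  proof (cases i)
    case 0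
    then show ?thesis using x tau_C[OF x] by (simp add: G.Zt_def ZPhi_def)
  next
    case (Suc b)
    then have xb: "x \<in> Phi p (Suc b)" using x by simp
    show ?thesis using x tau_C[OF x] tau_dK[OF xb] tau_zero[OF dK_Phi[OF xb]] Suc by (simp add: G.Zt_def ZPhi_def)
  qed
  have Bt_iff: "tau p i x \<in> G.Bt i p \<longleftrightarrow> x \<in> BPhi i p" if x: "x \<in> Phi p i" for x
  proof
    interpret Vm: Module.module R "V i" by (rule graded_mod.N_module[OF famN])
    assume "tau p i x \<in> G.Bt i p"
    then obtain u where u: "u \<in> Cg (Suc i) p" "tau p i x = dKg i u" by (auto simp: G.Bt_def)
    \<comment> \<open>With the chain lifted to \<open>y\<close>, the elements \<open>x\<close> and
      \<open>dK N i y\<close> have the same leading form, so their difference lies one filtration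
      step further.\<close>
    obtain y where y: "y \<in> Phi p (Suc i)" "tau p (Suc i) y = u" using tau_onto[OF u(1)] by blast
    note dy = dK_Phi[OF y(1)]
    define z where "z = x \<ominus>\<^bsub>V i\<^esub> dK N i y"
    have z: "z \<in> Phi p i" unfolding z_def by (rule Vm.submodule_diff_closed[OF Phi_submodule x dy])
    have xz: "x = dK N i y \<oplus>\<^bsub>V i\<^esub> z"
      using Vm.minus_add_cancel[OF Phi_carrier[OF x] Phi_carrier[OF dy]] Vm.M.a_comm[OF Phi_carrier[OF dy] Phi_carrier[OF z]]
      by (simp add: z_def del: fam_simps)
    have "tau p i x = tau p i x \<oplus>\<^bsub>?Vg\<^esub> tau p i z" using tau_add[OF dy z] tau_dK[OF y(1)] y(2) u(2) xz by simp
    moreover have c: "tau p i w \<in> carrier ?Vg" if "w \<in> Phi p i" for w using tau_C[OF that] G.C_carrier by blast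
    ultimately have "tau p i z = \<zero>\<^bsub>?Vg\<^esub>" using Vg.M.add.r_cancel_one[of "tau p i x" "tau p i z"] c[OF x] c[OF z]
      by (simp del: fam_simps)
    then have "z \<in> Phi (Suc p) i" using tau_zero[OF z] by simp
    then show "x \<in> BPhi i p" unfolding BPhi_def set_add_iff using xz y(1) by blast
  next
    assume "x \<in> BPhi i p"
    then obtain y z where y: "y \<in> Phi p (Suc i)" and z: "z \<in> Phi (Suc p) i" and x: "x = dK N i y \<oplus>\<^bsub>V i\<^esub> z"
      by (auto simp: BPhi_def set_add_iff simp del: fam_simps)
    have zp: "z \<in> Phi p i" using z Phi_Suc by blast
    have "tau p i x = tau p i (dK N i y) \<oplus>\<^bsub>?Vg\<^esub> \<zero>\<^bsub>?Vg\<^esub>"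
      unfolding x tau_add[OF dK_Phi[OF y] zp] using tau_zero[OF zp] z by simp
    also have "\<dots> = dKg i (tau p (Suc i) y)"
      unfolding tau_dK[OF y] using tau_C[OF dK_Phi[OF y]] G.C_carrier by (intro Vg.M.r_zero) blast
    finally show "tau p i x \<in> G.Bt i p" using tau_C[OF y] unfolding G.Bt_def by blast
  qed
  have GZ: "G.Zt i p \<subseteq> Cg i p" by (auto simp: G.Zt_def)
  have tot: "\<exists>z\<in>ZPhi i p. L z z'" if z': "z' \<in> G.Zt i p" for z'
  proof -
    obtain x where x: "x \<in> Phi p i" "tau p i x = z'" using tau_onto z' GZ by blast
    then show ?thesis using Zt_iff[OF x(1)] z' by (auto simp: L_def)
  qed
  have tot': "\<exists>z'\<in>G.Zt i p. L z z'" if "z \<in> ZPhi i p" for z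
    using Zt_iff[of z] that by (auto simp: L_def ZPhi_def)
  have inj: "z \<in> BPhi i p \<longleftrightarrow> z' \<in> G.Bt i p" if "L z z'" for z z'
    using Bt_iff that by (auto simp: L_def)
  have e1: "finq K (V i) (ZPhi i p) (BPhi i p) \<longleftrightarrow> finq K ?V' (G.Zt i p) (G.Bt i p)"
    using tot' tot inj
    by (rule dimq_eq(1)[OF V_vectorspace ZPhi_submodule BPhi_submodule BPhi_ZPhi V' sub'[OF G.Zt_submodule]
        sub'[OF G.Bt_submodule] G.Bt_Zt L])
  have e2: "dimq K (V i) (ZPhi i p) (BPhi i p) = dimq K ?V' (G.Zt i p) (G.Bt i p)"
    if "finq K (V i) (ZPhi i p) (BPhi i p)"
    by (rule dimq_eq(2)[OF V_vectorspace ZPhi_submodule BPhi_submodule BPhi_ZPhi V' sub'[OF G.Zt_submodule]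
        sub'[OF G.Bt_submodule] G.Bt_Zt L tot' tot inj that])
  show ?thesis using e1 e2 fin' dim' gbetti by simp
qed

text \<open>Splits the first page by internal degree. It is measured on the subquotient of
  \<open>V i\<close>, whose internal grading is inherited because every \<open>F p\<close> is
  graded.\<close>

definition "h i p j = dimq K (V i) (ZPhi i p \<inter> C N B i j) (BPhi i p \<inter> C N B i j)"

abbreviation "cV i x j \<equiv> component (V i) (C N B i) x j"

lemma V_igrading: "igrading (V i) (C N B i)"
  by (rule fam_igrading(1)[OF N_module B.igrading_axioms])

lemma Phi_comp: "x \<in> Phi p i \<Longrightarrow> cV i x j \<in> Phi p i"
  using igrading.comp_carrier[OF V_igrading Phi_carrier] F_comp F_zero
  by (simp add: Phi_def fam_igrading(2)[OF N_module B.igrading_axioms])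

lemma dK_comp:
  assumes "x \<in> carrier (V (Suc b))" shows "cV b (dK N b x) j = dK N b (cV (Suc b) x j)"
  by (rule comp_map[OF V_igrading V_igrading _ _ _ assms])
    (use dK_closed dK_add dK_grading[OF graded_mod_axioms] in \<open>auto simp del: fam_simps\<close>)

lemma ZPhi_comp: "x \<in> ZPhi i p \<Longrightarrow> cV i x j \<in> ZPhi i p"
  using Phi_comp[of x p i j] Phi_comp[of "dK N (i - 1) x" "Suc p" "i - 1" j] dK_comp[of x "i - 1" j] Phi_carrier[of x p i]
  by (auto simp: ZPhi_def)

lemma BPhi_comp: assumes x: "x \<in> BPhi i p" shows "cV i x j \<in> BPhi i p"
proof -
  obtain y z where y: "y \<in> Phi p (Suc i)" and z: "z \<in> Phi (Suc p) i" and x: "x = dK N i y \<oplus>\<^bsub>V i\<^esub> z"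
    using x by (auto simp: BPhi_def set_add_iff simp del: fam_simps)
  have "cV i x j = dK N i (cV (Suc i) y j) \<oplus>\<^bsub>V i\<^esub> cV i z j"
    unfolding x dK_comp[OF Phi_carrier[OF y], symmetric]
    by (rule igrading.comp_add[OF V_igrading dK_closed[OF Phi_carrier[OF y]] Phi_carrier[OF z]])
  then show ?thesis unfolding BPhi_def set_add_iff using Phi_comp[OF y] Phi_comp[OF z] by blast
qed

lemma C_K: "submodule K (C N B i j) (V i)"
  by (rule graded_mod.B_submodule_K[OF famN])

text \<open>Partial sums over \<open>j\<close> are bounded by the whole, so no limit on the internal
  degrees in column \<open>p\<close> has to be found beforehand.\<close>

lemma h_props:
  shows "finq K (V i) (ZPhi i p \<inter> C N B i j) (BPhi i p \<inter> C N B i j)"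
    and "(\<Sum>j<n. h i p j) \<le> graded_betti gR gA gM gB i p"
proof -
  have f: "finq K (V i) (ZPhi i p) (BPhi i p)" using gr_betti_Phi by blast
  note g = graded_subquotient(1,2)[OF V_vectorspace V_igrading C_K ZPhi_submodule BPhi_submodule BPhi_ZPhi ZPhi_comp BPhi_comp f]
  show "finq K (V i) (ZPhi i p \<inter> C N B i j) (BPhi i p \<inter> C N B i j)" by (rule g(1))
  show "(\<Sum>j<n. h i p j) \<le> graded_betti gR gA gM gB i p" unfolding h_def using g(2)[of n] gr_betti_Phi[of i p] by simp
qed

text \<open>A coordinate of weight \<open>e\<close> has filtration index \<open>p - e\<close> and
  degree \<open>j - e\<close>, with the same difference \<open>j - p\<close>. If this lies outside
  the interval from \<open>u\<close> to \<open>v\<close>, then \<open>jump\<close> moves every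
  coordinate one step further, and \<open>ZPhi\<close> in degree \<open>j\<close> falls into
  \<open>Phi (Suc p) i\<close>, hence into \<open>BPhi\<close>.\<close>

lemma h_jump:
  assumes "h i p j \<noteq> 0"
  shows "u_inv R A N B F \<le> int j - int p" "int j - int p \<le> v_inv R A N B F"
proof -
  interpret VK: vectorspace K "V i" by (rule V_vectorspace)
  have "u_inv R A N B F \<le> int j - int p \<and> int j - int p \<le> v_inv R A N B F"
  proof (rule ccontr)
    assume n: "\<not> ?thesis"
    have "ZPhi i p \<inter> C N B i j \<subseteq> Phi (Suc p) i"
    proof
      fix x assume "x \<in> ZPhi i p \<inter> C N B i j"
      then have x: "x \<in> Phi p i" "x \<in> C N B i j" by (auto simp: ZPhi_def)
      have "x c \<in> F (Suc p - e i c)" if c: "c \<in> J i" for c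
      proof (cases "e i c \<le> p \<and> e i c \<le> j")
        case True
        have xc: "x c \<in> F (p - e i c)" "x c \<in> B (j - e i c)" using x c True C_gr[OF x(2) c] by (auto simp: Phi_def)
        have "int (j - e i c) - int (p - e i c) = int j - int p" using True by simp
        then show ?thesis using jump[OF xc] n True by (auto simp: Suc_diff_le)
      next
        case False
        then consider "p < e i c" | "j < e i c" by linarith
        then show ?thesis
        proof cases
          case 1
          then show ?thesis using x(1) c F_0 by (auto simp: Phi_def V_iff)
        next
          case 2
          then show ?thesis using C_zero[OF x(2), of c] F_zero by simp
        qed
      qed
      then show "x \<in> Phi (Suc p) i" using Phi_carrier[OF x(1)] by (simp add: Phi_def)
    qed
    moreover have "Phi (Suc p) i \<subseteq> BPhi i p"
    proof
      fix x assume x: "x \<in> Phi (Suc p) i"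
      have "x = dK N i (\<lambda>_. \<zero>) \<oplus>\<^bsub>V i\<^esub> x" using Phi_carrier[OF x] by (simp add: dK_zero V_iff)
      then show "x \<in> BPhi i p" unfolding BPhi_def set_add_iff using x Phi_zero by blast
    qed
    ultimately have "ZPhi i p \<inter> C N B i j = BPhi i p \<inter> C N B i j" using BPhi_ZPhi by blast
    then have "h i p j = 0"
      unfolding h_def using dimq_self(2)[OF V_vectorspace VK.submodule_Int[OF BPhi_submodule C_K]] by simp
    then show False using assms by simp
  qed
  then show "u_inv R A N B F \<le> int j - int p" "int j - int p \<le> v_inv R A N B F" by blast+
qed

text \<open>The homology of \<open>M \<otimes> K\<close> in degree \<open>j\<close> is filtered by
  the classes of cycles in \<open>Phi p i\<close>, and each graded piece is a subquotient of the
  first page. Convergence is elementary: in a fixed degree the filtration is zero from a known stage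
  on.\<close>

lemma betti_le_h: "graded_betti R A N B i j \<le> (\<Sum>p<Suc (pst + j). h i p j)"
proof -
  interpret VK: vectorspace K "V i" by (rule V_vectorspace)
  define Y where "Y p = (Zt i j \<inter> Phi p i) <+>\<^bsub>V i\<^esub> Bt i j" for p
  have ZtC: "Zt i j \<subseteq> C N B i j" by (auto simp: Zt_def)
  have Ys: "submodule K (Y p) (V i)" for p
    unfolding Y_def by (intro VK.submodule_set_add VK.submodule_Int Zt_submodule Phi_K Bt_submodule)
  have Zt_add: "x \<oplus>\<^bsub>V i\<^esub> y \<in> Zt i j" if "x \<in> Zt i j" "y \<in> Zt i j" for x y
    using Zt_submodule[of i j] that by (simp add: submodule_def del: fam_simps)
  have Bt_add: "x \<oplus>\<^bsub>V i\<^esub> y \<in> Bt i j" if "x \<in> Bt i j" "y \<in> Bt i j" for x y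
    using Bt_submodule[of i j] that by (simp add: submodule_def del: fam_simps)
  have Vc: "x \<in> carrier (V i)" if "x \<in> Zt i j" for x using that ZtC C_carrier by blast
  have Bt0: "\<zero>\<^bsub>V i\<^esub> \<in> Bt i j" using Bt_submodule[of i j] by (simp add: submodule_def)
  have Y_Zt: "Y p \<subseteq> Zt i j" for p
  proof
    fix y assume "y \<in> Y p"
    then obtain x b where x: "x \<in> Zt i j" and b: "b \<in> Bt i j" and y: "y = x \<oplus>\<^bsub>V i\<^esub> b"
      by (auto simp: Y_def set_add_iff simp del: fam_simps)
    show "y \<in> Zt i j" unfolding y by (rule Zt_add[OF x subsetD[OF Bt_Zt b]])
  qed
  have Bt_Y: "Bt i j \<subseteq> Y p" for p
  proof
    fix b assume b: "b \<in> Bt i j"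
    then have "b = \<zero>\<^bsub>V i\<^esub> \<oplus>\<^bsub>V i\<^esub> b" using VK.M.l_zero[OF Vc] Bt_Zt by (metis subsetD)
    moreover have "\<zero>\<^bsub>V i\<^esub> \<in> Zt i j \<inter> Phi p i" using Bt0 Bt_Zt[of i j] Phi_zero by auto
    ultimately show "b \<in> Y p" unfolding Y_def set_add_iff using b by blast
  qed
  have Y_Suc: "Y (Suc p) \<subseteq> Y p" for p unfolding Y_def set_add_def set_mult_def using Phi_Suc by fastforce
  have Y0: "Y 0 = Zt i j"
  proof
    show "Zt i j \<subseteq> Y 0"
    proof
      fix x assume x: "x \<in> Zt i j"
      have "x \<in> Phi 0 i" using Vc[OF x] F_0 by (simp add: Phi_def V_iff)
      moreover have "x = x \<oplus>\<^bsub>V i\<^esub> \<zero>\<^bsub>V i\<^esub>" using VK.M.r_zero[OF Vc[OF x]] by simp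
      ultimately show "x \<in> Y 0" unfolding Y_def set_add_iff using x Bt0 by blast
    qed
  qed (rule Y_Zt)
  \<comment> \<open>A coordinate of weight \<open>e\<close>, degree \<open>j - e\<close> and
    filtration index \<open>Suc (pst + j) - e\<close> vanishes by \<open>F_B_zero\<close>; this
    fixes the number of summands.\<close>
  have Yn: "Y (Suc (pst + j)) = Bt i j"
  proof
    show "Y (Suc (pst + j)) \<subseteq> Bt i j"
    proof
      fix y assume "y \<in> Y (Suc (pst + j))"
      then obtain x b where x: "x \<in> Zt i j" "x \<in> Phi (Suc (pst + j)) i" and b: "b \<in> Bt i j" and y: "y = x \<oplus>\<^bsub>V i\<^esub> b"
        by (auto simp: Y_def set_add_iff simp del: fam_simps)
      have xC: "x \<in> C N B i j" using x ZtC by blast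
      have "x c = \<zero>" for c
      proof (cases "c \<in> J i \<and> e i c \<le> j")
        case True
        show ?thesis
        proof (rule F_B_zero)
          show "x c \<in> F (Suc (pst + j) - e i c)" using x(2) True by (simp add: Phi_def)
          show "x c \<in> B (j - e i c)" using C_gr[OF xC] True by blast
          show "pst + (j - e i c) < Suc (pst + j) - e i c" using True by linarith
        qed
      qed (use C_zero[OF xC] in blast)
      then have "x = \<zero>\<^bsub>V i\<^esub>" by (simp add: fun_eq_iff)
      then show "y \<in> Bt i j" using y b VK.M.l_zero[OF Vc] Bt_Zt by (metis subsetD)
    qed
  qed (rule Bt_Y)
  have step: "finq K (V i) (Y p) (Y (Suc p)) \<and> dimq K (V i) (Y p) (Y (Suc p)) \<le> h i p j" for p
    unfolding h_def
  proof (rule dimq_le[OF V_vectorspace Ys Ys Y_Suc V_vectorspace VK.submodule_Int[OF ZPhi_submodule C_K]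
        VK.submodule_Int[OF BPhi_submodule C_K] _ _ _ _ h_props(1)])
    \<comment> \<open>Relates an element to the cycles in the same homology class; the boundaries
      \<open>b\<close> range over all of \<open>Bt i j\<close>, regardless of the
      filtration.\<close>
    define L where "L y z \<longleftrightarrow> z \<in> Zt i j \<and> (\<exists>b\<in>Bt i j. y = z \<oplus>\<^bsub>V i\<^esub> b)" for y z
    show "BPhi i p \<inter> C N B i j \<subseteq> ZPhi i p \<inter> C N B i j" using BPhi_ZPhi by blast
    show "linrel K (V i) (V i) L"
      unfolding linrel_def
    proof (intro conjI allI impI)
      fix v w assume "L v w"
      then show "v \<in> carrier (V i)" "w \<in> carrier (V i)" unfolding L_def using Vc Bt_Zt Zt_add by blast+
    next
      fix v w v' w' assume "L v w" "L v' w'"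
      then obtain b b' where w: "w \<in> Zt i j" "w' \<in> Zt i j" and b: "b \<in> Bt i j" "b' \<in> Bt i j"
        and v: "v = w \<oplus>\<^bsub>V i\<^esub> b" "v' = w' \<oplus>\<^bsub>V i\<^esub> b'" unfolding L_def by blast
      have bc: "b \<in> carrier (V i)" "b' \<in> carrier (V i)" using b Bt_Zt Vc by blast+
      have "v \<oplus>\<^bsub>V i\<^esub> v' = (w \<oplus>\<^bsub>V i\<^esub> w') \<oplus>\<^bsub>V i\<^esub> (b \<oplus>\<^bsub>V i\<^esub> b')"
        unfolding v using Vc[OF w(1)] Vc[OF w(2)] bc by (simp add: VK.M.a_ac del: fam_simps)
      then show "L (v \<oplus>\<^bsub>V i\<^esub> v') (w \<oplus>\<^bsub>V i\<^esub> w')" unfolding L_def using Zt_add[OF w] Bt_add[OF b] by blast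
    next
      fix a v w assume a: "a \<in> carrier K" and "L v w"
      then obtain b where w: "w \<in> Zt i j" and b: "b \<in> Bt i j" and v: "v = w \<oplus>\<^bsub>V i\<^esub> b" unfolding L_def by blast
      have "a \<odot>\<^bsub>V i\<^esub> v = a \<odot>\<^bsub>V i\<^esub> w \<oplus>\<^bsub>V i\<^esub> a \<odot>\<^bsub>V i\<^esub> b"
        unfolding v using b Bt_Zt by (intro VK.smult_r_distr a Vc w) blast
      moreover have "a \<odot>\<^bsub>V i\<^esub> w \<in> Zt i j" "a \<odot>\<^bsub>V i\<^esub> b \<in> Bt i j"
        using Zt_submodule[of i j] Bt_submodule[of i j] a w b unfolding submodule_def by blast+
      ultimately show "L (a \<odot>\<^bsub>V i\<^esub> v) (a \<odot>\<^bsub>V i\<^esub> w)" unfolding L_def by blast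
    qed
    show "\<exists>z\<in>ZPhi i p \<inter> C N B i j. L y z" if y: "y \<in> Y p" for y
    proof -
      obtain x b where x: "x \<in> Zt i j" "x \<in> Phi p i" and b: "b \<in> Bt i j" and y: "y = x \<oplus>\<^bsub>V i\<^esub> b"
        using y by (auto simp: Y_def set_add_iff simp del: fam_simps)
      have "x \<in> ZPhi i p" using x Phi_zero by (auto simp: ZPhi_def Zt_def)
      then show ?thesis using x b y ZtC unfolding L_def by blast
    qed
    show "y \<in> Y (Suc p)" if Lyz: "L y z" and zB: "z \<in> BPhi i p \<inter> C N B i j" for y z
    proof -
      obtain b where z: "z \<in> Zt i j" and b: "b \<in> Bt i j" and y: "y = z \<oplus>\<^bsub>V i\<^esub> b" using Lyz unfolding L_def by blast
      obtain u w where u: "u \<in> Phi p (Suc i)" and w: "w \<in> Phi (Suc p) i" and zu: "z = dK N i u \<oplus>\<^bsub>V i\<^esub> w"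
        using zB by (auto simp: BPhi_def set_add_iff simp del: fam_simps)
      \<comment> \<open>\<open>u\<close> and \<open>w\<close> may be inhomogeneous while
        \<open>z\<close> has degree \<open>j\<close>; their components of degree \<open>j\<close>
        represent \<open>z\<close> in the same way. Then \<open>w'\<close> is a cycle in
        \<open>Phi (Suc p) i\<close> in the homology class of \<open>y\<close>.\<close>
      define u' w' where "u' = cV (Suc i) u j" and "w' = cV i w j"
      have "cV i z j = z" using zB igrading.comp_eq_self[OF V_igrading Vc[OF z], of j] by blast
      then have zu': "z = dK N i u' \<oplus>\<^bsub>V i\<^esub> w'"
        using igrading.comp_add[OF V_igrading dK_closed[OF Phi_carrier[OF u]] Phi_carrier[OF w], of j]
        by (simp add: zu[symmetric] u'_def w'_def dK_comp[OF Phi_carrier[OF u]] del: fam_simps)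
      have "u' \<in> C N B (Suc i) j" unfolding u'_def by (rule igrading.comp_props(1)[OF V_igrading Phi_carrier[OF u]])
      then have du: "dK N i u' \<in> Bt i j" unfolding Bt_def by blast
      have w'P: "w' \<in> Phi (Suc p) i" unfolding w'_def by (rule Phi_comp[OF w])
      have duZ: "dK N i u' \<in> Zt i j" using du Bt_Zt by blast
      have "w' = z \<ominus>\<^bsub>V i\<^esub> dK N i u'"
        using Vc[OF duZ] Phi_carrier[OF w'P] unfolding zu' a_minus_def
        by (simp add: VK.M.a_ac VK.M.r_neg VK.M.r_neg1 VK.M.r_neg2 del: fam_simps)
      then have w'Z: "w' \<in> Zt i j" using VK.submodule_diff_closed[OF Zt_submodule z duZ] by simp
      have "y = w' \<oplus>\<^bsub>V i\<^esub> (dK N i u' \<oplus>\<^bsub>V i\<^esub> b)"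
        unfolding y zu' using Vc[OF duZ] Vc[OF w'Z] Vc[of b] b Bt_Zt[of i j]
        by (simp add: subset_iff VK.M.a_ac del: fam_simps)
      then show ?thesis unfolding Y_def set_add_iff using w'Z w'P Bt_add[OF du b] by blast
    qed
  qed
  have "finq K (V i) (Y 0) (Y n) \<and> dimq K (V i) (Y 0) (Y n) \<le> (\<Sum>p<n. h i p j)" for n
  proof (induction n)
    case 0
    show ?case using dimq_self[OF V_vectorspace Ys] by simp
  next
    case (Suc n)
    have Y0n: "Y n \<subseteq> Y 0" using Y0 Y_Zt by simp
    have "finq K (V i) (Y 0) (Y (Suc n))" using dimq_add(1)[OF V_vectorspace Ys Ys Ys Y_Suc Y0n] Suc step[of n] by blast
    then show ?case using dimq_add(2)[OF V_vectorspace Ys Ys Ys Y_Suc Y0n] Suc step[of n] by simp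
  qed
  from this[of "Suc (pst + j)"] show ?thesis
    using betti_eq(1)[OF stdR fgN, of i j] by (simp only: Y0 Yn)
qed

lemma betti_jump:
  assumes "graded_betti R A N B i j \<noteq> 0"
  shows "\<exists>p. graded_betti gR gA gM gB i p \<noteq> 0 \<and> int j \<le> int p + v_inv R A N B F"
proof -
  obtain p where p: "h i p j \<noteq> 0" using betti_le_h[of i j] assms by (metis le_zero_eq sum.neutral)
  have "h i p j \<le> (\<Sum>j'<Suc j. h i p j')" by (rule member_le_sum) auto
  also note h_props(2)[of i p "Suc j"]
  finally show ?thesis using p h_jump(2)[OF p] by (intro exI[of _ p]) auto
qed

text \<open>If the total Betti numbers agree, no term can be lost below the first column with
  \<open>j \<ge> p + u\<close>.\<close>

lemma gr_betti_jump:
  assumes eq: "betti R A N B i = betti gR gA gM gB i" and p: "graded_betti gR gA gM gB i p \<noteq> 0"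
  shows "\<exists>j. graded_betti R A N B i j \<noteq> 0 \<and> int p + u_inv R A N B F \<le> int j"
proof (rule ccontr)
  assume no: "\<nexists>j. graded_betti R A N B i j \<noteq> 0 \<and> int p + u_inv R A N B F \<le> int j"
  interpret gr: alg_iso R A gR gr_iso by (rule gr_alg_iso)
  interpret G: kmod gR gA J e \<kappa>g gM gB by (rule G_kmod)
  have gstd: "standard_graded_algebra gR gA" unfolding gA_image by (rule gr.S_standard)
  let ?a = "graded_betti R A N B i" and ?b = "graded_betti gR gA gM gB i"
  obtain j0 where j0: "betti R A N B i = (\<Sum>j<j0. ?a j)" using betti_eq(2)[OF stdR fgN] by blast
  obtain q0 where q0: "\<forall>q\<ge>q0. ?b q = 0" "betti gR gA gM gB i = (\<Sum>q<q0. ?b q)"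
    using G.betti_eq(2)[OF gstd gM_finitely_generated] by blast
  \<comment> \<open>If \<open>?a j\<close> is nonzero, then \<open>j < p + u\<close> by assumption,
    and a nonzero \<open>h i q j\<close> requires \<open>q + u \<le> j\<close>. So everything that
    contributes to such a degree comes from \<open>q < p\<close>.\<close>
  have le: "?a j \<le> (\<Sum>q<p. h i q j)" for j
  proof (cases "?a j = 0")
    case False
    then have "\<not> int p + u_inv R A N B F \<le> int j" using no by blast
    then have j: "int j < int p + u_inv R A N B F" by linarith
    have "(\<Sum>q<Suc (pst + j). h i q j) = (\<Sum>q\<in>{..<Suc (pst + j)} \<inter> {..<p}. h i q j)"
    proof (rule sum.mono_neutral_right)
      show "\<forall>q\<in>{..<Suc (pst + j)} - {..<Suc (pst + j)} \<inter> {..<p}. h i q j = 0"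
      proof
        fix q assume "q \<in> {..<Suc (pst + j)} - {..<Suc (pst + j)} \<inter> {..<p}"
        then show "h i q j = 0" using h_jump(1)[of i q j] j by force
      qed
    qed auto
    also have "\<dots> \<le> (\<Sum>q<p. h i q j)" by (rule sum_mono2) auto
    finally show ?thesis using betti_le_h[of i j] by linarith
  qed simp
  have "betti R A N B i \<le> (\<Sum>j<j0. \<Sum>q<p. h i q j)" unfolding j0 by (rule sum_mono) (rule le)
  also have "\<dots> = (\<Sum>q<p. \<Sum>j<j0. h i q j)" by (rule sum.swap)
  also have "\<dots> \<le> (\<Sum>q<p. ?b q)" by (rule sum_mono) (rule h_props(2))
  \<comment> \<open>Strict because the summand at \<open>q = p\<close> is nonzero and has not been
    used so far.\<close>
  also have "\<dots> < (\<Sum>q<Suc p. ?b q)" using p by simp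
  also have "\<dots> \<le> (\<Sum>q<q0. ?b q)"
  proof (rule sum_mono2)
    have "p < q0" using q0(1) p by (metis not_le)
    then show "{..<Suc p} \<subseteq> {..<q0}" by auto
  qed auto
  finally show False using eq q0(2) by simp
qed

end

text \<open>Serves both bounds: for the lower one, \<open>M\<close> and gr M change places and the
  shift is \<open>- u\<close>.\<close>

lemma t_inv_shift_le:
  assumes "\<And>j. graded_betti R A M B i j \<noteq> 0 \<Longrightarrow> \<exists>p. graded_betti S A' N B' i p \<noteq> 0 \<and> int j \<le> int p + v"
  shows "t_inv R A M B i \<le> t_inv S A' N B' i + ereal (of_int v)"
  unfolding t_inv_def
proof (rule SUP_least)
  fix j assume "j \<in> {j. graded_betti R A M B i j \<noteq> 0}"
  then obtain p where p: "graded_betti S A' N B' i p \<noteq> 0" "int j \<le> int p + v" using assms by blast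
  have "real j \<le> real p + of_int v" using p(2) by linarith
  then have "ereal (real j) \<le> ereal (real p) + ereal (of_int v)" by simp
  also have "\<dots> \<le> (SUP j\<in>{j. graded_betti S A' N B' i j \<noteq> 0}. ereal (real j)) + ereal (of_int v)"
    using p(1) by (intro add_right_mono SUP_upper) simp
  finally show "ereal (real j) \<le> (SUP j\<in>{j. graded_betti S A' N B' i j \<noteq> 0}. ereal (real j)) + ereal (of_int v)" .
qed

theorem theorem2p4:
  fixes R :: "('a, 'x) ring_scheme" and A :: "nat \<Rightarrow> 'a set"
    and M :: "('a, 'b, 'y) module_scheme" and B :: "nat \<Rightarrow> 'b set"
    and F :: "nat \<Rightarrow> 'b set"
  assumes "standard_graded_algebra R A"
    and "graded_module R A M B"
    and "finitely_generated R M"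
    and "carrier M \<noteq> {\<zero>\<^bsub>M\<^esub>}"
    and "graded_stable_filtration R A M B F"
  shows "(\<forall>i. t_inv R A M B i \<le> gr_t R A M F i + ereal (of_int (v_inv R A M B F))) \<and>
    (homogeneous_type R A M B F \<longrightarrow>
      (\<forall>i. gr_t R A M F i + ereal (of_int (u_inv R A M B F)) \<le> t_inv R A M B i \<and>
           t_inv R A M B i \<le> gr_t R A M F i + ereal (of_int (v_inv R A M B F))))"
proof -
  obtain J e \<kappa> where k: "kres R A J e \<kappa>" using kres_exists[OF assms(1)] by blast
  have gm: "graded_mod R A M B"
    using standard_graded_alg[OF assms(1)] assms(2) by (simp add: graded_mod_def graded_mod_axioms_def)
  interpret filtered_kmod R A J e \<kappa> M B F
    by (intro filtered_kmod.intro kmod.intro stable_mod.intro stable_mod_axioms.intro k gm assms)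
  have 1: "t_inv R A M B i \<le> gr_t R A M F i + ereal (of_int (v_inv R A M B F))" for i
    by (rule t_inv_shift_le) (rule betti_jump)
  have 2: "gr_t R A M F i + ereal (of_int (u_inv R A M B F)) \<le> t_inv R A M B i" if ht: "homogeneous_type R A M B F" for i
  proof -
    let ?u = "ereal (of_int (u_inv R A M B F))"
    have "gr_t R A M F i \<le> t_inv R A M B i + ereal (of_int (- u_inv R A M B F))"
    proof (rule t_inv_shift_le)
      fix p assume "graded_betti gR gA gM gB i p \<noteq> 0"
      moreover have "betti R A M B i = betti gR gA gM gB i" using ht by (simp add: homogeneous_type_def)
      ultimately obtain j where "graded_betti R A M B i j \<noteq> 0" "int p + u_inv R A M B F \<le> int j"
        using gr_betti_jump by blast
      then show "\<exists>j. graded_betti R A M B i j \<noteq> 0 \<and> int p \<le> int j + - u_inv R A M B F" by (intro exI[of _ j]) auto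
    qed
    then have "gr_t R A M F i + ?u \<le> t_inv R A M B i + ereal (of_int (- u_inv R A M B F)) + ?u" by (rule add_right_mono)
    \<comment> \<open>The shift is a real number, so it cancels in the extended reals also when the
      supremum is infinite.\<close>
    also have "\<dots> = t_inv R A M B i" by (cases "t_inv R A M B i") simp_all
    finally show ?thesis .
  qed
  show ?thesis using 1 2 by blast
qed

end
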